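(* Let $-1\le\alpha<0$, and let $s_1,s_2$ be real numbers with $s_2\le s_1$ such that, for some $0<\epsilon<1$, $$s_1>\frac{17+4\epsilon-3\alpha}{12}\qquad\text{and}\qquad\frac{5+4\epsilon-3\alpha}{12\,s_1}+\frac1{s_2}<1 .$$ Then the flow $\psi\mapsto u(t)$ on $H^{s_1,s_2}(\mathbb{R}^2)$ associated to the Cauchy problem $$u_t=u_{xxx}-\mathscr{H}D_x^{\alpha}u_{yy}+uu_x,\qquad u(0)=\psi,$$ is not of class $C^2$.
   Context: Functions are of $(x,y)\in\mathbb{R}^2$ with dual Fourier variables $(\xi,\eta)$; $u$ is real valued. $\mathscr{H}$ is the Hilbert transform in $x$ (Fourier symbol $-i\,\mathrm{sgn}(\xi)$), $D_x^\alpha$ has Fourier symbol $|\xi|^\alpha$, $\langle a\rangle=(1+a^2)^{1/2}$. $H^{s_1,s_2}(\mathbb{R}^2)$ has norm $\|f\|_{H^{s_1,s_2}}^2=\int(\langle\xi\rangle^{2s_1}+\langle\eta\rangle^{2s_2})|\widehat f|^2d\xi d\eta$. Under the stated conditions the Cauchy problem is locally well-posed in $H^{s_1,s_2}$: for each $\psi$ there are $T=T(\|\psi\|_{H^{s_1,s_2}})>0$ and a unique solution $u\in C([0,T];H^{s_1,s_2})$ with $u,\partial_xu,\partial_yu\in L^1([0,T];L^\infty(\mathbb{R}^2))$, depending continuously on $\psi$. The flow is the map sending an initial datum $\psi\in H^{s_1,s_2}$ to the value $u(t)\in H^{s_1,s_2}$ of this solution at times $t$ in its existence interval. *)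

theory Defs
  imports "HOL-Probability.Essential_Supremum"
begin

section \<open>Real \<open>L\<^sup>2\<close> functions on the plane\<close>

definition square_integrable :: "(real \<times> real \<Rightarrow> real) \<Rightarrow> bool" where
  "square_integrable f \<longleftrightarrow>
     f \<in> borel_measurable lborel \<and> integrable lborel (\<lambda>z. (f z)\<^sup>2)"

definition ae_equal :: "(real \<times> real \<Rightarrow> real) \<Rightarrow> (real \<times> real \<Rightarrow> real) \<Rightarrow> bool" where
  "ae_equal f g \<longleftrightarrow>
     square_integrable f \<and> square_integrable g \<and> (AE z in lborel. f z = g z)"

lemma square_integrable_zero: "square_integrable (\<lambda>z. 0)"
  by (simp add: square_integrable_def)

lemma square_integrable_add:
  assumes "square_integrable f" "square_integrable g"
  shows "square_integrable (\<lambda>z. f z + g z)"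
proof -
  have m: "f \<in> borel_measurable lborel" "g \<in> borel_measurable lborel"
    and i: "integrable lborel (\<lambda>z. (f z)\<^sup>2)" "integrable lborel (\<lambda>z. (g z)\<^sup>2)"
    using assms by (auto simp: square_integrable_def)
  have "integrable lborel (\<lambda>z. (f z + g z)\<^sup>2)"
  proof (rule Bochner_Integration.integrable_bound)
    show "integrable lborel (\<lambda>z. 2 * (f z)\<^sup>2 + 2 * (g z)\<^sup>2)" using i by simp
    show "(\<lambda>z. (f z + g z)\<^sup>2) \<in> borel_measurable lborel" using m by simp
    have "(a + b)\<^sup>2 \<le> 2 * a\<^sup>2 + 2 * b\<^sup>2" for a b :: real
      using zero_le_power2[of "a - b"] by (simp add: power2_eq_square algebra_simps)
    then show "AE z in lborel. norm ((f z + g z)\<^sup>2) \<le> norm (2 * (f z)\<^sup>2 + 2 * (g z)\<^sup>2)"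
      by (intro AE_I2) (simp add: abs_of_nonneg)
  qed
  with m show ?thesis by (simp add: square_integrable_def)
qed

lemma square_integrable_scale:
  assumes "square_integrable f"
  shows "square_integrable (\<lambda>z. c * f z)"
  using assms by (auto simp: square_integrable_def power_mult_distrib)

quotient_type L2 = "real \<times> real \<Rightarrow> real" / partial: ae_equal
  morphisms rep_L2 abs_L2
proof (rule part_equivpI)
  show "\<exists>f. ae_equal f f"
    using square_integrable_zero by (auto simp: ae_equal_def)
  show "symp ae_equal"
    by (rule sympI) (auto simp: ae_equal_def elim: eventually_mono)
  show "transp ae_equal"
    by (rule transpI) (auto simp: ae_equal_def elim: eventually_elim2)
qed

instantiation L2 :: real_vector
begin

lift_definition zero_L2 :: L2 is "\<lambda>z. 0"
  by (simp add: ae_equal_def square_integrable_zero)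

lift_definition plus_L2 :: "L2 \<Rightarrow> L2 \<Rightarrow> L2" is "\<lambda>f g z. f z + g z"
  by (auto simp: ae_equal_def intro: square_integrable_add elim: eventually_elim2)

lift_definition scaleR_L2 :: "real \<Rightarrow> L2 \<Rightarrow> L2" is "\<lambda>c f z. c * f z"
  by (auto simp: ae_equal_def intro: square_integrable_scale elim: eventually_mono)

definition uminus_L2 :: "L2 \<Rightarrow> L2" where "uminus_L2 f = (-1) *\<^sub>R f"

definition minus_L2 :: "L2 \<Rightarrow> L2 \<Rightarrow> L2" where "minus_L2 f g = f + (-1) *\<^sub>R g"

instance
proof
  fix a b c :: L2 and r s :: real
  show "a + b + c = a + (b + c)"
    by transfer (auto simp: ae_equal_def add.assoc intro!: square_integrable_add)
  show "a + b = b + a"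
    by transfer (auto simp: ae_equal_def add.commute intro!: square_integrable_add)
  show "0 + a = a"
    by transfer (auto simp: ae_equal_def)
  show "- a + a = 0"
    unfolding uminus_L2_def
    by transfer
      (auto simp: ae_equal_def intro!: square_integrable_zero)
  show "a - b = a + - b"
    by (simp add: uminus_L2_def minus_L2_def)
  show "r *\<^sub>R (a + b) = r *\<^sub>R a + r *\<^sub>R b"
    by transfer (auto simp: ae_equal_def distrib_left
        intro!: square_integrable_add square_integrable_scale)
  show "(r + s) *\<^sub>R a = r *\<^sub>R a + s *\<^sub>R a"
    by transfer (auto simp: ae_equal_def distrib_right[symmetric]
        intro!: square_integrable_scale)
  show "r *\<^sub>R s *\<^sub>R a = (r * s) *\<^sub>R a"
    by transfer (auto simp: ae_equal_def mult.assoc[symmetric] intro!: square_integrable_scale)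
  show "1 *\<^sub>R a = a"
    by transfer (auto simp: ae_equal_def)
qed

end


section \<open>Fourier transform and the spaces \<open>H\<^bsup>s1,s2\<^esup>\<close>\<close>

definition fourier :: "(real \<times> real \<Rightarrow> real) \<Rightarrow> real \<times> real \<Rightarrow> complex" where
  "fourier f \<zeta> = (LINT z|lborel. complex_of_real (f z) * cis (- (z \<bullet> \<zeta>))) / complex_of_real (2 * pi)"

text \<open>On \<open>L\<^sup>2\<close> the transform is the \<open>L\<^sup>2\<close> limit of the transforms of truncations
  (Plancherel); it is determined up to null sets, and only used up to null sets.\<close>

definition is_fourier_L2 :: "L2 \<Rightarrow> (real \<times> real \<Rightarrow> complex) \<Rightarrow> bool" where
  "is_fourier_L2 f g \<longleftrightarrow>
     g \<in> borel_measurable lborel \<and>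
     integrable lborel (\<lambda>\<zeta>. (cmod (g \<zeta>))\<^sup>2) \<and>
     (\<lambda>n::nat. \<integral>\<^sup>+\<zeta>. ennreal ((cmod (g \<zeta> -
         fourier (\<lambda>z. indicator (cball 0 (real n)) z * rep_L2 f z) \<zeta>))\<^sup>2) \<partial>lborel)
       \<longlonglongrightarrow> 0"

definition fourier_L2 :: "L2 \<Rightarrow> real \<times> real \<Rightarrow> complex" where
  "fourier_L2 f = (SOME g. is_fourier_L2 f g)"

definition bracket :: "real \<Rightarrow> real" where
  "bracket a = sqrt (1 + a\<^sup>2)"

definition sobolev_density :: "real \<Rightarrow> real \<Rightarrow> L2 \<Rightarrow> real \<times> real \<Rightarrow> real" where
  "sobolev_density s1 s2 f = (\<lambda>(\<xi>, \<eta>).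
     (bracket \<xi> powr (2 * s1) + bracket \<eta> powr (2 * s2)) * (cmod (fourier_L2 f (\<xi>, \<eta>)))\<^sup>2)"

text \<open>For \<open>s1 \<ge> 0\<close>, the only case used, the weight is at least 1, so that every element
  of \<open>H\<^bsup>s1,s2\<^esup>\<close> is indeed an \<open>L\<^sup>2\<close> function.\<close>

definition sobolev :: "real \<Rightarrow> real \<Rightarrow> L2 set" where
  "sobolev s1 s2 = {f. integrable lborel (sobolev_density s1 s2 f)}"

definition sobolev_norm :: "real \<Rightarrow> real \<Rightarrow> L2 \<Rightarrow> real" where
  "sobolev_norm s1 s2 f = sqrt (LINT \<zeta>|lborel. sobolev_density s1 s2 f \<zeta>)"


section \<open>Solutions of the Cauchy problem\<close>

text \<open>Distributional derivative in the direction \<open>v\<close>; for locally integrable functions,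
  compactly supported \<open>C\<^sup>1\<close> test functions are equivalent to smooth ones.\<close>

definition test_function :: "(real \<times> real \<Rightarrow> real) \<Rightarrow> bool" where
  "test_function \<phi> \<longleftrightarrow>
     \<phi> differentiable_on UNIV \<and>
     (\<forall>v. continuous_on UNIV (\<lambda>z. frechet_derivative \<phi> (at z) v)) \<and>
     bounded {z. \<phi> z \<noteq> 0}"

definition weak_derivative ::
    "real \<times> real \<Rightarrow> (real \<times> real \<Rightarrow> real) \<Rightarrow> (real \<times> real \<Rightarrow> real) \<Rightarrow> bool" where
  "weak_derivative v f g \<longleftrightarrow>
     (\<forall>r. set_integrable lborel (cball 0 r) f) \<and>
     g \<in> borel_measurable lborel \<and>
     (\<forall>r. set_integrable lborel (cball 0 r) g) \<and>
     (\<forall>\<phi>. test_function \<phi> \<longrightarrow>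
        (LINT z|lborel. f z * frechet_derivative \<phi> (at z) v) = - (LINT z|lborel. g z * \<phi> z))"

definition L1_Linf :: "real \<Rightarrow> (real \<Rightarrow> real \<times> real \<Rightarrow> real) \<Rightarrow> bool" where
  "L1_Linf T v \<longleftrightarrow>
     (\<integral>\<^sup>+t\<in>{0..T}. esssup lborel (\<lambda>z. ennreal \<bar>v t z\<bar>) \<partial>lborel) < \<infinity>"

text \<open>Fourier symbol of \<open>\<partial>\<^sub>x\<^sup>3 - H D\<^sub>x\<^sup>\<alpha> \<partial>\<^sub>y\<^sup>2\<close>, factor by factor.\<close>

definition linear_symbol :: "real \<Rightarrow> real \<times> real \<Rightarrow> complex" where
  "linear_symbol \<alpha> = (\<lambda>(\<xi>, \<eta>).
     (\<i> * complex_of_real \<xi>) ^ 3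
     - (- \<i> * complex_of_real (sgn \<xi>)) * complex_of_real (\<bar>\<xi>\<bar> powr \<alpha>)
         * (\<i> * complex_of_real \<eta>)\<^sup>2)"

text \<open>The linear operator is a Fourier multiplier that takes values outside \<open>L\<^sup>2\<close> and
  whose symbol is singular on the null line \<open>\<xi> = 0\<close>, so the equation is tested on the
  frequency side against continuous functions with compact support off that line.\<close>

definition frequency_test :: "(real \<times> real \<Rightarrow> complex) \<Rightarrow> bool" where
  "frequency_test \<theta> \<longleftrightarrow>
     continuous_on UNIV \<theta> \<and>
     (\<exists>K. compact K \<and> (\<forall>\<eta>. (0, \<eta>) \<notin> K) \<and> (\<forall>\<zeta>. \<zeta> \<notin> K \<longrightarrow> \<theta> \<zeta> = 0))"

text \<open>In the last conjunct \<open>u u\<^sub>x\<close> is a product of two \<open>L\<^sup>2\<close> functions (when \<open>s1 \<ge> 1\<close>), hence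
  integrable, so its transform is the classical one.\<close>

definition cauchy_solution ::
    "real \<Rightarrow> real \<Rightarrow> real \<Rightarrow> real \<Rightarrow> L2 \<Rightarrow> (real \<Rightarrow> L2) \<Rightarrow> bool" where
  "cauchy_solution \<alpha> s1 s2 T \<psi> u \<longleftrightarrow>
     0 < T \<and> u 0 = \<psi> \<and>
     (\<forall>t\<in>{0..T}. u t \<in> sobolev s1 s2) \<and>
     (\<forall>t\<in>{0..T}. ((\<lambda>\<tau>. sobolev_norm s1 s2 (u \<tau> - u t)) \<longlongrightarrow> 0) (at t within {0..T})) \<and>
     L1_Linf T (\<lambda>t. rep_L2 (u t)) \<and>
     (\<exists>ux uy.
        (\<forall>t\<in>{0..T}. weak_derivative (1, 0) (rep_L2 (u t)) (ux t)) \<and>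
        (AE t in lborel. t \<in> {0..T} \<longrightarrow> weak_derivative (0, 1) (rep_L2 (u t)) (uy t)) \<and>
        L1_Linf T ux \<and> L1_Linf T uy \<and>
        (\<forall>\<theta>. frequency_test \<theta> \<longrightarrow> (\<forall>t\<in>{0..T}.
           ((\<lambda>\<tau>. LINT \<zeta>|lborel. \<theta> \<zeta> * fourier_L2 (u \<tau>) \<zeta>)
              has_vector_derivative
            (LINT \<zeta>|lborel. \<theta> \<zeta> *
               (linear_symbol \<alpha> \<zeta> * fourier_L2 (u t) \<zeta>
                + fourier (\<lambda>z. rep_L2 (u t) z * ux t z) \<zeta>)))
           (at t within {0..T}))))"

definition flow_domain :: "real \<Rightarrow> real \<Rightarrow> real \<Rightarrow> real \<Rightarrow> L2 set" where
  "flow_domain \<alpha> s1 s2 t =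
     {\<psi> \<in> sobolev s1 s2. \<exists>T u. t \<le> T \<and> cauchy_solution \<alpha> s1 s2 T \<psi> u}"

text \<open>Solutions are unique, so on \<open>flow_domain\<close> there is exactly one value to choose.\<close>

definition flow :: "real \<Rightarrow> real \<Rightarrow> real \<Rightarrow> real \<Rightarrow> L2 \<Rightarrow> L2" where
  "flow \<alpha> s1 s2 t \<psi> = (SOME v. \<exists>T u. t \<le> T \<and> cauchy_solution \<alpha> s1 s2 T \<psi> u \<and> v = u t)"


section \<open>Maps of class \<open>C\<^sup>2\<close> on a subspace with its own norm\<close>

text \<open>The library's Frechet derivative refers to the norm of a type; here \<open>V\<close> is a linear
  subspace of a real vector space and \<open>N\<close> a norm on \<open>V\<close>.\<close>

definition open_wrt :: "'a::real_vector set \<Rightarrow> ('a \<Rightarrow> real) \<Rightarrow> 'a set \<Rightarrow> bool" where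
  "open_wrt V N U \<longleftrightarrow>
     U \<subseteq> V \<and> (\<forall>\<psi>\<in>U. \<exists>r>0. \<forall>h\<in>V. N h < r \<longrightarrow> \<psi> + h \<in> U)"

definition bounded_linear_wrt :: "'a::real_vector set \<Rightarrow> ('a \<Rightarrow> real) \<Rightarrow> ('a \<Rightarrow> 'a) \<Rightarrow> bool" where
  "bounded_linear_wrt V N A \<longleftrightarrow>
     (\<forall>h\<in>V. A h \<in> V) \<and>
     (\<forall>h\<in>V. \<forall>k\<in>V. A (h + k) = A h + A k) \<and>
     (\<forall>c. \<forall>h\<in>V. A (c *\<^sub>R h) = c *\<^sub>R A h) \<and>
     (\<exists>K. \<forall>h\<in>V. N (A h) \<le> K * N h)"

definition bounded_bilinear_wrt ::
    "'a::real_vector set \<Rightarrow> ('a \<Rightarrow> real) \<Rightarrow> ('a \<Rightarrow> 'a \<Rightarrow> 'a) \<Rightarrow> bool" where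
  "bounded_bilinear_wrt V N B \<longleftrightarrow>
     (\<forall>h\<in>V. \<forall>k\<in>V. B h k \<in> V) \<and>
     (\<forall>h\<in>V. \<forall>h'\<in>V. \<forall>k\<in>V. B (h + h') k = B h k + B h' k) \<and>
     (\<forall>h\<in>V. \<forall>k\<in>V. \<forall>k'\<in>V. B h (k + k') = B h k + B h k') \<and>
     (\<forall>c. \<forall>h\<in>V. \<forall>k\<in>V. B (c *\<^sub>R h) k = c *\<^sub>R B h k \<and> B h (c *\<^sub>R k) = c *\<^sub>R B h k) \<and>
     (\<exists>K. \<forall>h\<in>V. \<forall>k\<in>V. N (B h k) \<le> K * N h * N k)"

text \<open>\<open>F'\<close> is the Frechet derivative of \<open>F\<close>, \<open>F''\<close> that of \<open>F'\<close> (for the operator norm),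
  and \<open>F''\<close> is continuous (for the norm of bounded bilinear maps).\<close>

definition C2_on_wrt ::
    "'a::real_vector set \<Rightarrow> ('a \<Rightarrow> real) \<Rightarrow> 'a set \<Rightarrow> ('a \<Rightarrow> 'a) \<Rightarrow> bool" where
  "C2_on_wrt V N U F \<longleftrightarrow>
     (\<forall>\<psi>\<in>U. F \<psi> \<in> V) \<and>
     (\<exists>F' F''. \<forall>\<psi>\<in>U.
        bounded_linear_wrt V N (F' \<psi>) \<and>
        (\<forall>e>0. \<exists>d>0. \<forall>h\<in>V. N h < d \<longrightarrow> \<psi> + h \<in> U \<longrightarrow>
           N (F (\<psi> + h) - F \<psi> - F' \<psi> h) \<le> e * N h) \<and>
        bounded_bilinear_wrt V N (F'' \<psi>) \<and>
        (\<forall>e>0. \<exists>d>0. \<forall>h\<in>V. N h < d \<longrightarrow> \<psi> + h \<in> U \<longrightarrow>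
           (\<forall>k\<in>V. N (F' (\<psi> + h) k - F' \<psi> k - F'' \<psi> h k) \<le> e * N h * N k)) \<and>
        (\<forall>e>0. \<exists>d>0. \<forall>h\<in>V. N h < d \<longrightarrow> \<psi> + h \<in> U \<longrightarrow>
           (\<forall>k\<in>V. \<forall>l\<in>V. N (F'' (\<psi> + h) k l - F'' \<psi> k l) \<le> e * N k * N l)))"

end

theory Submission
  imports Defs "HOL-Probability.Characteristic_Functions"
begin

text \<open>Suppose that the flow is \<open>C\<^sup>2\<close> near \<open>0\<close>. Then, for data \<open>d \<phi>\<close> with \<open>d \<rightarrow> 0\<close>, its symmetric second
  difference at \<open>0\<close> is at most \<open>K \<parallel>\<phi>\<parallel>\<^sup>2 d\<^sup>2\<close> up to \<open>o(d\<^sup>2)\<close>. To compare this with the equation, write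
  the solution \<open>u\<close> in the interaction picture as \<open>w(\<tau>) = exp(-\<tau> L) FT u(\<tau>)\<close> with \<open>L\<close> the linear symbol. The
  \<open>L\<^sup>2\<close> norm is conserved, since \<open>u \<in> L\<^sup>1\<^sub>t L\<^sup>\<infinity>\<^sub>x\<^sub>y\<close>, and \<open>w\<close> stays weakly close to its initial value
  \<open>d FT \<phi>\<close>; hence \<open>w(\<tau>) = d FT \<phi> + o(d)\<close> in \<open>L\<^sup>2\<close>, uniformly in \<open>\<tau>\<close>. Thus, for a test function \<open>\<theta>\<close>
  supported where \<open>FT \<phi>\<close> vanishes, the pairing of \<open>w\<close> with \<open>\<theta>\<close> has derivative \<open>d\<^sup>2 r(\<tau>) + o(d\<^sup>2)\<close>,
  where \<open>r\<close> is the rate of the quadratic Picard iterate.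

  The datum \<open>\<phi>\<close> consists of a block of low frequencies of size \<open>a\<close> by \<open>b\<close> near the origin and a normalised block
  near a frequency \<open>(N, H)\<close> at which \<open>\<partial>\<^sub>\<xi> \<omega> = 0\<close> for the dispersion relation \<open>\<omega>\<close>. With \<open>a = k N\<^bsup>-1/2\<^esup>\<close> and
  \<open>b = k N\<^bsup>-(3+\<alpha>)/2\<^esup>\<close> the interaction is resonant up to time \<open>t\<close>, so that no oscillation reduces \<open>r\<close>. The
  \<open>C\<^sup>2\<close> bound then forces \<open>N (a b)\<^bsup>1/2\<^esup>\<close> to be bounded, but it equals \<open>k N\<^bsup>-\<alpha>/4\<^esup>\<close>.\<close>

text \<open>All estimates are made for an arbitrary solution, because the flow is a choice among end
  points of solutions. The obstacle is the quadratic term: to know it up to o(d^2), the interaction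
  profile has to be known up to o(d) in L2, and weak convergence does not pass to products.
  Integrating the equation in L2 does not help either, since the Sobolev and sup bounds of a
  solution come with no uniformity in d. The conserved L2 norm is the quantity that is known exactly
  in terms of the datum.

  The powers in the final inequality arise as follows. Let W be the Sobolev weight at (N, H). The
  low block has amplitude 1 and the high block amplitude 1/W, so that both have Sobolev norm of
  order (a b)^(1/2). The derivative in the nonlinearity contributes N, so the pairing grows at the
  rate N (a b)^2 / W, while the test function has dual norm of order (a b)^(1/2) / W and the squared
  norm of the datum is of order a b. The weight cancels and N (a b)^(1/2) is what remains.\<close>

type_synonym plane = "real \<times> real"

section \<open>Complex L2 functions on the plane: norm, pairing, convergence, completeness\<close>

definition sqint :: "(plane \<Rightarrow> complex) \<Rightarrow> bool" where
  "sqint f \<longleftrightarrow> f \<in> borel_measurable borel \<and> integrable lborel (\<lambda>z. (cmod (f z))\<^sup>2)"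

text \<open>Norms are taken of concrete functions, since \<open>L2\<close> consists of classes of
  real functions while Fourier transforms are complex and are handled pointwise. When the square is
  not integrable the value defaults to 0, so estimates carry \<open>sqint\<close>.\<close>

definition l2norm :: "(plane \<Rightarrow> complex) \<Rightarrow> real" where
  "l2norm f = sqrt (LINT z|lborel. (cmod (f z))\<^sup>2)"

lemma sqint_measurable [measurable_dest]: "sqint f \<Longrightarrow> f \<in> borel_measurable borel"
  by (simp add: sqint_def)

lemma sqint_integrable: "sqint f \<Longrightarrow> integrable lborel (\<lambda>z. (cmod (f z))\<^sup>2)"
  by (simp add: sqint_def)

lemma l2norm_nonneg [simp]: "0 \<le> l2norm f"
  by (simp add: l2norm_def)

lemma l2norm_square: "(l2norm f)\<^sup>2 = (LINT z|lborel. (cmod (f z))\<^sup>2)"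
  by (simp add: l2norm_def)

lemma sqint_dominated:
  assumes f: "integrable lborel (\<lambda>z. (w z)\<^sup>2)" and g: "g \<in> borel_measurable borel"
    and le: "AE z in lborel. cmod (g z) \<le> w z"
  shows "sqint g"
  unfolding sqint_def
proof
  show "integrable lborel (\<lambda>z. (cmod (g z))\<^sup>2)"
  proof (rule Bochner_Integration.integrable_bound[OF f])
    show "AE z in lborel. norm ((cmod (g z))\<^sup>2) \<le> norm ((w z)\<^sup>2)"
      using le by eventually_elim (auto intro: power_mono)
  qed (use g in simp)
qed (use g in simp)

lemma sqint_scale: "sqint f \<Longrightarrow> sqint (\<lambda>z. c * f z)"
  by (auto simp: sqint_def norm_mult power_mult_distrib)

lemma sqint_cong_norm:
  "\<lbrakk>sqint f; g \<in> borel_measurable borel; \<And>z. cmod (g z) = cmod (f z)\<rbrakk> \<Longrightarrow> sqint g"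
  by (simp add: sqint_def)

lemma l2norm_cong_norm: "(\<And>z. cmod (g z) = cmod (f z)) \<Longrightarrow> l2norm g = l2norm f"
  by (simp add: l2norm_def)

lemma sqint_cnj: "sqint f \<Longrightarrow> sqint (\<lambda>z. cnj (f z))"
  by (rule sqint_cong_norm[of f], assumption, rule measurable_compose[OF sqint_measurable], assumption)
    (auto intro: borel_measurable_continuous_onI continuous_intros)

lemma l2norm_cnj [simp]: "l2norm (\<lambda>z. cnj (f z)) = l2norm f"
  by (simp add: l2norm_def)

lemma sqint_add:
  assumes "sqint f" "sqint g" shows "sqint (\<lambda>z. f z + g z)"
  unfolding sqint_def
proof
  show "integrable lborel (\<lambda>z. (cmod (f z + g z))\<^sup>2)"
  proof (rule Bochner_Integration.integrable_bound)
    show "integrable lborel (\<lambda>z. 2 * (cmod (f z))\<^sup>2 + 2 * (cmod (g z))\<^sup>2)"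
      using assms by (auto simp: sqint_def)
    have "(cmod (a + b))\<^sup>2 \<le> 2 * (cmod a)\<^sup>2 + 2 * (cmod b)\<^sup>2" for a b :: complex
    proof -
      have "(cmod (a + b))\<^sup>2 \<le> (cmod a + cmod b)\<^sup>2" by (intro power_mono norm_triangle_ineq) simp
      also have "\<dots> \<le> 2 * (cmod a)\<^sup>2 + 2 * (cmod b)\<^sup>2"
        using zero_le_power2[of "cmod a - cmod b"] by (simp add: power2_eq_square algebra_simps)
      finally show ?thesis .
    qed
    then show "AE z in lborel. norm ((cmod (f z + g z))\<^sup>2) \<le> norm (2 * (cmod (f z))\<^sup>2 + 2 * (cmod (g z))\<^sup>2)"
      by (intro AE_I2) (simp add: abs_of_nonneg)
  qed (use assms in measurable)
qed (use assms in measurable)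

lemma sqint_diff:
  assumes "sqint f" "sqint g" shows "sqint (\<lambda>z. f z - g z)"
  using sqint_add[OF assms(1) sqint_scale[OF assms(2), of "-1"]] by simp

lemma l2norm_cong_AE:
  assumes "f \<in> borel_measurable borel" "g \<in> borel_measurable borel" "AE z in lborel. f z = g z"
  shows "l2norm f = l2norm g"
proof -
  have "(LINT z|lborel. (cmod (f z))\<^sup>2) = (LINT z|lborel. (cmod (g z))\<^sup>2)"
    using assms by (intro integral_cong_AE) auto
  then show ?thesis by (simp add: l2norm_def)
qed

lemma sqint_cong_AE:
  assumes f: "sqint f" and g: "g \<in> borel_measurable borel" and eq: "AE z in lborel. f z = g z"
  shows "sqint g"
  using sqint_integrable[OF f] g
  by (rule sqint_dominated) (use eq in eventually_elim, simp)

lemma l2norm_scale: "l2norm (\<lambda>z. c * f z) = cmod c * l2norm f"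
  by (simp add: l2norm_def norm_mult power_mult_distrib real_sqrt_mult)

lemma l2norm_minus_commute: "l2norm (\<lambda>z. f z - g z) = l2norm (\<lambda>z. g z - f z)"
  by (simp add: l2norm_def norm_minus_commute)

lemma l2norm_eq_0_AE:
  assumes "sqint f" "l2norm f = 0" shows "AE z in lborel. f z = 0"
proof -
  have "(LINT z|lborel. (cmod (f z))\<^sup>2) = 0" using assms(2) by (simp add: l2norm_def)
  then show ?thesis
    using sqint_integrable[OF assms(1)] by (subst (asm) integral_nonneg_eq_0_iff_AE) auto
qed

lemma nn_integral_l2norm:
  "sqint f \<Longrightarrow> (\<integral>\<^sup>+z. ennreal ((cmod (f z))\<^sup>2) \<partial>lborel) = ennreal ((l2norm f)\<^sup>2)"
  by (simp add: nn_integral_eq_integral sqint_integrable l2norm_square)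

lemma sqint_if_nn_integral:
  assumes "f \<in> borel_measurable borel" "(\<integral>\<^sup>+z. ennreal ((cmod (f z))\<^sup>2) \<partial>lborel) \<le> ennreal C"
  shows "sqint f"
  using assms by (auto simp: sqint_def intro!: integrableI_bounded intro: le_less_trans)

lemma l2norm_le_if_nn_integral:
  assumes f: "f \<in> borel_measurable borel"
    and le: "(\<integral>\<^sup>+z. ennreal ((cmod (f z))\<^sup>2) \<partial>lborel) \<le> ennreal (C\<^sup>2)" and C: "0 \<le> C"
  shows "l2norm f \<le> C"
proof -
  have "sqint f" using f le by (rule sqint_if_nn_integral)
  then have "(l2norm f)\<^sup>2 \<le> C\<^sup>2" using le by (simp add: nn_integral_l2norm)
  then show ?thesis using C by (rule power2_le_imp_le)
qed

lemma sqint_mult_integrable: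
  assumes f: "sqint f" and g: "sqint g"
  shows "integrable lborel (\<lambda>z. f z * g z)"
proof (rule Bochner_Integration.integrable_bound)
  show "integrable lborel (\<lambda>z. (cmod (f z))\<^sup>2 + (cmod (g z))\<^sup>2)"
    using f g by (auto simp: sqint_def)
  have "a * b \<le> a\<^sup>2 + b\<^sup>2" for a b :: real
    using zero_le_power2[of "a - b"] zero_le_power2[of a] zero_le_power2[of b]
    unfolding power2_diff by linarith
  then show "AE z in lborel. norm (f z * g z) \<le> norm ((cmod (f z))\<^sup>2 + (cmod (g z))\<^sup>2)"
    by (intro AE_I2) (simp add: norm_mult)
qed (use f g in measurable)

lemma l2_Cauchy_Schwarz_abs:
  assumes f: "sqint f" and g: "sqint g"
  shows "(LINT z|lborel. cmod (f z) * cmod (g z)) \<le> l2norm f * l2norm g"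
proof -
  have i: "integrable lborel (\<lambda>z. cmod (f z) * cmod (g z))"
    using integrable_norm[OF sqint_mult_integrable[OF f g]] by (simp add: norm_mult)
  have "(\<integral>\<^sup>+z. ennreal (cmod (f z)) * ennreal (cmod (g z)) \<partial>lborel)\<^sup>2
      \<le> (\<integral>\<^sup>+z. (ennreal (cmod (f z)))\<^sup>2 \<partial>lborel) * (\<integral>\<^sup>+z. (ennreal (cmod (g z)))\<^sup>2 \<partial>lborel)"
    using f[THEN sqint_measurable] g[THEN sqint_measurable] by (intro Cauchy_Schwarz_nn_integral) simp_all
  also have "\<dots> = ennreal ((l2norm f)\<^sup>2) * ennreal ((l2norm g)\<^sup>2)"
    using f g by (simp add: ennreal_power nn_integral_l2norm)
  also have "\<dots> = ennreal ((l2norm f * l2norm g)\<^sup>2)"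
    by (simp add: ennreal_mult' power_mult_distrib)
  also have "(\<integral>\<^sup>+z. ennreal (cmod (f z)) * ennreal (cmod (g z)) \<partial>lborel)
      = ennreal (LINT z|lborel. cmod (f z) * cmod (g z))"
    using i by (simp add: nn_integral_eq_integral flip: ennreal_mult')
  finally have "(LINT z|lborel. cmod (f z) * cmod (g z))\<^sup>2 \<le> (l2norm f * l2norm g)\<^sup>2"
    by (simp add: ennreal_power)
  then show ?thesis by (rule power2_le_imp_le) simp
qed

lemma l2_Cauchy_Schwarz:
  assumes f: "sqint f" and g: "sqint g"
  shows "cmod (LINT z|lborel. f z * g z) \<le> l2norm f * l2norm g"
  using integral_norm_bound[of lborel "\<lambda>z. f z * g z"] l2_Cauchy_Schwarz_abs[OF f g]
  by (simp add: norm_mult)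

lemma l2norm_triangle:
  assumes f: "sqint f" and g: "sqint g"
  shows "l2norm (\<lambda>z. f z + g z) \<le> l2norm f + l2norm g"
proof -
  have i: "integrable lborel (\<lambda>z. cmod (f z) * cmod (g z))"
    using integrable_norm[OF sqint_mult_integrable[OF f g]] by (simp add: norm_mult)
  have "(l2norm (\<lambda>z. f z + g z))\<^sup>2
      \<le> (LINT z|lborel. (cmod (f z))\<^sup>2 + 2 * (cmod (f z) * cmod (g z)) + (cmod (g z))\<^sup>2)"
    unfolding l2norm_square
  proof (rule integral_mono)
    show "integrable lborel (\<lambda>z. (cmod (f z + g z))\<^sup>2)" using sqint_integrable[OF sqint_add[OF f g]] .
    show "integrable lborel (\<lambda>z. (cmod (f z))\<^sup>2 + 2 * (cmod (f z) * cmod (g z)) + (cmod (g z))\<^sup>2)"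
      using sqint_integrable[OF f] sqint_integrable[OF g] i by simp
    fix z
    have "(cmod (f z + g z))\<^sup>2 \<le> (cmod (f z) + cmod (g z))\<^sup>2"
      by (intro power_mono norm_triangle_ineq) simp
    then show "(cmod (f z + g z))\<^sup>2 \<le> (cmod (f z))\<^sup>2 + 2 * (cmod (f z) * cmod (g z)) + (cmod (g z))\<^sup>2"
      by (simp add: power2_sum algebra_simps)
  qed
  also have "\<dots> = (l2norm f)\<^sup>2 + 2 * (LINT z|lborel. cmod (f z) * cmod (g z)) + (l2norm g)\<^sup>2"
    using sqint_integrable[OF f] sqint_integrable[OF g] i by (simp add: l2norm_square)
  also have "\<dots> \<le> (l2norm f + l2norm g)\<^sup>2"
    using l2_Cauchy_Schwarz_abs[OF f g] by (simp add: power2_sum)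
  finally show ?thesis by (rule power2_le_imp_le) simp
qed

lemma l2norm_triangle_diff:
  assumes "sqint f" "sqint g" "sqint h"
  shows "l2norm (\<lambda>z. f z - h z) \<le> l2norm (\<lambda>z. f z - g z) + l2norm (\<lambda>z. g z - h z)"
  using l2norm_triangle[OF sqint_diff[OF assms(1,2)] sqint_diff[OF assms(2,3)]] by simp

lemma l2norm_reverse_triangle:
  assumes "sqint f" "sqint g"
  shows "\<bar>l2norm f - l2norm g\<bar> \<le> l2norm (\<lambda>z. f z - g z)"
  using l2norm_triangle[OF sqint_diff[OF assms] assms(2)]
    l2norm_triangle[OF sqint_diff[OF assms(2,1)] assms(1)] l2norm_minus_commute[of f g] by simp

lemma l2norm_dominated_convergence:
  fixes f :: "nat \<Rightarrow> plane \<Rightarrow> complex"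
  assumes f: "\<And>n. f n \<in> borel_measurable borel" and g: "g \<in> borel_measurable borel"
    and w: "integrable lborel (\<lambda>z. (w z)\<^sup>2)"
    and le: "\<And>n. AE z in lborel. cmod (f n z) \<le> w z"
    and lim: "AE z in lborel. (\<lambda>n. f n z) \<longlonglongrightarrow> g z"
  shows "sqint g" "(\<lambda>n. l2norm (\<lambda>z. f n z - g z)) \<longlonglongrightarrow> 0"
proof -
  have "AE z in lborel. \<forall>n. cmod (f n z) \<le> w z" using le by (simp add: AE_all_countable)
  with lim have gle: "AE z in lborel. cmod (g z) \<le> w z"
  proof eventually_elim
    case (elim z)
    show ?case
      by (rule LIMSEQ_le_const2[OF tendsto_norm[OF elim(1)]]) (use elim(2) in blast)
  qed
  show "sqint g" using w g gle by (rule sqint_dominated)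
  have "(\<lambda>n. LINT z|lborel. (cmod (f n z - g z))\<^sup>2) \<longlonglongrightarrow> (LINT z|(lborel :: plane measure). 0)"
  proof (rule integral_dominated_convergence[where w = "\<lambda>z. 4 * (w z)\<^sup>2"])
    show "integrable lborel (\<lambda>z. 4 * (w z)\<^sup>2)" using w by simp
    show "AE z in lborel. (\<lambda>n. (cmod (f n z - g z))\<^sup>2) \<longlonglongrightarrow> 0"
      using lim
    proof eventually_elim
      case (elim z)
      have "(\<lambda>n. (cmod (f n z - g z))\<^sup>2) \<longlonglongrightarrow> (cmod (g z - g z))\<^sup>2"
        by (intro tendsto_intros elim)
      then show ?case by simp
    qed
    show "AE z in lborel. norm ((cmod (f n z - g z))\<^sup>2) \<le> 4 * (w z)\<^sup>2" for n
      using le[of n] gle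
    proof eventually_elim
      case (elim z)
      have "cmod (f n z - g z) \<le> 2 * w z" using norm_triangle_ineq4[of "f n z" "g z"] elim by simp
      then have "(cmod (f n z - g z))\<^sup>2 \<le> (2 * w z)\<^sup>2" by (rule power_mono) simp
      then show ?case by simp
    qed
  qed (use f g in measurable)
  then have "(\<lambda>n. sqrt (LINT z|lborel. (cmod (f n z - g z))\<^sup>2)) \<longlonglongrightarrow> sqrt 0"
    by (intro tendsto_real_sqrt) simp
  then show "(\<lambda>n. l2norm (\<lambda>z. f n z - g z)) \<longlonglongrightarrow> 0" by (simp add: l2norm_def)
qed

lemma l2norm_AE_subseq:
  fixes f :: "nat \<Rightarrow> plane \<Rightarrow> complex"
  assumes f: "\<And>n. sqint (f n)" and g: "sqint g" and lim: "(\<lambda>n. l2norm (\<lambda>z. f n z - g z)) \<longlonglongrightarrow> 0"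
  shows "\<exists>r. strict_mono r \<and> (AE z in lborel. (\<lambda>n. f (r n) z) \<longlonglongrightarrow> g z)"
proof -
  have "(\<lambda>n. (l2norm (\<lambda>z. f n z - g z))\<^sup>2) \<longlonglongrightarrow> 0\<^sup>2" by (intro tendsto_power lim)
  then have "(\<lambda>n. LINT z|lborel. norm ((cmod (f n z - g z))\<^sup>2)) \<longlonglongrightarrow> 0" by (simp add: l2norm_square)
  then obtain r :: "nat \<Rightarrow> nat" where r: "strict_mono r"
    "AE z in lborel. (\<lambda>n. (cmod (f (r n) z - g z))\<^sup>2) \<longlonglongrightarrow> 0"
    using tendsto_L1_AE_subseq[of lborel "\<lambda>n z. (cmod (f n z - g z))\<^sup>2"] sqint_integrable[OF sqint_diff[OF f g]]
    by blast
  from r(2) have "AE z in lborel. (\<lambda>n. f (r n) z) \<longlonglongrightarrow> g z"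
  proof eventually_elim
    case (elim z)
    have "(\<lambda>n. sqrt ((cmod (f (r n) z - g z))\<^sup>2)) \<longlonglongrightarrow> sqrt 0" by (intro tendsto_real_sqrt elim)
    then have "(\<lambda>n. cmod (f (r n) z - g z)) \<longlonglongrightarrow> 0" by simp
    then show ?case using LIM_zero_cancel tendsto_norm_zero_iff by blast
  qed
  with r(1) show ?thesis by blast
qed

lemma l2norm_limit_unique:
  assumes f: "\<And>n. sqint (f n)" and g: "sqint g" and h: "sqint h"
    and "(\<lambda>n. l2norm (\<lambda>z. f n z - g z)) \<longlonglongrightarrow> 0" "(\<lambda>n. l2norm (\<lambda>z. f n z - h z)) \<longlonglongrightarrow> 0"
  shows "AE z in lborel. g z = h z"
proof -
  have "(\<lambda>n. l2norm (\<lambda>z. f n z - g z) + l2norm (\<lambda>z. f n z - h z)) \<longlonglongrightarrow> 0 + 0"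
    by (intro tendsto_add assms)
  moreover have "l2norm (\<lambda>z. g z - h z) \<le> l2norm (\<lambda>z. f n z - g z) + l2norm (\<lambda>z. f n z - h z)" for n
    using l2norm_triangle_diff[OF g f[of n] h] by (simp add: l2norm_minus_commute)
  ultimately have "l2norm (\<lambda>z. g z - h z) \<le> 0"
    by (intro LIMSEQ_le_const) auto
  then have "l2norm (\<lambda>z. g z - h z) = 0" using l2norm_nonneg[of "\<lambda>z. g z - h z"] by linarith
  from l2norm_eq_0_AE[OF sqint_diff[OF g h] this] show ?thesis by simp
qed

lemma l2norm_tendsto:
  assumes f: "\<And>n. sqint (f n)" and g: "sqint g" and "(\<lambda>n. l2norm (\<lambda>z. f n z - g z)) \<longlonglongrightarrow> 0"
  shows "(\<lambda>n. l2norm (f n)) \<longlonglongrightarrow> l2norm g"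
proof -
  have "(\<lambda>n. l2norm (f n) - l2norm g) \<longlonglongrightarrow> 0"
    by (rule Lim_null_comparison[OF _ assms(3)])
      (use l2norm_reverse_triangle[OF f g] in auto)
  then show ?thesis by (rule LIM_zero_cancel)
qed

lemma l2_pairing_tendsto:
  assumes f: "\<And>n. sqint (f n)" and g: "sqint g" and fg: "(\<lambda>n. l2norm (\<lambda>z. f n z - g z)) \<longlonglongrightarrow> 0"
    and h: "\<And>n. sqint (h n)" and k: "sqint k" and hk: "(\<lambda>n. l2norm (\<lambda>z. h n z - k z)) \<longlonglongrightarrow> 0"
  shows "(\<lambda>n. LINT z|lborel. f n z * h n z) \<longlonglongrightarrow> (LINT z|lborel. g z * k z)"
proof -
  have "(\<lambda>n. (LINT z|lborel. f n z * h n z) - (LINT z|lborel. g z * k z)) \<longlonglongrightarrow> 0"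
  proof (rule Lim_null_comparison)
    have "norm ((LINT z|lborel. f n z * h n z) - (LINT z|lborel. g z * k z))
        \<le> l2norm (\<lambda>z. f n z - g z) * l2norm (h n) + l2norm g * l2norm (\<lambda>z. h n z - k z)" for n
    proof -
      have "(LINT z|lborel. f n z * h n z) - (LINT z|lborel. g z * k z)
          = (LINT z|lborel. (f n z - g z) * h n z + g z * (h n z - k z))"
        by (subst Bochner_Integration.integral_diff[OF sqint_mult_integrable[OF f h] sqint_mult_integrable[OF g k], symmetric])
          (simp add: algebra_simps)
      also have "\<dots> = (LINT z|lborel. (f n z - g z) * h n z) + (LINT z|lborel. g z * (h n z - k z))"
        by (intro Bochner_Integration.integral_add sqint_mult_integrable sqint_diff f g h k)
      also have "norm \<dots> \<le> l2norm (\<lambda>z. f n z - g z) * l2norm (h n) + l2norm g * l2norm (\<lambda>z. h n z - k z)"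
        by (intro norm_triangle_mono l2_Cauchy_Schwarz sqint_diff f g h k)
      finally show ?thesis .
    qed
    then show "\<forall>\<^sub>F n in sequentially. norm ((LINT z|lborel. f n z * h n z) - (LINT z|lborel. g z * k z))
        \<le> l2norm (\<lambda>z. f n z - g z) * l2norm (h n) + l2norm g * l2norm (\<lambda>z. h n z - k z)" by simp
    have "(\<lambda>n. l2norm (\<lambda>z. f n z - g z) * l2norm (h n) + l2norm g * l2norm (\<lambda>z. h n z - k z))
      \<longlonglongrightarrow> 0 * l2norm k + l2norm g * 0"
      by (intro tendsto_intros fg hk l2norm_tendsto[OF h k hk])
    then show "(\<lambda>n. l2norm (\<lambda>z. f n z - g z) * l2norm (h n) + l2norm g * l2norm (\<lambda>z. h n z - k z)) \<longlonglongrightarrow> 0" by simp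
  qed
  then show ?thesis by (rule LIM_zero_cancel)
qed

text \<open>Riesz-Fischer. A subsequence with rapidly decaying increments converges almost
  everywhere, and Fatou's lemma turns the pointwise limit into a norm limit of the whole
  sequence.\<close>

lemma l2_complete:
  fixes f :: "nat \<Rightarrow> plane \<Rightarrow> complex"
  assumes f: "\<And>n. sqint (f n)"
    and cauchy: "\<And>e. e > 0 \<Longrightarrow> \<exists>N. \<forall>m\<ge>N. \<forall>n\<ge>N. l2norm (\<lambda>z. f m z - f n z) < e"
  shows "\<exists>g. sqint g \<and> (\<lambda>n. l2norm (\<lambda>z. f n z - g z)) \<longlonglongrightarrow> 0"
proof -
  have "\<exists>r. \<forall>n. (\<forall>m\<ge>r n. l2norm (\<lambda>z. f m z - f (r n) z) < (1/4)^n) \<and> r n < r (Suc n)"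
  proof (rule dependent_nat_choice)
    show "\<exists>x. \<forall>m\<ge>x. l2norm (\<lambda>z. f m z - f x z) < (1 / 4) ^ 0"
      using cauchy[of "(1/4)^0"] by fastforce
    fix x n
    obtain N where N: "\<forall>m\<ge>N. \<forall>n'\<ge>N. l2norm (\<lambda>z. f m z - f n' z) < (1/4)^Suc n"
      using cauchy[of "(1/4)^Suc n"] by fastforce
    then show "\<exists>y. (\<forall>m\<ge>y. l2norm (\<lambda>z. f m z - f y z) < (1 / 4) ^ Suc n) \<and> x < y"
      by (intro exI[of _ "max N (Suc x)"]) auto
  qed
  then obtain r where r: "\<And>n m. m \<ge> r n \<Longrightarrow> l2norm (\<lambda>z. f m z - f (r n) z) < (1/4)^n"
    and r_Suc: "\<And>n. r n < r (Suc n)" by blast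
  have sm: "strict_mono r" using r_Suc by (simp add: strict_mono_Suc_iff)
  note [measurable] = f[THEN sqint_measurable]
  define d where "d k z = (cmod (f (r (Suc k)) z - f (r k) z))\<^sup>2" for k z
  \<comment> \<open>The norm bound 4^-k becomes 16^-k after squaring, and the factor 4^k leaves a
    summable 4^-k. Almost everywhere this makes the k-th increment at most
    \<open>sqrt C * (1/2)^k\<close>.\<close>
  have d_le: "(\<integral>\<^sup>+z. ennreal (4^k * d k z) \<partial>lborel) \<le> ennreal ((1/4)^k)" for k
  proof -
    have l: "l2norm (\<lambda>z. f (r (Suc k)) z - f (r k) z) \<le> (1/4)^k"
      using r[of k "r (Suc k)"] r_Suc[of k] by (simp add: less_imp_le)
    have "(\<integral>\<^sup>+z. ennreal (4^k * d k z) \<partial>lborel) = ennreal (4^k) * (\<integral>\<^sup>+z. ennreal (d k z) \<partial>lborel)"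
      by (subst nn_integral_cmult[symmetric]) (auto simp: d_def ennreal_mult)
    also have "(\<integral>\<^sup>+z. ennreal (d k z) \<partial>lborel) = ennreal ((l2norm (\<lambda>z. f (r (Suc k)) z - f (r k) z))\<^sup>2)"
      unfolding d_def by (intro nn_integral_l2norm sqint_diff f)
    also have "ennreal (4^k) * \<dots> \<le> ennreal (4^k) * ennreal (((1/4)^k)\<^sup>2)"
      by (intro mult_left_mono ennreal_leI power_mono l) auto
    also have "\<dots> = ennreal ((1/4)^k)"
      by (simp add: power2_eq_square flip: ennreal_mult) (simp add: field_simps)
    finally show ?thesis .
  qed
  have "(\<integral>\<^sup>+z. (\<Sum>k. ennreal (4^k * d k z)) \<partial>lborel) = (\<Sum>k. \<integral>\<^sup>+z. ennreal (4^k * d k z) \<partial>lborel)"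
    by (rule nn_integral_suminf) (simp add: d_def)
  also have "\<dots> \<le> (\<Sum>k. ennreal ((1/4)^k))" by (intro suminf_le d_le) auto
  also have "\<dots> = ennreal (\<Sum>k. (1/4)^k)" by (rule suminf_ennreal2) auto
  also have "\<dots> < \<infinity>" by simp
  finally have "(\<integral>\<^sup>+z. (\<Sum>k. ennreal (4^k * d k z)) \<partial>lborel) \<noteq> \<infinity>" by simp
  then have "AE z in lborel. (\<Sum>k. ennreal (4^k * d k z)) \<noteq> \<infinity>"
    by (intro nn_integral_PInf_AE) (simp add: d_def)
  then have conv: "AE z in lborel. convergent (\<lambda>k. f (r k) z)"
  proof eventually_elim
    case (elim z)
    define C where "C = enn2real (\<Sum>k. ennreal (4^k * d k z))"
    have C: "4^k * d k z \<le> C" for k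
    proof -
      have "ennreal (4^k * d k z) \<le> (\<Sum>k. ennreal (4^k * d k z))"
        using sum_le_suminf[of "\<lambda>k. ennreal (4^k * d k z)" "{k}"] by simp
      also have "\<dots> = ennreal C" using elim by (simp add: C_def less_top)
      finally show ?thesis by (simp add: C_def)
    qed
    have "C \<ge> 0" by (simp add: C_def)
    have bd: "cmod (f (r (Suc k)) z - f (r k) z) \<le> sqrt C * (1/2)^k" for k
    proof (rule power2_le_imp_le)
      have "(4::real)^k = (2^k)\<^sup>2" by (simp add: power_mult[symmetric] mult.commute[of k] power_mult)
      then show "(cmod (f (r (Suc k)) z - f (r k) z))\<^sup>2 \<le> (sqrt C * (1/2)^k)\<^sup>2"
        using C[of k] \<open>C \<ge> 0\<close> by (simp add: d_def power_mult_distrib power_divide field_simps)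
    qed (use \<open>C \<ge> 0\<close> in simp)
    have "summable (\<lambda>k. f (r (Suc k)) z - f (r k) z)"
      by (rule summable_comparison_test'[OF _ bd]) (auto intro!: summable_mult summable_geometric)
    then have "convergent (\<lambda>n. \<Sum>k<n. f (r (Suc k)) z - f (r k) z)" by (simp add: summable_iff_convergent)
    then have "convergent (\<lambda>n. f (r n) z - f (r 0) z)" by (simp add: sum_lessThan_telescope[of "\<lambda>k. f (r k) z"])
    then have "convergent (\<lambda>n. (f (r n) z - f (r 0) z) + f (r 0) z)" by (intro convergent_add convergent_const)
    then show ?case by simp
  qed
  define g where "g z = lim (\<lambda>k. f (r k) z)" for z
  have g_meas [measurable]: "g \<in> borel_measurable borel"
    unfolding g_def by measurable
  have lim: "AE z in lborel. (\<lambda>k. f (r k) z) \<longlonglongrightarrow> g z"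
    using conv by eventually_elim (simp add: g_def convergent_LIMSEQ_iff)
  have close: "(\<integral>\<^sup>+z. ennreal ((cmod (f m z - g z))\<^sup>2) \<partial>lborel) \<le> ennreal (e\<^sup>2)"
    if m: "\<And>n. n \<ge> m \<Longrightarrow> l2norm (\<lambda>z. f m z - f n z) \<le> e" for m e
  proof -
    have "(\<integral>\<^sup>+z. ennreal ((cmod (f m z - g z))\<^sup>2) \<partial>lborel)
        = (\<integral>\<^sup>+z. liminf (\<lambda>k. ennreal ((cmod (f m z - f (r k) z))\<^sup>2)) \<partial>lborel)"
    proof (rule nn_integral_cong_AE, use lim in eventually_elim)
      case (elim z)
      have "(\<lambda>k. ennreal ((cmod (f m z - f (r k) z))\<^sup>2)) \<longlonglongrightarrow> ennreal ((cmod (f m z - g z))\<^sup>2)"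
        by (intro tendsto_intros elim)
      from lim_imp_Liminf[OF sequentially_bot this] show ?case by (rule sym)
    qed
    also have "\<dots> \<le> liminf (\<lambda>k. \<integral>\<^sup>+z. ennreal ((cmod (f m z - f (r k) z))\<^sup>2) \<partial>lborel)"
      by (intro nn_integral_liminf) measurable
    also have "\<dots> \<le> liminf (\<lambda>k. ennreal (e\<^sup>2))"
    proof (rule Liminf_mono, use eventually_ge_at_top[of m] in eventually_elim)
      case (elim k)
      have "r k \<ge> m" using elim seq_suble[OF sm, of k] by linarith
      from m[OF this] show ?case
        by (subst nn_integral_l2norm[OF sqint_diff[OF f f]]) (auto intro!: ennreal_leI power_mono)
    qed
    also have "\<dots> = ennreal (e\<^sup>2)" by (simp add: Liminf_const)
    finally show ?thesis .
  qed
  have sq: "sqint g"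
  proof -
    obtain N where "\<forall>m\<ge>N. \<forall>n\<ge>N. l2norm (\<lambda>z. f m z - f n z) < 1" using cauchy[of 1] by auto
    then have "(\<integral>\<^sup>+z. ennreal ((cmod (f N z - g z))\<^sup>2) \<partial>lborel) \<le> ennreal (1\<^sup>2)"
      by (intro close) (auto simp: less_imp_le)
    then have "sqint (\<lambda>z. f N z - g z)" by (intro sqint_if_nn_integral[where C = "1\<^sup>2"]) auto
    from sqint_diff[OF f[of N] this] show ?thesis by simp
  qed
  have "(\<lambda>n. l2norm (\<lambda>z. f n z - g z)) \<longlonglongrightarrow> 0"
  proof (rule LIMSEQ_I)
    fix e :: real assume "0 < e"
    then obtain N where N: "\<forall>m\<ge>N. \<forall>n\<ge>N. l2norm (\<lambda>z. f m z - f n z) < e / 2" using cauchy[of "e/2"] by auto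
    have "l2norm (\<lambda>z. f m z - g z) \<le> e / 2" if "m \<ge> N" for m
    proof (rule l2norm_le_if_nn_integral)
      show "(\<integral>\<^sup>+z. ennreal ((cmod (f m z - g z))\<^sup>2) \<partial>lborel) \<le> ennreal ((e / 2)\<^sup>2)"
        using N that by (intro close) (simp add: less_imp_le)
    qed (use \<open>0 < e\<close> in auto)
    then show "\<exists>no. \<forall>n\<ge>no. norm (l2norm (\<lambda>z. f n z - g z) - 0) < e"
      using \<open>0 < e\<close> by (intro exI[of _ N]) force
  qed
  with sq show ?thesis by blast
qed

section \<open>Frequency tests: bounds, integrability, density in L2\<close>

lemma frequency_test_continuous: "frequency_test \<theta> \<Longrightarrow> continuous_on UNIV \<theta>"
  by (simp add: frequency_test_def)

lemma frequency_test_measurable: "frequency_test \<theta> \<Longrightarrow> \<theta> \<in> borel_measurable borel"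
  by (simp add: frequency_test_def borel_measurable_continuous_onI)

lemma frequency_test_bounded: "frequency_test \<theta> \<Longrightarrow> \<exists>C. \<forall>z. cmod (\<theta> z) \<le> C"
proof -
  assume t: "frequency_test \<theta>"
  then obtain K where K: "compact K" "\<And>z. z \<notin> K \<Longrightarrow> \<theta> z = 0" by (auto simp: frequency_test_def)
  have "compact (\<theta> ` K)" using K(1) t
    by (intro compact_continuous_image) (auto simp: frequency_test_def intro: continuous_on_subset)
  then obtain C where "\<forall>w\<in>\<theta> ` K. cmod w \<le> C" using compact_imp_bounded bounded_iff by blast
  then have "cmod (\<theta> z) \<le> max C 0" for z using K(2)[of z] by (cases "z \<in> K") (auto simp: max.coboundedI1)
  then show ?thesis by blast
qed

lemma integrable_bounded_compact_support:
  fixes f :: "plane \<Rightarrow> 'b::{banach, second_countable_topology}"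
  assumes "f \<in> borel_measurable borel" "compact K" "\<And>z. z \<notin> K \<Longrightarrow> f z = 0" "\<And>z. norm (f z) \<le> C"
  shows "integrable lborel f"
proof (rule Bochner_Integration.integrable_bound)
  have "K \<in> sets borel" "emeasure lborel K < \<infinity>"
    using borel_compact[OF assms(2)] emeasure_compact_finite[OF assms(2)] by simp_all
  then show "integrable lborel (\<lambda>z. indicator K z *\<^sub>R C)" by (intro integrable_scaleR_left) auto
  show "AE z in lborel. norm (f z) \<le> norm (indicator K z *\<^sub>R C)"
  proof (rule AE_I2)
    fix z
    have "0 \<le> C" using assms(4)[of z] norm_ge_zero[of "f z"] by linarith
    then show "norm (f z) \<le> norm (indicator K z *\<^sub>R C)" using assms(3)[of z] assms(4)[of z]
      by (cases "z \<in> K") auto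
  qed
qed (use assms in simp)

lemma frequency_test_integrable: "frequency_test \<theta> \<Longrightarrow> integrable lborel \<theta>"
proof -
  assume t: "frequency_test \<theta>"
  obtain C where "\<And>z. cmod (\<theta> z) \<le> C" using frequency_test_bounded[OF t] by blast
  moreover obtain K where "compact K" "\<And>z. z \<notin> K \<Longrightarrow> \<theta> z = 0" using t by (auto simp: frequency_test_def)
  ultimately show ?thesis using frequency_test_measurable[OF t]
    by (intro integrable_bounded_compact_support[of \<theta> K C]) auto
qed

lemma frequency_test_sqint: "frequency_test \<theta> \<Longrightarrow> sqint \<theta>"
proof -
  assume t: "frequency_test \<theta>"
  obtain C where C: "\<And>z. cmod (\<theta> z) \<le> C" using frequency_test_bounded[OF t] by blast
  obtain K where K: "compact K" "\<And>z. z \<notin> K \<Longrightarrow> \<theta> z = 0" using t by (auto simp: frequency_test_def)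
  have "integrable lborel (\<lambda>z. (cmod (\<theta> z))\<^sup>2)"
    using K frequency_test_measurable[OF t] power_mono[OF C norm_ge_zero, of _ 2]
    by (intro integrable_bounded_compact_support[where K = K and C = "C\<^sup>2"]) auto
  then show ?thesis using frequency_test_measurable[OF t] by (simp add: sqint_def)
qed

text \<open>The line on which the symbol is singular is a hyperplane, hence null; this is why
  functions vanishing near it can still be dense.\<close>

lemma AE_fst_nonzero: "AE z in lborel. fst (z :: plane) \<noteq> 0"
proof -
  have "negligible {z :: plane. (1, 0) \<bullet> z = 0}" by (intro negligible_hyperplane) (simp add: zero_prod_def)
  moreover have "{z :: plane. (1, 0) \<bullet> z = 0} = {z. fst z = 0}" by (auto simp: inner_prod_def)
  ultimately have "{z :: plane. fst z = 0} \<in> null_sets lebesgue" by (simp add: negligible_iff_null_sets)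
  moreover have "{z :: plane. fst z = 0} \<in> sets borel" by (intro borel_closed closed_Collect_eq continuous_intros)
  ultimately have "{z :: plane. fst z = 0} \<in> null_sets lborel"
    by (simp add: null_sets_def)
  then show ?thesis by (intro AE_I[of _ _ "{z. fst z = 0}"]) (auto simp: null_sets_def)
qed

text \<open>The two cutoffs exhaust the plane off the line \<open>\<xi> = 0\<close>, and clipping makes the approximants bounded,
  so that dominated convergence applies twice.\<close>

lemma frequency_test_dense:
  assumes f: "sqint f" and e: "0 < e"
  shows "\<exists>\<theta>. frequency_test \<theta> \<and> l2norm (\<lambda>z. f z - \<theta> z) < e \<and>
    (integrable lborel f \<longrightarrow> (LINT z|lborel. cmod (f z - \<theta> z)) < e)"
proof -
  note [measurable] = sqint_measurable[OF f]
  \<comment> \<open>Lebesgue measurability supplies continuous functions converging to f off a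
    negligible set. They come without bound or decay, which the clipping and the cutoffs below
    provide.\<close>
  have "f measurable_on UNIV"
    using sqint_measurable[OF f] by (intro lebesgue_measurable_imp_measurable_on) (auto simp: measurable_completion)
  then obtain N g where N: "negligible N" and g: "\<And>n. continuous_on UNIV (g n)"
    and gf: "\<And>x. x \<notin> N \<Longrightarrow> (\<lambda>n. g n x) \<longlonglongrightarrow> f x"
    by (auto simp: measurable_on_def)
  have gm [measurable]: "g n \<in> borel_measurable borel" for n
    using g by (intro borel_measurable_continuous_onI)
  have ae: "AE z in lborel. (\<lambda>n. g n z) \<longlonglongrightarrow> f z"
  proof -
    have "N \<in> null_sets lebesgue" using N by (simp add: negligible_iff_null_sets)
    then have "AE z in lebesgue. (\<lambda>n. g n z) \<longlonglongrightarrow> f z" by (rule AE_I') (use gf in auto)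
    then show ?thesis by (subst (asm) AE_completion_iff) measurable
  qed
  define clip where "clip k w = w / complex_of_real (max 1 (cmod w / real k))" for k w
  define chi where "chi k z = max 0 (min 1 (real k * \<bar>fst z\<bar> - 1)) * max 0 (min 1 (real k - norm z))"
    for k and z :: plane
  have clip_le: "cmod (clip k w) \<le> cmod w" for k w
  proof -
    have "cmod w * 1 \<le> cmod w * max 1 (cmod w / real k)" by (intro mult_left_mono) auto
    moreover have "0 < max 1 (cmod w / real k)" by (simp add: less_max_iff_disj)
    ultimately show ?thesis by (simp add: clip_def norm_divide pos_divide_le_eq)
  qed
  have clip_k: "cmod (clip k w) \<le> real k" if "k > 0" for k w
  proof -
    have "cmod w \<le> real k * max 1 (cmod w / real k)"
      using mult_left_mono[of "cmod w / real k" "max 1 (cmod w / real k)" "real k"] that by simp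
    moreover have "0 < max 1 (cmod w / real k)" by (simp add: less_max_iff_disj)
    ultimately show ?thesis by (simp add: clip_def norm_divide pos_divide_le_eq)
  qed
  have clip_cont: "continuous_on UNIV (clip k)" for k
  proof -
    have "max 1 (inverse (real k) * cmod w) \<noteq> 0" for w
      using max.cobounded1[of 1 "inverse (real k) * cmod w"] by linarith
    then have "continuous_on UNIV (\<lambda>w. w / complex_of_real (max 1 (inverse (real k) * cmod w)))"
      by (intro continuous_intros) (simp only: of_real_eq_0_iff, blast)
    then show ?thesis by (simp add: clip_def[abs_def] divide_inverse mult.commute)
  qed
  have clip_lim: "(\<lambda>k. clip k w) \<longlonglongrightarrow> w" for w
  proof (rule tendsto_eventually)
    show "\<forall>\<^sub>F k in sequentially. clip k w = w"
      using eventually_ge_at_top[of "nat \<lceil>cmod w\<rceil>"] eventually_gt_at_top[of 0]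
    proof eventually_elim
      case (elim k)
      then have "cmod w / real k \<le> 1" by (simp add: divide_le_eq)
      then have "max 1 (cmod w / real k) = 1" by (rule max_absorb1)
      then show ?case by (simp add: clip_def)
    qed
  qed
  have [measurable]: "clip k \<in> borel_measurable borel" for k
    using clip_cont by (rule borel_measurable_continuous_onI)
  have chi01: "0 \<le> chi k z" "chi k z \<le> 1" for k z
    by (auto simp: chi_def intro: mult_le_one)
  have chi_cont: "continuous_on UNIV (chi k)" for k
    unfolding chi_def[abs_def] by (intro continuous_intros)
  have [measurable]: "chi k \<in> borel_measurable borel" for k
    using chi_cont by (rule borel_measurable_continuous_onI)
  have chi_lim: "(\<lambda>k. chi k z) \<longlonglongrightarrow> 1" if "fst z \<noteq> 0" for z
  proof (rule tendsto_eventually)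
    show "\<forall>\<^sub>F k in sequentially. chi k z = 1"
      using eventually_ge_at_top[of "nat \<lceil>norm z + 1\<rceil>"] eventually_ge_at_top[of "nat \<lceil>2 / \<bar>fst z\<bar>\<rceil>"]
    proof eventually_elim
      case (elim k)
      have "real k \<ge> norm z + 1" "real k \<ge> 2 / \<bar>fst z\<bar>" using elim by linarith+
      then show ?case using that by (simp add: chi_def divide_le_eq)
    qed
  qed
  define K where "K k = {z :: plane. 1 \<le> real k * \<bar>fst z\<bar>} \<inter> cball 0 (real k)" for k
  have K: "compact (K k)" "(0, \<eta>) \<notin> K k" "z \<notin> K k \<Longrightarrow> chi k z = 0" for k \<eta> z
  proof -
    show "compact (K k)" unfolding K_def
      by (intro closed_Int_compact closed_Collect_le continuous_intros compact_cball)
    show "(0, \<eta>) \<notin> K k" by (simp add: K_def)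
    show "z \<notin> K k \<Longrightarrow> chi k z = 0" by (auto simp: K_def chi_def)
  qed
  have test: "frequency_test (\<lambda>z. chi k z * clip k (g n z))" for k n
    unfolding frequency_test_def
  proof (intro conjI exI[of _ "K k"] allI impI K)
    show "continuous_on UNIV (\<lambda>z. complex_of_real (chi k z) * clip k (g n z))"
      by (intro continuous_intros continuous_on_compose2[OF clip_cont] chi_cont g) auto
  qed (auto simp: K)
  define h where "h k z = chi k z * clip k (f z)" for k z
  have h_le: "cmod (h k z) \<le> cmod (f z)" for k z
    using mult_mono[OF chi01(2)[of k z] clip_le[of k "f z"]] chi01[of k z] by (simp add: h_def norm_mult)
  have [measurable]: "h k \<in> borel_measurable borel" for k unfolding h_def by measurable
  have h_lim: "AE z in lborel. (\<lambda>k. h k z) \<longlonglongrightarrow> f z"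
    using AE_fst_nonzero
  proof eventually_elim
    case (elim z)
    have "(\<lambda>k. complex_of_real (chi k z) * clip k (f z)) \<longlonglongrightarrow> complex_of_real 1 * f z"
      by (intro tendsto_intros chi_lim clip_lim elim)
    then show ?case by (simp add: h_def)
  qed
  have h1: "(\<lambda>k. l2norm (\<lambda>z. h k z - f z)) \<longlonglongrightarrow> 0"
    by (rule l2norm_dominated_convergence(2)[where w = "\<lambda>z. cmod (f z)"])
      (use sqint_integrable[OF f] h_le h_lim in auto)
  have h2: "(\<lambda>k. LINT z|lborel. cmod (h k z - f z)) \<longlonglongrightarrow> 0" if i: "integrable lborel f"
  proof -
    have "(\<lambda>k. LINT z|lborel. cmod (h k z - f z)) \<longlonglongrightarrow> (LINT z|(lborel::plane measure). 0)"
    proof (rule integral_dominated_convergence[where w = "\<lambda>z. 2 * cmod (f z)"])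
      show "AE z in lborel. norm (cmod (h k z - f z)) \<le> 2 * cmod (f z)" for k
      proof (rule AE_I2)
        fix z show "norm (cmod (h k z - f z)) \<le> 2 * cmod (f z)"
          using norm_triangle_ineq4[of "h k z" "f z"] h_le[of k z] by simp
      qed
      show "AE z in lborel. (\<lambda>k. cmod (h k z - f z)) \<longlonglongrightarrow> 0"
        using h_lim by eventually_elim (simp add: LIM_zero_iff tendsto_norm_zero_iff)
    qed (use i in auto)
    then show ?thesis by simp
  qed
  have "\<forall>\<^sub>F k in sequentially. l2norm (\<lambda>z. h k z - f z) < e / 2 \<and>
      (integrable lborel f \<longrightarrow> (LINT z|lborel. cmod (h k z - f z)) < e / 2) \<and> 0 < k"
    using order_tendstoD(2)[OF h1, of "e/2"] order_tendstoD(2)[OF h2, of "e/2"] e eventually_gt_at_top[of 0]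
    by (cases "integrable lborel f") (auto simp: eventually_conj_iff)
  then obtain k where k: "l2norm (\<lambda>z. h k z - f z) < e / 2"
    "integrable lborel f \<Longrightarrow> (LINT z|lborel. cmod (h k z - f z)) < e / 2" "0 < k"
    by (auto simp: eventually_sequentially)
  define p where "p n z = chi k z * clip k (g n z)" for n z
  have [measurable]: "p n \<in> borel_measurable borel" for n unfolding p_def by measurable
  have ptest: "frequency_test (p n)" for n using test[of k n] by (simp add: p_def[abs_def])
  have p_le: "cmod (p n z) \<le> indicator (K k) z * real k" for n z
    using chi01[of k z] clip_k[OF k(3), of "g n z"] K(3)[of z k]
      mult_mono[OF chi01(2)[of k z] clip_k[OF k(3), of "g n z"]]
    by (cases "z \<in> K k") (auto simp: p_def norm_mult)
  have hk_le: "cmod (h k z) \<le> indicator (K k) z * real k" for z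
    using chi01[of k z] clip_k[OF k(3), of "f z"] K(3)[of z k]
      mult_mono[OF chi01(2)[of k z] clip_k[OF k(3), of "f z"]]
    by (cases "z \<in> K k") (auto simp: h_def norm_mult)
  have Ki: "integrable lborel (\<lambda>z. indicator (K k) z * c :: real)" for c
    using borel_compact[OF K(1)[of k]] emeasure_compact_finite[OF K(1)[of k]]
    by (intro integrable_mult_left integrable_real_indicator) simp_all
  have p_lim: "AE z in lborel. (\<lambda>n. p n z) \<longlonglongrightarrow> h k z"
    using ae
  proof eventually_elim
    case (elim z)
    have "isCont (clip k) (f z)" using clip_cont[of k] by (simp add: continuous_on_eq_continuous_at)
    then show ?case unfolding p_def h_def by (intro tendsto_intros isCont_tendsto_compose[of _ "clip k"] elim)
  qed
  have "(\<lambda>n. l2norm (\<lambda>z. p n z - h k z)) \<longlonglongrightarrow> 0"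
  proof (rule l2norm_dominated_convergence(2)[where w = "\<lambda>z. indicator (K k) z * real k"])
    show "integrable lborel (\<lambda>z. (indicator (K k) z * real k)\<^sup>2)"
    proof -
      have "(\<lambda>z. (indicator (K k) z * real k)\<^sup>2) = (\<lambda>z. indicator (K k) z * (real k)\<^sup>2)"
        by (auto simp: indicator_def)
      then show ?thesis using Ki[of "(real k)\<^sup>2"] by simp
    qed
  qed (use p_le p_lim in auto)
  moreover have "(\<lambda>n. LINT z|lborel. cmod (p n z - h k z)) \<longlonglongrightarrow> 0"
  proof -
    have "(\<lambda>n. LINT z|lborel. cmod (p n z - h k z)) \<longlonglongrightarrow> (LINT z|(lborel::plane measure). 0)"
    proof (rule integral_dominated_convergence[where w = "\<lambda>z. indicator (K k) z * (2 * real k)"])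
      have "cmod (p n z - h k z) \<le> indicator (K k) z * (2 * real k)" for n z
        using norm_triangle_ineq4[of "p n z" "h k z"] p_le[of n z] hk_le[of z] by (simp add: algebra_simps)
      then show "AE z in lborel. norm (cmod (p n z - h k z)) \<le> indicator (K k) z * (2 * real k)" for n
        by auto
      show "AE z in lborel. (\<lambda>n. cmod (p n z - h k z)) \<longlonglongrightarrow> 0"
        using p_lim by eventually_elim (simp add: LIM_zero_iff tendsto_norm_zero_iff)
    qed (use Ki in auto)
    then show ?thesis by simp
  qed
  ultimately have "\<forall>\<^sub>F n in sequentially. l2norm (\<lambda>z. p n z - h k z) < e / 2 \<and> (LINT z|lborel. cmod (p n z - h k z)) < e / 2"
    using e by (intro eventually_conj order_tendstoD(2)) auto
  then obtain n where n: "l2norm (\<lambda>z. p n z - h k z) < e / 2" "(LINT z|lborel. cmod (p n z - h k z)) < e / 2"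
    by (auto simp: eventually_sequentially)
  have hk: "sqint (h k)" using sqint_integrable[OF f] by (rule sqint_dominated) (use h_le in auto)
  have "l2norm (\<lambda>z. f z - p n z) < e"
    using l2norm_triangle_diff[OF f hk frequency_test_sqint[OF ptest[of n]]] k(1) n(1)
      l2norm_minus_commute[of f "h k"] l2norm_minus_commute[of "h k" "p n"] by linarith
  moreover have "(LINT z|lborel. cmod (f z - p n z)) < e" if i: "integrable lborel f"
  proof -
    have hi: "integrable lborel (h k)"
      using integrable_norm[OF i] by (rule Bochner_Integration.integrable_bound) (use h_le in auto)
    have pi: "integrable lborel (p n)" using ptest by (rule frequency_test_integrable)
    have "(LINT z|lborel. cmod (f z - p n z)) \<le> (LINT z|lborel. cmod (h k z - f z) + cmod (p n z - h k z))"
    proof (rule integral_mono)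
      fix z
      have "cmod (f z - p n z) \<le> cmod (f z - h k z) + cmod (h k z - p n z)"
        using norm_triangle_ineq[of "f z - h k z" "h k z - p n z"] by simp
      then show "cmod (f z - p n z) \<le> cmod (h k z - f z) + cmod (p n z - h k z)" by (simp add: norm_minus_commute)
    qed (use i hi pi in auto)
    also have "\<dots> < e" using k(2)[OF i] n(2) i hi pi by simp
    finally show ?thesis .
  qed
  ultimately show ?thesis using ptest[of n] by blast
qed

section \<open>The Fourier transform on \<open>L\<^sup>2\<close> of the plane\<close>

lemma lborel_plane_affine:
  fixes f :: "plane \<Rightarrow> 'b::{banach, second_countable_topology}"
  assumes c: "c \<noteq> 0" and f: "f \<in> borel_measurable borel"
  shows "(LINT z|lborel. f z) = c\<^sup>2 *\<^sub>R (LINT z|lborel. f (t + c *\<^sub>R z))"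
    and "integrable lborel (\<lambda>z. f (t + c *\<^sub>R z)) \<longleftrightarrow> integrable lborel f"
proof -
  have eq: "lborel = density (distr lborel borel (\<lambda>z::plane. t + c *\<^sub>R z)) (\<lambda>_. ennreal (c\<^sup>2))"
    using lborel_affine[OF c, of t] by (simp add: eval_nat_numeral)
  show "(LINT z|lborel. f z) = c\<^sup>2 *\<^sub>R (LINT z|lborel. f (t + c *\<^sub>R z))"
    using f by (subst eq) (simp add: integral_density integral_distr)
  have "integrable lborel f \<longleftrightarrow> integrable (density (distr lborel borel (\<lambda>z::plane. t + c *\<^sub>R z)) (\<lambda>_. ennreal (c\<^sup>2))) f"
    by (subst eq) simp
  also have "\<dots> \<longleftrightarrow> integrable lborel (\<lambda>z. f (t + c *\<^sub>R z))"
  proof -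
    have "integrable lborel (\<lambda>z. c\<^sup>2 *\<^sub>R f (t + c *\<^sub>R z)) \<longleftrightarrow> integrable lborel (\<lambda>z. f (t + c *\<^sub>R z))"
      using integrable_scaleR_right[of "1 / c\<^sup>2" lborel "\<lambda>z. c\<^sup>2 *\<^sub>R f (t + c *\<^sub>R z)"] c by auto
    then show ?thesis using f by (subst integrable_density) (auto simp: integrable_distr_eq)
  qed
  finally show "integrable lborel (\<lambda>z. f (t + c *\<^sub>R z)) \<longleftrightarrow> integrable lborel f" by simp
qed

lemma lborel_plane_reflect:
  fixes f :: "plane \<Rightarrow> 'b::{banach, second_countable_topology}"
  assumes f: "f \<in> borel_measurable borel"
  shows "(LINT z|lborel. f (t - z)) = (LINT z|lborel. f z)"
    and "integrable lborel (\<lambda>z. f (t - z)) \<longleftrightarrow> integrable lborel f"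
  using lborel_plane_affine[of "-1" f t] f by auto

lemma lborel_plane_translate:
  fixes f :: "plane \<Rightarrow> 'b::{banach, second_countable_topology}"
  assumes f: "f \<in> borel_measurable borel"
  shows "(LINT z|lborel. f (t + z)) = (LINT z|lborel. f z)"
    and "integrable lborel (\<lambda>z. f (t + z)) \<longleftrightarrow> integrable lborel f"
  using lborel_plane_affine[of 1 f t] f by auto

lemma sqint_reflect: "sqint f \<Longrightarrow> sqint (\<lambda>z. f (t - z))"
  using lborel_plane_reflect(2)[of "\<lambda>z. (cmod (f z))\<^sup>2" t] by (auto simp: sqint_def)

lemma l2norm_reflect: "f \<in> borel_measurable borel \<Longrightarrow> l2norm (\<lambda>z. f (t - z)) = l2norm f"
  using lborel_plane_reflect(1)[of "\<lambda>z. (cmod (f z))\<^sup>2" t] by (auto simp: l2norm_def)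

section \<open>Gaussian integrals\<close>

definition gauss :: "plane \<Rightarrow> real" where
  "gauss z = exp (- (norm z)\<^sup>2 / 2)"

lemma gauss_Pair: "gauss (x, y) = exp (- x\<^sup>2 / 2) * exp (- y\<^sup>2 / 2)"
  by (simp add: gauss_def norm_Pair exp_add[symmetric] add_divide_distrib diff_divide_distrib)

lemma gauss_bounds: "0 < gauss z" "gauss z \<le> 1"
  by (auto simp: gauss_def)

lemma gauss_measurable [measurable]: "gauss \<in> borel_measurable borel"
  unfolding gauss_def[abs_def] by measurable

text \<open>This is the characteristic function of the standard normal distribution, freed of the
  factor \<open>1 / sqrt (2 * pi)\<close> in its density.\<close>

lemma gaussian_integral_cis:
  "integrable lborel (\<lambda>x. complex_of_real (exp (- x\<^sup>2 / 2)) * cis (t * x))"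
  "(LINT x|lborel. complex_of_real (exp (- x\<^sup>2 / 2)) * cis (t * x)) = complex_of_real (sqrt (2 * pi) * exp (- t\<^sup>2 / 2))"
proof -
  have i: "integrable lborel std_normal_density" by simp
  have eq: "exp (- x\<^sup>2 / 2) = sqrt (2 * pi) * std_normal_density x" for x
    by (simp add: std_normal_density_def)
  have "integrable lborel (\<lambda>x. complex_of_real (exp (- x\<^sup>2 / 2)))"
    unfolding eq using i by simp
  then show "integrable lborel (\<lambda>x. complex_of_real (exp (- x\<^sup>2 / 2)) * cis (t * x))"
    by (rule Bochner_Integration.integrable_bound) (auto simp: norm_mult cis_conv_exp)
  have "complex_of_real (exp (- t\<^sup>2 / 2)) = char std_normal_distribution t"
    by (simp add: char_std_normal_distribution)
  also have "\<dots> = (LINT x|lborel. std_normal_density x *\<^sub>R cis (t * x))"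
    by (simp add: char_def integral_density cis_conv_exp)
  finally have "complex_of_real (sqrt (2 * pi) * exp (- t\<^sup>2 / 2)) = sqrt (2 * pi) *\<^sub>R (LINT x|lborel. std_normal_density x *\<^sub>R cis (t * x))"
    by (simp add: scaleR_conv_of_real)
  also have "\<dots> = (LINT x|lborel. sqrt (2 * pi) *\<^sub>R (std_normal_density x *\<^sub>R cis (t * x)))"
    by (rule integral_scaleR_right[symmetric])
  also have "\<dots> = (LINT x|lborel. complex_of_real (exp (- x\<^sup>2 / 2)) * cis (t * x))"
    unfolding eq by (simp add: scaleR_conv_of_real mult.assoc)
  finally show "(LINT x|lborel. complex_of_real (exp (- x\<^sup>2 / 2)) * cis (t * x)) = complex_of_real (sqrt (2 * pi) * exp (- t\<^sup>2 / 2))" ..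
qed

text \<open>By Fubini from the line. Divided by 2 pi, as in \<open>fourier\<close>, it says that the
  Gaussian is its own transform.\<close>

lemma gauss_fourier:
  "integrable lborel gauss"
  "(LINT z|lborel. complex_of_real (gauss z) * cis (h \<bullet> z)) = complex_of_real (2 * pi * gauss h)"
proof -
  define F where "F t x = complex_of_real (exp (- x\<^sup>2 / 2)) * cis (t * x)" for t x
  obtain t s where h: "h = (t, s)" by (cases h)
  have F: "integrable lborel (F t)" "(LINT x|lborel. F t x) = complex_of_real (sqrt (2 * pi) * exp (- t\<^sup>2 / 2))" for t
    using gaussian_integral_cis[of t] by (simp_all add: F_def[abs_def])
  have [measurable]: "F t \<in> borel_measurable borel" for t using F(1)[of t] by simp
  have split: "complex_of_real (gauss (x, y)) * cis ((t, s) \<bullet> (x, y)) = F t x * F s y" for x y t s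
    by (simp add: F_def gauss_Pair cis_mult mult_ac add.commute)
  have int: "integrable (lborel \<Otimes>\<^sub>M lborel) (\<lambda>(x, y). F t x * F s y)" for t s
  proof (rule lborel_pair.Fubini_integrable)
    show "integrable lborel (\<lambda>x. LINT y|lborel. norm (case (x, y) of (x, y) \<Rightarrow> F t x * F s y))"
      using integrable_norm[OF F(1)[of t]] by (simp add: norm_mult)
    show "AE x in lborel. integrable lborel (\<lambda>y. case (x, y) of (x, y) \<Rightarrow> F t x * F s y)"
      using F(1)[of s] by simp
  qed measurable
  have "integrable (lborel :: plane measure) (\<lambda>z. complex_of_real (gauss z) * cis ((0,0) \<bullet> z))"
    using int[of 0 0] by (simp only: lborel_prod[symmetric] case_prod_beta' prod.collapse flip: split)
  from integrable_norm[OF this] show "integrable lborel gauss"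
    using gauss_bounds by (simp add: less_imp_le norm_mult)
  have "(LINT z|lborel. complex_of_real (gauss z) * cis (h \<bullet> z)) = (LINT z|(lborel \<Otimes>\<^sub>M lborel). (case z of (x, y) \<Rightarrow> F t x * F s y))"
    by (simp only: h lborel_prod[symmetric] case_prod_beta' prod.collapse flip: split)
  also have "\<dots> = (LINT x|lborel. LINT y|lborel. F t x * F s y)"
    using lborel_pair.integral_fst'[OF int[of t s]] by simp
  also have "\<dots> = complex_of_real (2 * pi * gauss h)"
  proof -
    have "sqrt (2 * pi) * exp (- t\<^sup>2 / 2) * (sqrt (2 * pi) * exp (- s\<^sup>2 / 2)) = 2 * pi * gauss h"
      using real_sqrt_mult_self[of "2 * pi"] by (simp add: h gauss_Pair mult_ac)
    then show ?thesis
      by (simp only: F(2) integral_mult_right_zero integral_mult_left_zero of_real_mult[symmetric])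
  qed
  finally show "(LINT z|lborel. complex_of_real (gauss z) * cis (h \<bullet> z)) = complex_of_real (2 * pi * gauss h)" .
qed

section \<open>The classical transform and Plancherel's identity for frequency tests\<close>

definition fourierc :: "(plane \<Rightarrow> complex) \<Rightarrow> plane \<Rightarrow> complex" where
  "fourierc f \<zeta> = (LINT z|lborel. f z * cis (- (z \<bullet> \<zeta>))) / complex_of_real (2 * pi)"

lemma fourier_eq_fourierc: "fourier f = fourierc (\<lambda>z. complex_of_real (f z))"
  by (simp add: fun_eq_iff fourier_def fourierc_def)

lemma cis_inner_measurable [measurable]: "(\<lambda>z::plane. cis (- (z \<bullet> \<zeta>))) \<in> borel_measurable borel"
  "(\<lambda>z::plane. cis (z \<bullet> \<zeta>)) \<in> borel_measurable borel"
  unfolding cis_conv_exp by measurable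

lemma integrable_mult_cis:
  assumes f: "integrable lborel (f :: plane \<Rightarrow> complex)"
  shows "integrable lborel (\<lambda>z. f z * cis (- (z \<bullet> \<zeta>)))" "integrable lborel (\<lambda>z. f z * cis (z \<bullet> \<zeta>))"
  by (rule Bochner_Integration.integrable_bound[OF f];
      use borel_measurable_integrable[OF f] in \<open>simp add: norm_mult\<close>)+

lemma fourierc_measurable [measurable]:
  assumes [measurable]: "f \<in> borel_measurable borel"
  shows "fourierc f \<in> borel_measurable borel"
  unfolding fourierc_def[abs_def] cis_conv_exp by measurable

lemma fourierc_bound: "cmod (fourierc f \<zeta>) \<le> (LINT z|lborel. cmod (f z)) / (2 * pi)"
  using integral_norm_bound[of lborel "\<lambda>z. f z * cis (- (z \<bullet> \<zeta>))"]
  by (simp add: fourierc_def norm_divide norm_mult divide_right_mono)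

lemma fourierc_add:
  assumes "integrable lborel f" "integrable lborel g"
  shows "fourierc (\<lambda>z. a * f z + b * g z) \<zeta> = a * fourierc f \<zeta> + b * fourierc g \<zeta>"
  using integrable_mult_cis(1)[OF assms(1)] integrable_mult_cis(1)[OF assms(2)]
  by (simp add: fourierc_def distrib_right mult.assoc add_divide_distrib)

text \<open>Fubini: the kernel is symmetric and bounded, so the integrand is dominated by a product
  of two integrable functions. Both Plancherel's identity and the adjoint formula on L2 rest on this
  exchange.\<close>

lemma fourierc_mult_formula:
  assumes f: "integrable lborel f" and k: "integrable lborel k"
  shows "(LINT \<zeta>|lborel. fourierc f \<zeta> * k \<zeta>) = (LINT z|lborel. f z * fourierc k z)"
proof -
  note [measurable] = borel_measurable_integrable[OF f, simplified] borel_measurable_integrable[OF k, simplified]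
  define H where "H z \<zeta> = f z * k \<zeta> * cis (- (z \<bullet> \<zeta>))" for z \<zeta>
  have "integrable (lborel \<Otimes>\<^sub>M lborel) (\<lambda>(z, \<zeta>). H z \<zeta>)"
  proof (rule lborel_pair.Fubini_integrable)
    show "(\<lambda>(z, \<zeta>). H z \<zeta>) \<in> borel_measurable (lborel \<Otimes>\<^sub>M lborel)"
      unfolding H_def cis_conv_exp by measurable
    show "integrable lborel (\<lambda>z. LINT \<zeta>|lborel. norm (case (z, \<zeta>) of (z, \<zeta>) \<Rightarrow> H z \<zeta>))"
      using integrable_norm[OF f] by (simp add: H_def norm_mult)
    show "AE z in lborel. integrable lborel (\<lambda>\<zeta>. case (z, \<zeta>) of (z, \<zeta>) \<Rightarrow> H z \<zeta>)"
      using integrable_mult_cis(1)[OF k] by (simp add: H_def mult.assoc inner_commute)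
  qed
  then have "(LINT \<zeta>|lborel. LINT z|lborel. H z \<zeta>) = (LINT z|lborel. LINT \<zeta>|lborel. H z \<zeta>)"
    by (rule lborel_pair.Fubini_integral)
  moreover have "(LINT z|lborel. H z \<zeta>) = complex_of_real (2 * pi) * (fourierc f \<zeta> * k \<zeta>)" for \<zeta>
  proof -
    have "(LINT z|lborel. H z \<zeta>) = k \<zeta> * (LINT z|lborel. f z * cis (- (z \<bullet> \<zeta>)))"
      by (subst integral_mult_right_zero[symmetric]) (simp add: H_def mult_ac)
    then show ?thesis by (simp add: fourierc_def)
  qed
  moreover have "(LINT \<zeta>|lborel. H z \<zeta>) = complex_of_real (2 * pi) * (f z * fourierc k z)" for z
  proof -
    have "(LINT \<zeta>|lborel. H z \<zeta>) = f z * (LINT \<zeta>|lborel. k \<zeta> * cis (- (\<zeta> \<bullet> z)))"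
      unfolding integral_mult_right_zero[symmetric] by (simp add: H_def[abs_def] mult_ac inner_commute)
    then show ?thesis by (simp add: fourierc_def)
  qed
  ultimately show ?thesis by simp
qed

lemma fourierc_cnj_reflect:
  assumes f: "f \<in> borel_measurable borel"
  shows "fourierc (\<lambda>z. cnj (f z)) \<zeta> = cnj (fourierc f (- \<zeta>))"
proof -
  have "(LINT z|lborel. cnj (f z) * cis (- (z \<bullet> \<zeta>))) = (LINT z|lborel. cnj (f z * cis (- (z \<bullet> (- \<zeta>)))))"
    by (simp add: cis_cnj)
  also have "\<dots> = cnj (LINT z|lborel. f z * cis (- (z \<bullet> (- \<zeta>))))"
    by (rule Bochner_Integration.integral_cnj)
  finally show ?thesis by (simp add: fourierc_def)
qed

text \<open>As e tends to 0 this is an approximate identity of mass 2 pi at \<open>- x\<close>: the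
  modulation sets the centre and the dilation the width.\<close>

lemma fourierc_gauss_scaled:
  assumes "0 < e"
  shows "fourierc (\<lambda>\<zeta>. gauss (e *\<^sub>R \<zeta>) * cis (- (x \<bullet> \<zeta>))) y = gauss ((1 / e) *\<^sub>R (x + y)) / e\<^sup>2"
proof -
  define G where "G w = complex_of_real (gauss w) * cis ((- (1/e) *\<^sub>R (x + y)) \<bullet> w)" for w
  have [measurable]: "G \<in> borel_measurable borel"
    unfolding G_def cis_conv_exp by measurable
  have "(LINT \<zeta>|lborel. gauss (e *\<^sub>R \<zeta>) * cis (- (x \<bullet> \<zeta>)) * cis (- (\<zeta> \<bullet> y))) = (LINT \<zeta>|lborel. G (0 + e *\<^sub>R \<zeta>))"
  proof (rule Bochner_Integration.integral_cong[OF refl])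
    fix \<zeta> :: plane
    have "(- (1/e) *\<^sub>R (x + y)) \<bullet> (e *\<^sub>R \<zeta>) = - (x \<bullet> \<zeta>) + - (\<zeta> \<bullet> y)"
      using assms by (simp add: inner_add_left inner_add_right inner_commute)
    then show "gauss (e *\<^sub>R \<zeta>) * cis (- (x \<bullet> \<zeta>)) * cis (- (\<zeta> \<bullet> y)) = G (0 + e *\<^sub>R \<zeta>)"
      by (simp only: G_def add_0 cis_mult mult.assoc)
  qed
  also have "\<dots> = (LINT w|lborel. G w) / e\<^sup>2"
    using assms lborel_plane_affine(1)[of e G 0] by (simp add: scaleR_conv_of_real field_simps)
  also have "(LINT w|lborel. G w) = complex_of_real (2 * pi * gauss ((1 / e) *\<^sub>R (x + y)))"
    unfolding G_def gauss_fourier(2) by (simp add: gauss_def)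
  finally show ?thesis by (simp add: fourierc_def)
qed


text \<open>With a Gaussian convergence factor the squared transform is integrable, and the
  multiplication formula rewrites the damped integral as the pairing of f with a mollification of
  its conjugate. As the damping disappears, the pairing converges by dominated convergence and the
  damped integral by monotone convergence, which also yields integrability.\<close>

lemma fourierc_plancherel_test:
  assumes t: "frequency_test f"
  shows "sqint (fourierc f)" "l2norm (fourierc f) = l2norm f"
proof -
  have fi: "integrable lborel f" and fc: "continuous_on UNIV f" and fm [measurable]: "f \<in> borel_measurable borel"
    using t by (simp_all add: frequency_test_integrable frequency_test_continuous frequency_test_measurable)
  obtain C where C: "\<And>z. cmod (f z) \<le> C" using frequency_test_bounded[OF t] by blast
  \<comment> \<open>Reflecting and conjugating f conjugates its transform, so the squared modulus
    becomes a product of two transforms, to which the multiplication formula applies.\<close>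
  define f' where "f' z = cnj (f (0 - z))" for z
  have cnjm: "cnj \<in> borel_measurable borel" by (intro borel_measurable_continuous_onI continuous_intros)
  have f'i: "integrable lborel f'"
    unfolding f'_def complex_integrable_cnj lborel_plane_reflect(2)[OF fm] by (rule fi)
  have F': "fourierc f' \<zeta> = cnj (fourierc f \<zeta>)" for \<zeta>
  proof -
    have "fourierc (\<lambda>z. f (0 - z)) (- \<zeta>) = fourierc f \<zeta>"
      using lborel_plane_reflect(1)[of "\<lambda>z. f z * cis (- (z \<bullet> \<zeta>))" 0] by (simp add: fourierc_def)
    then show ?thesis unfolding f'_def using fourierc_cnj_reflect[of "\<lambda>z. f (0 - z)" \<zeta>] by simp
  qed
  define P where "P e = (LINT \<zeta>|lborel. (cmod (fourierc f \<zeta>))\<^sup>2 * gauss (e *\<^sub>R \<zeta>))" for e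
  have gi: "integrable lborel (\<lambda>\<zeta>. gauss (e *\<^sub>R \<zeta>))" if "0 < e" for e
    using lborel_plane_affine(2)[of e gauss 0] that gauss_fourier(1) by simp
  define B where "B = (LINT z|lborel. cmod (f z)) / (2 * pi)"
  have bd: "cmod (fourierc f \<zeta>) \<le> B" for \<zeta>
    unfolding B_def by (rule fourierc_bound)
  have Pi: "integrable lborel (\<lambda>\<zeta>. (cmod (fourierc f \<zeta>))\<^sup>2 * gauss (e *\<^sub>R \<zeta>))" if "0 < e" for e
  proof (rule Bochner_Integration.integrable_bound)
    show "integrable lborel (\<lambda>\<zeta>. B\<^sup>2 * gauss (e *\<^sub>R \<zeta>))" using gi[OF that] by simp
    show "AE \<zeta> in lborel. norm ((cmod (fourierc f \<zeta>))\<^sup>2 * gauss (e *\<^sub>R \<zeta>)) \<le> norm (B\<^sup>2 * gauss (e *\<^sub>R \<zeta>))"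
      using power_mono[OF bd, of _ 2] gauss_bounds(1) by (intro AE_I2) (simp add: abs_mult less_imp_le mult_right_mono)
  qed measurable
  \<comment> \<open>The mollification of \<open>cnj f\<close> at scale e; the Gaussian has mass 2
    pi, hence the divisor.\<close>
  define J where "J e x = (LINT s|lborel. cnj (f (x - e *\<^sub>R s)) * gauss s) / (2 * pi)" for e x
  have PJ: "complex_of_real (P e) = (LINT x|lborel. f x * J e x)" if e: "0 < e" for e
  proof -
    define k where "k \<zeta> = cnj (fourierc f \<zeta>) * complex_of_real (gauss (e *\<^sub>R \<zeta>))" for \<zeta>
    have ki: "integrable lborel k"
    proof (rule Bochner_Integration.integrable_bound)
      show "integrable lborel (\<lambda>\<zeta>. B * gauss (e *\<^sub>R \<zeta>))" using gi[OF e] by simp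
      show "k \<in> borel_measurable lborel" unfolding k_def F'[symmetric]
        using f'i by measurable
      show "AE \<zeta> in lborel. norm (k \<zeta>) \<le> norm (B * gauss (e *\<^sub>R \<zeta>))"
        using order_trans[OF bd abs_ge_self] gauss_bounds(1)
        by (intro AE_I2) (simp add: k_def norm_mult abs_mult less_imp_le mult_right_mono)
    qed
    have kJ: "fourierc k x = J e x" for x
    proof -
      have "fourierc k x = (LINT \<zeta>|lborel. fourierc f' \<zeta> * (gauss (e *\<^sub>R \<zeta>) * cis (- (x \<bullet> \<zeta>)))) / (2 * pi)"
        by (simp add: fourierc_def[of k] k_def F' mult.assoc inner_commute)
      also have "(LINT \<zeta>|lborel. fourierc f' \<zeta> * (gauss (e *\<^sub>R \<zeta>) * cis (- (x \<bullet> \<zeta>))))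
          = (LINT y|lborel. f' y * fourierc (\<lambda>\<zeta>. gauss (e *\<^sub>R \<zeta>) * cis (- (x \<bullet> \<zeta>))) y)"
      proof (rule fourierc_mult_formula[OF f'i])
        have "integrable lborel (\<lambda>\<zeta>. complex_of_real (gauss (e *\<^sub>R \<zeta>)))" using gi[OF e] by simp
        from integrable_mult_cis(1)[OF this, of x]
        show "integrable lborel (\<lambda>\<zeta>. complex_of_real (gauss (e *\<^sub>R \<zeta>)) * cis (- (x \<bullet> \<zeta>)))" by (simp add: inner_commute)
      qed
      also have "\<dots> = (LINT y|lborel. f' y * (gauss ((1 / e) *\<^sub>R (x + y)) / e\<^sup>2))"
        by (simp add: fourierc_gauss_scaled[OF e])
      also have "\<dots> = e\<^sup>2 *\<^sub>R (LINT s|lborel. f' (- x + e *\<^sub>R s) * (gauss ((1 / e) *\<^sub>R (x + (- x + e *\<^sub>R s))) / e\<^sup>2))"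
        using f'i by (intro lborel_plane_affine(1)[of e "\<lambda>y. f' y * (gauss ((1 / e) *\<^sub>R (x + y)) / e\<^sup>2)" "- x"]) (use e in auto)
      also have "\<dots> = (LINT s|lborel. cnj (f (x - e *\<^sub>R s)) * gauss s)"
        unfolding integral_scaleR_right[symmetric] using e by (simp add: f'_def scaleR_conv_of_real)
      finally show ?thesis by (simp add: J_def)
    qed
    have "complex_of_real (P e) = (LINT \<zeta>|lborel. complex_of_real ((cmod (fourierc f \<zeta>))\<^sup>2 * gauss (e *\<^sub>R \<zeta>)))"
      unfolding P_def by (rule integral_complex_of_real[symmetric])
    also have "\<dots> = (LINT \<zeta>|lborel. fourierc f \<zeta> * k \<zeta>)"
      by (simp add: k_def complex_norm_square mult_ac del: of_real_power)
    also have "\<dots> = (LINT x|lborel. f x * fourierc k x)" by (rule fourierc_mult_formula[OF fi ki])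
    finally show ?thesis by (simp only: kJ)
  qed
  have C0: "0 \<le> C" using C[of 0] norm_ge_zero[of "f 0"] by linarith
  have Jm: "J e \<in> borel_measurable borel" for e
    unfolding J_def[abs_def] using cnjm by measurable
  have J_lim: "(\<lambda>n. J (1 / real (Suc n)) x) \<longlonglongrightarrow> cnj (f x)" for x
  proof -
    have "(\<lambda>n. LINT s|lborel. cnj (f (x - (1 / real (Suc n)) *\<^sub>R s)) * gauss s) \<longlonglongrightarrow> (LINT s|lborel. cnj (f x) * gauss s)"
    proof (rule integral_dominated_convergence[where w = "\<lambda>s. C * gauss s"])
      show "AE s in lborel. (\<lambda>n. cnj (f (x - (1 / real (Suc n)) *\<^sub>R s)) * gauss s) \<longlonglongrightarrow> cnj (f x) * gauss s"
      proof (rule AE_I2)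
        fix s :: plane
        have "(\<lambda>n. x - (1 / real (Suc n)) *\<^sub>R s) \<longlonglongrightarrow> x - 0 *\<^sub>R s"
          by (intro tendsto_intros LIMSEQ_Suc[OF lim_1_over_n])
        moreover have "isCont f x" using fc by (simp add: continuous_on_eq_continuous_at del: split_paired_All)
        ultimately show "(\<lambda>n. cnj (f (x - (1 / real (Suc n)) *\<^sub>R s)) * gauss s) \<longlonglongrightarrow> cnj (f x) * gauss s"
          by (intro tendsto_intros isCont_tendsto_compose[of x f]) auto
      qed
      show "AE s in lborel. norm (cnj (f (x - (1 / real (Suc n)) *\<^sub>R s)) * gauss s) \<le> C * gauss s" for n
        using C gauss_bounds(1) by (intro AE_I2) (simp add: norm_mult less_imp_le mult_right_mono)
    qed (use gauss_fourier(1) cnjm in \<open>simp_all, measurable\<close>)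
    moreover have "(LINT s|lborel. complex_of_real (gauss s)) = 2 * pi"
      using gauss_fourier(2)[of 0] by (simp add: gauss_def)
    ultimately show ?thesis unfolding J_def
      by (intro tendsto_eq_intros) (auto simp del: of_nat_Suc)
  qed
  have J_bd: "cmod (J e x) \<le> C" for e x
  proof -
    have "cmod (LINT s|lborel. cnj (f (x - e *\<^sub>R s)) * gauss s) \<le> (LINT s|lborel. C * gauss s)"
    proof (rule Bochner_Integration.integral_norm_bound_integral)
      show "integrable lborel (\<lambda>s. C * gauss s)" using gauss_fourier(1) by simp
      show bdd: "norm (cnj (f (x - e *\<^sub>R s)) * gauss s) \<le> C * gauss s" for s
        using C gauss_bounds(1) by (simp add: norm_mult less_imp_le mult_right_mono)
      show "integrable lborel (\<lambda>s. cnj (f (x - e *\<^sub>R s)) * gauss s)"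
      proof (rule Bochner_Integration.integrable_bound[OF \<open>integrable lborel (\<lambda>s. C * gauss s)\<close>])
        show "(\<lambda>s. cnj (f (x - e *\<^sub>R s)) * gauss s) \<in> borel_measurable lborel" using cnjm by measurable
        show "AE s in lborel. norm (cnj (f (x - e *\<^sub>R s)) * gauss s) \<le> norm (C * gauss s)"
          using bdd order_trans[OF _ abs_ge_self] by (intro AE_I2) (simp add: order_trans[OF _ abs_ge_self])
      qed
    qed
    moreover have "complex_of_real (LINT s|lborel. gauss s) = complex_of_real (2 * pi)"
      using gauss_fourier(2)[of 0] by (simp add: gauss_def flip: integral_complex_of_real)
    then have "(LINT s|lborel. gauss s) = 2 * pi" by (simp only: of_real_eq_iff)
    ultimately show ?thesis by (simp add: J_def norm_divide divide_le_eq)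
  qed
  have "(\<lambda>n. LINT x|lborel. f x * J (1 / real (Suc n)) x) \<longlonglongrightarrow> (LINT x|lborel. f x * cnj (f x))"
  proof (rule integral_dominated_convergence[where w = "\<lambda>x. cmod (f x) * C"])
    show "AE x in lborel. norm (f x * J (1 / real (Suc n)) x) \<le> cmod (f x) * C" for n
      by (intro AE_I2) (simp only: norm_mult, intro mult_left_mono J_bd, simp)
    show "AE x in lborel. (\<lambda>n. f x * J (1 / real (Suc n)) x) \<longlonglongrightarrow> f x * cnj (f x)"
      by (intro AE_I2 tendsto_intros J_lim)
    show "integrable lborel (\<lambda>x. cmod (f x) * C)" using fi by simp
  qed (use Jm cnjm in measurable)
  moreover have "(LINT x|lborel. f x * cnj (f x)) = complex_of_real ((l2norm f)\<^sup>2)"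
    unfolding l2norm_square integral_complex_of_real[symmetric]
    by (intro Bochner_Integration.integral_cong) (simp_all add: complex_norm_square del: of_real_power)
  ultimately have "(\<lambda>n. complex_of_real (P (1 / real (Suc n)))) \<longlonglongrightarrow> complex_of_real ((l2norm f)\<^sup>2)"
    by (simp add: PJ del: of_nat_Suc)
  then have P_lim: "(\<lambda>n. P (1 / real (Suc n))) \<longlonglongrightarrow> (l2norm f)\<^sup>2" by (simp only: tendsto_of_real_iff)
  have "has_bochner_integral lborel (\<lambda>\<zeta>. (cmod (fourierc f \<zeta>))\<^sup>2) ((l2norm f)\<^sup>2)"
  proof (rule has_bochner_integral_monotone_convergence)
    show "integrable lborel (\<lambda>\<zeta>. (cmod (fourierc f \<zeta>))\<^sup>2 * gauss ((1 / real (Suc n)) *\<^sub>R \<zeta>))" for n by (rule Pi) simp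
    show "AE \<zeta> in lborel. mono (\<lambda>n. (cmod (fourierc f \<zeta>))\<^sup>2 * gauss ((1 / real (Suc n)) *\<^sub>R \<zeta>))"
    proof (intro AE_I2 monoI mult_left_mono)
      fix \<zeta> :: plane and m n :: nat assume "m \<le> n"
      then have "norm ((1 / real (Suc n)) *\<^sub>R \<zeta>) \<le> norm ((1 / real (Suc m)) *\<^sub>R \<zeta>)"
        by (simp add: frac_le mult_right_mono divide_left_mono)
      then have "(norm ((1 / real (Suc n)) *\<^sub>R \<zeta>))\<^sup>2 \<le> (norm ((1 / real (Suc m)) *\<^sub>R \<zeta>))\<^sup>2" by (rule power_mono) simp
      then show "gauss ((1 / real (Suc m)) *\<^sub>R \<zeta>) \<le> gauss ((1 / real (Suc n)) *\<^sub>R \<zeta>)"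
        by (simp add: gauss_def)
    qed simp
    show "AE \<zeta> in lborel. (\<lambda>n. (cmod (fourierc f \<zeta>))\<^sup>2 * gauss ((1 / real (Suc n)) *\<^sub>R \<zeta>)) \<longlonglongrightarrow> (cmod (fourierc f \<zeta>))\<^sup>2"
    proof (rule AE_I2)
      fix \<zeta> :: plane
      have "(\<lambda>n. (cmod (fourierc f \<zeta>))\<^sup>2 * gauss ((1 / real (Suc n)) *\<^sub>R \<zeta>)) \<longlonglongrightarrow> (cmod (fourierc f \<zeta>))\<^sup>2 * exp (- (norm (0 *\<^sub>R \<zeta>))\<^sup>2 / 2)"
        unfolding gauss_def by (intro tendsto_intros LIMSEQ_Suc[OF lim_1_over_n]) auto
      then show "(\<lambda>n. (cmod (fourierc f \<zeta>))\<^sup>2 * gauss ((1 / real (Suc n)) *\<^sub>R \<zeta>)) \<longlonglongrightarrow> (cmod (fourierc f \<zeta>))\<^sup>2" by simp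
    qed
    show "(\<lambda>n. LINT \<zeta>|lborel. (cmod (fourierc f \<zeta>))\<^sup>2 * gauss ((1 / real (Suc n)) *\<^sub>R \<zeta>)) \<longlonglongrightarrow> (l2norm f)\<^sup>2"
      using P_lim by (simp only: P_def)
  qed measurable
  then show "sqint (fourierc f)" "l2norm (fourierc f) = l2norm f"
    by (auto simp: sqint_def has_bochner_integral_iff l2norm_def)
qed

section \<open>Extension of the transform to L2\<close>

lemma frequency_test_lincomb:
  assumes f: "frequency_test f" and g: "frequency_test g"
  shows "frequency_test (\<lambda>z. a * f z + b * g z)"
proof -
  obtain K K' where "compact K" "\<forall>\<eta>. (0, \<eta>) \<notin> K" "\<forall>\<zeta>. \<zeta> \<notin> K \<longrightarrow> f \<zeta> = 0"
    "compact K'" "\<forall>\<eta>. (0, \<eta>) \<notin> K'" "\<forall>\<zeta>. \<zeta> \<notin> K' \<longrightarrow> g \<zeta> = 0"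
    using f g unfolding frequency_test_def by blast
  then show ?thesis
    using frequency_test_continuous[OF f] frequency_test_continuous[OF g] unfolding frequency_test_def
    by (intro conjI exI[of _ "K \<union> K'"] continuous_intros compact_Un) auto
qed

text \<open>The multiplier may be singular on the line \<open>fst z = 0\<close>: f vanishes on the
  open complement of a compact set that avoids this line, and that complement together with
  \<open>{z. fst z \<noteq> 0}\<close> covers the plane. The phases of the linear evolution are
  multipliers of this kind.\<close>

lemma frequency_test_mult:
  assumes f: "frequency_test f" and g: "continuous_on {z. fst z \<noteq> 0} g"
  shows "frequency_test (\<lambda>z. f z * g z)"
proof -
  obtain K where K: "compact K" "\<forall>\<eta>. (0, \<eta>) \<notin> K" "\<forall>\<zeta>. \<zeta> \<notin> K \<longrightarrow> f \<zeta> = 0"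
    using f unfolding frequency_test_def by blast
  have "continuous_on ({z. fst z \<noteq> 0} \<union> (- K)) (\<lambda>z. f z * g z)"
  proof (rule continuous_on_open_Un)
    show "open {z :: plane. fst z \<noteq> 0}" by (intro open_Collect_neq continuous_intros)
    show "open (- K)" using K(1) compact_imp_closed by blast
    show "continuous_on {z. fst z \<noteq> 0} (\<lambda>z. f z * g z)"
      by (intro continuous_intros g continuous_on_subset[OF frequency_test_continuous[OF f]]) auto
    show "continuous_on (- K) (\<lambda>z. f z * g z)"
      using K(3) by (subst continuous_on_cong[OF refl, of _ _ "\<lambda>_. 0"]) auto
  qed
  moreover have "{z :: plane. fst z \<noteq> 0} \<union> (- K) = UNIV" using K(2) by auto
  ultimately show ?thesis using K unfolding frequency_test_def by auto
qed

text \<open>A relation, because the L2 transform is fixed only up to null sets. It is the closure of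
  the graph of the classical transform on frequency tests.\<close>

definition ft :: "(plane \<Rightarrow> complex) \<Rightarrow> (plane \<Rightarrow> complex) \<Rightarrow> bool" where
  "ft f g \<longleftrightarrow> sqint f \<and> sqint g \<and>
    (\<exists>\<phi>. (\<forall>n. frequency_test (\<phi> n)) \<and>
      (\<lambda>n. l2norm (\<lambda>z. \<phi> n z - f z)) \<longlonglongrightarrow> 0 \<and> (\<lambda>n. l2norm (\<lambda>z. fourierc (\<phi> n) z - g z)) \<longlonglongrightarrow> 0)"

lemma ft_sqint: "ft f g \<Longrightarrow> sqint f" "ft f g \<Longrightarrow> sqint g"
  by (simp_all add: ft_def)

lemma ft_isometry:
  assumes "ft f g" shows "l2norm g = l2norm f"
proof -
  obtain \<phi> where \<phi>: "\<And>n. frequency_test (\<phi> n)" "(\<lambda>n. l2norm (\<lambda>z. \<phi> n z - f z)) \<longlonglongrightarrow> 0"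
    "(\<lambda>n. l2norm (\<lambda>z. fourierc (\<phi> n) z - g z)) \<longlonglongrightarrow> 0"
    using assms unfolding ft_def by blast
  have "(\<lambda>n. l2norm (\<phi> n)) \<longlonglongrightarrow> l2norm f"
    using assms \<phi> by (intro l2norm_tendsto) (auto simp: ft_def frequency_test_sqint)
  moreover have "(\<lambda>n. l2norm (fourierc (\<phi> n))) \<longlonglongrightarrow> l2norm g"
    using assms \<phi> by (intro l2norm_tendsto) (auto simp: ft_def fourierc_plancherel_test)
  ultimately show ?thesis
    using \<phi>(1) by (simp add: fourierc_plancherel_test LIMSEQ_unique)
qed

lemma l2norm_lincomb_tendsto_0:
  assumes p: "\<And>n. sqint (p n)" and f: "sqint f" and pf: "(\<lambda>n. l2norm (\<lambda>z. p n z - f z)) \<longlonglongrightarrow> 0"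
    and q: "\<And>n. sqint (q n)" and g: "sqint g" and qg: "(\<lambda>n. l2norm (\<lambda>z. q n z - g z)) \<longlonglongrightarrow> 0"
  shows "(\<lambda>n. l2norm (\<lambda>z. (a * p n z + b * q n z) - (a * f z + b * g z))) \<longlonglongrightarrow> 0"
proof (rule Lim_null_comparison)
  have "l2norm (\<lambda>z. (a * p n z + b * q n z) - (a * f z + b * g z))
      \<le> cmod a * l2norm (\<lambda>z. p n z - f z) + cmod b * l2norm (\<lambda>z. q n z - g z)" for n
    using l2norm_triangle[OF sqint_scale[OF sqint_diff[OF p[of n] f], of a] sqint_scale[OF sqint_diff[OF q[of n] g], of b]]
    unfolding l2norm_scale by (simp add: algebra_simps)
  then show "\<forall>\<^sub>F n in sequentially. norm (l2norm (\<lambda>z. (a * p n z + b * q n z) - (a * f z + b * g z)))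
      \<le> cmod a * l2norm (\<lambda>z. p n z - f z) + cmod b * l2norm (\<lambda>z. q n z - g z)" by simp
  have "(\<lambda>n. cmod a * l2norm (\<lambda>z. p n z - f z) + cmod b * l2norm (\<lambda>z. q n z - g z)) \<longlonglongrightarrow> cmod a * 0 + cmod b * 0"
    by (intro tendsto_intros pf qg)
  then show "(\<lambda>n. cmod a * l2norm (\<lambda>z. p n z - f z) + cmod b * l2norm (\<lambda>z. q n z - g z)) \<longlonglongrightarrow> 0" by simp
qed

lemma ft_lincomb:
  assumes fg: "ft f g" and fg': "ft f' g'"
  shows "ft (\<lambda>z. a * f z + b * f' z) (\<lambda>z. a * g z + b * g' z)"
proof -
  obtain \<phi> \<psi> where \<phi>: "\<And>n. frequency_test (\<phi> n)" "(\<lambda>n. l2norm (\<lambda>z. \<phi> n z - f z)) \<longlonglongrightarrow> 0"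
      "(\<lambda>n. l2norm (\<lambda>z. fourierc (\<phi> n) z - g z)) \<longlonglongrightarrow> 0"
    and \<psi>: "\<And>n. frequency_test (\<psi> n)" "(\<lambda>n. l2norm (\<lambda>z. \<psi> n z - f' z)) \<longlonglongrightarrow> 0"
      "(\<lambda>n. l2norm (\<lambda>z. fourierc (\<psi> n) z - g' z)) \<longlonglongrightarrow> 0"
    using fg fg' unfolding ft_def by blast
  note sq = ft_sqint[OF fg] ft_sqint[OF fg'] frequency_test_sqint[OF \<phi>(1)] frequency_test_sqint[OF \<psi>(1)]
    fourierc_plancherel_test(1)[OF \<phi>(1)] fourierc_plancherel_test(1)[OF \<psi>(1)]
  have "fourierc (\<lambda>z. a * \<phi> n z + b * \<psi> n z) = (\<lambda>z. a * fourierc (\<phi> n) z + b * fourierc (\<psi> n) z)" for n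
    by (intro ext fourierc_add frequency_test_integrable \<phi> \<psi>)
  then show ?thesis unfolding ft_def
    by (intro conjI sqint_add sqint_scale sq exI[of _ "\<lambda>n z. a * \<phi> n z + b * \<psi> n z"] allI frequency_test_lincomb \<phi>(1) \<psi>(1))
      (auto intro!: l2norm_lincomb_tendsto_0 sq \<phi> \<psi>)
qed

lemma ft_scale: "ft f g \<Longrightarrow> ft (\<lambda>z. a * f z) (\<lambda>z. a * g z)"
  using ft_lincomb[of f g f g a 0] by simp

lemma ft_add: "ft f g \<Longrightarrow> ft f' g' \<Longrightarrow> ft (\<lambda>z. f z + f' z) (\<lambda>z. g z + g' z)"
  using ft_lincomb[of f g f' g' 1 1] by simp

lemma ft_diff: "ft f g \<Longrightarrow> ft f' g' \<Longrightarrow> ft (\<lambda>z. f z - f' z) (\<lambda>z. g z - g' z)"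
  using ft_lincomb[of f g f' g' 1 "-1"] by simp

lemma ft_isometry_diff: "ft f g \<Longrightarrow> ft f' g' \<Longrightarrow> l2norm (\<lambda>z. g z - g' z) = l2norm (\<lambda>z. f z - f' z)"
  by (rule ft_isometry[OF ft_diff])

lemma ft_unique:
  assumes "ft f g" "ft f g'" shows "AE z in lborel. g z = g' z"
proof -
  have "l2norm (\<lambda>z. g z - g' z) = 0" using ft_isometry_diff[OF assms] by (simp add: l2norm_def)
  from l2norm_eq_0_AE[OF sqint_diff[OF ft_sqint(2)[OF assms(1)] ft_sqint(2)[OF assms(2)]] this]
  show ?thesis by simp
qed

lemma ft_test: "frequency_test f \<Longrightarrow> ft f (fourierc f)"
  unfolding ft_def
  by (intro conjI exI[of _ "\<lambda>n. f"]) (auto simp: frequency_test_sqint fourierc_plancherel_test l2norm_def)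

lemma ft_exists:
  assumes f: "sqint f" shows "\<exists>g. ft f g"
proof -
  have "\<exists>\<phi>. \<forall>n. frequency_test (\<phi> n) \<and> l2norm (\<lambda>z. f z - \<phi> n z) < 1 / real (Suc n)"
    using frequency_test_dense[OF f, of "1 / real (Suc _)"] by (intro choice) fastforce
  then obtain \<phi> where \<phi>: "\<And>n. frequency_test (\<phi> n)" "\<And>n. l2norm (\<lambda>z. f z - \<phi> n z) < 1 / real (Suc n)" by blast
  note sq = frequency_test_sqint[OF \<phi>(1)]
  have lim: "(\<lambda>n. l2norm (\<lambda>z. \<phi> n z - f z)) \<longlonglongrightarrow> 0"
    by (rule Lim_null_comparison[OF _ LIMSEQ_Suc[OF lim_1_over_n]])
      (use \<phi>(2) in \<open>auto simp: l2norm_minus_commute[of f] less_imp_le simp del: of_nat_Suc\<close>)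
  have "\<exists>N. \<forall>m\<ge>N. \<forall>n\<ge>N. l2norm (\<lambda>z. fourierc (\<phi> m) z - fourierc (\<phi> n) z) < e" if e: "0 < e" for e
  proof -
    obtain N where N: "\<And>n. n \<ge> N \<Longrightarrow> l2norm (\<lambda>z. \<phi> n z - f z) < e / 2"
      using order_tendstoD(2)[OF lim, of "e / 2"] e by (auto simp: eventually_sequentially)
    have "l2norm (\<lambda>z. fourierc (\<phi> m) z - fourierc (\<phi> n) z) < e" if "m \<ge> N" "n \<ge> N" for m n
    proof -
      have "l2norm (\<lambda>z. fourierc (\<phi> m) z - fourierc (\<phi> n) z) = l2norm (\<lambda>z. \<phi> m z - \<phi> n z)"
        by (intro ft_isometry_diff ft_test \<phi>)
      also have "\<dots> \<le> l2norm (\<lambda>z. \<phi> m z - f z) + l2norm (\<lambda>z. f z - \<phi> n z)"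
        by (intro l2norm_triangle_diff sq f)
      also have "\<dots> < e" using N[OF that(1)] N[OF that(2)] by (simp add: l2norm_minus_commute[of f])
      finally show ?thesis .
    qed
    then show ?thesis by blast
  qed
  then obtain g where "sqint g" "(\<lambda>n. l2norm (\<lambda>z. fourierc (\<phi> n) z - g z)) \<longlonglongrightarrow> 0"
    using l2_complete[of "\<lambda>n. fourierc (\<phi> n)"] \<phi>(1) by (auto simp: fourierc_plancherel_test)
  then have "ft f g" unfolding ft_def using f \<phi>(1) lim by blast
  then show ?thesis by blast
qed

lemma ft_cong_AE:
  assumes ft: "ft f g" and f: "f' \<in> borel_measurable borel" "AE z in lborel. f z = f' z"
    and g: "g' \<in> borel_measurable borel" "AE z in lborel. g z = g' z"
  shows "ft f' g'"
proof -
  obtain \<phi> where \<phi>: "\<And>n. frequency_test (\<phi> n)" "(\<lambda>n. l2norm (\<lambda>z. \<phi> n z - f z)) \<longlonglongrightarrow> 0"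
    "(\<lambda>n. l2norm (\<lambda>z. fourierc (\<phi> n) z - g z)) \<longlonglongrightarrow> 0"
    using ft unfolding ft_def by blast
  note [measurable] = f(1) g(1) ft_sqint[OF ft, THEN sqint_measurable] frequency_test_measurable[OF \<phi>(1)]
  have "l2norm (\<lambda>z. \<phi> n z - f z) = l2norm (\<lambda>z. \<phi> n z - f' z)" for n
    by (rule l2norm_cong_AE) (measurable, use f(2) in eventually_elim, simp)
  moreover have "l2norm (\<lambda>z. fourierc (\<phi> n) z - g z) = l2norm (\<lambda>z. fourierc (\<phi> n) z - g' z)" for n
    by (rule l2norm_cong_AE) (measurable, use g(2) in eventually_elim, simp)
  ultimately show ?thesis
    using sqint_cong_AE[OF ft_sqint(1)[OF ft] f] sqint_cong_AE[OF ft_sqint(2)[OF ft] g] \<phi>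
    unfolding ft_def by auto
qed

text \<open>The graph is closed: by isometry the transforms converge to a transform of the limit,
  and L2 limits are unique almost everywhere.\<close>

lemma ft_limit:
  assumes fg: "\<And>n. ft (f n) (g n)" and f': "sqint f'" and g': "sqint g'"
    and "(\<lambda>n. l2norm (\<lambda>z. f n z - f' z)) \<longlonglongrightarrow> 0" "(\<lambda>n. l2norm (\<lambda>z. g n z - g' z)) \<longlonglongrightarrow> 0"
  shows "ft f' g'"
proof -
  obtain h where h: "ft f' h" using ft_exists[OF f'] by blast
  have "(\<lambda>n. l2norm (\<lambda>z. g n z - h z)) \<longlonglongrightarrow> 0" using assms(4) by (simp add: ft_isometry_diff[OF fg h])
  then have "AE z in lborel. h z = g' z"
    using assms ft_sqint[OF fg] ft_sqint[OF h] by (intro l2norm_limit_unique[of g]) auto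
  then show ?thesis using h f' g' by (intro ft_cong_AE[OF h]) (auto intro: sqint_measurable)
qed

lemma l2norm_add_square:
  assumes f: "sqint f" and g: "sqint g"
  shows "(l2norm (\<lambda>z. f z + g z))\<^sup>2 = (l2norm f)\<^sup>2 + (l2norm g)\<^sup>2 + 2 * Re (LINT z|lborel. f z * cnj (g z))"
proof -
  have i: "integrable lborel (\<lambda>z. f z * cnj (g z))" using sqint_mult_integrable[OF f sqint_cnj[OF g]] .
  define R where "R z = Re (f z * cnj (g z))" for z
  have iR: "integrable lborel R" unfolding R_def using i by (rule integrable_Re)
  have "(cmod (a + b))\<^sup>2 = (cmod a)\<^sup>2 + (cmod b)\<^sup>2 + 2 * Re (a * cnj b)" for a b :: complex
    unfolding cmod_power2 by (simp add: power2_eq_square algebra_simps)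
  then have "(l2norm (\<lambda>z. f z + g z))\<^sup>2 = (LINT z|lborel. (cmod (f z))\<^sup>2 + (cmod (g z))\<^sup>2 + 2 * R z)"
    by (simp add: l2norm_square R_def)
  also have "\<dots> = (l2norm f)\<^sup>2 + (l2norm g)\<^sup>2 + 2 * (LINT z|lborel. R z)"
    using sqint_integrable[OF f] sqint_integrable[OF g] iR by (simp add: l2norm_square)
  also have "(LINT z|lborel. R z) = Re (LINT z|lborel. f z * cnj (g z))" unfolding R_def using i by (rule integral_Re)
  finally show ?thesis .
qed

lemma l2norm_diff_square:
  assumes f: "sqint f" and g: "sqint g"
  shows "(l2norm (\<lambda>z. f z - g z))\<^sup>2 = (l2norm f)\<^sup>2 + (l2norm g)\<^sup>2 - 2 * Re (LINT z|lborel. f z * cnj (g z))"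
  using l2norm_add_square[OF f sqint_scale[OF g, of "-1"]] l2norm_scale[of "-1" g] by simp

text \<open>Polarisation: the isometry applied to a sum gives equality of the real parts, and
  multiplying the second function by \<open>\<i>\<close> gives that of the imaginary parts.\<close>

lemma ft_parseval:
  assumes fg: "ft f g" and fg': "ft f' g'"
  shows "(LINT z|lborel. g z * cnj (g' z)) = (LINT z|lborel. f z * cnj (f' z))"
proof -
  have re: "Re (LINT z|lborel. g z * cnj (k z)) = Re (LINT z|lborel. f z * cnj (h z))" if "ft h k" for h k
    using l2norm_add_square[OF ft_sqint(1)[OF fg] ft_sqint(1)[OF that]]
      l2norm_add_square[OF ft_sqint(2)[OF fg] ft_sqint(2)[OF that]]
      ft_isometry[OF fg] ft_isometry[OF that] ft_isometry[OF ft_add[OF fg that]] by simp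
  have "Re (- \<i> * (LINT z|lborel. g z * cnj (g' z))) = Re (- \<i> * (LINT z|lborel. f z * cnj (f' z)))"
    using re[OF ft_scale[OF fg', of \<i>]] unfolding integral_mult_right_zero[symmetric] by (simp add: mult_ac)
  with re[OF fg'] show ?thesis by (simp add: complex_eq_iff)
qed

text \<open>Combined with Parseval's identity, this is how the transform of a product becomes a
  convolution.\<close>

lemma ft_modulate:
  assumes ft: "ft f g"
  shows "ft (\<lambda>z. f z * cis (z \<bullet> \<zeta>0)) (\<lambda>\<zeta>. g (\<zeta> - \<zeta>0))"
proof -
  obtain \<phi> where \<phi>: "\<And>n. frequency_test (\<phi> n)" "(\<lambda>n. l2norm (\<lambda>z. \<phi> n z - f z)) \<longlonglongrightarrow> 0"
    "(\<lambda>n. l2norm (\<lambda>z. fourierc (\<phi> n) z - g z)) \<longlonglongrightarrow> 0"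
    using ft unfolding ft_def by blast
  note [measurable] = ft_sqint[OF ft, THEN sqint_measurable] frequency_test_measurable[OF \<phi>(1)]
  have trans: "l2norm (\<lambda>z. h (z - \<zeta>0)) = l2norm h" "sqint h \<Longrightarrow> sqint (\<lambda>z. h (z - \<zeta>0))"
    if [measurable]: "h \<in> borel_measurable borel" for h
    using lborel_plane_translate[of "\<lambda>z. (cmod (h z))\<^sup>2" "- \<zeta>0"] by (auto simp: l2norm_def sqint_def)
  have cis: "continuous_on UNIV (\<lambda>z. cis (z \<bullet> \<zeta>0))" unfolding cis_conv_exp by (intro continuous_intros)
  have shift: "fourierc (\<lambda>z. h z * cis (z \<bullet> \<zeta>0)) \<zeta> = fourierc h (\<zeta> - \<zeta>0)" for h \<zeta>
    by (simp add: fourierc_def mult.assoc cis_mult inner_diff_right algebra_simps)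
  show ?thesis unfolding ft_def
  proof (intro conjI exI[of _ "\<lambda>n z. \<phi> n z * cis (z \<bullet> \<zeta>0)"] allI)
    show "sqint (\<lambda>z. f z * cis (z \<bullet> \<zeta>0))"
      by (rule sqint_cong_norm[OF ft_sqint(1)[OF ft]]) (measurable, simp add: norm_mult)
    show "sqint (\<lambda>\<zeta>. g (\<zeta> - \<zeta>0))" by (rule trans(2)) (use ft_sqint(2)[OF ft] in auto)
    show "frequency_test (\<lambda>z. \<phi> n z * cis (z \<bullet> \<zeta>0))" for n
      by (intro frequency_test_mult \<phi> continuous_on_subset[OF cis]) auto
    have "l2norm (\<lambda>z. \<phi> n z * cis (z \<bullet> \<zeta>0) - f z * cis (z \<bullet> \<zeta>0)) = l2norm (\<lambda>z. \<phi> n z - f z)" for n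
      by (rule l2norm_cong_norm) (simp add: norm_mult flip: left_diff_distrib)
    then show "(\<lambda>n. l2norm (\<lambda>z. \<phi> n z * cis (z \<bullet> \<zeta>0) - f z * cis (z \<bullet> \<zeta>0))) \<longlonglongrightarrow> 0" using \<phi>(2) by simp
    show "(\<lambda>n. l2norm (\<lambda>z. fourierc (\<lambda>z. \<phi> n z * cis (z \<bullet> \<zeta>0)) z - g (z - \<zeta>0))) \<longlonglongrightarrow> 0"
      unfolding shift using \<phi>(3) trans(1)[of "\<lambda>z. fourierc (\<phi> _) z - g z"] by simp
  qed
qed

lemma ft_cnj:
  assumes ft: "ft f g"
  shows "ft (\<lambda>z. cnj (f z)) (\<lambda>\<zeta>. cnj (g (- \<zeta>)))"
proof -
  obtain \<phi> where \<phi>: "\<And>n. frequency_test (\<phi> n)" "(\<lambda>n. l2norm (\<lambda>z. \<phi> n z - f z)) \<longlonglongrightarrow> 0"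
    "(\<lambda>n. l2norm (\<lambda>z. fourierc (\<phi> n) z - g z)) \<longlonglongrightarrow> 0"
    using ft unfolding ft_def by blast
  note [measurable] = ft_sqint[OF ft, THEN sqint_measurable] frequency_test_measurable[OF \<phi>(1)]
  show ?thesis unfolding ft_def
  proof (intro conjI exI[of _ "\<lambda>n z. cnj (\<phi> n z)"] allI)
    show "sqint (\<lambda>z. cnj (f z))" by (rule sqint_cnj[OF ft_sqint(1)[OF ft]])
    show "sqint (\<lambda>\<zeta>. cnj (g (- \<zeta>)))"
      using sqint_cnj[OF sqint_reflect[OF ft_sqint(2)[OF ft], of 0]] by simp
    show "frequency_test (\<lambda>z. cnj (\<phi> n z))" for n
      using \<phi>(1)[of n] by (auto simp: frequency_test_def intro!: continuous_intros)
    have "l2norm (\<lambda>z. cnj (\<phi> n z) - cnj (f z)) = l2norm (\<lambda>z. \<phi> n z - f z)" for n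
      by (rule l2norm_cong_norm) (simp flip: complex_cnj_diff)
    then show "(\<lambda>n. l2norm (\<lambda>z. cnj (\<phi> n z) - cnj (f z))) \<longlonglongrightarrow> 0" using \<phi>(2) by simp
    have "l2norm (\<lambda>z. fourierc (\<lambda>z. cnj (\<phi> n z)) z - cnj (g (- z))) = l2norm (\<lambda>z. fourierc (\<phi> n) (0 - z) - g (0 - z))" for n
      by (rule l2norm_cong_norm) (simp add: fourierc_cnj_reflect flip: complex_cnj_diff)
    also have "\<dots> n = l2norm (\<lambda>z. fourierc (\<phi> n) z - g z)" for n
      by (rule l2norm_reflect[of "\<lambda>z. fourierc (\<phi> n) z - g z"]) measurable
    finally show "(\<lambda>n. l2norm (\<lambda>z. fourierc (\<lambda>z. cnj (\<phi> n z)) z - cnj (g (- z)))) \<longlonglongrightarrow> 0" using \<phi>(3) by simp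
  qed
qed

lemma ft_adjoint:
  assumes fg: "ft f g" and hk: "ft h k"
  shows "(LINT z|lborel. g z * h z) = (LINT z|lborel. f z * k z)"
proof -
  obtain \<phi> \<psi> where \<phi>: "\<And>n. frequency_test (\<phi> n)" "(\<lambda>n. l2norm (\<lambda>z. \<phi> n z - f z)) \<longlonglongrightarrow> 0"
      "(\<lambda>n. l2norm (\<lambda>z. fourierc (\<phi> n) z - g z)) \<longlonglongrightarrow> 0"
    and \<psi>: "\<And>n. frequency_test (\<psi> n)" "(\<lambda>n. l2norm (\<lambda>z. \<psi> n z - h z)) \<longlonglongrightarrow> 0"
      "(\<lambda>n. l2norm (\<lambda>z. fourierc (\<psi> n) z - k z)) \<longlonglongrightarrow> 0"
    using fg hk unfolding ft_def by blast
  note sq = ft_sqint[OF fg] ft_sqint[OF hk] frequency_test_sqint[OF \<phi>(1)] frequency_test_sqint[OF \<psi>(1)]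
    fourierc_plancherel_test(1)[OF \<phi>(1)] fourierc_plancherel_test(1)[OF \<psi>(1)]
  have "(\<lambda>n. LINT z|lborel. fourierc (\<phi> n) z * \<psi> n z) \<longlonglongrightarrow> (LINT z|lborel. g z * h z)"
    by (intro l2_pairing_tendsto sq \<phi> \<psi>)
  moreover have "(\<lambda>n. LINT z|lborel. \<phi> n z * fourierc (\<psi> n) z) \<longlonglongrightarrow> (LINT z|lborel. f z * k z)"
    by (intro l2_pairing_tendsto sq \<phi> \<psi>)
  ultimately show ?thesis
    by (simp add: fourierc_mult_formula frequency_test_integrable \<phi> \<psi> LIMSEQ_unique)
qed

text \<open>The Fourier transform and its adjoint are both isometries, hence mutually inverse.\<close>

lemma ft_surjective:
  assumes g: "sqint g"
  shows "\<exists>k. ft (\<lambda>z. cnj (g z)) k \<and> ft (\<lambda>z. cnj (k z)) g"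
proof -
  obtain k where k: "ft (\<lambda>z. cnj (g z)) k" using ft_exists[OF sqint_cnj[OF g]] by blast
  have sk: "sqint k" using ft_sqint(2)[OF k] .
  obtain h where h: "ft (\<lambda>z. cnj (k z)) h" using ft_exists[OF sqint_cnj[OF sk]] by blast
  have sh: "sqint h" using ft_sqint(2)[OF h] .
  have n: "l2norm k = l2norm g" "l2norm h = l2norm k" using ft_isometry[OF k] ft_isometry[OF h] by auto
  \<comment> \<open>The adjoint formula makes the inner product of h and g equal to the square of
    their common norm, which forces h = g.\<close>
  have "(LINT z|lborel. h z * cnj (g z)) = (LINT z|lborel. cnj (k z) * k z)" by (rule ft_adjoint[OF h k])
  also have "\<dots> = complex_of_real ((l2norm k)\<^sup>2)"
    unfolding l2norm_square integral_complex_of_real[symmetric]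
    by (intro Bochner_Integration.integral_cong) (simp_all add: complex_norm_square mult.commute del: of_real_power)
  finally have "(l2norm (\<lambda>z. h z - g z))\<^sup>2 = 0" using l2norm_diff_square[OF sh g] n by simp
  then have "AE z in lborel. h z - g z = 0" by (intro l2norm_eq_0_AE sqint_diff sh g) simp
  then have "ft (\<lambda>z. cnj (k z)) g"
    by (intro ft_cong_AE[OF h]) (auto intro: sqint_measurable[OF g] sqint_measurable[OF sqint_cnj[OF sk]])
  with k show ?thesis by blast
qed

text \<open>Convergence in L2 gives a subsequence of transforms converging almost everywhere to the
  L2 transform, while convergence in L1 gives pointwise convergence to the integral formula; the two
  limits must agree.\<close>

lemma fourierc_limit:
  assumes f: "\<And>n. ft (f n) (fourierc (f n))" "\<And>n. integrable lborel (f n)"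
    and g: "sqint g" "integrable lborel g"
    and lim: "(\<lambda>n. l2norm (\<lambda>z. f n z - g z)) \<longlonglongrightarrow> 0" "(\<lambda>n. LINT z|lborel. cmod (f n z - g z)) \<longlonglongrightarrow> 0"
  shows "ft g (fourierc g)"
proof -
  obtain h where h: "ft g h" using ft_exists[OF g(1)] by blast
  have "(\<lambda>n. l2norm (\<lambda>z. fourierc (f n) z - h z)) \<longlonglongrightarrow> 0" using lim(1) by (simp add: ft_isometry_diff[OF f(1) h])
  then obtain r where r: "strict_mono r" "AE z in lborel. (\<lambda>n. fourierc (f (r n)) z) \<longlonglongrightarrow> h z"
    using l2norm_AE_subseq[of "\<lambda>n. fourierc (f n)" h] ft_sqint[OF f(1)] ft_sqint[OF h] by blast
  have pointwise: "(\<lambda>n. fourierc (f n) z) \<longlonglongrightarrow> fourierc g z" for z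
  proof (rule LIM_zero_cancel, rule Lim_null_comparison)
    have "fourierc (f n) z - fourierc g z = fourierc (\<lambda>z. f n z - g z) z" for n
      using fourierc_add[OF f(2)[of n] g(2), of 1 "-1"] by simp
    then show "\<forall>\<^sub>F n in sequentially. norm (fourierc (f n) z - fourierc g z) \<le> (LINT z|lborel. cmod (f n z - g z)) / (2 * pi)"
      using fourierc_bound[of "\<lambda>z. f _ z - g z"] by simp
    show "(\<lambda>n. (LINT z|lborel. cmod (f n z - g z)) / (2 * pi)) \<longlonglongrightarrow> 0"
      using tendsto_divide[OF lim(2) tendsto_const, of "2 * pi"] by simp
  qed
  have "(\<lambda>n. fourierc (f (r n)) z) \<longlonglongrightarrow> fourierc g z" for z
    using LIMSEQ_subseq_LIMSEQ[OF pointwise[of z] r(1)] by (simp add: o_def)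
  with r(2) have "AE z in lborel. h z = fourierc g z"
    by (auto elim!: eventually_mono intro: LIMSEQ_unique)
  then show ?thesis
    using g by (intro ft_cong_AE[OF h]) (auto intro: sqint_measurable)
qed

lemma ft_fourierc:
  assumes f: "sqint f" "integrable lborel f" shows "ft f (fourierc f)"
proof -
  have "\<exists>\<phi>. \<forall>n. frequency_test (\<phi> n) \<and> l2norm (\<lambda>z. f z - \<phi> n z) < 1 / real (Suc n) \<and>
      (LINT z|lborel. cmod (f z - \<phi> n z)) < 1 / real (Suc n)"
    using frequency_test_dense[OF f(1), of "1 / real (Suc _)"] f(2) by (intro choice) fastforce
  then obtain \<phi> where \<phi>: "\<And>n. frequency_test (\<phi> n)" "\<And>n. l2norm (\<lambda>z. f z - \<phi> n z) < 1 / real (Suc n)"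
     "\<And>n. (LINT z|lborel. cmod (f z - \<phi> n z)) < 1 / real (Suc n)" by blast
  show ?thesis
  proof (rule fourierc_limit[of \<phi>])
    show "(\<lambda>n. l2norm (\<lambda>z. \<phi> n z - f z)) \<longlonglongrightarrow> 0"
      by (rule Lim_null_comparison[OF _ LIMSEQ_Suc[OF lim_1_over_n]])
        (use \<phi>(2) in \<open>auto simp: l2norm_minus_commute[of f] less_imp_le simp del: of_nat_Suc\<close>)
    show "(\<lambda>n. LINT z|lborel. cmod (\<phi> n z - f z)) \<longlonglongrightarrow> 0"
      by (rule Lim_null_comparison[OF _ LIMSEQ_Suc[OF lim_1_over_n]])
        (use \<phi>(3) in \<open>auto simp: norm_minus_commute[of "f _"] less_imp_le simp del: of_nat_Suc\<close>)
  qed (use f \<phi>(1) in \<open>auto intro: ft_test frequency_test_integrable\<close>)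
qed

section \<open>Test functions and weak derivatives\<close>

text \<open>Boxes are stable under intersection and generate the Borel sets, so the vanishing
  spreads to all Borel sets. The restriction to the boxes \<open>B n\<close> comes first because k
  is only locally integrable, whereas the step to complements uses a finite total integral.\<close>

lemma AE_zero_if_box_integrals_zero:
  fixes k :: "plane \<Rightarrow> real"
  assumes k: "\<And>a b. set_integrable lborel (box a b) k"
    and zero: "\<And>a b. (LINT z:box a b|lborel. k z) = 0"
  shows "AE z in lborel. k z = 0"
proof -
  define B where "B n = box (- real n, - real n) (real n, real n)" for n :: nat
  have "AE z in lborel. indicator (B n) z * k z = 0" for n
  proof -
    define K where "K z = indicator (B n) z * k z" for z
    have K: "integrable lborel K"
      using k[of "(- real n, - real n)" "(real n, real n)"] by (simp add: set_integrable_def K_def[abs_def] B_def)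
    have basic: "(LINT z:box a b|lborel. K z) = 0" for a b
    proof -
      obtain c d where cd: "box a b \<inter> B n = box c d" unfolding B_def box_Int_box by blast
      have "(LINT z:box a b|lborel. K z) = (LINT z:box a b \<inter> B n|lborel. k z)"
        unfolding set_lebesgue_integral_def K_def by (intro Bochner_Integration.integral_cong) (auto simp: indicator_def)
      then show ?thesis using zero cd by simp
    qed
    have whole: "integral\<^sup>L lborel K = 0"
      using zero[of "(- real n, - real n)" "(real n, real n)"] by (simp add: set_lebesgue_integral_def K_def[abs_def] B_def)
    have si: "set_integrable lborel A K" if "A \<in> sets borel" for A
      unfolding set_integrable_def using that by (intro integrable_mult_indicator K) simp
    have "(LINT z:A|lborel. K z) = 0" if "A \<in> sets borel" for A
    proof -
      let ?G = "range (\<lambda>(a, b). box a b :: plane set)"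
      have "Int_stable ?G" "?G \<subseteq> Pow UNIV" "A \<in> sigma_sets UNIV ?G"
        using that by (auto simp: Int_stable_def box_Int_box borel_eq_box)
      then show ?thesis
      proof (induction rule: sigma_sets_induct_disjoint)
        case (union A)
        then have A: "A i \<in> sets borel" for i by (auto simp: borel_eq_box)
        moreover have "disjoint_family A" using union by simp
        ultimately have "(LINT z:(\<Union>i. A i)|lborel. K z) = (\<Sum>i. LINT z:A i|lborel. K z)"
          by (intro lebesgue_integral_countable_add si) (auto simp: disjoint_family_on_def)
        then show ?case using union by simp
      next
        case (compl A)
        then have A: "A \<in> sets borel" by (simp add: borel_eq_box)
        have "(LINT z:(UNIV - A) \<union> A|lborel. K z) = (LINT z:UNIV - A|lborel. K z) + (LINT z:A|lborel. K z)"
          by (rule set_integral_Un) (use A in \<open>auto intro: si\<close>)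
        then show ?case using compl whole by (simp add: set_lebesgue_integral_def)
      qed (use basic in \<open>auto simp: set_lebesgue_integral_def\<close>)
    qed
    then have "AE z in lborel. K z = 0"
      using density_unique_real[OF K, of "\<lambda>z. 0"] by (simp add: set_lebesgue_integral_def)
    then show ?thesis by (simp add: K_def)
  qed
  then have "AE z in lborel. \<forall>n. indicator (B n) z * k z = 0" unfolding AE_all_countable by blast
  then show ?thesis
  proof eventually_elim
    case (elim z)
    obtain n :: nat where "max \<bar>fst z\<bar> \<bar>snd z\<bar> < real n" using reals_Archimedean2 by blast
    then have "z \<in> B n" by (auto simp: B_def box_def Basis_prod_def inner_prod_def)
    then show ?case using elim by (auto dest: spec[of _ n])
  qed
qed

text \<open>The squared positive part meets 0 with slope 0 and is therefore C1, the regularity asked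
  of test functions; bump functions are built from it.\<close>

lemma DERIV_max_0_square: "((\<lambda>s::real. (max 0 s)\<^sup>2) has_real_derivative 2 * max 0 s) (at s)"
proof -
  consider "s > 0" | "s < 0" | "s = 0" by linarith
  then show ?thesis
  proof cases
    case 1
    have "((\<lambda>s::real. s\<^sup>2) has_real_derivative 2 * max 0 s) (at s)"
      using 1 by (auto intro!: derivative_eq_intros)
    then show ?thesis
      by (rule has_field_derivative_transform_within_open[where S = "{0<..}"]) (use 1 in auto)
  next
    case 2
    have "((\<lambda>s::real. 0) has_real_derivative 2 * max 0 s) (at s)"
      using 2 by (auto intro!: derivative_eq_intros)
    then show ?thesis
      by (rule has_field_derivative_transform_within_open[where S = "{..<0}"]) (use 2 in auto)
  next
    case 3
    have "(\<lambda>h::real. ((max 0 (0 + h))\<^sup>2 - (max 0 0)\<^sup>2) / h) \<midarrow>0\<rightarrow> 0"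
    proof (rule Lim_null_comparison)
      show "\<forall>\<^sub>F h in at (0::real). norm (((max 0 (0 + h))\<^sup>2 - (max 0 0)\<^sup>2) / h) \<le> \<bar>h\<bar>"
        by (intro always_eventually) (auto simp: max_def power2_eq_square)
      show "(\<lambda>h::real. \<bar>h\<bar>) \<midarrow>0\<rightarrow> 0" using tendsto_rabs[OF tendsto_ident_at, of 0] by simp
    qed
    then show ?thesis using 3 by (simp add: DERIV_def)
  qed
qed

lemma has_derivative_max_0_square:
  fixes g :: "'a::real_normed_vector \<Rightarrow> real"
  assumes "(g has_derivative g') (at z)"
  shows "((\<lambda>z. (max 0 (g z))\<^sup>2) has_derivative (\<lambda>h. 2 * max 0 (g z) * g' h)) (at z)"
  using has_derivative_compose[OF assms, of "\<lambda>s. (max 0 s)\<^sup>2" "\<lambda>x. 2 * max 0 (g z) * x"]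
    DERIV_max_0_square[of "g z"] by (simp add: has_field_derivative_def)

lemma test_functionI:
  assumes "\<And>z. (\<phi> has_derivative D z) (at z)" "\<And>v. continuous_on UNIV (\<lambda>z. D z v)" "bounded {z. \<phi> z \<noteq> 0}"
  shows "test_function \<phi>"
proof -
  have "frechet_derivative \<phi> (at z) = D z" for z using frechet_derivative_at[OF assms(1)] by simp
  moreover have "\<phi> differentiable_on UNIV"
    unfolding differentiable_on_def differentiable_def using assms(1) by blast
  ultimately show ?thesis using assms(2,3) by (simp add: test_function_def)
qed

text \<open>The test functions \<open>n r / (1 + n r)\<close>, with \<open>r > 0\<close> exactly on the box, increase to its indicator.\<close>

lemma box_indicator_limit_test_functions:
  fixes a b :: plane
  obtains \<phi> :: "nat \<Rightarrow> plane \<Rightarrow> real" where "\<And>n. test_function (\<phi> n)"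
    "\<And>n z. \<bar>\<phi> n z\<bar> \<le> indicator (box a b) z" "\<And>z. (\<lambda>n. \<phi> n z) \<longlonglongrightarrow> indicator (box a b) z"
proof
  define q :: "real \<Rightarrow> real" where "q s = (max 0 s)\<^sup>2" for s
  define r where "r z = q (fst z - fst a) * q (fst b - fst z) * (q (snd z - snd a) * q (snd b - snd z))" for z
  define r' where "r' z h = (q (fst z - fst a) * (2 * max 0 (fst b - fst z) * - fst h) + 2 * max 0 (fst z - fst a) * fst h * q (fst b - fst z))
        * (q (snd z - snd a) * q (snd b - snd z))
      + q (fst z - fst a) * q (fst b - fst z)
        * (q (snd z - snd a) * (2 * max 0 (snd b - snd z) * - snd h) + 2 * max 0 (snd z - snd a) * snd h * q (snd b - snd z))" for z h
  have r': "(r has_derivative r' z) (at z)" for z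
    unfolding r_def[abs_def] r'_def[abs_def] q_def
    by (rule derivative_eq_intros has_derivative_max_0_square refl | simp add: algebra_simps)+
  have r0: "0 \<le> r z" for z by (simp add: r_def q_def)
  have q: "0 \<le> q s" "0 < q s \<longleftrightarrow> 0 < s" for s by (auto simp: q_def max_def)
  have pos: "0 < u * v \<longleftrightarrow> 0 < u \<and> 0 < v" if "0 \<le> u" "0 \<le> v" for u v :: real
    using that by (auto simp: zero_less_mult_iff)
  have r_pos: "0 < r z \<longleftrightarrow> z \<in> box a b" for z
    by (auto simp: r_def pos q box_def Basis_prod_def inner_prod_def)
  have r_zero: "r z = 0 \<longleftrightarrow> z \<notin> box a b" for z using r_pos[of z] r0[of z] by linarith
  define \<phi> where "\<phi> n z = real n * r z / (1 + real n * r z)" for n z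
  have den: "1 + real n * r z > 0" for n z using r0[of z] by (simp add: add_pos_nonneg)
  have nz: "1 + real n * r z \<noteq> 0" for n z using den[of n z] by simp
  have \<phi>_eq: "\<phi> n z = 1 - inverse (1 + real n * r z)" for n z
    using nz[of n z] by (simp add: \<phi>_def field_simps)
  show "test_function (\<phi> n)" for n
  proof (rule test_functionI)
    fix z
    show "(\<phi> n has_derivative (\<lambda>h. inverse (1 + real n * r z) * (real n * r' z h) * inverse (1 + real n * r z))) (at z)"
      unfolding \<phi>_eq[abs_def] by (rule derivative_eq_intros r' refl nz | simp)+
  next
    fix v
    have "continuous_on UNIV r" "continuous_on UNIV (\<lambda>z. r' z v)"
      unfolding r'_def r_def[abs_def] q_def by (intro continuous_intros)+
    then show "continuous_on UNIV (\<lambda>z. inverse (1 + real n * r z) * (real n * r' z v) * inverse (1 + real n * r z))"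
      by (intro continuous_intros) (use nz in auto)
  next
    have "{z. \<phi> n z \<noteq> 0} \<subseteq> box a b" using r_zero by (auto simp: \<phi>_def)
    then show "bounded {z. \<phi> n z \<noteq> 0}" using bounded_subset bounded_box by blast
  qed
  show "\<bar>\<phi> n z\<bar> \<le> indicator (box a b) z" for n z
  proof (cases "z \<in> box a b")
    case True
    have "0 \<le> real n * r z" using r0[of z] by simp
    then have "0 \<le> \<phi> n z" "\<phi> n z \<le> 1" by (auto simp: \<phi>_def)
    then show ?thesis using True by simp
  qed (use r_zero[of z] in \<open>simp add: \<phi>_def\<close>)
  show "(\<lambda>n. \<phi> n z) \<longlonglongrightarrow> indicator (box a b) z" for z
  proof (cases "z \<in> box a b")
    case True
    have "r z > 0" using r_pos True by blast
    then have "filterlim (\<lambda>n. 1 + real n * r z) at_top sequentially"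
      by (intro filterlim_tendsto_add_at_top[OF tendsto_const] filterlim_at_top_mult_tendsto_pos[OF tendsto_const] filterlim_real_sequentially)
    then have "(\<lambda>n. 1 - inverse (1 + real n * r z)) \<longlonglongrightarrow> 1 - 0"
      by (intro tendsto_intros tendsto_inverse_0_at_top)
    then show ?thesis using True by (simp add: \<phi>_eq)
  next
    case False
    then show ?thesis using r_zero[of z] by (simp add: \<phi>_def)
  qed
qed

lemma AE_zero_if_test_integrals_zero:
  fixes k :: "plane \<Rightarrow> real"
  assumes k: "\<And>r. set_integrable lborel (cball 0 r) k"
    and zero: "\<And>\<phi>. test_function \<phi> \<Longrightarrow> (LINT z|lborel. k z * \<phi> z) = 0"
    and km: "k \<in> borel_measurable borel"
  shows "AE z in lborel. k z = 0"
proof (rule AE_zero_if_box_integrals_zero)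
  fix a b :: plane
  obtain r where "box a b \<subseteq> cball 0 r" using bounded_subset_ballD[OF bounded_box, of a b 0] ball_subset_cball by (meson order_trans)
  then show si: "set_integrable lborel (box a b) k" by (intro set_integrable_subset[OF k[of r]]) auto
  obtain \<phi> :: "nat \<Rightarrow> plane \<Rightarrow> real" where \<phi>: "\<And>n. test_function (\<phi> n)"
    "\<And>n z. \<bar>\<phi> n z\<bar> \<le> indicator (box a b) z" "\<And>z. (\<lambda>n. \<phi> n z) \<longlonglongrightarrow> indicator (box a b) z"
    using box_indicator_limit_test_functions[of a b] by blast
  have [measurable]: "\<phi> n \<in> borel_measurable borel" for n
    using \<phi>(1)[of n] by (intro borel_measurable_continuous_onI differentiable_imp_continuous_on) (simp add: test_function_def)
  note [measurable] = km
  have "(\<lambda>n. LINT z|lborel. k z * \<phi> n z) \<longlonglongrightarrow> (LINT z|lborel. k z * indicator (box a b) z)"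
  proof (rule integral_dominated_convergence[where w = "\<lambda>z. \<bar>indicator (box a b) z * k z\<bar>"])
    show "integrable lborel (\<lambda>z. \<bar>indicator (box a b) z * k z\<bar>)" using si by (simp add: set_integrable_def)
    show "AE z in lborel. (\<lambda>n. k z * \<phi> n z) \<longlonglongrightarrow> k z * indicator (box a b) z"
      by (intro AE_I2 tendsto_intros \<phi>)
    show "AE z in lborel. norm (k z * \<phi> n z) \<le> \<bar>indicator (box a b) z * k z\<bar>" for n
      using mult_left_mono[OF \<phi>(2)[of n], of "\<bar>k _\<bar>"] by (intro AE_I2) (simp add: abs_mult mult.commute)
  qed measurable
  then show "(LINT z:box a b|lborel. k z) = 0"
    using zero[OF \<phi>(1)] by (simp add: set_lebesgue_integral_def LIMSEQ_const_iff mult.commute)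
qed

lemma integral_partial_derivative_zero:
  fixes F G :: "plane \<Rightarrow> complex"
  assumes der: "\<And>x y. ((\<lambda>x. F (x, y)) has_vector_derivative G (x, y)) (at x)"
    and G: "continuous_on UNIV G" and supp: "\<And>z. norm z > R \<Longrightarrow> F z = 0" "\<And>z. norm z > R \<Longrightarrow> G z = 0"
    and Gi: "integrable lborel G"
  shows "(LINT z|lborel. G z) = 0"
proof -
  \<comment> \<open>Points with \<open>\<bar>x\<bar> \<ge> S\<close> lie outside the ball of radius
    R, so the boundary terms at \<open>S\<close> and \<open>- S\<close> vanish.\<close>
  define S where "S = \<bar>R\<bar> + 1"
  have out: "norm (x, y) > R" if "\<bar>x\<bar> \<ge> S" for x y :: real
    using that real_sqrt_sum_squares_ge1[of x y] unfolding S_def norm_Pair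
    by (smt (verit) real_sqrt_abs real_sqrt_le_iff real_norm_def power2_abs zero_le_power2)
  have inner: "(LINT x|lborel. G (x, y)) = 0" for y
  proof -
    have "(LINT x|lborel. G (x, y)) = (LINT x|lborel. indicator {-S..S} x *\<^sub>R G (x, y))"
      using supp(2)[OF out] by (intro Bochner_Integration.integral_cong) (auto simp: indicator_def)
    also have "\<dots> = F (S, y) - F (- S, y)"
    proof (rule integral_FTC_atLeastAtMost)
      show "- S \<le> S" by (simp add: S_def)
      show "((\<lambda>x. F (x, y)) has_vector_derivative G (x, y)) (at x within {- S..S})" for x
        using der by (rule has_vector_derivative_at_within)
      show "continuous_on {- S..S} (\<lambda>x. G (x, y))"
        by (intro continuous_on_compose2[OF G] continuous_intros) auto
    qed
    also have "\<dots> = 0" using supp(1)[OF out[of S y]] supp(1)[OF out[of "- S" y]] by (simp add: S_def)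
    finally show ?thesis .
  qed
  have "integrable (lborel \<Otimes>\<^sub>M lborel) (\<lambda>(x, y). G (x, y))" using Gi by (simp add: lborel_prod)
  from lborel_pair.integral_snd[OF this] have "(LINT z|lborel. G z) = (LINT y|lborel. LINT x|lborel. G (x, y))"
    by (simp add: lborel_prod)
  then show ?thesis by (simp add: inner)
qed

text \<open>The x-derivative of the test function times a character has integral zero; by the
  product rule this moves the derivative on to the character.\<close>

lemma test_function_fourier_derivative:
  fixes \<phi> :: "plane \<Rightarrow> real"
  assumes t: "test_function \<phi>"
  defines "\<phi>x \<equiv> \<lambda>z. frechet_derivative \<phi> (at z) (1, 0)"
  shows "ft (\<lambda>z. complex_of_real (\<phi> z)) (fourierc (\<lambda>z. complex_of_real (\<phi> z)))"
    and "ft (\<lambda>z. complex_of_real (\<phi>x z)) (\<lambda>\<zeta>. \<i> * complex_of_real (fst \<zeta>) * fourierc (\<lambda>z. complex_of_real (\<phi> z)) \<zeta>)"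
proof -
  obtain R where R: "{z. \<phi> z \<noteq> 0} \<subseteq> cball 0 R" 
    using t bounded_subset_ballD[of "{z. \<phi> z \<noteq> 0}" 0] ball_subset_cball unfolding test_function_def by (meson order_trans)
  have der: "(\<phi> has_derivative frechet_derivative \<phi> (at z)) (at z)" for z
    using t by (simp add: test_function_def differentiable_on_def frechet_derivative_works del: split_paired_All)
  have \<phi>c: "continuous_on UNIV \<phi>" using t by (simp add: test_function_def differentiable_imp_continuous_on)
  have \<phi>xc: "continuous_on UNIV \<phi>x" using t by (simp add: test_function_def \<phi>x_def)
  have \<phi>0: "\<phi> z = 0" if "norm z > R" for z using R that by force
  have \<phi>x0: "\<phi>x z = 0" if "norm z > R" for z
  proof -
    have "((\<lambda>z. 0) has_derivative frechet_derivative \<phi> (at z)) (at z)"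
    proof (rule has_derivative_transform_within_open[OF der[of z]])
      show "open {z :: plane. norm z > R}" by (intro open_Collect_less continuous_intros)
    qed (use that \<phi>0 in auto)
    then have "frechet_derivative \<phi> (at z) = (\<lambda>h. 0)"
      using has_derivative_unique has_derivative_const by blast
    then show ?thesis by (simp add: \<phi>x_def)
  qed
  have *: "integrable lborel f \<and> sqint f"
    if f: "continuous_on UNIV f" "\<And>z. norm z > R \<Longrightarrow> f z = 0" for f :: "plane \<Rightarrow> complex"
  proof -
    have "compact (f ` cball 0 R)" using f(1) by (intro compact_continuous_image) (auto intro: continuous_on_subset)
    then obtain C where "\<forall>w\<in>f ` cball 0 R. cmod w \<le> C" using compact_imp_bounded bounded_iff by blast
    then have C: "cmod (f z) \<le> max C 0" for z using f(2)[of z] by (cases "norm z > R") (auto simp: max.coboundedI1)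
    have fm: "f \<in> borel_measurable borel" using f(1) by (rule borel_measurable_continuous_onI)
    have "integrable lborel (\<lambda>z. (cmod (f z))\<^sup>2)"
      using f(2) fm power_mono[OF C norm_ge_zero, of _ 2]
      by (intro integrable_bounded_compact_support[of _ "cball 0 R" "(max C 0)\<^sup>2"]) auto
    moreover have "integrable lborel f"
      using f(2) fm C by (intro integrable_bounded_compact_support[of _ "cball 0 R" "max C 0"]) auto
    ultimately show ?thesis using fm by (simp add: sqint_def)
  qed
  have \<phi>i: "integrable lborel (\<lambda>z. complex_of_real (\<phi> z))" "sqint (\<lambda>z. complex_of_real (\<phi> z))"
    using *[of "\<lambda>z. complex_of_real (\<phi> z)"] \<phi>c \<phi>0 by (auto intro!: continuous_intros)
  have \<phi>xi: "integrable lborel (\<lambda>z. complex_of_real (\<phi>x z))" "sqint (\<lambda>z. complex_of_real (\<phi>x z))"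
    using *[of "\<lambda>z. complex_of_real (\<phi>x z)"] \<phi>xc \<phi>x0 by (auto intro!: continuous_intros)
  show "ft (\<lambda>z. complex_of_real (\<phi> z)) (fourierc (\<lambda>z. complex_of_real (\<phi> z)))" using \<phi>i by (intro ft_fourierc)
  have "fourierc (\<lambda>z. complex_of_real (\<phi>x z)) \<zeta> = \<i> * complex_of_real (fst \<zeta>) * fourierc (\<lambda>z. complex_of_real (\<phi> z)) \<zeta>" for \<zeta>
  proof -
    define e where "e z = cis (- (z \<bullet> \<zeta>))" for z :: plane
    define G where "G z = complex_of_real (\<phi>x z) * e z + complex_of_real (\<phi> z) * (- \<i> * complex_of_real (fst \<zeta>) * e z)" for z
    have ec: "continuous_on UNIV e" unfolding e_def cis_conv_exp by (intro continuous_intros)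
    have Gc: "continuous_on UNIV G" unfolding G_def by (intro continuous_intros ec \<phi>c \<phi>xc)
    have G0: "G z = 0" if "norm z > R" for z using \<phi>0[OF that] \<phi>x0[OF that] by (simp add: G_def)
    have "(LINT z|lborel. G z) = 0"
    proof (rule integral_partial_derivative_zero[where F = "\<lambda>z. complex_of_real (\<phi> z) * e z"])
      fix x y :: real
      have "((\<lambda>x. (x, y)) has_derivative (\<lambda>h. (h, 0))) (at x)" by (auto intro!: derivative_eq_intros)
      from has_derivative_compose[OF this der] have "((\<lambda>x. \<phi> (x, y)) has_derivative (\<lambda>h. frechet_derivative \<phi> (at (x, y)) (h, 0))) (at x)" .
      moreover have "frechet_derivative \<phi> (at (x, y)) (h, 0) = \<phi>x (x, y) * h" for h
      proof -
        have "linear (frechet_derivative \<phi> (at (x, y)))" using der by (rule has_derivative_linear)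
        from linear_scale[OF this, of h "(1, 0)"] show ?thesis by (simp add: \<phi>x_def)
      qed
      ultimately have "((\<lambda>x. \<phi> (x, y)) has_real_derivative \<phi>x (x, y)) (at x)" by (simp add: has_field_derivative_def)
      then have d1: "((\<lambda>x. complex_of_real (\<phi> (x, y))) has_vector_derivative complex_of_real (\<phi>x (x, y))) (at x)"
        by (intro has_vector_derivative_of_real) (simp add: has_real_derivative_iff_has_vector_derivative)
      have d2: "((\<lambda>x. e (x, y)) has_vector_derivative - \<i> * complex_of_real (fst \<zeta>) * e (x, y)) (at x)"
        unfolding e_def cis_conv_exp inner_prod_def
        by (auto intro!: derivative_eq_intros has_vector_derivative_real_field simp: algebra_simps)
      from has_vector_derivative_mult[OF d1 d2]
      show "((\<lambda>x. complex_of_real (\<phi> (x, y)) * e (x, y)) has_vector_derivative G (x, y)) (at x)"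
        by (simp add: G_def add.commute)
    qed (use Gc \<phi>0 G0 *[OF Gc G0] in auto)
    moreover have "(LINT z|lborel. G z) = (LINT z|lborel. complex_of_real (\<phi>x z) * e z) + (LINT z|lborel. complex_of_real (\<phi> z) * (- \<i> * complex_of_real (fst \<zeta>) * e z))"
      unfolding G_def
    proof (rule Bochner_Integration.integral_add)
      show "integrable lborel (\<lambda>z. complex_of_real (\<phi>x z) * e z)" unfolding e_def by (rule integrable_mult_cis(1)[OF \<phi>xi(1)])
      have "integrable lborel (\<lambda>z. - \<i> * complex_of_real (fst \<zeta>) * (complex_of_real (\<phi> z) * e z))"
        unfolding e_def by (intro integrable_mult_right integrable_mult_cis(1)[OF \<phi>i(1)])
      then show "integrable lborel (\<lambda>z. complex_of_real (\<phi> z) * (- \<i> * complex_of_real (fst \<zeta>) * e z))" by (simp add: mult_ac)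
    qed
    moreover have "(LINT z|lborel. complex_of_real (\<phi> z) * (- \<i> * complex_of_real (fst \<zeta>) * e z))
        = - \<i> * complex_of_real (fst \<zeta>) * (LINT z|lborel. complex_of_real (\<phi> z) * e z)"
      unfolding integral_mult_right_zero[symmetric] by (simp add: mult_ac)
    ultimately show ?thesis by (simp add: fourierc_def e_def)
  qed
  then show "ft (\<lambda>z. complex_of_real (\<phi>x z)) (\<lambda>\<zeta>. \<i> * complex_of_real (fst \<zeta>) * fourierc (\<lambda>z. complex_of_real (\<phi> z)) \<zeta>)"
    using ft_fourierc[OF \<phi>xi(2,1)] by presburger
qed

section \<open>Classes in \<open>L2\<close>, their representatives and their transforms\<close>

lemma ae_equal_rep_L2: "ae_equal (rep_L2 f) (rep_L2 f)"
  using Quotient3_rep_reflp[OF Quotient3_L2] .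

lemma ae_equal_rep_abs_L2: "ae_equal f f \<Longrightarrow> ae_equal (rep_L2 (abs_L2 f)) f"
  using rep_abs_rsp_left[OF Quotient3_L2] Quotient3_rep_abs[OF Quotient3_L2] by blast

lemma rep_L2_square_integrable: "square_integrable (rep_L2 f)"
  using ae_equal_rep_L2[of f] by (simp add: ae_equal_def)

lemma sqint_of_real: "sqint (\<lambda>z. complex_of_real (f z)) \<longleftrightarrow> square_integrable f"
proof -
  have "f \<in> borel_measurable borel" if "(\<lambda>z. complex_of_real (f z)) \<in> borel_measurable borel"
    using measurable_compose[OF that borel_measurable_Re] by simp
  then have "(\<lambda>z. complex_of_real (f z)) \<in> borel_measurable borel \<longleftrightarrow> f \<in> borel_measurable borel"
    using measurable_compose[OF _ borel_measurable_of_real, of f borel] by blast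
  then show ?thesis by (simp add: sqint_def square_integrable_def)
qed

lemma sqint_rep_L2: "sqint (\<lambda>z. complex_of_real (rep_L2 f z))"
  by (simp add: sqint_of_real rep_L2_square_integrable)

lemma rep_L2_add: "AE z in lborel. rep_L2 (f + g) z = rep_L2 f z + rep_L2 g z"
proof -
  have "f + g = abs_L2 (\<lambda>z. rep_L2 f z + rep_L2 g z)"
    using plus_L2.abs_eq[OF ae_equal_rep_L2[of f] ae_equal_rep_L2[of g]]
    by (simp add: Quotient3_abs_rep[OF Quotient3_L2])
  moreover have "ae_equal (\<lambda>z. rep_L2 f z + rep_L2 g z) (\<lambda>z. rep_L2 f z + rep_L2 g z)"
    by (simp add: ae_equal_def square_integrable_add rep_L2_square_integrable)
  ultimately show ?thesis using ae_equal_rep_abs_L2 by (metis ae_equal_def)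
qed

lemma rep_L2_scale: "AE z in lborel. rep_L2 (c *\<^sub>R f) z = c * rep_L2 f z"
proof -
  have "c *\<^sub>R f = abs_L2 (\<lambda>z. c * rep_L2 f z)"
    using scaleR_L2.abs_eq[OF ae_equal_rep_L2[of f]]
    by (simp add: Quotient3_abs_rep[OF Quotient3_L2])
  moreover have "ae_equal (\<lambda>z. c * rep_L2 f z) (\<lambda>z. c * rep_L2 f z)"
    by (simp add: ae_equal_def square_integrable_scale rep_L2_square_integrable)
  ultimately show ?thesis using ae_equal_rep_abs_L2 by (metis ae_equal_def)
qed

lemma rep_L2_abs: "square_integrable f \<Longrightarrow> AE z in lborel. rep_L2 (abs_L2 f) z = f z"
  using ae_equal_rep_abs_L2[of f] by (simp add: ae_equal_def)

lemma truncation_ft: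
  assumes f: "square_integrable f"
  defines "F \<equiv> \<lambda>n z. complex_of_real (indicator (cball 0 (real n)) z * f z)"
  shows "ft (F n) (fourierc (F n))"
    and "(\<lambda>n. l2norm (\<lambda>z. F n z - complex_of_real (f z))) \<longlonglongrightarrow> 0"
proof -
  have fs: "sqint (\<lambda>z. complex_of_real (f z))" using f by (simp add: sqint_of_real)
  have fm [measurable]: "f \<in> borel_measurable borel" using f by (simp add: square_integrable_def)
  have [measurable]: "cball (0::plane) r \<in> sets borel" for r by simp
  have [measurable]: "F n \<in> borel_measurable borel" for n unfolding F_def by measurable
  have le: "cmod (F n z) \<le> cmod (complex_of_real (f z))" for n z by (simp add: F_def indicator_def)
  have Fs: "sqint (F n)" for n using sqint_integrable[OF fs] by (rule sqint_dominated) (use le in auto)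
  have "integrable lborel (F n)" for n
  proof -
    have c: "sqint (\<lambda>z. complex_of_real (indicator (cball 0 (real n)) z))"
      unfolding sqint_of_real square_integrable_def
      using emeasure_compact_finite[of "cball (0::plane) (real n)"]
      by (auto simp: power2_eq_square simp flip: indicator_inter_arith)
    have "F n = (\<lambda>z. complex_of_real (indicator (cball 0 (real n)) z) * complex_of_real (f z))"
      by (simp add: F_def)
    then show ?thesis using sqint_mult_integrable[OF c fs] by simp
  qed
  then show "ft (F n) (fourierc (F n))" by (intro ft_fourierc Fs)
  show "(\<lambda>n. l2norm (\<lambda>z. F n z - complex_of_real (f z))) \<longlonglongrightarrow> 0"
  proof (rule l2norm_dominated_convergence(2)[OF _ _ sqint_integrable[OF fs]])
    show "AE z in lborel. (\<lambda>n. F n z) \<longlonglongrightarrow> complex_of_real (f z)"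
    proof (rule AE_I2, rule tendsto_eventually)
      fix z :: plane
      show "\<forall>\<^sub>F n in sequentially. F n z = complex_of_real (f z)"
        using eventually_ge_at_top[of "nat \<lceil>norm z\<rceil>"] by eventually_elim (simp add: F_def indicator_def)
    qed
  qed (use le in auto)
qed

text \<open>Links the choice in \<open>fourier_L2\<close> with \<open>ft\<close>. Existence comes
  first: the transform from \<open>ft_exists\<close> has the truncation property, hence so has the
  chosen function, and closedness of the graph identifies it.\<close>

lemma fourier_L2_ft: "ft (\<lambda>z. complex_of_real (rep_L2 f z)) (fourier_L2 f)"
proof -
  define F where "F n z = complex_of_real (indicator (cball 0 (real n)) z * rep_L2 f z)" for n z
  have F: "ft (F n) (fourierc (F n))" "(\<lambda>n. l2norm (\<lambda>z. F n z - complex_of_real (rep_L2 f z))) \<longlonglongrightarrow> 0" for n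
    using truncation_ft[OF rep_L2_square_integrable[of f]] by (simp_all only: F_def[abs_def])
  have eq: "fourier (\<lambda>z. indicator (cball 0 (real n)) z * rep_L2 f z) = fourierc (F n)" for n
    by (simp add: fourier_eq_fourierc F_def[abs_def])
  have lim_iff: "((\<lambda>n. \<integral>\<^sup>+\<zeta>. ennreal ((cmod (g \<zeta> - fourierc (F n) \<zeta>))\<^sup>2) \<partial>lborel) \<longlonglongrightarrow> 0)
      \<longleftrightarrow> (\<lambda>n. l2norm (\<lambda>\<zeta>. fourierc (F n) \<zeta> - g \<zeta>)) \<longlonglongrightarrow> 0" if g: "sqint g" for g
  proof -
    have "(\<lambda>n. \<integral>\<^sup>+\<zeta>. ennreal ((cmod (g \<zeta> - fourierc (F n) \<zeta>))\<^sup>2) \<partial>lborel)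
        = (\<lambda>n. ennreal ((l2norm (\<lambda>\<zeta>. fourierc (F n) \<zeta> - g \<zeta>))\<^sup>2))"
      by (simp add: nn_integral_l2norm sqint_diff g ft_sqint[OF F(1)] l2norm_minus_commute[of g])
    moreover have "((\<lambda>n. ennreal ((l2norm (\<lambda>\<zeta>. fourierc (F n) \<zeta> - g \<zeta>))\<^sup>2)) \<longlonglongrightarrow> ennreal 0)
        \<longleftrightarrow> (\<lambda>n. (l2norm (\<lambda>\<zeta>. fourierc (F n) \<zeta> - g \<zeta>))\<^sup>2) \<longlonglongrightarrow> 0"
      by (rule tendsto_ennreal_iff) auto
    moreover have "((\<lambda>n. (l2norm (\<lambda>\<zeta>. fourierc (F n) \<zeta> - g \<zeta>))\<^sup>2) \<longlonglongrightarrow> 0)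
        \<longleftrightarrow> (\<lambda>n. l2norm (\<lambda>\<zeta>. fourierc (F n) \<zeta> - g \<zeta>)) \<longlonglongrightarrow> 0"
      using tendsto_power[of "\<lambda>n. l2norm (\<lambda>\<zeta>. fourierc (F n) \<zeta> - g \<zeta>)" 0 sequentially 2]
        tendsto_real_sqrt[of "\<lambda>n. (l2norm (\<lambda>\<zeta>. fourierc (F n) \<zeta> - g \<zeta>))\<^sup>2" 0 sequentially] by auto
    ultimately show ?thesis by simp
  qed
  have is_iff: "is_fourier_L2 f g \<longleftrightarrow> sqint g \<and> (\<lambda>n. l2norm (\<lambda>\<zeta>. fourierc (F n) \<zeta> - g \<zeta>)) \<longlonglongrightarrow> 0" for g
    unfolding is_fourier_L2_def eq using lim_iff[of g] by (auto simp: sqint_def)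
  obtain g where g: "ft (\<lambda>z. complex_of_real (rep_L2 f z)) g" using ft_exists[OF sqint_rep_L2] by blast
  have "is_fourier_L2 f g"
    unfolding is_iff using F(2) ft_sqint(2)[OF g] by (simp add: ft_isometry_diff[OF F(1) g])
  then have "is_fourier_L2 f (fourier_L2 f)" unfolding fourier_L2_def by (rule someI[where P = "is_fourier_L2 f"])
  then have "sqint (fourier_L2 f)" "(\<lambda>n. l2norm (\<lambda>\<zeta>. fourierc (F n) \<zeta> - fourier_L2 f \<zeta>)) \<longlonglongrightarrow> 0"
    unfolding is_iff by auto
  then show ?thesis using F by (intro ft_limit[OF F(1)] sqint_rep_L2)
qed

lemmas sqint_fourier_L2 = ft_sqint(2)[OF fourier_L2_ft]

lemma fourier_L2_unique:
  "ft (\<lambda>z. complex_of_real (rep_L2 f z)) g \<Longrightarrow> AE \<zeta> in lborel. fourier_L2 f \<zeta> = g \<zeta>"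
  by (rule ft_unique[OF fourier_L2_ft])

text \<open>Additivity is an almost everywhere statement, since \<open>fourier_L2\<close> picks a
  representative separately for each argument.\<close>

lemma fourier_L2_add: "AE \<zeta> in lborel. fourier_L2 (f + g) \<zeta> = fourier_L2 f \<zeta> + fourier_L2 g \<zeta>"
proof (rule fourier_L2_unique, rule ft_cong_AE[OF ft_add[OF fourier_L2_ft[of f] fourier_L2_ft[of g]]])
  show "AE z in lborel. complex_of_real (rep_L2 f z) + complex_of_real (rep_L2 g z) = complex_of_real (rep_L2 (f + g) z)"
    using rep_L2_add[of f g] by eventually_elim simp
qed (simp_all add: sqint_measurable[OF sqint_rep_L2] sqint_measurable[OF sqint_add[OF sqint_fourier_L2 sqint_fourier_L2]])

lemma fourier_L2_scale: "AE \<zeta> in lborel. fourier_L2 (c *\<^sub>R f) \<zeta> = complex_of_real c * fourier_L2 f \<zeta>"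
proof (rule fourier_L2_unique, rule ft_cong_AE[OF ft_scale[OF fourier_L2_ft[of f], of "complex_of_real c"]])
  show "AE z in lborel. complex_of_real c * complex_of_real (rep_L2 f z) = complex_of_real (rep_L2 (c *\<^sub>R f) z)"
    using rep_L2_scale[of c f] by eventually_elim simp
qed (simp_all add: sqint_measurable[OF sqint_rep_L2] sqint_measurable[OF sqint_scale[OF sqint_fourier_L2]])

lemma fourier_L2_diff: "AE \<zeta> in lborel. fourier_L2 (f - g) \<zeta> = fourier_L2 f \<zeta> - fourier_L2 g \<zeta>"
  using fourier_L2_add[of f "(-1) *\<^sub>R g"] fourier_L2_scale[of "-1" g]
proof eventually_elim
  case (elim \<zeta>)
  show ?case unfolding minus_L2_def elim by simp
qed

section \<open>Convolution and the transform of a product\<close>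

lemma AE_lborel_reflect:
  fixes t :: plane
  assumes "AE z in lborel. P z" shows "AE z in lborel. P (t - z)"
proof -
  have "lborel = distr lborel borel (\<lambda>z::plane. t - z)"
    using lborel_affine[of "-1" t] by (simp add: density_1)
  then have eq: "distr lborel borel (\<lambda>z::plane. t - z) = lborel" by (rule sym)
  have "AE z in distr lborel borel (\<lambda>z::plane. t - z). P z" unfolding eq by (rule assms)
  then show ?thesis by (rule AE_distrD[rotated]) simp
qed

definition conv :: "(plane \<Rightarrow> complex) \<Rightarrow> (plane \<Rightarrow> complex) \<Rightarrow> plane \<Rightarrow> complex" where
  "conv f g \<zeta> = (LINT \<zeta>'|lborel. f (\<zeta> - \<zeta>') * g \<zeta>')"

lemma conv_bound:
  assumes "sqint f" "sqint g" shows "cmod (conv f g \<zeta>) \<le> l2norm f * l2norm g"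
  using l2_Cauchy_Schwarz[OF sqint_reflect[OF assms(1), of \<zeta>] assms(2)]
  by (simp add: conv_def l2norm_reflect sqint_measurable assms)

lemma conv_integrable:
  "sqint f \<Longrightarrow> sqint g \<Longrightarrow> integrable lborel (\<lambda>\<zeta>'. f (\<zeta> - \<zeta>') * g \<zeta>')"
  by (rule sqint_mult_integrable[OF sqint_reflect])

lemma conv_commute:
  assumes [measurable]: "f \<in> borel_measurable borel" "g \<in> borel_measurable borel"
  shows "conv f g \<zeta> = conv g f \<zeta>"
  unfolding conv_def
  using lborel_plane_reflect(1)[of "\<lambda>\<zeta>'. f (\<zeta> - \<zeta>') * g \<zeta>'" \<zeta>] by (simp add: mult.commute)

text \<open>Bilinearity splits the difference into \<open>conv (f - g) f\<close> and
  \<open>conv g (f - g)\<close>; linear dependence on the distance of f and g is what the expansion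
  at zero uses.\<close>

lemma conv_diff_bound:
  assumes f: "sqint f" and g: "sqint g"
  shows "cmod (conv f f \<zeta> - conv g g \<zeta>) \<le> l2norm (\<lambda>z. f z - g z) * (l2norm f + l2norm g)"
proof -
  define d where "d z = f z - g z" for z
  have d: "sqint d" unfolding d_def by (rule sqint_diff[OF f g])
  have "conv f f \<zeta> - conv g g \<zeta> = (LINT \<zeta>'|lborel. d (\<zeta> - \<zeta>') * f \<zeta>' + g (\<zeta> - \<zeta>') * d \<zeta>')"
    unfolding conv_def Bochner_Integration.integral_diff[OF conv_integrable[OF f f] conv_integrable[OF g g], symmetric]
    by (simp add: d_def algebra_simps)
  also have "\<dots> = conv d f \<zeta> + conv g d \<zeta>"
    unfolding conv_def by (intro Bochner_Integration.integral_add conv_integrable d f g)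
  also have "cmod \<dots> \<le> l2norm d * l2norm f + l2norm g * l2norm d"
    by (intro norm_triangle_mono conv_bound d f g)
  finally show ?thesis by (simp add: d_def[abs_def] algebra_simps)
qed

lemma ft_real_hermitian:
  assumes "ft (\<lambda>z. complex_of_real (u z)) g" shows "AE \<zeta> in lborel. g \<zeta> = cnj (g (- \<zeta>))"
  using ft_unique[OF assms, of "\<lambda>\<zeta>. cnj (g (- \<zeta>))"] ft_cnj[OF assms] by simp

text \<open>The transform of the product at \<open>\<zeta>\<close> is the pairing of v with u
  modulated by \<open>\<zeta>\<close>, so Parseval's identity applies. The conjugate it produces is
  removed by the Hermitian symmetry of the transform of a real function.\<close>

lemma fourier_mult:
  assumes u: "ft (\<lambda>z. complex_of_real (u z)) g" and v: "ft (\<lambda>z. complex_of_real (v z)) k"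
  shows "fourier (\<lambda>z. u z * v z) \<zeta> = conv g k \<zeta> / (2 * pi)"
proof -
  have "(LINT z|lborel. complex_of_real (u z * v z) * cis (- (z \<bullet> \<zeta>)))
      = (LINT z|lborel. complex_of_real (v z) * cnj (complex_of_real (u z) * cis (z \<bullet> \<zeta>)))"
    by (simp add: cis_cnj mult_ac)
  also have "\<dots> = (LINT \<zeta>'|lborel. k \<zeta>' * cnj (g (\<zeta>' - \<zeta>)))"
    by (rule ft_parseval[OF v ft_modulate[OF u], symmetric])
  also have "\<dots> = conv g k \<zeta>"
    unfolding conv_def
  proof (rule integral_cong_AE)
    show "AE \<zeta>' in lborel. k \<zeta>' * cnj (g (\<zeta>' - \<zeta>)) = g (\<zeta> - \<zeta>') * k \<zeta>'"
      using AE_lborel_reflect[OF ft_real_hermitian[OF u], of \<zeta>] by eventually_elim simp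
    have [measurable]: "k \<in> borel_measurable borel" "g \<in> borel_measurable borel"
      using ft_sqint[OF u] ft_sqint[OF v] by auto
    have "cnj \<in> borel_measurable borel" by (intro borel_measurable_continuous_onI continuous_intros)
    then show "(\<lambda>\<zeta>'. k \<zeta>' * cnj (g (\<zeta>' - \<zeta>))) \<in> borel_measurable lborel" by measurable
    show "(\<lambda>\<zeta>'. g (\<zeta> - \<zeta>') * k \<zeta>') \<in> borel_measurable lborel" by measurable
  qed
  finally show ?thesis by (simp add: fourier_def)
qed

text \<open>The inverse transform v of \<open>\<i> \<xi> g\<close> pairs with every test function as
  ux does, by Parseval's identity. Treating real and imaginary parts separately gives v = ux almost
  everywhere, so ux, which the definition makes only locally integrable, is in L2.\<close>

lemma weak_derivative_ft:
  assumes u: "ft (\<lambda>z. complex_of_real (u z)) g"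
    and xg: "sqint (\<lambda>\<zeta>. \<i> * complex_of_real (fst \<zeta>) * g \<zeta>)"
    and w: "weak_derivative (1, 0) u ux"
  shows "ft (\<lambda>z. complex_of_real (ux z)) (\<lambda>\<zeta>. \<i> * complex_of_real (fst \<zeta>) * g \<zeta>)"
proof -
  obtain v where v: "ft v (\<lambda>\<zeta>. \<i> * complex_of_real (fst \<zeta>) * g \<zeta>)"
    using ft_surjective[OF xg] by blast
  have vs: "sqint v" using ft_sqint(1)[OF v] .
  note [measurable] = sqint_measurable[OF vs]
  have uxm [measurable]: "ux \<in> borel_measurable borel" using w by (simp add: weak_derivative_def)
  have uxi: "set_integrable lborel (cball 0 r) ux" for r using w by (simp add: weak_derivative_def)
  have vi: "integrable lborel (\<lambda>z. indicator (cball 0 r) z *\<^sub>R v z)" for r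
  proof -
    have [measurable]: "cball (0::plane) r \<in> sets borel" for r by simp
    have "sqint (\<lambda>z. complex_of_real (indicator (cball (0::plane) r) z))"
      unfolding sqint_of_real square_integrable_def
      using emeasure_compact_finite[of "cball (0::plane) r"]
      by (auto simp: power2_eq_square simp flip: indicator_inter_arith)
    from sqint_mult_integrable[OF this vs] show ?thesis by (simp add: scaleR_conv_of_real)
  qed
  have key: "(LINT z|lborel. v z * complex_of_real (\<phi> z)) = complex_of_real (LINT z|lborel. ux z * \<phi> z)"
    if \<phi>: "test_function \<phi>" for \<phi>
  proof -
    define \<phi>x where "\<phi>x z = frechet_derivative \<phi> (at z) (1, 0)" for z
    define p where "p = fourierc (\<lambda>z. complex_of_real (\<phi> z))"
    note F = test_function_fourier_derivative[OF \<phi>, folded \<phi>x_def p_def]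
    have "complex_of_real (LINT z|lborel. ux z * \<phi> z) = - complex_of_real (LINT z|lborel. u z * \<phi>x z)"
      using w \<phi> by (simp add: weak_derivative_def \<phi>x_def)
    also have "\<dots> = - (LINT z|lborel. complex_of_real (u z) * cnj (complex_of_real (\<phi>x z)))"
      by (simp flip: integral_complex_of_real)
    also have "\<dots> = - (LINT \<zeta>|lborel. g \<zeta> * cnj (\<i> * complex_of_real (fst \<zeta>) * p \<zeta>))"
      by (simp only: ft_parseval[OF u F(2)])
    also have "\<dots> = (LINT \<zeta>|lborel. \<i> * complex_of_real (fst \<zeta>) * g \<zeta> * cnj (p \<zeta>))"
      by (simp add: mult_ac flip: Bochner_Integration.integral_minus)
    also have "\<dots> = (LINT z|lborel. v z * cnj (complex_of_real (\<phi> z)))"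
      by (rule ft_parseval[OF v F(1)])
    finally show ?thesis by simp
  qed
  have vphi: "integrable lborel (\<lambda>z. v z * complex_of_real (\<phi> z))" if "test_function \<phi>" for \<phi>
    using sqint_mult_integrable[OF vs ft_sqint(1)[OF test_function_fourier_derivative(1)[OF that]]] .
  have "AE z in lborel. Im (v z) = 0"
  proof (rule AE_zero_if_test_integrals_zero)
    show "set_integrable lborel (cball 0 r) (\<lambda>z. Im (v z))" for r
      using integrable_Im[OF vi[of r]] by (simp add: set_integrable_def)
    show "(LINT z|lborel. Im (v z) * \<phi> z) = 0" if "test_function \<phi>" for \<phi>
      using key[OF that] integral_Im[OF vphi[OF that]] by simp
  qed measurable
  moreover have "AE z in lborel. Re (v z) - ux z = 0"
  proof (rule AE_zero_if_test_integrals_zero)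
    show si: "set_integrable lborel (cball 0 r) (\<lambda>z. Re (v z) - ux z)" for r
      using integrable_Re[OF vi[of r]] uxi[of r]
      unfolding set_integrable_def by (simp add: right_diff_distrib)
    show "(LINT z|lborel. (Re (v z) - ux z) * \<phi> z) = 0" if \<phi>: "test_function \<phi>" for \<phi>
    proof -
      have re: "integrable lborel (\<lambda>z. Re (v z) * \<phi> z)" "(LINT z|lborel. Re (v z) * \<phi> z) = (LINT z|lborel. ux z * \<phi> z)"
        using key[OF \<phi>] integral_Re[OF vphi[OF \<phi>]] integrable_Re[OF vphi[OF \<phi>]] by simp_all
      have "integrable lborel (\<lambda>z. ux z * \<phi> z)"
      proof -
        obtain r where r: "{z. \<phi> z \<noteq> 0} \<subseteq> cball 0 r"
          using \<phi> bounded_subset_ballD[of "{z. \<phi> z \<noteq> 0}" 0] ball_subset_cball unfolding test_function_def by (meson order_trans)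
        have pc: "continuous_on UNIV \<phi>" using \<phi> by (simp add: test_function_def differentiable_imp_continuous_on)
        then have "compact (\<phi> ` cball 0 r)" by (intro compact_continuous_image) (auto intro: continuous_on_subset)
        then obtain C where C: "\<forall>w\<in>\<phi> ` cball 0 r. \<bar>w\<bar> \<le> C" using compact_imp_bounded bounded_iff by (metis real_norm_def)
        have [measurable]: "\<phi> \<in> borel_measurable borel" using pc by (rule borel_measurable_continuous_onI)
        show ?thesis
        proof (rule Bochner_Integration.integrable_bound)
          show "integrable lborel (\<lambda>z. C * (indicator (cball 0 r) z *\<^sub>R ux z))"
            using uxi[of r] by (simp add: set_integrable_def)
          show "AE z in lborel. norm (ux z * \<phi> z) \<le> norm (C * (indicator (cball 0 r) z *\<^sub>R ux z))"
          proof (rule AE_I2)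
            fix z show "norm (ux z * \<phi> z) \<le> norm (C * (indicator (cball 0 r) z *\<^sub>R ux z))"
            proof (cases "z \<in> cball 0 r")
              case True
              then have "\<bar>\<phi> z\<bar> \<le> \<bar>C\<bar>" using C by force
              then show ?thesis using True by (simp add: abs_mult mult.commute[of "ux z"] mult_right_mono)
            qed (use r in auto)
          qed
        qed measurable
      qed
      then show ?thesis using re by (simp add: left_diff_distrib)
    qed
  qed measurable
  ultimately have "AE z in lborel. v z = complex_of_real (ux z)"
    by eventually_elim (simp add: complex_eq_iff)
  then show ?thesis using sqint_measurable[OF xg] by (intro ft_cong_AE[OF v]) auto
qed

text \<open>Fourier form of \<open>u u_x = (u^2)_x / 2\<close>: the convolution is symmetrised, and
  the frequencies \<open>\<zeta> - \<zeta>'\<close> and \<open>\<zeta>'\<close> of the two halves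
  add up to \<open>\<zeta>\<close>.\<close>

lemma fourier_mult_derivative:
  assumes u: "ft (\<lambda>z. complex_of_real (u z)) g"
    and ux: "ft (\<lambda>z. complex_of_real (ux z)) (\<lambda>\<zeta>. \<i> * complex_of_real (fst \<zeta>) * g \<zeta>)"
  shows "fourier (\<lambda>z. u z * ux z) \<zeta> = \<i> * complex_of_real (fst \<zeta>) * conv g g \<zeta> / (4 * pi)"
proof -
  define h where "h \<zeta> = \<i> * complex_of_real (fst \<zeta>) * g \<zeta>" for \<zeta>
  have h: "sqint h" using ft_sqint(2)[OF ux] by (simp add: h_def[abs_def])
  have g: "sqint g" using ft_sqint(2)[OF u] .
  have "2 * conv g h \<zeta> = conv h g \<zeta> + conv g h \<zeta>"
    using conv_commute[of g h \<zeta>] g h by (simp add: sqint_measurable)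
  also have "\<dots> = (LINT \<zeta>'|lborel. h (\<zeta> - \<zeta>') * g \<zeta>' + g (\<zeta> - \<zeta>') * h \<zeta>')"
    unfolding conv_def by (intro Bochner_Integration.integral_add[symmetric] conv_integrable g h)
  also have "\<dots> = \<i> * complex_of_real (fst \<zeta>) * conv g g \<zeta>"
    unfolding conv_def integral_mult_right_zero[symmetric] by (simp add: h_def algebra_simps)
  finally have half: "conv g h \<zeta> = \<i> * complex_of_real (fst \<zeta>) * conv g g \<zeta> / 2" by (simp add: mult.commute)
  have "fourier (\<lambda>z. u z * ux z) \<zeta> = conv g h \<zeta> / (2 * pi)"
    using fourier_mult[OF u ux, of \<zeta>] by (simp only: h_def[abs_def])
  then show ?thesis unfolding half by simp
qed

text \<open>Integration by parts is done on the Fourier side: both pairings below express \<open>\<integral> u\<^sup>2 u\<^sub>x\<close>,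
  and \<open>FT (u u\<^sub>x) = i \<xi> FT (u\<^sup>2) / 2\<close> makes one of them minus twice the other.\<close>

lemma bounded_energy:
  assumes u: "ft (\<lambda>z. complex_of_real (u z)) g"
    and ux: "ft (\<lambda>z. complex_of_real (ux z)) (\<lambda>\<zeta>. \<i> * complex_of_real (fst \<zeta>) * g \<zeta>)"
    and bd: "AE z in lborel. \<bar>u z\<bar> \<le> m"
  shows "sqint (fourier (\<lambda>z. u z * ux z))"
    and "l2norm (fourier (\<lambda>z. u z * ux z)) \<le> m * l2norm (\<lambda>\<zeta>. \<i> * complex_of_real (fst \<zeta>) * g \<zeta>)"
    and "(LINT \<zeta>|lborel. cnj (g \<zeta>) * fourier (\<lambda>z. u z * ux z) \<zeta>) = 0"
proof -
  have us: "sqint (\<lambda>z. complex_of_real (u z))" and xs: "sqint (\<lambda>z. complex_of_real (ux z))"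
    using ft_sqint[OF u] ft_sqint[OF ux] by auto
  have [measurable]: "u \<in> borel_measurable borel" "ux \<in> borel_measurable borel"
    using us xs by (auto simp: sqint_of_real square_integrable_def)
  have m0: "0 \<le> m"
  proof (rule ccontr)
    assume "\<not> 0 \<le> m"
    with bd have "AE z in (lborel :: plane measure). False" by (auto elim!: eventually_mono)
    then show False by (simp add: eventually_False ae_filter_eq_bot_iff)
  qed
  have ft_prod: "ft (\<lambda>z. complex_of_real (u z * w z)) (fourier (\<lambda>z. u z * w z)) \<and>
      l2norm (\<lambda>z. complex_of_real (u z * w z)) \<le> m * l2norm (\<lambda>z. complex_of_real (w z))"
    if ws: "sqint (\<lambda>z. complex_of_real (w z))" for w
  proof -
    have [measurable]: "w \<in> borel_measurable borel" using ws by (auto simp: sqint_of_real square_integrable_def)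
    have le: "AE z in lborel. cmod (complex_of_real (u z * w z)) \<le> m * cmod (complex_of_real (w z))"
      using bd by eventually_elim (simp add: norm_mult mult_right_mono)
    have i: "integrable lborel (\<lambda>z. (m * cmod (complex_of_real (w z)))\<^sup>2)"
      using sqint_integrable[OF ws] by (simp add: power_mult_distrib)
    have s: "sqint (\<lambda>z. complex_of_real (u z * w z))" using i by (rule sqint_dominated) (use le in auto)
    have "(l2norm (\<lambda>z. complex_of_real (u z * w z)))\<^sup>2 \<le> (LINT z|lborel. (m * cmod (complex_of_real (w z)))\<^sup>2)"
      unfolding l2norm_square
    proof (rule integral_mono_AE[OF sqint_integrable[OF s] i])
      show "AE z in lborel. (cmod (complex_of_real (u z * w z)))\<^sup>2 \<le> (m * cmod (complex_of_real (w z)))\<^sup>2"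
        using le by eventually_elim (intro power_mono, auto)
    qed
    also have "\<dots> = (m * l2norm (\<lambda>z. complex_of_real (w z)))\<^sup>2"
      by (simp add: power_mult_distrib l2norm_square)
    finally have "l2norm (\<lambda>z. complex_of_real (u z * w z)) \<le> m * l2norm (\<lambda>z. complex_of_real (w z))"
      by (rule power2_le_imp_le) (simp add: m0)
    moreover have "integrable lborel (\<lambda>z. complex_of_real (u z * w z))" using sqint_mult_integrable[OF us ws] by simp
    ultimately show ?thesis using ft_fourierc[OF s] by (simp add: fourier_eq_fourierc)
  qed
  define h where "h \<zeta> = \<i> * complex_of_real (fst \<zeta>) * g \<zeta>" for \<zeta>
  define N where "N = fourier (\<lambda>z. u z * ux z)"
  define Q where "Q = fourier (\<lambda>z. u z * u z)"
  note uux = ft_prod[OF xs, folded N_def] and uu = ft_prod[OF us, folded Q_def]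
  show "sqint (fourier (\<lambda>z. u z * ux z))" using uux ft_sqint(2) unfolding N_def by blast
  show "l2norm (fourier (\<lambda>z. u z * ux z)) \<le> m * l2norm (\<lambda>\<zeta>. \<i> * complex_of_real (fst \<zeta>) * g \<zeta>)"
    using uux ft_isometry[OF ux] ft_isometry[OF uux[THEN conjunct1]] unfolding N_def by simp
  have NQ: "N \<zeta> = \<i> * complex_of_real (fst \<zeta>) * Q \<zeta> / 2" for \<zeta>
    unfolding N_def Q_def fourier_mult_derivative[OF u ux] fourier_mult[OF u u] by simp
  have "(LINT \<zeta>|lborel. N \<zeta> * cnj (g \<zeta>)) = (LINT z|lborel. complex_of_real (u z * ux z) * cnj (complex_of_real (u z)))"
    by (rule ft_parseval[OF uux[THEN conjunct1] u])
  also have "\<dots> = (LINT z|lborel. complex_of_real (u z * u z) * cnj (complex_of_real (ux z)))" by (simp add: mult_ac)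
  also have "\<dots> = (LINT \<zeta>|lborel. Q \<zeta> * cnj (h \<zeta>))"
    unfolding h_def by (rule ft_parseval[OF uu[THEN conjunct1] ux, symmetric])
  also have "\<dots> = (LINT \<zeta>|lborel. - 2 * (N \<zeta> * cnj (g \<zeta>)))" by (simp add: NQ h_def mult_ac)
  also have "\<dots> = - 2 * (LINT \<zeta>|lborel. N \<zeta> * cnj (g \<zeta>))" by (rule integral_mult_right_zero)
  finally have "3 * (LINT \<zeta>|lborel. N \<zeta> * cnj (g \<zeta>)) = 0" by (simp add: algebra_simps)
  then show "(LINT \<zeta>|lborel. cnj (g \<zeta>) * fourier (\<lambda>z. u z * ux z) \<zeta>) = 0" by (simp add: N_def mult.commute)
qed

lemma plane_projections_measurable [measurable]:
  "(\<lambda>z::plane. fst z) \<in> borel_measurable borel" "(\<lambda>z::plane. snd z) \<in> borel_measurable borel"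
  by (intro borel_measurable_continuous_onI continuous_intros)+

section \<open>Sobolev norms and the dispersion relation\<close>

text \<open>The square root turns the Sobolev norm of f into the \<open>l2norm\<close> of the
  weighted transform.\<close>

definition weight :: "real \<Rightarrow> real \<Rightarrow> plane \<Rightarrow> real" where
  "weight s1 s2 \<zeta> = sqrt (bracket (fst \<zeta>) powr (2 * s1) + bracket (snd \<zeta>) powr (2 * s2))"

lemma bracket_ge_1: "1 \<le> bracket a"
  by (simp add: bracket_def)

lemma weight_square: "(weight s1 s2 \<zeta>)\<^sup>2 = bracket (fst \<zeta>) powr (2 * s1) + bracket (snd \<zeta>) powr (2 * s2)"
  by (simp add: weight_def)

lemma weight_pos: "0 < weight s1 s2 \<zeta>"
proof -
  have "0 < bracket (fst \<zeta>) powr (2 * s1) + bracket (snd \<zeta>) powr (2 * s2)"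
    using bracket_ge_1[of "fst \<zeta>"] by (intro add_pos_nonneg) auto
  then show ?thesis by (simp add: weight_def)
qed

lemma weight_measurable [measurable]: "weight s1 s2 \<in> borel_measurable borel"
  unfolding weight_def[abs_def] bracket_def[abs_def] by measurable

text \<open>For \<open>s1 \<ge> 1\<close> the bracket in \<open>\<xi>\<close> alone contributes at
  least \<open>1 + \<xi>^2\<close>, which puts both a function and its x-derivative in L2.\<close>

lemma weight_ge:
  assumes "1 \<le> s1" shows "1 \<le> weight s1 s2 \<zeta>" "\<bar>fst \<zeta>\<bar> \<le> weight s1 s2 \<zeta>"
proof -
  have "bracket (fst \<zeta>) powr 2 \<le> bracket (fst \<zeta>) powr (2 * s1)"
    using assms bracket_ge_1[of "fst \<zeta>"] by (intro powr_mono) auto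
  moreover have "bracket (fst \<zeta>) powr 2 = 1 + (fst \<zeta>)\<^sup>2"
    using bracket_ge_1[of "fst \<zeta>"] by (simp add: bracket_def)
  moreover have "0 \<le> bracket (snd \<zeta>) powr (2 * s2)" by simp
  ultimately have *: "1 + (fst \<zeta>)\<^sup>2 \<le> bracket (fst \<zeta>) powr (2 * s1) + bracket (snd \<zeta>) powr (2 * s2)" by linarith
  show "1 \<le> weight s1 s2 \<zeta>" 
  proof -
    have "1 \<le> bracket (fst \<zeta>) powr (2 * s1) + bracket (snd \<zeta>) powr (2 * s2)"
      using * zero_le_power2[of "fst \<zeta>"] by linarith
    then show ?thesis by (simp add: weight_def)
  qed
  show "\<bar>fst \<zeta>\<bar> \<le> weight s1 s2 \<zeta>" unfolding weight_def using * by (intro real_le_rsqrt) simp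
qed

definition wfourier :: "real \<Rightarrow> real \<Rightarrow> L2 \<Rightarrow> plane \<Rightarrow> complex" where
  "wfourier s1 s2 f \<zeta> = complex_of_real (weight s1 s2 \<zeta>) * fourier_L2 f \<zeta>"

lemma fourier_L2_measurable [measurable]: "fourier_L2 f \<in> borel_measurable borel"
  by (rule sqint_measurable[OF sqint_fourier_L2])

lemma wfourier_measurable [measurable]: "wfourier s1 s2 f \<in> borel_measurable borel"
  unfolding wfourier_def[abs_def] by measurable

lemma sobolev_density_wfourier: "sobolev_density s1 s2 f = (\<lambda>\<zeta>. (cmod (wfourier s1 s2 f \<zeta>))\<^sup>2)"
  by (auto simp: fun_eq_iff sobolev_density_def wfourier_def norm_mult power_mult_distrib weight_square)

lemma sobolev_iff: "f \<in> sobolev s1 s2 \<longleftrightarrow> sqint (wfourier s1 s2 f)"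
  by (simp add: sobolev_def sqint_def sobolev_density_wfourier)

lemma sobolev_norm_eq: "sobolev_norm s1 s2 f = l2norm (wfourier s1 s2 f)"
  by (simp add: sobolev_norm_def l2norm_def sobolev_density_wfourier)

lemma wfourier_diff: "AE \<zeta> in lborel. wfourier s1 s2 (f - g) \<zeta> = wfourier s1 s2 f \<zeta> - wfourier s1 s2 g \<zeta>"
  using fourier_L2_diff[of f g] by eventually_elim (simp add: wfourier_def right_diff_distrib)

lemma wfourier_scale: "AE \<zeta> in lborel. wfourier s1 s2 (c *\<^sub>R f) \<zeta> = complex_of_real c * wfourier s1 s2 f \<zeta>"
  using fourier_L2_scale[of c f] by eventually_elim (simp add: wfourier_def)

lemma sobolev_diff:
  assumes "f \<in> sobolev s1 s2" "g \<in> sobolev s1 s2"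
  shows "f - g \<in> sobolev s1 s2"
    and "sobolev_norm s1 s2 (f - g) = l2norm (\<lambda>\<zeta>. wfourier s1 s2 f \<zeta> - wfourier s1 s2 g \<zeta>)"
proof -
  have s: "sqint (\<lambda>\<zeta>. wfourier s1 s2 f \<zeta> - wfourier s1 s2 g \<zeta>)"
    using assms unfolding sobolev_iff by (rule sqint_diff)
  have ae: "AE \<zeta> in lborel. wfourier s1 s2 f \<zeta> - wfourier s1 s2 g \<zeta> = wfourier s1 s2 (f - g) \<zeta>"
    using wfourier_diff[of s1 s2 f g] by eventually_elim simp
  show "f - g \<in> sobolev s1 s2" unfolding sobolev_iff by (rule sqint_cong_AE[OF s _ ae]) simp
  show "sobolev_norm s1 s2 (f - g) = l2norm (\<lambda>\<zeta>. wfourier s1 s2 f \<zeta> - wfourier s1 s2 g \<zeta>)"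
    unfolding sobolev_norm_eq using ae by (intro l2norm_cong_AE) (auto elim: eventually_mono)
qed

lemma sobolev_scale:
  assumes "f \<in> sobolev s1 s2"
  shows "c *\<^sub>R f \<in> sobolev s1 s2" and "sobolev_norm s1 s2 (c *\<^sub>R f) = \<bar>c\<bar> * sobolev_norm s1 s2 f"
proof -
  have s: "sqint (\<lambda>\<zeta>. complex_of_real c * wfourier s1 s2 f \<zeta>)"
    using assms unfolding sobolev_iff by (rule sqint_scale)
  have ae: "AE \<zeta> in lborel. complex_of_real c * wfourier s1 s2 f \<zeta> = wfourier s1 s2 (c *\<^sub>R f) \<zeta>"
    using wfourier_scale[of s1 s2 c f] by eventually_elim simp
  show "c *\<^sub>R f \<in> sobolev s1 s2" unfolding sobolev_iff by (rule sqint_cong_AE[OF s _ ae]) simp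
  have "sobolev_norm s1 s2 (c *\<^sub>R f) = l2norm (\<lambda>\<zeta>. complex_of_real c * wfourier s1 s2 f \<zeta>)"
    unfolding sobolev_norm_eq using ae by (intro l2norm_cong_AE) (auto elim: eventually_mono)
  then show "sobolev_norm s1 s2 (c *\<^sub>R f) = \<bar>c\<bar> * sobolev_norm s1 s2 f"
    by (simp add: l2norm_scale sobolev_norm_eq)
qed

lemma l2norm_mono_norm:
  assumes f: "sqint f" and g: "g \<in> borel_measurable borel" and le: "\<And>z. cmod (g z) \<le> cmod (f z)"
  shows "sqint g" "l2norm g \<le> l2norm f"
proof -
  show s: "sqint g" using sqint_integrable[OF f] g by (rule sqint_dominated) (use le in auto)
  have "(LINT z|lborel. (cmod (g z))\<^sup>2) \<le> (LINT z|lborel. (cmod (f z))\<^sup>2)"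
    using sqint_integrable[OF f] sqint_integrable[OF s] le by (intro integral_mono power_mono) auto
  then show "l2norm g \<le> l2norm f" by (simp add: l2norm_def)
qed

lemma sobolev_bounds:
  assumes s1: "1 \<le> s1" and f: "f \<in> sobolev s1 s2"
  shows "l2norm (fourier_L2 f) \<le> sobolev_norm s1 s2 f"
    and "sqint (\<lambda>\<zeta>. \<i> * complex_of_real (fst \<zeta>) * fourier_L2 f \<zeta>)"
    and "l2norm (\<lambda>\<zeta>. \<i> * complex_of_real (fst \<zeta>) * fourier_L2 f \<zeta>) \<le> sobolev_norm s1 s2 f"
proof -
  have w: "sqint (wfourier s1 s2 f)" using f by (simp add: sobolev_iff)
  have "cmod (fourier_L2 f \<zeta>) \<le> cmod (wfourier s1 s2 f \<zeta>)" for \<zeta>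
    using mult_right_mono[OF weight_ge(1)[OF s1, of s2 \<zeta>], of "cmod (fourier_L2 f \<zeta>)"] weight_pos[of s1 s2 \<zeta>]
    by (simp add: wfourier_def norm_mult)
  then show "l2norm (fourier_L2 f) \<le> sobolev_norm s1 s2 f"
    unfolding sobolev_norm_eq by (intro l2norm_mono_norm(2)[OF w]) auto
  have le: "cmod (\<i> * complex_of_real (fst \<zeta>) * fourier_L2 f \<zeta>) \<le> cmod (wfourier s1 s2 f \<zeta>)" for \<zeta>
    using mult_right_mono[OF weight_ge(2)[OF s1, of \<zeta> s2], of "cmod (fourier_L2 f \<zeta>)"] weight_pos[of s1 s2 \<zeta>]
    by (simp add: wfourier_def norm_mult)
  have m: "(\<lambda>\<zeta>. \<i> * complex_of_real (fst \<zeta>) * fourier_L2 f \<zeta>) \<in> borel_measurable borel" by measurable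
  show "sqint (\<lambda>\<zeta>. \<i> * complex_of_real (fst \<zeta>) * fourier_L2 f \<zeta>)" by (rule l2norm_mono_norm(1)[OF w m le])
  show "l2norm (\<lambda>\<zeta>. \<i> * complex_of_real (fst \<zeta>) * fourier_L2 f \<zeta>) \<le> sobolev_norm s1 s2 f"
    unfolding sobolev_norm_eq by (rule l2norm_mono_norm(2)[OF w m le])
qed

section \<open>Dispersion relation and interaction picture\<close>

definition dispersion :: "real \<Rightarrow> plane \<Rightarrow> real" where
  "dispersion \<alpha> \<zeta> = fst \<zeta> ^ 3 + sgn (fst \<zeta>) * \<bar>fst \<zeta>\<bar> powr \<alpha> * (snd \<zeta>)\<^sup>2"

text \<open>This fixes the sign: the free evolution multiplies the transform by
  \<open>cis (- \<tau> * dispersion \<alpha> \<zeta>)\<close>.\<close>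

lemma linear_symbol_dispersion: "linear_symbol \<alpha> \<zeta> = - \<i> * complex_of_real (dispersion \<alpha> \<zeta>)"
  by (cases \<zeta>) (simp add: linear_symbol_def dispersion_def power_mult_distrib power3_eq_cube algebra_simps)

lemma dispersion_continuous: "continuous_on {z. fst z \<noteq> 0} (dispersion \<alpha>)"
proof -
  have "continuous_on {z :: plane. fst z \<noteq> 0} (\<lambda>z. sgn (fst z))"
    by (intro continuous_on_sgn continuous_intros) auto
  then show ?thesis unfolding dispersion_def[abs_def]
    by (intro continuous_intros) auto
qed

lemma dispersion_measurable [measurable]: "dispersion \<alpha> \<in> borel_measurable borel"
  unfolding dispersion_def[abs_def] by measurable

lemma cis_measurable [measurable (raw)]: "f \<in> borel_measurable M \<Longrightarrow> (\<lambda>x. cis (f x)) \<in> borel_measurable M"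
  unfolding cis_conv_exp by measurable

lemma cis_bounds: "cmod (cis a - cis b) \<le> \<bar>a - b\<bar>" "cmod (cis a - cis b - \<i> * complex_of_real (a - b) * cis b) \<le> (a - b)\<^sup>2"
proof -
  have eq: "cis a = cis (a - b) * cis b" by (simp add: cis_mult)
  have "cmod (cis (a - b) - 1) \<le> \<bar>a - b\<bar>"
    using iexp_approx1[of "a - b" 0] by (simp add: cis_conv_exp)
  moreover have "cmod (cis a - cis b) = cmod (cis (a - b) - 1)"
  proof -
    have "cis a - cis b = (cis (a - b) - 1) * cis b" by (simp add: eq algebra_simps)
    then show ?thesis by (simp add: norm_mult)
  qed
  ultimately show "cmod (cis a - cis b) \<le> \<bar>a - b\<bar>" by simp
  have "cmod (cis (a - b) - 1 - \<i> * complex_of_real (a - b)) \<le> (a - b)\<^sup>2 / 2"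
    using iexp_approx1[of "a - b" 1] by (simp add: cis_conv_exp numeral_2_eq_2 algebra_simps power2_eq_square)
  moreover have "cis a - cis b - \<i> * complex_of_real (a - b) * cis b = (cis (a - b) - 1 - \<i> * complex_of_real (a - b)) * cis b"
    by (simp add: eq algebra_simps)
  ultimately have "cmod (cis a - cis b - \<i> * complex_of_real (a - b) * cis b) \<le> (a - b)\<^sup>2 / 2"
    by (simp add: norm_mult)
  then show "cmod (cis a - cis b - \<i> * complex_of_real (a - b) * cis b) \<le> (a - b)\<^sup>2"
    using zero_le_power2[of "a - b"] by linarith
qed

text \<open>The sign is the one that undoes the free evolution. Being a multiplication, it can be
  moved from the solution to the test function, where it preserves the L2 norm and the class of
  frequency tests.\<close>

definition propagate :: "real \<Rightarrow> real \<Rightarrow> (plane \<Rightarrow> complex) \<Rightarrow> plane \<Rightarrow> complex" where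
  "propagate \<alpha> \<tau> f \<zeta> = cis (\<tau> * dispersion \<alpha> \<zeta>) * f \<zeta>"

lemma propagate_measurable [measurable (raw)]:
  "f \<in> borel_measurable borel \<Longrightarrow> propagate \<alpha> \<tau> f \<in> borel_measurable borel"
  unfolding propagate_def[abs_def] by measurable

lemma sqint_propagate: "sqint f \<Longrightarrow> sqint (propagate \<alpha> \<tau> f)"
  by (rule sqint_cong_norm[of f]) (auto simp: propagate_def norm_mult intro: propagate_measurable sqint_measurable)

lemma l2norm_propagate [simp]: "l2norm (propagate \<alpha> \<tau> f) = l2norm f"
  by (rule l2norm_cong_norm) (simp add: propagate_def norm_mult)

lemma frequency_test_propagate: "frequency_test \<theta> \<Longrightarrow> frequency_test (propagate \<alpha> \<tau> \<theta>)"
proof -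
  assume t: "frequency_test \<theta>"
  have "continuous_on {z. fst z \<noteq> 0} (\<lambda>z. cis (\<tau> * dispersion \<alpha> z))"
    unfolding cis_conv_exp by (intro continuous_intros dispersion_continuous)
  from frequency_test_mult[OF t this] show ?thesis by (simp add: propagate_def[abs_def] mult.commute)
qed

text \<open>The support is compact and avoids the singular line. Bounded phase speed is what makes
  the moving test function differentiable in time.\<close>

lemma dispersion_bounded_on_test:
  assumes t: "frequency_test \<theta>"
  shows "\<exists>B\<ge>0. \<forall>\<zeta>. \<theta> \<zeta> \<noteq> 0 \<longrightarrow> \<bar>dispersion \<alpha> \<zeta>\<bar> \<le> B"
proof -
  obtain K where K: "compact K" "\<forall>\<eta>. (0, \<eta>) \<notin> K" "\<forall>\<zeta>. \<zeta> \<notin> K \<longrightarrow> \<theta> \<zeta> = 0"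
    using t unfolding frequency_test_def by blast
  have "compact (dispersion \<alpha> ` K)"
    using K by (intro compact_continuous_image continuous_on_subset[OF dispersion_continuous]) auto
  then obtain B where B: "\<forall>w\<in>dispersion \<alpha> ` K. \<bar>w\<bar> \<le> B" using compact_imp_bounded bounded_iff by (metis real_norm_def)
  show ?thesis using B K(3) by (intro exI[of _ "max B 0"]) (auto simp: le_max_iff_disj)
qed

text \<open>Passing to the interaction picture: the time-dependent test function absorbs the linear part.\<close>

lemma interaction_derivative:
  fixes g :: "real \<Rightarrow> plane \<Rightarrow> complex"
  assumes \<theta>: "frequency_test \<theta>" and t: "t \<in> S"
    and g: "\<And>\<tau>. sqint (g \<tau>)"
    and cont: "((\<lambda>\<tau>. l2norm (\<lambda>\<zeta>. g \<tau> \<zeta> - g t \<zeta>)) \<longlongrightarrow> 0) (at t within S)"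
    and G: "integrable lborel (\<lambda>\<zeta>. propagate \<alpha> t \<theta> \<zeta> * G \<zeta>)"
    and eq: "((\<lambda>\<tau>. LINT \<zeta>|lborel. propagate \<alpha> t \<theta> \<zeta> * g \<tau> \<zeta>) has_vector_derivative
      (LINT \<zeta>|lborel. propagate \<alpha> t \<theta> \<zeta> * (linear_symbol \<alpha> \<zeta> * g t \<zeta> + G \<zeta>))) (at t within S)"
  shows "((\<lambda>\<tau>. LINT \<zeta>|lborel. propagate \<alpha> \<tau> \<theta> \<zeta> * g \<tau> \<zeta>) has_vector_derivative
      (LINT \<zeta>|lborel. propagate \<alpha> t \<theta> \<zeta> * G \<zeta>)) (at t within S)"
proof -
  obtain B where B: "0 \<le> B" "\<And>\<zeta>. \<theta> \<zeta> \<noteq> 0 \<Longrightarrow> \<bar>dispersion \<alpha> \<zeta>\<bar> \<le> B"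
    using dispersion_bounded_on_test[OF \<theta>] by blast
  have \<theta>s: "sqint \<theta>" using \<theta> by (rule frequency_test_sqint)
  note [measurable] = sqint_measurable[OF \<theta>s] sqint_measurable[OF g]
  define p where "p \<tau> = propagate \<alpha> \<tau> \<theta>" for \<tau>
  have ps: "sqint (p \<tau>)" for \<tau> unfolding p_def by (rule sqint_propagate[OF \<theta>s])
  have pm [measurable]: "p \<tau> \<in> borel_measurable borel" for \<tau> by (rule sqint_measurable[OF ps])
  define p' where "p' \<zeta> = \<i> * complex_of_real (dispersion \<alpha> \<zeta>) * p t \<zeta>" for \<zeta>
  have p'm [measurable]: "p' \<in> borel_measurable borel" unfolding p'_def by measurable
  have B\<theta>: "sqint (\<lambda>\<zeta>. complex_of_real c * \<theta> \<zeta>)" for c by (rule sqint_scale[OF \<theta>s])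
  have p'le: "cmod (p' \<zeta>) \<le> cmod (complex_of_real B * \<theta> \<zeta>)" for \<zeta>
    using B(1) B(2)[of \<zeta>] by (cases "\<theta> \<zeta> = 0") (auto simp: p'_def p_def propagate_def norm_mult mult_right_mono)
  have p's: "sqint p'" by (rule l2norm_mono_norm(1)[OF B\<theta> p'm p'le])
  define d where "d \<tau> \<zeta> = p \<tau> \<zeta> - p t \<zeta>" for \<tau> \<zeta>
  have dm [measurable]: "d \<tau> \<in> borel_measurable borel" for \<tau> unfolding d_def by measurable
  have d_le: "cmod (d \<tau> \<zeta>) \<le> cmod (complex_of_real (B * \<bar>\<tau> - t\<bar>) * \<theta> \<zeta>)" for \<tau> \<zeta>
  proof (cases "\<theta> \<zeta> = 0")
    case False
    have "d \<tau> \<zeta> = (cis (\<tau> * dispersion \<alpha> \<zeta>) - cis (t * dispersion \<alpha> \<zeta>)) * \<theta> \<zeta>"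
      by (simp add: d_def p_def propagate_def algebra_simps)
    moreover have "cmod (cis (\<tau> * dispersion \<alpha> \<zeta>) - cis (t * dispersion \<alpha> \<zeta>)) \<le> B * \<bar>\<tau> - t\<bar>"
    proof -
      have "cmod (cis (\<tau> * dispersion \<alpha> \<zeta>) - cis (t * dispersion \<alpha> \<zeta>)) \<le> \<bar>dispersion \<alpha> \<zeta>\<bar> * \<bar>\<tau> - t\<bar>"
        using cis_bounds(1)[of "\<tau> * dispersion \<alpha> \<zeta>" "t * dispersion \<alpha> \<zeta>"]
        by (simp add: abs_mult mult.commute flip: left_diff_distrib)
      also have "\<dots> \<le> B * \<bar>\<tau> - t\<bar>" using B(2)[OF False] by (rule mult_right_mono) simp
      finally show ?thesis .
    qed
    ultimately show ?thesis using B(1) by (simp add: norm_mult mult_right_mono)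
  qed (simp add: d_def p_def propagate_def)
  \<comment> \<open>The Taylor remainder of the moving test function, of size
    \<open>(\<tau> - t)^2\<close>.\<close>
  define r where "r \<tau> \<zeta> = d \<tau> \<zeta> - complex_of_real (\<tau> - t) * p' \<zeta>" for \<tau> \<zeta>
  have rm [measurable]: "r \<tau> \<in> borel_measurable borel" for \<tau> unfolding r_def by measurable
  have r_le: "cmod (r \<tau> \<zeta>) \<le> cmod (complex_of_real (B\<^sup>2 * (\<tau> - t)\<^sup>2) * \<theta> \<zeta>)" for \<tau> \<zeta>
  proof (cases "\<theta> \<zeta> = 0")
    case False
    define a b where "a = \<tau> * dispersion \<alpha> \<zeta>" and "b = t * dispersion \<alpha> \<zeta>"
    have "r \<tau> \<zeta> = (cis a - cis b - \<i> * complex_of_real (a - b) * cis b) * \<theta> \<zeta>"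
      by (simp add: r_def d_def p'_def p_def propagate_def a_def b_def algebra_simps)
    moreover have le: "cmod (cis a - cis b - \<i> * complex_of_real (a - b) * cis b) \<le> B\<^sup>2 * (\<tau> - t)\<^sup>2"
    proof -
      have "(a - b)\<^sup>2 = \<bar>dispersion \<alpha> \<zeta>\<bar>\<^sup>2 * (\<tau> - t)\<^sup>2"
        by (simp add: a_def b_def power_mult_distrib[symmetric] algebra_simps)
      also have "\<dots> \<le> B\<^sup>2 * (\<tau> - t)\<^sup>2" using B(2)[OF False] by (intro mult_right_mono power_mono) auto
      finally show ?thesis using cis_bounds(2)[of a b] by linarith
    qed
    moreover have "\<bar>B\<^sup>2 * (\<tau> - t)\<^sup>2\<bar> = B\<^sup>2 * (\<tau> - t)\<^sup>2" by simp
    ultimately show ?thesis using mult_right_mono[OF le, of "cmod (\<theta> \<zeta>)"]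
      by (simp only: norm_mult[of _ "\<theta> \<zeta>"] norm_of_real norm_ge_zero)
  qed (simp add: r_def d_def p'_def p_def propagate_def)
  have ds: "sqint (d \<tau>)" and rs: "sqint (r \<tau>)" for \<tau>
    by (rule l2norm_mono_norm(1)[OF B\<theta> dm d_le], rule l2norm_mono_norm(1)[OF B\<theta> rm r_le])
  have dn: "l2norm (d \<tau>) \<le> B * \<bar>\<tau> - t\<bar> * l2norm \<theta>" for \<tau>
    using l2norm_mono_norm(2)[OF B\<theta> dm d_le, of \<tau>] B(1) by (simp add: l2norm_scale norm_mult)
  have rn: "l2norm (r \<tau>) \<le> B\<^sup>2 * (\<tau> - t)\<^sup>2 * l2norm \<theta>" for \<tau>
    using l2norm_mono_norm(2)[OF B\<theta> rm r_le, of \<tau>] unfolding l2norm_scale norm_of_real by simp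
  \<comment> \<open>The contribution of the motion of the test function. As \<open>d \<tau>\<close>
    is of size \<open>\<bar>\<tau> - t\<bar>\<close>, mere L2 continuity of g makes its pairing with
    \<open>g \<tau> - g t\<close> of smaller order.\<close>
  define F where "F \<tau> = (LINT \<zeta>|lborel. d \<tau> \<zeta> * g \<tau> \<zeta>)" for \<tau>
  define F' where "F' = (LINT \<zeta>|lborel. p' \<zeta> * g t \<zeta>)"
  have "(F has_derivative (\<lambda>x. x *\<^sub>R F')) (at t within S)"
  proof (rule has_derivativeI_sandwich[where e = 1 and H = "\<lambda>\<tau>. B * l2norm \<theta> * l2norm (\<lambda>\<zeta>. g \<tau> \<zeta> - g t \<zeta>) + B\<^sup>2 * \<bar>\<tau> - t\<bar> * l2norm \<theta> * l2norm (g t)"])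
    show "bounded_linear (\<lambda>x. x *\<^sub>R F')" by (rule bounded_linear_scaleR_left)
    have "((\<lambda>\<tau>. B * l2norm \<theta> * l2norm (\<lambda>\<zeta>. g \<tau> \<zeta> - g t \<zeta>) + B\<^sup>2 * \<bar>\<tau> - t\<bar> * l2norm \<theta> * l2norm (g t))
        \<longlongrightarrow> B * l2norm \<theta> * 0 + B\<^sup>2 * \<bar>t - t\<bar> * l2norm \<theta> * l2norm (g t)) (at t within S)"
      by (intro tendsto_intros cont)
    then show "((\<lambda>\<tau>. B * l2norm \<theta> * l2norm (\<lambda>\<zeta>. g \<tau> \<zeta> - g t \<zeta>) + B\<^sup>2 * \<bar>\<tau> - t\<bar> * l2norm \<theta> * l2norm (g t)) \<longlongrightarrow> 0) (at t within S)"
      by simp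
    fix \<tau> assume "\<tau> \<noteq> t"
    have "d t = (\<lambda>\<zeta>. 0)" by (simp add: d_def fun_eq_iff)
    then have "F t = 0" by (simp add: F_def)
    then have "F \<tau> - F t - (\<tau> - t) *\<^sub>R F' = F \<tau> - complex_of_real (\<tau> - t) * F'" by (simp add: scaleR_conv_of_real)
    also have "\<dots> = (LINT \<zeta>|lborel. d \<tau> \<zeta> * g \<tau> \<zeta>) - (LINT \<zeta>|lborel. complex_of_real (\<tau> - t) * p' \<zeta> * g t \<zeta>)"
      unfolding F_def F'_def integral_mult_right_zero[symmetric] by (simp only: mult.assoc)
    also have "\<dots> = (LINT \<zeta>|lborel. d \<tau> \<zeta> * g \<tau> \<zeta> - complex_of_real (\<tau> - t) * p' \<zeta> * g t \<zeta>)"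
      by (intro Bochner_Integration.integral_diff[symmetric] sqint_mult_integrable sqint_scale ds g p's)
    also have "\<dots> = (LINT \<zeta>|lborel. d \<tau> \<zeta> * (g \<tau> \<zeta> - g t \<zeta>) + r \<tau> \<zeta> * g t \<zeta>)"
      by (simp add: r_def algebra_simps)
    also have "\<dots> = (LINT \<zeta>|lborel. d \<tau> \<zeta> * (g \<tau> \<zeta> - g t \<zeta>)) + (LINT \<zeta>|lborel. r \<tau> \<zeta> * g t \<zeta>)"
      by (intro Bochner_Integration.integral_add sqint_mult_integrable sqint_diff ds rs g)
    also have "norm \<dots> \<le> l2norm (d \<tau>) * l2norm (\<lambda>\<zeta>. g \<tau> \<zeta> - g t \<zeta>) + l2norm (r \<tau>) * l2norm (g t)"
      by (intro norm_triangle_mono l2_Cauchy_Schwarz sqint_diff ds rs g)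
    also have "\<dots> \<le> (B * \<bar>\<tau> - t\<bar> * l2norm \<theta>) * l2norm (\<lambda>\<zeta>. g \<tau> \<zeta> - g t \<zeta>) + (B\<^sup>2 * (\<tau> - t)\<^sup>2 * l2norm \<theta>) * l2norm (g t)"
      by (intro add_mono mult_right_mono dn rn) auto
    also have "\<dots> = (B * l2norm \<theta> * l2norm (\<lambda>\<zeta>. g \<tau> \<zeta> - g t \<zeta>) + B\<^sup>2 * \<bar>\<tau> - t\<bar> * l2norm \<theta> * l2norm (g t)) * \<bar>\<tau> - t\<bar>"
      by (simp add: algebra_simps power2_eq_square abs_mult_self_eq flip: abs_mult)
    finally show "norm (F \<tau> - F t - (\<tau> - t) *\<^sub>R F') / norm (\<tau> - t)
        \<le> B * l2norm \<theta> * l2norm (\<lambda>\<zeta>. g \<tau> \<zeta> - g t \<zeta>) + B\<^sup>2 * \<bar>\<tau> - t\<bar> * l2norm \<theta> * l2norm (g t)"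
      using \<open>\<tau> \<noteq> t\<close> by (simp add: divide_le_eq)
  qed simp
  then have "(F has_vector_derivative F') (at t within S)" by (simp add: has_vector_derivative_def)
  from has_vector_derivative_add[OF eq this]
  have "((\<lambda>\<tau>. (LINT \<zeta>|lborel. p t \<zeta> * g \<tau> \<zeta>) + F \<tau>) has_vector_derivative
      ((LINT \<zeta>|lborel. p t \<zeta> * (linear_symbol \<alpha> \<zeta> * g t \<zeta> + G \<zeta>)) + F')) (at t within S)"
    by (simp only: p_def)
  moreover have "(LINT \<zeta>|lborel. p t \<zeta> * g \<tau> \<zeta>) + F \<tau> = (LINT \<zeta>|lborel. p \<tau> \<zeta> * g \<tau> \<zeta>)" for \<tau>
    unfolding F_def Bochner_Integration.integral_add[OF sqint_mult_integrable[OF ps g] sqint_mult_integrable[OF ds g], symmetric]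
    by (simp add: d_def algebra_simps)
  moreover have "(LINT \<zeta>|lborel. p t \<zeta> * (linear_symbol \<alpha> \<zeta> * g t \<zeta> + G \<zeta>)) + F' = (LINT \<zeta>|lborel. p t \<zeta> * G \<zeta>)"
  proof -
    have "(LINT \<zeta>|lborel. p t \<zeta> * (linear_symbol \<alpha> \<zeta> * g t \<zeta> + G \<zeta>)) = (LINT \<zeta>|lborel. p t \<zeta> * G \<zeta> - p' \<zeta> * g t \<zeta>)"
      by (simp add: p'_def linear_symbol_dispersion algebra_simps)
    also have "\<dots> = (LINT \<zeta>|lborel. p t \<zeta> * G \<zeta>) - F'"
      unfolding F'_def by (rule Bochner_Integration.integral_diff[OF G[folded p_def] sqint_mult_integrable[OF p's g]])
    finally show ?thesis by simp
  qed
  ultimately show ?thesis by (simp only: p_def)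
qed

section \<open>Conservation of the \<open>L\<^sup>2\<close> norm\<close>

text \<open>The transform of \<open>u u_x\<close> when g is that of u: in \<open>4 * pi\<close>, a
  factor 2 comes from \<open>u u_x = (u^2)_x / 2\<close> and 2 pi from the normalisation of
  \<open>fourier\<close>.\<close>

definition nonlinear_part :: "(plane \<Rightarrow> complex) \<Rightarrow> plane \<Rightarrow> complex" where
  "nonlinear_part g \<zeta> = \<i> * complex_of_real (fst \<zeta>) * conv g g \<zeta> / (4 * pi)"

lemma l2norm_fourier_L2_diff:
  "l2norm (\<lambda>\<zeta>. fourier_L2 f \<zeta> - fourier_L2 g \<zeta>) = l2norm (fourier_L2 (f - g))"
  by (rule l2norm_cong_AE[symmetric])
    (auto intro: sqint_measurable sqint_diff sqint_fourier_L2 fourier_L2_diff)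

lemma solution_continuous:
  assumes s1: "1 \<le> s1" and sol: "cauchy_solution \<alpha> s1 s2 T \<psi> u" and t: "t \<in> {0..T}"
  shows "((\<lambda>\<tau>. l2norm (\<lambda>\<zeta>. fourier_L2 (u \<tau>) \<zeta> - fourier_L2 (u t) \<zeta>)) \<longlongrightarrow> 0) (at t within {0..T})"
proof (rule Lim_null_comparison)
  have us: "u \<tau> \<in> sobolev s1 s2" if "\<tau> \<in> {0..T}" for \<tau> using sol that by (simp add: cauchy_solution_def)
  show "\<forall>\<^sub>F \<tau> in at t within {0..T}. norm (l2norm (\<lambda>\<zeta>. fourier_L2 (u \<tau>) \<zeta> - fourier_L2 (u t) \<zeta>)) \<le> sobolev_norm s1 s2 (u \<tau> - u t)"
    unfolding eventually_at
    by (intro exI[of _ 1]) (auto simp: l2norm_fourier_L2_diff intro!: sobolev_bounds(1)[OF s1 sobolev_diff(1)] us t)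
  show "((\<lambda>\<tau>. sobolev_norm s1 s2 (u \<tau> - u t)) \<longlongrightarrow> 0) (at t within {0..T})"
    using sol t by (simp add: cauchy_solution_def)
qed

lemma solution_bounded:
  assumes sol: "cauchy_solution \<alpha> s1 s2 T \<psi> u"
  shows "\<exists>B. \<forall>t\<in>{0..T}. sobolev_norm s1 s2 (u t) \<le> B"
proof -
  have us: "u \<tau> \<in> sobolev s1 s2" if "\<tau> \<in> {0..T}" for \<tau> using sol that by (simp add: cauchy_solution_def)
  have "continuous_on {0..T} (\<lambda>\<tau>. sobolev_norm s1 s2 (u \<tau>))"
    unfolding continuous_on_def
  proof
    fix t assume t: "t \<in> {0..T}"
    show "((\<lambda>\<tau>. sobolev_norm s1 s2 (u \<tau>)) \<longlongrightarrow> sobolev_norm s1 s2 (u t)) (at t within {0..T})"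
    proof (rule LIM_zero_cancel, rule Lim_null_comparison)
      have "norm (sobolev_norm s1 s2 (u \<tau>) - sobolev_norm s1 s2 (u t)) \<le> sobolev_norm s1 s2 (u \<tau> - u t)"
        if "\<tau> \<in> {0..T}" for \<tau>
        using l2norm_reverse_triangle us[OF t] us[OF that] unfolding sobolev_diff(2)[OF us[OF that] us[OF t]]
        by (auto simp: sobolev_norm_eq sobolev_iff)
      then show "\<forall>\<^sub>F \<tau> in at t within {0..T}. norm (sobolev_norm s1 s2 (u \<tau>) - sobolev_norm s1 s2 (u t)) \<le> sobolev_norm s1 s2 (u \<tau> - u t)"
        unfolding eventually_at by (intro exI[of _ 1]) auto
      show "((\<lambda>\<tau>. sobolev_norm s1 s2 (u \<tau> - u t)) \<longlongrightarrow> 0) (at t within {0..T})"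
        using sol t by (simp add: cauchy_solution_def)
    qed
  qed
  then have "compact ((\<lambda>\<tau>. sobolev_norm s1 s2 (u \<tau>)) ` {0..T})" by (rule compact_continuous_image) simp
  then obtain B where "\<forall>x\<in>(\<lambda>\<tau>. sobolev_norm s1 s2 (u \<tau>)) ` {0..T}. norm x \<le> B" using compact_imp_bounded bounded_iff by blast
  then have "sobolev_norm s1 s2 (u t) \<le> B" if "t \<in> {0..T}" for t
    using imageI[OF that, of "\<lambda>\<tau>. sobolev_norm s1 s2 (u \<tau>)"] by (auto dest!: bspec simp: abs_le_iff)
  then show ?thesis by blast
qed

text \<open>What the definition of a solution says about the transform g alone: the weak derivative
  is identified with \<open>\<i> \<xi> g\<close> and disappears. The last three claims need a sup
  bound at the given time, which will be available at almost every time.\<close>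

lemma solution_interaction:
  assumes s1: "1 \<le> s1" and sol: "cauchy_solution \<alpha> s1 s2 T \<psi> u" and t: "t \<in> {0..T}"
  defines "g \<equiv> \<lambda>\<tau>. fourier_L2 (u \<tau>)"
  shows "frequency_test \<theta> \<Longrightarrow> ((\<lambda>\<tau>. LINT \<zeta>|lborel. propagate \<alpha> \<tau> \<theta> \<zeta> * g \<tau> \<zeta>) has_vector_derivative
      (LINT \<zeta>|lborel. propagate \<alpha> t \<theta> \<zeta> * nonlinear_part (g t) \<zeta>)) (at t within {0..T})"
    and "frequency_test \<theta> \<Longrightarrow> integrable lborel (\<lambda>\<zeta>. \<theta> \<zeta> * nonlinear_part (g t) \<zeta>)"
    and "AE z in lborel. \<bar>rep_L2 (u t) z\<bar> \<le> m \<Longrightarrow> sqint (nonlinear_part (g t))"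
    and "AE z in lborel. \<bar>rep_L2 (u t) z\<bar> \<le> m \<Longrightarrow> l2norm (nonlinear_part (g t)) \<le> m * sobolev_norm s1 s2 (u t)"
    and "AE z in lborel. \<bar>rep_L2 (u t) z\<bar> \<le> m \<Longrightarrow> (LINT \<zeta>|lborel. cnj (g t \<zeta>) * nonlinear_part (g t) \<zeta>) = 0"
proof -
  have us: "u t \<in> sobolev s1 s2" using sol t by (simp add: cauchy_solution_def)
  obtain ux where w: "weak_derivative (1, 0) (rep_L2 (u t)) (ux t)"
    and eq: "\<And>\<theta>. frequency_test \<theta> \<Longrightarrow>
       ((\<lambda>\<tau>. LINT \<zeta>|lborel. \<theta> \<zeta> * fourier_L2 (u \<tau>) \<zeta>) has_vector_derivative
         (LINT \<zeta>|lborel. \<theta> \<zeta> * (linear_symbol \<alpha> \<zeta> * fourier_L2 (u t) \<zeta> + fourier (\<lambda>z. rep_L2 (u t) z * ux t z) \<zeta>)))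
       (at t within {0..T})"
    using sol t unfolding cauchy_solution_def by blast
  have uf: "ft (\<lambda>z. complex_of_real (rep_L2 (u t) z)) (g t)" unfolding g_def by (rule fourier_L2_ft)
  have xg: "sqint (\<lambda>\<zeta>. \<i> * complex_of_real (fst \<zeta>) * g t \<zeta>)"
    "l2norm (\<lambda>\<zeta>. \<i> * complex_of_real (fst \<zeta>) * g t \<zeta>) \<le> sobolev_norm s1 s2 (u t)"
    unfolding g_def using sobolev_bounds[OF s1 us] by auto
  have uxf: "ft (\<lambda>z. complex_of_real (ux t z)) (\<lambda>\<zeta>. \<i> * complex_of_real (fst \<zeta>) * g t \<zeta>)"
    by (rule weak_derivative_ft[OF uf xg(1) w])
  have N: "fourier (\<lambda>z. rep_L2 (u t) z * ux t z) = nonlinear_part (g t)"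
    using fourier_mult_derivative[OF uf uxf] by (simp add: fun_eq_iff nonlinear_part_def)
  have prod: "integrable lborel (\<lambda>z. complex_of_real (rep_L2 (u t) z * ux t z))"
    using sqint_mult_integrable[OF ft_sqint(1)[OF uf] ft_sqint(1)[OF uxf]] by simp
  show int: "integrable lborel (\<lambda>\<zeta>. \<theta> \<zeta> * nonlinear_part (g t) \<zeta>)" if \<theta>: "frequency_test \<theta>" for \<theta>
  proof -
    define C where "C = (LINT z|lborel. cmod (complex_of_real (rep_L2 (u t) z * ux t z))) / (2 * pi)"
    have C: "cmod (nonlinear_part (g t) \<zeta>) \<le> C" for \<zeta>
      unfolding N[symmetric] fourier_eq_fourierc C_def by (rule fourierc_bound)
    show ?thesis
    proof (rule Bochner_Integration.integrable_bound)
      show "integrable lborel (\<lambda>\<zeta>. C * cmod (\<theta> \<zeta>))" using frequency_test_integrable[OF \<theta>] by simp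
      show "AE \<zeta> in lborel. norm (\<theta> \<zeta> * nonlinear_part (g t) \<zeta>) \<le> norm (C * cmod (\<theta> \<zeta>))"
        using order_trans[OF C abs_ge_self] by (intro AE_I2) (simp add: norm_mult abs_mult mult.commute[of "cmod (\<theta> _)"] mult_right_mono)
      have "fourierc (\<lambda>z. complex_of_real (rep_L2 (u t) z * ux t z)) \<in> borel_measurable borel"
        using borel_measurable_integrable[OF prod] by (intro fourierc_measurable) simp
      then have "nonlinear_part (g t) \<in> borel_measurable borel" unfolding N[symmetric] fourier_eq_fourierc .
      then show "(\<lambda>\<zeta>. \<theta> \<zeta> * nonlinear_part (g t) \<zeta>) \<in> borel_measurable lborel"
        using frequency_test_measurable[OF \<theta>] by simp
    qed
  qed
  show "((\<lambda>\<tau>. LINT \<zeta>|lborel. propagate \<alpha> \<tau> \<theta> \<zeta> * g \<tau> \<zeta>) has_vector_derivative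
      (LINT \<zeta>|lborel. propagate \<alpha> t \<theta> \<zeta> * nonlinear_part (g t) \<zeta>)) (at t within {0..T})" if \<theta>: "frequency_test \<theta>"
    using solution_continuous[OF s1 sol t] eq[OF frequency_test_propagate[OF \<theta>]] int[OF frequency_test_propagate[OF \<theta>]]
    unfolding N g_def by (intro interaction_derivative \<theta> t sqint_fourier_L2) auto
  assume m: "AE z in lborel. \<bar>rep_L2 (u t) z\<bar> \<le> m"
  note be = bounded_energy[OF uf uxf m, unfolded N]
  show "sqint (nonlinear_part (g t))" "(LINT \<zeta>|lborel. cnj (g t \<zeta>) * nonlinear_part (g t) \<zeta>) = 0"
    using be by auto
  have m0: "0 \<le> m"
  proof (rule ccontr)
    assume "\<not> 0 \<le> m"
    with m have "AE z in (lborel :: plane measure). False" by (auto elim!: eventually_mono)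
    then show False by (simp add: eventually_False ae_filter_eq_bot_iff)
  qed
  show "l2norm (nonlinear_part (g t)) \<le> m * sobolev_norm s1 s2 (u t)"
    using be(2) mult_left_mono[OF xg(2) m0] by linarith
qed

text \<open>\<open>L1_Linf\<close> bounds an integral without saying that the integrand is
  measurable. Its sublevel sets are closed in time: L2 continuity gives almost everywhere
  convergence along a subsequence, and pointwise bounds survive it.\<close>

lemma esssup_lower_semicontinuous:
  assumes s1: "1 \<le> s1" and sol: "cauchy_solution \<alpha> s1 s2 T \<psi> u"
  shows "(\<lambda>t. esssup lborel (\<lambda>z. ennreal \<bar>rep_L2 (u t) z\<bar>) * indicator {0..T} t) \<in> borel_measurable borel"
proof -
  have [measurable]: "rep_L2 f \<in> borel_measurable borel" for f
    using rep_L2_square_integrable[of f] by (simp add: square_integrable_def)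
  define M where "M t = esssup lborel (\<lambda>z. ennreal \<bar>rep_L2 (u t) z\<bar>)" for t
  have "closed {t \<in> {0..T}. M t \<le> y}" for y
    unfolding closed_sequential_limits
  proof (intro allI impI, elim conjE)
    fix x l assume x: "\<forall>n. x n \<in> {t \<in> {0..T}. M t \<le> y}" and lim: "x \<longlonglongrightarrow> l"
    have l: "l \<in> {0..T}" using closed_sequentially[OF closed_atLeastAtMost _ lim, of 0 T] x by auto
    define D where "D \<tau> = l2norm (\<lambda>z. complex_of_real (rep_L2 (u \<tau>) z) - complex_of_real (rep_L2 (u l) z))" for \<tau>
    have D: "D \<tau> = l2norm (\<lambda>\<zeta>. fourier_L2 (u \<tau>) \<zeta> - fourier_L2 (u l) \<zeta>)" for \<tau>
      unfolding D_def by (rule ft_isometry_diff[OF fourier_L2_ft fourier_L2_ft, symmetric])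
    have "D l = 0" by (simp add: D_def l2norm_def)
    then have "continuous (at l within {0..T}) D"
      using solution_continuous[OF s1 sol l] unfolding continuous_within D by simp
    then have "(\<lambda>n. D (x n)) \<longlonglongrightarrow> D l"
      using x lim unfolding continuous_within_sequentially by (auto simp: o_def)
    then have "(\<lambda>n. D (x n)) \<longlonglongrightarrow> 0" using \<open>D l = 0\<close> by simp
    then obtain r where r: "strict_mono r"
      "AE z in lborel. (\<lambda>n. complex_of_real (rep_L2 (u (x (r n))) z)) \<longlonglongrightarrow> complex_of_real (rep_L2 (u l) z)"
      using l2norm_AE_subseq[of "\<lambda>n z. complex_of_real (rep_L2 (u (x n)) z)" "\<lambda>z. complex_of_real (rep_L2 (u l) z)"]
        sqint_rep_L2 unfolding D_def by blast
    have "AE z in lborel. ennreal \<bar>rep_L2 (u (x n)) z\<bar> \<le> y" for n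
      using esssup_AE[of "\<lambda>z. ennreal \<bar>rep_L2 (u (x n)) z\<bar>" lborel] x[rule_format, of n]
      by (auto simp: M_def elim!: eventually_mono intro: order_trans)
    then have "AE z in lborel. \<forall>n. ennreal \<bar>rep_L2 (u (x n)) z\<bar> \<le> y" unfolding AE_all_countable by blast
    with r(2) have "AE z in lborel. ennreal \<bar>rep_L2 (u l) z\<bar> \<le> y"
    proof eventually_elim
      case (elim z)
      have "(\<lambda>n. rep_L2 (u (x (r n))) z) \<longlonglongrightarrow> rep_L2 (u l) z" using elim(1) by (simp only: tendsto_of_real_iff)
      then have "(\<lambda>n. ennreal \<bar>rep_L2 (u (x (r n))) z\<bar>) \<longlonglongrightarrow> ennreal \<bar>rep_L2 (u l) z\<bar>"
        by (intro tendsto_intros)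
      then show ?case by (rule LIMSEQ_le_const2) (use elim(2) in auto)
    qed
    then have "M l \<le> y" unfolding M_def by (intro esssup_I) auto
    then show "l \<in> {t \<in> {0..T}. M t \<le> y}" using l by simp
  qed
  then have "{t \<in> {0..T}. M t \<le> y} \<in> sets borel" for y by (rule borel_closed)
  then have "{t \<in> {0..T}. M t \<le> y} \<union> - {0..T} \<in> sets borel" for y by auto
  moreover have "{t \<in> space borel. M t * indicator {0..T} t \<le> y} = {t \<in> {0..T}. M t \<le> y} \<union> - {0..T}" for y
    by (auto simp: indicator_def)
  ultimately show ?thesis unfolding M_def by (intro borel_measurableI_le) simp
qed

text \<open>The pointwise bound is integrable in time, which is all that \<open>L\<^sup>1\<^sub>t L\<^sup>\<infinity>\<^sub>x\<^sub>y\<close> gives.\<close>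

lemma solution_sup_bound:
  assumes s1: "1 \<le> s1" and sol: "cauchy_solution \<alpha> s1 s2 T \<psi> u"
  obtains m :: "real \<Rightarrow> real" where "m integrable_on {0..T}" "\<And>t. 0 \<le> m t"
    "negligible {t \<in> {0..T}. \<not> (AE z in lborel. \<bar>rep_L2 (u t) z\<bar> \<le> m t)}"
proof -
  define M where "M t = esssup lborel (\<lambda>z. ennreal \<bar>rep_L2 (u t) z\<bar>) * indicator {0..T} t" for t
  have Mm [measurable]: "M \<in> borel_measurable borel"
    unfolding M_def by (rule esssup_lower_semicontinuous[OF s1 sol])
  have fin: "(\<integral>\<^sup>+t. M t \<partial>lborel) < \<infinity>"
    using sol unfolding M_def cauchy_solution_def L1_Linf_def by simp
  have ae: "AE t in lborel. M t \<noteq> \<infinity>" using fin by (intro nn_integral_PInf_AE) auto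
  define m where "m t = enn2real (M t)" for t
  have mm: "m \<in> borel_measurable borel" unfolding m_def by measurable
  have "(\<integral>\<^sup>+t. ennreal (m t) \<partial>lborel) = (\<integral>\<^sup>+t. M t \<partial>lborel)"
    by (rule nn_integral_cong_AE) (use ae in eventually_elim, simp add: m_def less_top)
  then have "integrable lborel m" using fin mm by (intro integrableI_nonneg) (auto simp: m_def)
  \<comment> \<open>From here on the gauge integral is used, because the fundamental theorem of
    calculus below integrates derivatives in that sense.\<close>
  then have "m integrable_on UNIV" by (rule integrable_on_lborel)
  then have 1: "m integrable_on {0..T}" using integrable_on_subinterval by blast
  obtain N where N: "N \<in> null_sets lborel" "\<And>t. t \<notin> N \<Longrightarrow> M t \<noteq> \<infinity>"
    using ae by (auto simp: eventually_ae_filter)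
  have "{t \<in> {0..T}. \<not> (AE z in lborel. \<bar>rep_L2 (u t) z\<bar> \<le> m t)} \<subseteq> N"
  proof (rule ccontr)
    assume "\<not> ?thesis"
    then obtain t where t: "t \<in> {0..T}" "\<not> (AE z in lborel. \<bar>rep_L2 (u t) z\<bar> \<le> m t)" "t \<notin> N" by blast
    have "esssup lborel (\<lambda>z. ennreal \<bar>rep_L2 (u t) z\<bar>) = ennreal (m t)"
      using N(2)[OF t(3)] t(1) by (simp add: m_def M_def less_top)
    then have "AE z in lborel. ennreal \<bar>rep_L2 (u t) z\<bar> \<le> ennreal (m t)"
      using esssup_AE[of "\<lambda>z. ennreal \<bar>rep_L2 (u t) z\<bar>" lborel] by simp
    then have "AE z in lborel. \<bar>rep_L2 (u t) z\<bar> \<le> m t"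
      by eventually_elim (simp add: m_def)
    then show False using t(2) by blast
  qed
  moreover have "negligible N" using N(1) by (simp add: negligible_iff_null_sets null_sets_completionI)
  ultimately have 2: "negligible {t \<in> {0..T}. \<not> (AE z in lborel. \<bar>rep_L2 (u t) z\<bar> \<le> m t)}"
    using negligible_subset by blast
  show thesis using that[OF 1 _ 2] by (simp add: m_def)
qed

lemma le_if_le_add_small:
  fixes x y c :: real
  assumes "\<And>e. 0 < e \<Longrightarrow> x \<le> y + e * c" shows "x \<le> y"
proof (rule field_le_epsilon)
  fix e :: real assume e: "0 < e"
  have "x \<le> y + e / (\<bar>c\<bar> + 1) * c" using e by (intro assms) simp
  also have "e / (\<bar>c\<bar> + 1) * c \<le> e / (\<bar>c\<bar> + 1) * (\<bar>c\<bar> + 1)" using e by (intro mult_left_mono) auto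
  also have "\<dots> = e" by (simp add: add_nonneg_eq_0_iff)
  finally show "x \<le> y + e" by simp
qed

text \<open>The equation cannot be tested with the solution itself, whose profile is differentiable
  in time only weakly. But the increment of the squared norm is the real part of the pairing of
  \<open>cnj (w a + w b)\<close> with \<open>w b - w a\<close>, so one fixed test function near that
  sum suffices. On a short interval it is close to \<open>2 * cnj (w t)\<close>, whose pairing with
  the nonlinearity vanishes; hence the small factor k.\<close>

lemma energy_increment:
  fixes g :: "real \<Rightarrow> plane \<Rightarrow> complex" and m :: "real \<Rightarrow> real" and \<alpha> :: real
  defines "w \<equiv> \<lambda>\<tau>. propagate \<alpha> \<tau> (g \<tau>)"
  assumes ab: "a \<le> b" and g: "\<And>\<tau>. sqint (g \<tau>)"
    and der: "\<And>\<theta> t. frequency_test \<theta> \<Longrightarrow> t \<in> {a..b} \<Longrightarrow>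
      ((\<lambda>\<tau>. LINT \<zeta>|lborel. propagate \<alpha> \<tau> \<theta> \<zeta> * g \<tau> \<zeta>) has_vector_derivative
        (LINT \<zeta>|lborel. propagate \<alpha> t \<theta> \<zeta> * N t \<zeta>)) (at t within {a..b})"
    and neg: "negligible Z" and m: "m integrable_on {a..b}" "\<And>t. 0 \<le> m t"
    and N: "\<And>t. t \<in> {a..b} - Z \<Longrightarrow> sqint (N t) \<and> l2norm (N t) \<le> m t \<and> (LINT \<zeta>|lborel. cnj (g t \<zeta>) * N t \<zeta>) = 0"
    and close: "\<And>t. t \<in> {a..b} \<Longrightarrow> l2norm (\<lambda>\<zeta>. w t \<zeta> - w a \<zeta>) \<le> k \<and> l2norm (\<lambda>\<zeta>. w t \<zeta> - w b \<zeta>) \<le> k"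
  shows "\<bar>(l2norm (g b))\<^sup>2 - (l2norm (g a))\<^sup>2\<bar> \<le> 2 * k * integral {a..b} m"
proof (rule le_if_le_add_small)
  fix e :: real assume e: "0 < e"
  have ws: "sqint (w \<tau>)" for \<tau> unfolding w_def by (rule sqint_propagate[OF g])
  define v where "v \<zeta> = cnj (w a \<zeta> + w b \<zeta>)" for \<zeta>
  have vs: "sqint v" unfolding v_def by (intro sqint_cnj sqint_add ws)
  obtain \<theta> where \<theta>: "frequency_test \<theta>" "l2norm (\<lambda>\<zeta>. v \<zeta> - \<theta> \<zeta>) < e" using frequency_test_dense[OF vs e] by blast
  have \<theta>s: "sqint \<theta>" by (rule frequency_test_sqint[OF \<theta>(1)])
  define h where "h \<tau> = (LINT \<zeta>|lborel. propagate \<alpha> \<tau> \<theta> \<zeta> * g \<tau> \<zeta>)" for \<tau>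
  define h' where "h' \<tau> = (LINT \<zeta>|lborel. propagate \<alpha> \<tau> \<theta> \<zeta> * N \<tau> \<zeta>)" for \<tau>
  have hw: "h \<tau> = (LINT \<zeta>|lborel. \<theta> \<zeta> * w \<tau> \<zeta>)" for \<tau>
    by (simp add: h_def w_def propagate_def mult_ac)
  \<comment> \<open>The derivative exists at every time, so the gauge integral of \<open>h'\<close>
    exists too; its values on Z, where no bound is available, are then replaced by 0.\<close>
  have "(h' has_integral h b - h a) {a..b}"
    using der[OF \<theta>(1)] unfolding h_def h'_def by (intro fundamental_theorem_of_calculus ab) auto
  then have HI: "((\<lambda>t. if t \<in> Z then 0 else h' t) has_integral h b - h a) {a..b}"
    by (rule has_integral_spike[OF neg, rotated]) simp
  have h'_le: "cmod (h' t) \<le> (e + 2 * k) * m t" if t: "t \<in> {a..b} - Z" for t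
  proof -
    note Nt = N[OF t, THEN conjunct1] N[OF t, THEN conjunct2, THEN conjunct1] N[OF t, THEN conjunct2, THEN conjunct2]
    have k: "l2norm (\<lambda>\<zeta>. w t \<zeta> - w a \<zeta>) \<le> k" "l2norm (\<lambda>\<zeta>. w t \<zeta> - w b \<zeta>) \<le> k" using close t by auto
    have ps: "sqint (propagate \<alpha> t \<theta>)" by (rule sqint_propagate[OF \<theta>s])
    have cs: "sqint (\<lambda>\<zeta>. 2 * cnj (g t \<zeta>))" by (intro sqint_scale sqint_cnj g)
    \<comment> \<open>Subtracting a multiple of the vanishing energy pairing replaces the test
      function by its deviation from \<open>2 * cnj (g t)\<close>.\<close>
    have "h' t = (LINT \<zeta>|lborel. propagate \<alpha> t \<theta> \<zeta> * N t \<zeta>) - 2 * (LINT \<zeta>|lborel. cnj (g t \<zeta>) * N t \<zeta>)"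
      using Nt(3) by (simp add: h'_def)
    also have "\<dots> = (LINT \<zeta>|lborel. propagate \<alpha> t \<theta> \<zeta> * N t \<zeta>) - (LINT \<zeta>|lborel. 2 * cnj (g t \<zeta>) * N t \<zeta>)"
      unfolding integral_mult_right_zero[symmetric] by (simp only: mult.assoc)
    also have "\<dots> = (LINT \<zeta>|lborel. (propagate \<alpha> t \<theta> \<zeta> - 2 * cnj (g t \<zeta>)) * N t \<zeta>)"
      unfolding Bochner_Integration.integral_diff[OF sqint_mult_integrable[OF ps Nt(1)] sqint_mult_integrable[OF cs Nt(1)], symmetric]
      by (simp only: left_diff_distrib)
    also have "cmod \<dots> \<le> l2norm (\<lambda>\<zeta>. propagate \<alpha> t \<theta> \<zeta> - 2 * cnj (g t \<zeta>)) * l2norm (N t)"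
      by (intro l2_Cauchy_Schwarz sqint_diff ps cs Nt)
    also have "l2norm (\<lambda>\<zeta>. propagate \<alpha> t \<theta> \<zeta> - 2 * cnj (g t \<zeta>)) = l2norm (\<lambda>\<zeta>. \<theta> \<zeta> - 2 * cnj (w t \<zeta>))"
    proof (rule l2norm_cong_norm)
      fix \<zeta>
      have "propagate \<alpha> t \<theta> \<zeta> - 2 * cnj (g t \<zeta>) = cis (t * dispersion \<alpha> \<zeta>) * (\<theta> \<zeta> - 2 * cnj (w t \<zeta>))"
        by (simp add: propagate_def w_def cis_cnj right_diff_distrib mult.left_commute[of _ 2])
          (simp add: cis_mult flip: mult.assoc)
      then show "cmod (propagate \<alpha> t \<theta> \<zeta> - 2 * cnj (g t \<zeta>)) = cmod (\<theta> \<zeta> - 2 * cnj (w t \<zeta>))" by (simp add: norm_mult)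
    qed
    also have "\<dots> \<le> e + 2 * k"
    proof -
      have ds: "sqint (\<lambda>\<zeta>. 2 * cnj (w t \<zeta>))" by (intro sqint_scale sqint_cnj ws)
      have "l2norm (\<lambda>\<zeta>. \<theta> \<zeta> - 2 * cnj (w t \<zeta>)) \<le> l2norm (\<lambda>\<zeta>. \<theta> \<zeta> - v \<zeta>) + l2norm (\<lambda>\<zeta>. v \<zeta> - 2 * cnj (w t \<zeta>))"
        by (rule l2norm_triangle_diff[OF \<theta>s vs ds])
      also have "l2norm (\<lambda>\<zeta>. \<theta> \<zeta> - v \<zeta>) \<le> e" using \<theta>(2) by (simp add: l2norm_minus_commute[of \<theta>])
      also have "l2norm (\<lambda>\<zeta>. v \<zeta> - 2 * cnj (w t \<zeta>)) = l2norm (\<lambda>\<zeta>. (w t \<zeta> - w a \<zeta>) + (w t \<zeta> - w b \<zeta>))"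
      proof (rule l2norm_cong_norm)
        fix \<zeta>
        have "v \<zeta> - 2 * cnj (w t \<zeta>) = - cnj ((w t \<zeta> - w a \<zeta>) + (w t \<zeta> - w b \<zeta>))" by (simp add: v_def)
        then show "cmod (v \<zeta> - 2 * cnj (w t \<zeta>)) = cmod ((w t \<zeta> - w a \<zeta>) + (w t \<zeta> - w b \<zeta>))"
          by (simp only: norm_minus_cancel complex_mod_cnj)
      qed
      also have "\<dots> \<le> l2norm (\<lambda>\<zeta>. w t \<zeta> - w a \<zeta>) + l2norm (\<lambda>\<zeta>. w t \<zeta> - w b \<zeta>)"
        by (intro l2norm_triangle sqint_diff ws)
      finally show ?thesis using k by simp
    qed
    finally have "cmod (h' t) \<le> (e + 2 * k) * l2norm (N t)" by (simp add: mult_right_mono)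
    also have "\<dots> \<le> (e + 2 * k) * m t"
    proof (rule mult_left_mono[OF Nt(2)])
      show "0 \<le> e + 2 * k" using k(1) l2norm_nonneg[of "\<lambda>\<zeta>. w t \<zeta> - w a \<zeta>"] e by linarith
    qed
    finally show ?thesis .
  qed
  have "l2norm (\<lambda>\<zeta>. w a \<zeta> - w a \<zeta>) \<le> k" using close[of a] ab by simp
  then have k0: "0 \<le> k" by (rule order_trans[OF l2norm_nonneg])
  have mi: "(\<lambda>t. (e + 2 * k) * m t) integrable_on {a..b}" using m(1) by (rule integrable_on_mult_right)
  have "norm (integral {a..b} (\<lambda>t. if t \<in> Z then 0 else h' t)) \<le> integral {a..b} (\<lambda>t. (e + 2 * k) * m t)"
    using HI h'_le m(2) k0 e by (intro Henstock_Kurzweil_Integration.integral_norm_bound_integral mi) (auto simp: has_integral_integrable)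
  then have h_diff: "cmod (h b - h a) \<le> (e + 2 * k) * integral {a..b} m"
    using integral_unique[OF HI] by simp
  define d where "d \<zeta> = w b \<zeta> - w a \<zeta>" for \<zeta>
  have ds: "sqint d" unfolding d_def by (intro sqint_diff ws)
  have E: "(l2norm (g b))\<^sup>2 - (l2norm (g a))\<^sup>2 = Re (LINT \<zeta>|lborel. v \<zeta> * d \<zeta>)"
  proof -
    have vd: "Re (v \<zeta> * d \<zeta>) = (cmod (w b \<zeta>))\<^sup>2 - (cmod (w a \<zeta>))\<^sup>2" for \<zeta>
      unfolding v_def d_def cmod_power2 by (simp add: power2_eq_square algebra_simps)
    have "Re (LINT \<zeta>|lborel. v \<zeta> * d \<zeta>) = (LINT \<zeta>|lborel. Re (v \<zeta> * d \<zeta>))"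
      by (rule integral_Re[OF sqint_mult_integrable[OF vs ds], symmetric])
    also have "\<dots> = (l2norm (w b))\<^sup>2 - (l2norm (w a))\<^sup>2"
      unfolding vd l2norm_square by (intro Bochner_Integration.integral_diff sqint_integrable ws)
    finally show ?thesis by (simp add: w_def)
  qed
  have hd: "h b - h a = (LINT \<zeta>|lborel. \<theta> \<zeta> * d \<zeta>)"
    unfolding hw Bochner_Integration.integral_diff[OF sqint_mult_integrable[OF \<theta>s ws] sqint_mult_integrable[OF \<theta>s ws], symmetric]
    by (simp add: d_def right_diff_distrib)
  have "(LINT \<zeta>|lborel. v \<zeta> * d \<zeta>) - (h b - h a) = (LINT \<zeta>|lborel. (v \<zeta> - \<theta> \<zeta>) * d \<zeta>)"
    unfolding hd Bochner_Integration.integral_diff[OF sqint_mult_integrable[OF vs ds] sqint_mult_integrable[OF \<theta>s ds], symmetric]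
    by (simp add: left_diff_distrib)
  also have "cmod \<dots> \<le> l2norm (\<lambda>\<zeta>. v \<zeta> - \<theta> \<zeta>) * l2norm d" by (intro l2_Cauchy_Schwarz sqint_diff vs \<theta>s ds)
  also have "\<dots> \<le> e * l2norm d" using \<theta>(2) by (intro mult_right_mono) auto
  finally have "cmod (LINT \<zeta>|lborel. v \<zeta> * d \<zeta>) \<le> (e + 2 * k) * integral {a..b} m + e * l2norm d"
    using h_diff norm_triangle_sub[of "LINT \<zeta>|lborel. v \<zeta> * d \<zeta>" "h b - h a"] by linarith
  then have "\<bar>(l2norm (g b))\<^sup>2 - (l2norm (g a))\<^sup>2\<bar> \<le> (e + 2 * k) * integral {a..b} m + e * l2norm d"
    unfolding E using abs_Re_le_cmod order_trans by blast
  then show "\<bar>(l2norm (g b))\<^sup>2 - (l2norm (g a))\<^sup>2\<bar> \<le> 2 * k * integral {a..b} m + e * (integral {a..b} m + l2norm d)"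
    by (simp add: algebra_simps)
qed


text \<open>The change of g is carried isometrically; what is left is strong continuity of the
  phases on a fixed function, by dominated convergence. The phase speed is unbounded, so there is no
  rate.\<close>

lemma propagate_continuous:
  fixes g :: "real \<Rightarrow> plane \<Rightarrow> complex"
  assumes g: "\<And>\<tau>. sqint (g \<tau>)"
    and cont: "((\<lambda>\<tau>. l2norm (\<lambda>\<zeta>. g \<tau> \<zeta> - g t \<zeta>)) \<longlongrightarrow> 0) (at t within S)"
  shows "((\<lambda>\<tau>. l2norm (\<lambda>\<zeta>. propagate \<alpha> \<tau> (g \<tau>) \<zeta> - propagate \<alpha> t (g t) \<zeta>)) \<longlongrightarrow> 0) (at t within S)"
proof (rule Lim_null_comparison)
  have ps: "sqint (propagate \<alpha> \<tau> (g \<sigma>))" for \<tau> \<sigma> by (rule sqint_propagate[OF g])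
  have "norm (l2norm (\<lambda>\<zeta>. propagate \<alpha> \<tau> (g \<tau>) \<zeta> - propagate \<alpha> t (g t) \<zeta>))
      \<le> l2norm (\<lambda>\<zeta>. g \<tau> \<zeta> - g t \<zeta>) + l2norm (\<lambda>\<zeta>. propagate \<alpha> \<tau> (g t) \<zeta> - propagate \<alpha> t (g t) \<zeta>)" for \<tau>
  proof -
    have "l2norm (\<lambda>\<zeta>. propagate \<alpha> \<tau> (g \<tau>) \<zeta> - propagate \<alpha> \<tau> (g t) \<zeta>) = l2norm (\<lambda>\<zeta>. g \<tau> \<zeta> - g t \<zeta>)"
      by (rule l2norm_cong_norm) (simp add: propagate_def norm_mult flip: right_diff_distrib)
    then show ?thesis using l2norm_triangle_diff[OF ps[of \<tau> \<tau>] ps[of \<tau> t] ps[of t t]] by simp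
  qed
  then show "\<forall>\<^sub>F \<tau> in at t within S. norm (l2norm (\<lambda>\<zeta>. propagate \<alpha> \<tau> (g \<tau>) \<zeta> - propagate \<alpha> t (g t) \<zeta>))
      \<le> l2norm (\<lambda>\<zeta>. g \<tau> \<zeta> - g t \<zeta>) + l2norm (\<lambda>\<zeta>. propagate \<alpha> \<tau> (g t) \<zeta> - propagate \<alpha> t (g t) \<zeta>)" by simp
  have "((\<lambda>\<tau>. l2norm (\<lambda>\<zeta>. propagate \<alpha> \<tau> (g t) \<zeta> - propagate \<alpha> t (g t) \<zeta>)) \<longlongrightarrow> 0) (at t within S)"
    unfolding tendsto_at_iff_sequentially o_def
  proof (intro allI impI)
    fix X assume X: "X \<longlonglongrightarrow> t"
    show "(\<lambda>n. l2norm (\<lambda>\<zeta>. propagate \<alpha> (X n) (g t) \<zeta> - propagate \<alpha> t (g t) \<zeta>)) \<longlonglongrightarrow> 0"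
    proof (rule l2norm_dominated_convergence(2)[OF _ _ sqint_integrable[OF g[of t]]])
      show "AE \<zeta> in lborel. cmod (propagate \<alpha> (X n) (g t) \<zeta>) \<le> cmod (g t \<zeta>)" for n
        by (intro AE_I2) (simp add: propagate_def norm_mult)
      show "AE \<zeta> in lborel. (\<lambda>n. propagate \<alpha> (X n) (g t) \<zeta>) \<longlonglongrightarrow> propagate \<alpha> t (g t) \<zeta>"
        unfolding propagate_def cis_conv_exp by (intro AE_I2 tendsto_intros X)
    qed (intro sqint_measurable ps)+
  qed
  from tendsto_add[OF cont this]
  show "((\<lambda>\<tau>. l2norm (\<lambda>\<zeta>. g \<tau> \<zeta> - g t \<zeta>) + l2norm (\<lambda>\<zeta>. propagate \<alpha> \<tau> (g t) \<zeta> - propagate \<alpha> t (g t) \<zeta>)) \<longlongrightarrow> 0) (at t within S)"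
    by simp
qed

text \<open>Over a short interval the increment is at most a small factor times the integral of an
  integrable function. Such a bound adds up over adjacent intervals, so bisection extends it to the
  whole interval, and the factor is arbitrary.\<close>

lemma energy_conservation:
  assumes s1: "1 \<le> s1" and sol: "cauchy_solution \<alpha> s1 s2 T \<psi> u" and t: "t \<in> {0..T}"
  shows "l2norm (fourier_L2 (u t)) = l2norm (fourier_L2 \<psi>)"
proof -
  define g where "g \<tau> = fourier_L2 (u \<tau>)" for \<tau>
  define w where "w \<tau> = propagate \<alpha> \<tau> (g \<tau>)" for \<tau>
  have gs: "sqint (g \<tau>)" for \<tau> unfolding g_def by (rule sqint_fourier_L2)
  have ws: "sqint (w \<tau>)" for \<tau> unfolding w_def by (rule sqint_propagate[OF gs])
  obtain B0 where B0: "\<And>t. t \<in> {0..T} \<Longrightarrow> sobolev_norm s1 s2 (u t) \<le> B0" using solution_bounded[OF sol] by blast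
  define B where "B = max B0 0"
  have B: "0 \<le> B" "\<And>t. t \<in> {0..T} \<Longrightarrow> sobolev_norm s1 s2 (u t) \<le> B" using B0 by (auto simp: B_def le_max_iff_disj)
  obtain m :: "real \<Rightarrow> real" where m: "m integrable_on {0..T}" "\<And>t. 0 \<le> m t"
    and neg: "negligible {t \<in> {0..T}. \<not> (AE z in lborel. \<bar>rep_L2 (u t) z\<bar> \<le> m t)}"
    using solution_sup_bound[OF s1 sol] by blast
  define Z where "Z = {t \<in> {0..T}. \<not> (AE z in lborel. \<bar>rep_L2 (u t) z\<bar> \<le> m t)}"
  define M where "M t = m t * B" for t
  have Mi: "M integrable_on {a..b}" if "0 \<le> a" "b \<le> T" for a b
    unfolding M_def using that by (intro integrable_on_mult_left integrable_on_subinterval[OF m(1)]) auto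
  have M0: "0 \<le> M t" for t using m(2) B(1) by (simp add: M_def)
  have w_cont: "\<exists>d>0. \<forall>\<tau>\<in>{0..T}. \<bar>\<tau> - x\<bar> < d \<longrightarrow> l2norm (\<lambda>\<zeta>. w \<tau> \<zeta> - w x \<zeta>) < k" if "x \<in> {0..T}" "0 < k" for x k
  proof -
    have "((\<lambda>\<tau>. l2norm (\<lambda>\<zeta>. w \<tau> \<zeta> - w x \<zeta>)) \<longlongrightarrow> 0) (at x within {0..T})"
      unfolding w_def by (rule propagate_continuous[OF gs]) (use solution_continuous[OF s1 sol that(1)] in \<open>simp add: g_def\<close>)
    from order_tendstoD(2)[OF this that(2)] obtain d where "0 < d"
      "\<And>\<tau>. \<tau> \<in> {0..T} \<Longrightarrow> \<tau> \<noteq> x \<Longrightarrow> dist \<tau> x < d \<Longrightarrow> l2norm (\<lambda>\<zeta>. w \<tau> \<zeta> - w x \<zeta>) < k"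
      unfolding eventually_at by blast
    moreover have "l2norm (\<lambda>\<zeta>. w x \<zeta> - w x \<zeta>) < k" using that(2) by (simp add: l2norm_def)
    ultimately show ?thesis by (metis dist_real_def)
  qed
  define E where "E \<tau> = (l2norm (g \<tau>))\<^sup>2" for \<tau>
  have bound: "\<bar>E t - E 0\<bar> \<le> 0 + e * (4 * integral {0..t} M)" if e: "0 < e" for e
  proof -
    define P where "P a b \<longleftrightarrow> 0 \<le> a \<and> b \<le> T \<longrightarrow> \<bar>E b - E a\<bar> \<le> 4 * e * integral {a..b} M" for a b
    have "P 0 t"
    proof (rule Bolzano[where a = 0 and b = t])
      show "0 \<le> t" using t by simp
    next
      fix a b c assume P: "P a b" "P b c" and abc: "a \<le> b" "b \<le> c"
      show "P a c" unfolding P_def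
      proof
        assume ac: "0 \<le> a \<and> c \<le> T"
        then have "\<bar>E b - E a\<bar> \<le> 4 * e * integral {a..b} M" "\<bar>E c - E b\<bar> \<le> 4 * e * integral {b..c} M"
          using P abc by (auto simp: P_def)
        moreover have "integral {a..b} M + integral {b..c} M = integral {a..c} M"
          using ac abc by (intro Henstock_Kurzweil_Integration.integral_combine Mi) auto
        then have "4 * e * integral {a..c} M = 4 * e * integral {a..b} M + 4 * e * integral {b..c} M"
          by (simp only: distrib_left[symmetric])
        ultimately show "\<bar>E c - E a\<bar> \<le> 4 * e * integral {a..c} M" by linarith
      qed
    next
      fix x assume "0 \<le> x" "x \<le> t"
      then have x: "x \<in> {0..T}" using t by simp
      obtain d where d: "0 < d" "\<And>\<tau>. \<tau> \<in> {0..T} \<Longrightarrow> \<bar>\<tau> - x\<bar> < d \<Longrightarrow> l2norm (\<lambda>\<zeta>. w \<tau> \<zeta> - w x \<zeta>) < e"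
        using w_cont[OF x e] by blast
      have "P a b" if ab: "a \<le> x" "x \<le> b" "b - a < d" for a b
        unfolding P_def
      proof
        assume ab': "0 \<le> a \<and> b \<le> T"
        \<comment> \<open>Distance e from the profile at x gives 2 e between any two times, and the
          increment estimate doubles this once more, whence 4 e in P.\<close>
        have close: "l2norm (\<lambda>\<zeta>. w \<tau> \<zeta> - w \<sigma> \<zeta>) \<le> 2 * e" if "\<tau> \<in> {a..b}" "\<sigma> \<in> {a..b}" for \<tau> \<sigma>
        proof -
          have "l2norm (\<lambda>\<zeta>. w \<tau> \<zeta> - w x \<zeta>) < e" "l2norm (\<lambda>\<zeta>. w \<sigma> \<zeta> - w x \<zeta>) < e"
            using that ab ab' by (intro d(2); simp; linarith)+
          then show ?thesis
            using l2norm_triangle_diff[OF ws[of \<tau>] ws[of x] ws[of \<sigma>]] l2norm_minus_commute[of "w x" "w \<sigma>"] by simp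
        qed
        have sub: "{a..b} \<subseteq> {0..T}" using ab' by auto
        have "\<bar>E b - E a\<bar> \<le> 2 * (2 * e) * integral {a..b} M"
          unfolding E_def
        proof (rule energy_increment[where \<alpha> = \<alpha> and g = g and N = "\<lambda>t. nonlinear_part (g t)" and Z = Z])
          show "a \<le> b" using ab by simp
          show "negligible Z" using neg by (simp add: Z_def)
          show "M integrable_on {a..b}" using ab' by (intro Mi) auto
          show "((\<lambda>\<tau>. LINT \<zeta>|lborel. propagate \<alpha> \<tau> \<theta> \<zeta> * g \<tau> \<zeta>) has_vector_derivative
              (LINT \<zeta>|lborel. propagate \<alpha> t \<theta> \<zeta> * nonlinear_part (g t) \<zeta>)) (at t within {a..b})"
            if "frequency_test \<theta>" "t \<in> {a..b}" for \<theta> t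
            using solution_interaction(1)[OF s1 sol _ that(1), of t] that(2) sub unfolding g_def
            by (auto intro: has_vector_derivative_within_subset)
          show "sqint (nonlinear_part (g t)) \<and> l2norm (nonlinear_part (g t)) \<le> M t \<and>
              (LINT \<zeta>|lborel. cnj (g t \<zeta>) * nonlinear_part (g t) \<zeta>) = 0" if "t \<in> {a..b} - Z" for t
          proof -
            have tT: "t \<in> {0..T}" and bd: "AE z in lborel. \<bar>rep_L2 (u t) z\<bar> \<le> m t"
              using that sub by (auto simp: Z_def)
            show ?thesis
              using solution_interaction(3-5)[OF s1 sol tT bd] mult_left_mono[OF B(2)[OF tT] m(2)[of t]]
              unfolding g_def M_def by auto
          qed
          show "l2norm (\<lambda>\<zeta>. propagate \<alpha> t (g t) \<zeta> - propagate \<alpha> a (g a) \<zeta>) \<le> 2 * e \<and>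
              l2norm (\<lambda>\<zeta>. propagate \<alpha> t (g t) \<zeta> - propagate \<alpha> b (g b) \<zeta>) \<le> 2 * e" if "t \<in> {a..b}" for t
            using close[OF that, of a] close[OF that, of b] ab unfolding w_def by auto
        qed (use gs M0 in auto)
        then show "\<bar>E b - E a\<bar> \<le> 4 * e * integral {a..b} M" by simp
      qed
      then show "\<exists>d>0. \<forall>a b. a \<le> x \<and> x \<le> b \<and> b - a < d \<longrightarrow> P a b" using d(1) by blast
    qed
    then show ?thesis using t by (simp add: P_def mult_ac)
  qed
  have "\<bar>E t - E 0\<bar> \<le> 0" by (rule le_if_le_add_small[OF bound])
  then have "l2norm (g t) = l2norm (g 0)" by (simp add: E_def)
  then show ?thesis using sol by (simp add: g_def cauchy_solution_def)
qed

section \<open>Quadratic expansion of the flow at zero\<close>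

lemma real_derivative_lower_bound:
  fixes f :: "real \<Rightarrow> real"
  assumes t: "0 \<le> t" and der: "\<And>s. s \<in> {0..t} \<Longrightarrow> (f has_vector_derivative f' s) (at s within {0..t})"
    and le: "\<And>s. s \<in> {0..t} \<Longrightarrow> c \<le> f' s"
  shows "c * t \<le> f t - f 0"
proof -
  obtain s where s: "s \<in> {0..t}" "f t - f 0 = (t - 0) *\<^sub>R f' s"
    using mvt_very_simple[OF t, of f "\<lambda>s h. h *\<^sub>R f' s"] der by (auto simp: has_vector_derivative_def)
  then show ?thesis using le[OF s(1)] t mult_right_mono[of c "f' s" t] by (simp add: mult.commute)
qed

lemma vector_derivative_norm_bound:
  fixes f :: "real \<Rightarrow> complex"
  assumes t: "0 \<le> t" and der: "\<And>s. s \<in> {0..t} \<Longrightarrow> (f has_vector_derivative f' s) (at s within {0..t})"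
    and le: "\<And>s. s \<in> {0..t} \<Longrightarrow> norm (f' s) \<le> c"
  shows "norm (f t - f 0) \<le> c * t"
proof -
  have "norm (f' 0) \<le> c" using le t by simp
  then have c: "0 \<le> c" by (rule order_trans[OF norm_ge_zero])
  have "onorm (\<lambda>h. h *\<^sub>R f' s) \<le> c" if "s \<in> {0..t}" for s
    using le[OF that] c by (intro onorm_bound) (auto simp: mult.commute[of c] intro: mult_left_mono)
  then have "norm (f t - f 0) \<le> c * norm (t - 0)"
    using t der by (intro differentiable_bound[of "{0..t}" f "\<lambda>s h. h *\<^sub>R f' s"]) (auto simp: has_vector_derivative_def)
  then show ?thesis using t by simp
qed

text \<open>The factor \<open>\<bar>fst \<zeta>\<bar> / (4 * pi)\<close> is the size of the
  multiplier in \<open>nonlinear_part\<close>. This moment times the squared L2 norm therefore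
  bounds the pairing with the nonlinearity, and the L2 norm is conserved.\<close>

definition test_moment :: "(plane \<Rightarrow> complex) \<Rightarrow> real" where
  "test_moment \<theta> = (LINT \<zeta>|lborel. cmod (\<theta> \<zeta>) * \<bar>fst \<zeta>\<bar>) / (4 * pi)"

lemma frequency_test_moment_integrable:
  assumes \<theta>: "frequency_test \<theta>" shows "integrable lborel (\<lambda>\<zeta>. cmod (\<theta> \<zeta>) * \<bar>fst \<zeta>\<bar>)"
proof -
  have "frequency_test (\<lambda>\<zeta>. \<theta> \<zeta> * complex_of_real (fst \<zeta>))"
    by (intro frequency_test_mult \<theta> continuous_intros)
  from integrable_norm[OF frequency_test_integrable[OF this]] show ?thesis by (simp add: norm_mult)
qed

lemma test_moment_nonneg: "0 \<le> test_moment \<theta>"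
  unfolding test_moment_def by (intro divide_nonneg_nonneg integral_nonneg_AE) auto

lemma test_moment_bound:
  assumes \<theta>: "frequency_test \<theta>" and le: "\<And>\<zeta>. cmod (p \<zeta>) \<le> cmod (\<theta> \<zeta>) * \<bar>fst \<zeta>\<bar> * C / (4 * pi)" and C: "0 \<le> C"
  shows "cmod (LINT \<zeta>|lborel. p \<zeta>) \<le> test_moment \<theta> * C"
proof (cases "integrable lborel p")
  case True
  have "cmod (LINT \<zeta>|lborel. p \<zeta>) \<le> (LINT \<zeta>|lborel. cmod (\<theta> \<zeta>) * \<bar>fst \<zeta>\<bar> * (C / (4 * pi)))"
    using le frequency_test_moment_integrable[OF \<theta>]
    by (intro Bochner_Integration.integral_norm_bound_integral True) auto
  then show ?thesis by (simp add: test_moment_def)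
next
  \<comment> \<open>The integral of a non-integrable function is 0 by convention.\<close>
  case False
  then show ?thesis using C test_moment_nonneg by (simp add: not_integrable_integral_eq)
qed

lemma nonlinear_part_bound:
  assumes "sqint g" shows "cmod (nonlinear_part g \<zeta>) \<le> \<bar>fst \<zeta>\<bar> * (l2norm g)\<^sup>2 / (4 * pi)"
  using mult_left_mono[OF conv_bound[OF assms assms, of \<zeta>], of "\<bar>fst \<zeta>\<bar>"]
  by (simp add: nonlinear_part_def norm_mult norm_divide divide_right_mono power2_eq_square)

lemma nonlinear_part_measurable [measurable]:
  assumes [measurable]: "g \<in> borel_measurable borel"
  shows "nonlinear_part g \<in> borel_measurable borel"
proof -
  have "conv g g \<in> borel_measurable borel" unfolding conv_def[abs_def] by measurable
  then show ?thesis unfolding nonlinear_part_def[abs_def] by measurable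
qed

lemma frequency_test_nonlinear_integrable:
  assumes \<theta>: "frequency_test \<theta>" and g: "sqint g"
  shows "integrable lborel (\<lambda>\<zeta>. \<theta> \<zeta> * nonlinear_part g \<zeta>)"
proof (rule Bochner_Integration.integrable_bound)
  show "integrable lborel (\<lambda>\<zeta>. (cmod (\<theta> \<zeta>) * \<bar>fst \<zeta>\<bar>) * ((l2norm g)\<^sup>2 / (4 * pi)))"
    using frequency_test_moment_integrable[OF \<theta>] by (rule integrable_mult_left)
  show "(\<lambda>\<zeta>. \<theta> \<zeta> * nonlinear_part g \<zeta>) \<in> borel_measurable lborel"
    using frequency_test_measurable[OF \<theta>] nonlinear_part_measurable[OF sqint_measurable[OF g]] by simp
  show "AE \<zeta> in lborel. norm (\<theta> \<zeta> * nonlinear_part g \<zeta>) \<le> norm ((cmod (\<theta> \<zeta>) * \<bar>fst \<zeta>\<bar>) * ((l2norm g)\<^sup>2 / (4 * pi)))"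
  proof (rule AE_I2)
    fix \<zeta>
    show "norm (\<theta> \<zeta> * nonlinear_part g \<zeta>) \<le> norm ((cmod (\<theta> \<zeta>) * \<bar>fst \<zeta>\<bar>) * ((l2norm g)\<^sup>2 / (4 * pi)))"
      using mult_left_mono[OF nonlinear_part_bound[OF g, of \<zeta>], of "cmod (\<theta> \<zeta>)"]
      by (simp add: norm_mult abs_mult mult_ac)
  qed
qed

lemma nonlinear_part_diff_bound:
  assumes f: "sqint f" and g: "sqint g"
  shows "cmod (nonlinear_part f \<zeta> - nonlinear_part g \<zeta>) \<le> \<bar>fst \<zeta>\<bar> * (l2norm (\<lambda>z. f z - g z) * (l2norm f + l2norm g)) / (4 * pi)"
proof -
  have "nonlinear_part f \<zeta> - nonlinear_part g \<zeta> = \<i> * complex_of_real (fst \<zeta>) * (conv f f \<zeta> - conv g g \<zeta>) / (4 * pi)"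
    by (simp add: nonlinear_part_def right_diff_distrib diff_divide_distrib)
  then show ?thesis
    using mult_left_mono[OF conv_diff_bound[OF f g, of \<zeta>], of "\<bar>fst \<zeta>\<bar>"]
    by (simp add: norm_mult norm_divide divide_right_mono)
qed

text \<open>The rate is quadratic in the conserved norm. For data of size d the pairing thus moves
  by O(d^2), with a constant that depends on the test function and not on the solution.\<close>

lemma interaction_pairing_drift:
  assumes s1: "1 \<le> s1" and sol: "cauchy_solution \<alpha> s1 s2 T \<psi> u" and t: "t \<in> {0..T}" and \<theta>: "frequency_test \<theta>"
  shows "cmod ((LINT \<zeta>|lborel. propagate \<alpha> t \<theta> \<zeta> * fourier_L2 (u t) \<zeta>) - (LINT \<zeta>|lborel. \<theta> \<zeta> * fourier_L2 \<psi> \<zeta>))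
    \<le> test_moment \<theta> * (l2norm (fourier_L2 \<psi>))\<^sup>2 * t"
proof -
  define h where "h \<tau> = (LINT \<zeta>|lborel. propagate \<alpha> \<tau> \<theta> \<zeta> * fourier_L2 (u \<tau>) \<zeta>)" for \<tau>
  define h' where "h' \<tau> = (LINT \<zeta>|lborel. propagate \<alpha> \<tau> \<theta> \<zeta> * nonlinear_part (fourier_L2 (u \<tau>)) \<zeta>)" for \<tau>
  have "norm (h t - h 0) \<le> test_moment \<theta> * (l2norm (fourier_L2 \<psi>))\<^sup>2 * t"
  proof (rule vector_derivative_norm_bound[where f' = h'])
    fix s assume s: "s \<in> {0..t}"
    then have sT: "s \<in> {0..T}" using t by simp
    show "(h has_vector_derivative h' s) (at s within {0..t})"
      using solution_interaction(1)[OF s1 sol sT \<theta>] t unfolding h_def h'_def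
      by (auto intro: has_vector_derivative_within_subset)
    show "norm (h' s) \<le> test_moment \<theta> * (l2norm (fourier_L2 \<psi>))\<^sup>2"
      unfolding h'_def
    proof (rule test_moment_bound[OF \<theta>])
      fix \<zeta>
      show "cmod (propagate \<alpha> s \<theta> \<zeta> * nonlinear_part (fourier_L2 (u s)) \<zeta>) \<le> cmod (\<theta> \<zeta>) * \<bar>fst \<zeta>\<bar> * (l2norm (fourier_L2 \<psi>))\<^sup>2 / (4 * pi)"
        using mult_left_mono[OF nonlinear_part_bound[OF sqint_fourier_L2, of "u s" \<zeta>], of "cmod (\<theta> \<zeta>)"]
        by (simp add: norm_mult propagate_def energy_conservation[OF s1 sol sT] mult_ac)
    qed simp
  qed (use t in simp)
  moreover have "u 0 = \<psi>" using sol by (simp add: cauchy_solution_def)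
  ultimately show ?thesis by (simp add: h_def propagate_def[of \<alpha> 0])
qed

text \<open>Weak convergence together with conservation of the norm is strong convergence.\<close>

lemma interaction_profile_convergence:
  assumes s1: "1 \<le> s1" and f: "sqint f" and \<phi>: "AE \<zeta> in lborel. fourier_L2 \<phi> \<zeta> = f \<zeta>" and t: "0 \<le> t" and e: "0 < e"
  shows "\<exists>d0>0. \<forall>d T u \<tau>. \<bar>d\<bar> < d0 \<longrightarrow> t \<le> T \<longrightarrow> cauchy_solution \<alpha> s1 s2 T (d *\<^sub>R \<phi>) u \<longrightarrow> \<tau> \<in> {0..t} \<longrightarrow>
    l2norm (\<lambda>\<zeta>. propagate \<alpha> \<tau> (fourier_L2 (u \<tau>)) \<zeta> - complex_of_real d * f \<zeta>) \<le> e * \<bar>d\<bar>"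
proof -
  define n where "n = l2norm f"
  have n0: "0 \<le> n" by (simp add: n_def)
  \<comment> \<open>\<open>\<eta>\<close> and \<open>d0\<close> make the two errors
    \<open>4 * \<eta> * n\<close> and \<open>2 * K * \<bar>d\<bar>\<close> at most
    \<open>e^2 / 2\<close> each; the added 1 avoids division by zero.\<close>
  define \<eta> where "\<eta> = e\<^sup>2 / (8 * (n + 1))"
  have \<eta>: "0 < \<eta>" using e n0 by (simp add: \<eta>_def)
  obtain \<theta> where \<theta>: "frequency_test \<theta>" "l2norm (\<lambda>\<zeta>. cnj (f \<zeta>) - \<theta> \<zeta>) < \<eta>"
    using frequency_test_dense[OF sqint_cnj[OF f] \<eta>] by blast
  define K where "K = test_moment \<theta> * n\<^sup>2 * t"
  have K0: "0 \<le> K" unfolding K_def using t test_moment_nonneg by simp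
  define d0 where "d0 = e\<^sup>2 / (4 * (K + 1))"
  have d0: "0 < d0" using e K0 by (simp add: d0_def)
  have "l2norm (\<lambda>\<zeta>. propagate \<alpha> \<tau> (fourier_L2 (u \<tau>)) \<zeta> - complex_of_real d * f \<zeta>) \<le> e * \<bar>d\<bar>"
    if d: "\<bar>d\<bar> < d0" and T: "t \<le> T" and sol: "cauchy_solution \<alpha> s1 s2 T (d *\<^sub>R \<phi>) u" and \<tau>: "\<tau> \<in> {0..t}" for d T u \<tau>
  proof -
    define w where "w = propagate \<alpha> \<tau> (fourier_L2 (u \<tau>))"
    have ws: "sqint w" unfolding w_def by (rule sqint_propagate[OF sqint_fourier_L2])
    have \<tau>T: "\<tau> \<in> {0..T}" using \<tau> T by simp
    have data: "AE \<zeta> in lborel. fourier_L2 (d *\<^sub>R \<phi>) \<zeta> = complex_of_real d * f \<zeta>"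
      using fourier_L2_scale[of d \<phi>] \<phi> by eventually_elim simp
    have data_n: "l2norm (fourier_L2 (d *\<^sub>R \<phi>)) = \<bar>d\<bar> * n"
      using l2norm_cong_AE[OF _ _ data] sqint_measurable[OF f] by (simp add: l2norm_scale n_def)
    have wn: "l2norm w = \<bar>d\<bar> * n" using energy_conservation[OF s1 sol \<tau>T] data_n by (simp add: w_def)
    note cs = sqint_cnj[OF f]
    have \<theta>s: "sqint \<theta>" by (rule frequency_test_sqint[OF \<theta>(1)])
    \<comment> \<open>The norms of w and \<open>d f\<close> agree, so their distance depends only on
      the real part of A. It is compared with \<open>d * n^2\<close> in three steps: replace
      \<open>cnj f\<close> by \<open>\<theta>\<close>, go back to time 0, return to
      \<open>cnj f\<close>.\<close>
    define A where "A = (LINT \<zeta>|lborel. cnj (f \<zeta>) * w \<zeta>)"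
    have A1: "cmod (A - (LINT \<zeta>|lborel. \<theta> \<zeta> * w \<zeta>)) \<le> \<eta> * (\<bar>d\<bar> * n)"
    proof -
      have "A - (LINT \<zeta>|lborel. \<theta> \<zeta> * w \<zeta>) = (LINT \<zeta>|lborel. (cnj (f \<zeta>) - \<theta> \<zeta>) * w \<zeta>)"
        unfolding A_def Bochner_Integration.integral_diff[OF sqint_mult_integrable[OF cs ws] sqint_mult_integrable[OF \<theta>s ws], symmetric]
        by (simp add: left_diff_distrib)
      also have "cmod \<dots> \<le> l2norm (\<lambda>\<zeta>. cnj (f \<zeta>) - \<theta> \<zeta>) * l2norm w" by (intro l2_Cauchy_Schwarz sqint_diff cs \<theta>s ws)
      also have "\<dots> \<le> \<eta> * (\<bar>d\<bar> * n)" unfolding wn using \<theta>(2) n0 by (intro mult_right_mono) auto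
      finally show ?thesis .
    qed
    have A2: "cmod ((LINT \<zeta>|lborel. \<theta> \<zeta> * w \<zeta>) - (LINT \<zeta>|lborel. \<theta> \<zeta> * fourier_L2 (d *\<^sub>R \<phi>) \<zeta>)) \<le> K * d\<^sup>2"
    proof -
      have "(LINT \<zeta>|lborel. \<theta> \<zeta> * w \<zeta>) = (LINT \<zeta>|lborel. propagate \<alpha> \<tau> \<theta> \<zeta> * fourier_L2 (u \<tau>) \<zeta>)"
        by (simp add: w_def propagate_def mult_ac)
      then have "cmod ((LINT \<zeta>|lborel. \<theta> \<zeta> * w \<zeta>) - (LINT \<zeta>|lborel. \<theta> \<zeta> * fourier_L2 (d *\<^sub>R \<phi>) \<zeta>)) \<le> test_moment \<theta> * (\<bar>d\<bar> * n)\<^sup>2 * \<tau>"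
        using interaction_pairing_drift[OF s1 sol \<tau>T \<theta>(1)] data_n by simp
      also have "\<dots> \<le> test_moment \<theta> * (\<bar>d\<bar> * n)\<^sup>2 * t" using \<tau> test_moment_nonneg by (intro mult_left_mono) auto
      finally show ?thesis by (simp add: K_def power_mult_distrib mult_ac)
    qed
    have A3: "cmod ((LINT \<zeta>|lborel. \<theta> \<zeta> * fourier_L2 (d *\<^sub>R \<phi>) \<zeta>) - complex_of_real (d * n\<^sup>2)) \<le> \<eta> * (\<bar>d\<bar> * n)"
    proof -
      define F where "F \<zeta> = complex_of_real d * f \<zeta>" for \<zeta>
      have Fs: "sqint F" unfolding F_def by (rule sqint_scale[OF f])
      have "(LINT \<zeta>|lborel. \<theta> \<zeta> * fourier_L2 (d *\<^sub>R \<phi>) \<zeta>) = (LINT \<zeta>|lborel. \<theta> \<zeta> * F \<zeta>)"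
        using data sqint_measurable[OF \<theta>s] sqint_measurable[OF f] by (intro integral_cong_AE) (auto simp: F_def)
      moreover have "complex_of_real (d * n\<^sup>2) = (LINT \<zeta>|lborel. cnj (f \<zeta>) * F \<zeta>)"
      proof -
        have "(LINT \<zeta>|lborel. cnj (f \<zeta>) * F \<zeta>) = complex_of_real d * (LINT \<zeta>|lborel. complex_of_real ((cmod (f \<zeta>))\<^sup>2))"
          unfolding integral_mult_right_zero[symmetric] F_def
          by (intro Bochner_Integration.integral_cong) (simp_all add: complex_norm_square mult_ac del: of_real_power)
        then show ?thesis by (simp add: n_def l2norm_square integral_complex_of_real del: of_real_power)
      qed
      ultimately have "(LINT \<zeta>|lborel. \<theta> \<zeta> * fourier_L2 (d *\<^sub>R \<phi>) \<zeta>) - complex_of_real (d * n\<^sup>2) = (LINT \<zeta>|lborel. (\<theta> \<zeta> - cnj (f \<zeta>)) * F \<zeta>)"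
        using Bochner_Integration.integral_diff[OF sqint_mult_integrable[OF \<theta>s Fs] sqint_mult_integrable[OF cs Fs]]
        by (simp add: left_diff_distrib)
      also have "cmod \<dots> \<le> l2norm (\<lambda>\<zeta>. \<theta> \<zeta> - cnj (f \<zeta>)) * l2norm F" by (intro l2_Cauchy_Schwarz sqint_diff cs \<theta>s Fs)
      also have "\<dots> \<le> \<eta> * (\<bar>d\<bar> * n)"
        using \<theta>(2) by (intro mult_mono) (auto simp: l2norm_minus_commute[of \<theta>] F_def[abs_def] l2norm_scale n_def \<eta> less_imp_le)
      finally show ?thesis .
    qed
    have "cmod (A - complex_of_real (d * n\<^sup>2)) \<le> 2 * (\<eta> * (\<bar>d\<bar> * n)) + K * d\<^sup>2"
    proof -
      have "A - complex_of_real (d * n\<^sup>2) = (A - (LINT \<zeta>|lborel. \<theta> \<zeta> * w \<zeta>))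
          + (((LINT \<zeta>|lborel. \<theta> \<zeta> * w \<zeta>) - (LINT \<zeta>|lborel. \<theta> \<zeta> * fourier_L2 (d *\<^sub>R \<phi>) \<zeta>))
          + ((LINT \<zeta>|lborel. \<theta> \<zeta> * fourier_L2 (d *\<^sub>R \<phi>) \<zeta>) - complex_of_real (d * n\<^sup>2)))" by simp
      also have "cmod \<dots> \<le> \<eta> * (\<bar>d\<bar> * n) + (K * d\<^sup>2 + \<eta> * (\<bar>d\<bar> * n))"
        by (intro norm_triangle_mono A1 A2 A3)
      also have "\<dots> = 2 * (\<eta> * (\<bar>d\<bar> * n)) + K * d\<^sup>2" by simp
      finally show ?thesis .
    qed
    then have re: "\<bar>Re A - d * n\<^sup>2\<bar> \<le> 2 * (\<eta> * (\<bar>d\<bar> * n)) + K * d\<^sup>2"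
      using abs_Re_le_cmod[of "A - complex_of_real (d * n\<^sup>2)"] by simp
    have "(l2norm (\<lambda>\<zeta>. w \<zeta> - complex_of_real d * f \<zeta>))\<^sup>2 = (\<bar>d\<bar> * n)\<^sup>2 + (\<bar>d\<bar> * n)\<^sup>2 - 2 * Re (LINT \<zeta>|lborel. w \<zeta> * cnj (complex_of_real d * f \<zeta>))"
      using l2norm_diff_square[OF ws sqint_scale[OF f, of "complex_of_real d"]] by (simp add: wn l2norm_scale n_def)
    also have "(LINT \<zeta>|lborel. w \<zeta> * cnj (complex_of_real d * f \<zeta>)) = complex_of_real d * A"
      unfolding A_def integral_mult_right_zero[symmetric] by (simp add: mult_ac)
    also have "(\<bar>d\<bar> * n)\<^sup>2 + (\<bar>d\<bar> * n)\<^sup>2 - 2 * Re (complex_of_real d * A) = - 2 * d * (Re A - d * n\<^sup>2)"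
      by (simp add: power_mult_distrib algebra_simps power2_eq_square)
    also have "\<dots> \<le> 2 * \<bar>d\<bar> * \<bar>Re A - d * n\<^sup>2\<bar>"
      using abs_ge_self[of "- 2 * d * (Re A - d * n\<^sup>2)"] by (simp add: abs_mult)
    also have "\<dots> \<le> 2 * \<bar>d\<bar> * (2 * (\<eta> * (\<bar>d\<bar> * n)) + K * d\<^sup>2)" by (intro mult_left_mono re) simp
    also have "\<dots> = d\<^sup>2 * (4 * \<eta> * n + 2 * K * \<bar>d\<bar>)"
      using power2_abs[of d] by (simp add: power2_eq_square algebra_simps)
    also have "\<dots> \<le> d\<^sup>2 * e\<^sup>2"
    proof (rule mult_left_mono)
      have "4 * \<eta> * n \<le> e\<^sup>2 / 2"
      proof -
        have "4 * \<eta> * n \<le> 4 * \<eta> * (n + 1)" using \<eta> by simp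
        also have "\<dots> = e\<^sup>2 / 2" using n0 by (simp add: \<eta>_def field_simps add_nonneg_eq_0_iff)
        finally show ?thesis .
      qed
      moreover have "2 * K * \<bar>d\<bar> \<le> e\<^sup>2 / 2"
      proof -
        have "2 * K * \<bar>d\<bar> \<le> 2 * (K + 1) * d0" using d K0 by (intro mult_mono) auto
        also have "\<dots> = e\<^sup>2 / 2" using K0 by (simp add: d0_def field_simps add_nonneg_eq_0_iff)
        finally show ?thesis .
      qed
      ultimately show "4 * \<eta> * n + 2 * K * \<bar>d\<bar> \<le> e\<^sup>2" by simp
    qed simp
    finally have "(l2norm (\<lambda>\<zeta>. w \<zeta> - complex_of_real d * f \<zeta>))\<^sup>2 \<le> (e * \<bar>d\<bar>)\<^sup>2" by (simp add: power_mult_distrib mult.commute)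
    then show ?thesis unfolding w_def by (rule power2_le_imp_le) (use e in simp)
  qed
  then show ?thesis using d0 by blast
qed

text \<open>The time derivative, in the interaction picture, of the pairing of
  \<open>\<theta>\<close> with the second Picard iterate: the free solution with transform f at time
  0 is inserted into the nonlinearity.\<close>

definition picard_rate :: "real \<Rightarrow> (plane \<Rightarrow> complex) \<Rightarrow> (plane \<Rightarrow> complex) \<Rightarrow> real \<Rightarrow> complex" where
  "picard_rate \<alpha> \<theta> f \<tau> = (LINT \<zeta>|lborel. propagate \<alpha> \<tau> \<theta> \<zeta> * nonlinear_part (propagate \<alpha> (- \<tau>) f) \<zeta>)"

text \<open>Since \<open>\<theta>\<close> and f have disjoint supports, the term linear in d is
  absent and the pairing starts at 0. Its derivative is d^2 times the Picard rate, up to an error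
  that the convergence of the profile brings below \<open>c / 2 * d^2\<close>.\<close>

lemma quadratic_growth_of_pairing:
  assumes s1: "1 \<le> s1" and f: "sqint f" and \<phi>: "AE \<zeta> in lborel. fourier_L2 \<phi> \<zeta> = f \<zeta>" and t: "0 \<le> t"
    and \<theta>: "frequency_test \<theta>" and disj: "\<And>\<zeta>. \<theta> \<zeta> * f \<zeta> = 0" and c: "0 < c"
    and rate: "\<And>\<tau>. \<tau> \<in> {0..t} \<Longrightarrow> c \<le> Im (picard_rate \<alpha> \<theta> f \<tau>)"
  shows "\<exists>d0>0. \<forall>d T u. \<bar>d\<bar> < d0 \<longrightarrow> t \<le> T \<longrightarrow> cauchy_solution \<alpha> s1 s2 T (d *\<^sub>R \<phi>) u \<longrightarrow>
    c / 2 * t * d\<^sup>2 \<le> Im (LINT \<zeta>|lborel. propagate \<alpha> t \<theta> \<zeta> * fourier_L2 (u t) \<zeta>)"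
proof -
  define n where "n = l2norm f"
  have n0: "0 \<le> n" by (simp add: n_def)
  \<comment> \<open>The error in the nonlinearity is at most
    \<open>e * (test_moment \<theta> * (2 * n))\<close> times d^2, hence \<open>c / 2\<close> times
    d^2 for \<open>e = c / (2 * L)\<close>; the added 1 keeps L positive.\<close>
  define L where "L = test_moment \<theta> * (2 * n) + 1"
  have L0: "0 < L" using n0 test_moment_nonneg[of \<theta>] unfolding L_def by (intro add_nonneg_pos mult_nonneg_nonneg) auto
  define e where "e = c / (2 * L)"
  have e: "0 < e" using c L0 by (simp add: e_def)
  obtain d0 where d0: "0 < d0" and close: "\<And>d T u \<tau>. \<bar>d\<bar> < d0 \<Longrightarrow> t \<le> T \<Longrightarrow> cauchy_solution \<alpha> s1 s2 T (d *\<^sub>R \<phi>) u \<Longrightarrow> \<tau> \<in> {0..t} \<Longrightarrow>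
    l2norm (\<lambda>\<zeta>. propagate \<alpha> \<tau> (fourier_L2 (u \<tau>)) \<zeta> - complex_of_real d * f \<zeta>) \<le> e * \<bar>d\<bar>"
    using interaction_profile_convergence[OF s1 f \<phi> t e] by blast
  have "c / 2 * t * d\<^sup>2 \<le> Im (LINT \<zeta>|lborel. propagate \<alpha> t \<theta> \<zeta> * fourier_L2 (u t) \<zeta>)"
    if d: "\<bar>d\<bar> < d0" and T: "t \<le> T" and sol: "cauchy_solution \<alpha> s1 s2 T (d *\<^sub>R \<phi>) u" for d T u
  proof -
    define g where "g \<tau> = fourier_L2 (u \<tau>)" for \<tau>
    have gs: "sqint (g \<tau>)" for \<tau> unfolding g_def by (rule sqint_fourier_L2)
    define h where "h \<tau> = (LINT \<zeta>|lborel. propagate \<alpha> \<tau> \<theta> \<zeta> * g \<tau> \<zeta>)" for \<tau>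
    define h' where "h' \<tau> = (LINT \<zeta>|lborel. propagate \<alpha> \<tau> \<theta> \<zeta> * nonlinear_part (g \<tau>) \<zeta>)" for \<tau>
    have data: "AE \<zeta> in lborel. fourier_L2 (d *\<^sub>R \<phi>) \<zeta> = complex_of_real d * f \<zeta>"
      using fourier_L2_scale[of d \<phi>] \<phi> by eventually_elim simp
    have data_n: "l2norm (fourier_L2 (d *\<^sub>R \<phi>)) = \<bar>d\<bar> * n"
      using l2norm_cong_AE[OF _ _ data] sqint_measurable[OF f] by (simp add: l2norm_scale n_def)
    have der: "(h has_vector_derivative h' \<tau>) (at \<tau> within {0..t})" if "\<tau> \<in> {0..t}" for \<tau>
      using solution_interaction(1)[OF s1 sol _ \<theta>, of \<tau>] that T unfolding h_def h'_def g_def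
      by (auto intro: has_vector_derivative_within_subset)
    have lower: "c / 2 * d\<^sup>2 \<le> Im (h' \<tau>)" if \<tau>: "\<tau> \<in> {0..t}" for \<tau>
    proof -
      have \<tau>T: "\<tau> \<in> {0..T}" using \<tau> T by simp
      define F where "F = propagate \<alpha> (- \<tau>) f"
      have Fs: "sqint F" unfolding F_def by (rule sqint_propagate[OF f])
      define G where "G \<zeta> = complex_of_real d * F \<zeta>" for \<zeta>
      have Gs: "sqint G" unfolding G_def by (rule sqint_scale[OF Fs])
      have NG: "nonlinear_part G \<zeta> = complex_of_real (d\<^sup>2) * nonlinear_part F \<zeta>" for \<zeta>
      proof -
        have "conv G G \<zeta> = complex_of_real (d\<^sup>2) * conv F F \<zeta>"
          unfolding conv_def integral_mult_right_zero[symmetric] by (simp add: G_def power2_eq_square mult_ac)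
        then show ?thesis by (simp add: nonlinear_part_def)
      qed
      have Fint: "integrable lborel (\<lambda>\<zeta>. propagate \<alpha> \<tau> \<theta> \<zeta> * nonlinear_part F \<zeta>)"
        by (rule frequency_test_nonlinear_integrable[OF frequency_test_propagate[OF \<theta>] Fs])
      have Gint: "integrable lborel (\<lambda>\<zeta>. propagate \<alpha> \<tau> \<theta> \<zeta> * nonlinear_part G \<zeta>)"
        using integrable_mult_right[of "complex_of_real (d\<^sup>2)", OF Fint] unfolding NG by (simp add: mult_ac)
      have Gval: "(LINT \<zeta>|lborel. propagate \<alpha> \<tau> \<theta> \<zeta> * nonlinear_part G \<zeta>) = complex_of_real (d\<^sup>2) * picard_rate \<alpha> \<theta> f \<tau>"
        unfolding NG picard_rate_def integral_mult_right_zero[symmetric] F_def by (simp add: mult_ac)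
      have gint: "integrable lborel (\<lambda>\<zeta>. propagate \<alpha> \<tau> \<theta> \<zeta> * nonlinear_part (g \<tau>) \<zeta>)"
        unfolding g_def by (rule solution_interaction(2)[OF s1 sol \<tau>T frequency_test_propagate[OF \<theta>]])
      have gG: "l2norm (\<lambda>\<zeta>. g \<tau> \<zeta> - G \<zeta>) \<le> e * \<bar>d\<bar>"
      proof -
        have "l2norm (\<lambda>\<zeta>. g \<tau> \<zeta> - G \<zeta>) = l2norm (\<lambda>\<zeta>. propagate \<alpha> \<tau> (g \<tau>) \<zeta> - complex_of_real d * f \<zeta>)"
        proof (rule l2norm_cong_norm)
          fix \<zeta>
          have "propagate \<alpha> \<tau> (g \<tau>) \<zeta> - complex_of_real d * f \<zeta> = cis (\<tau> * dispersion \<alpha> \<zeta>) * (g \<tau> \<zeta> - G \<zeta>)"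
            by (simp add: propagate_def G_def F_def right_diff_distrib mult.left_commute[of _ "complex_of_real d"])
              (simp add: cis_mult flip: mult.assoc[of "cis _" "cis _"])
          then show "cmod (g \<tau> \<zeta> - G \<zeta>) = cmod (propagate \<alpha> \<tau> (g \<tau>) \<zeta> - complex_of_real d * f \<zeta>)"
            by (simp add: norm_mult)
        qed
        then show ?thesis using close[OF d T sol \<tau>] by (simp add: g_def)
      qed
      have gn: "l2norm (g \<tau>) = \<bar>d\<bar> * n" unfolding g_def using energy_conservation[OF s1 sol \<tau>T] data_n by simp
      have Gn: "l2norm G = \<bar>d\<bar> * n" unfolding G_def l2norm_scale by (simp add: F_def n_def)
      have "cmod (h' \<tau> - complex_of_real (d\<^sup>2) * picard_rate \<alpha> \<theta> f \<tau>) \<le> test_moment \<theta> * (e * \<bar>d\<bar> * (\<bar>d\<bar> * n + \<bar>d\<bar> * n))"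
      proof -
        have "h' \<tau> - complex_of_real (d\<^sup>2) * picard_rate \<alpha> \<theta> f \<tau>
            = (LINT \<zeta>|lborel. propagate \<alpha> \<tau> \<theta> \<zeta> * (nonlinear_part (g \<tau>) \<zeta> - nonlinear_part G \<zeta>))"
          unfolding h'_def Gval[symmetric] Bochner_Integration.integral_diff[OF gint Gint, symmetric] by (simp add: right_diff_distrib)
        also have "cmod \<dots> \<le> test_moment \<theta> * (e * \<bar>d\<bar> * (\<bar>d\<bar> * n + \<bar>d\<bar> * n))"
        proof (rule test_moment_bound[OF \<theta>])
          fix \<zeta>
          have "cmod (nonlinear_part (g \<tau>) \<zeta> - nonlinear_part G \<zeta>) \<le> \<bar>fst \<zeta>\<bar> * (l2norm (\<lambda>z. g \<tau> z - G z) * (\<bar>d\<bar> * n + \<bar>d\<bar> * n)) / (4 * pi)"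
            using nonlinear_part_diff_bound[OF gs Gs, of \<tau> \<zeta>] by (simp only: gn Gn)
          also have "\<dots> \<le> \<bar>fst \<zeta>\<bar> * (e * \<bar>d\<bar> * (\<bar>d\<bar> * n + \<bar>d\<bar> * n)) / (4 * pi)"
            using gG n0 by (intro divide_right_mono mult_left_mono mult_right_mono) auto
          finally show "cmod (propagate \<alpha> \<tau> \<theta> \<zeta> * (nonlinear_part (g \<tau>) \<zeta> - nonlinear_part G \<zeta>))
              \<le> cmod (\<theta> \<zeta>) * \<bar>fst \<zeta>\<bar> * (e * \<bar>d\<bar> * (\<bar>d\<bar> * n + \<bar>d\<bar> * n)) / (4 * pi)"
            using mult_left_mono[of "cmod (nonlinear_part (g \<tau>) \<zeta> - nonlinear_part G \<zeta>)" "\<bar>fst \<zeta>\<bar> * (e * \<bar>d\<bar> * (\<bar>d\<bar> * n + \<bar>d\<bar> * n)) / (4 * pi)" "cmod (\<theta> \<zeta>)"]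
            by (simp add: norm_mult propagate_def mult_ac)
        qed (use e n0 in auto)
        finally show ?thesis .
      qed
      also have "\<dots> = d\<^sup>2 * (e * (test_moment \<theta> * (2 * n)))"
        using power2_abs[of d] by (simp add: power2_eq_square algebra_simps)
      also have "\<dots> \<le> d\<^sup>2 * (e * L)"
        using e by (intro mult_left_mono) (auto simp: L_def)
      also have "\<dots> = c / 2 * d\<^sup>2" using L0 by (simp add: e_def field_simps)
      finally have "\<bar>Im (h' \<tau> - complex_of_real (d\<^sup>2) * picard_rate \<alpha> \<theta> f \<tau>)\<bar> \<le> c / 2 * d\<^sup>2"
        using abs_Im_le_cmod order_trans by blast
      then have "\<bar>Im (h' \<tau>) - d\<^sup>2 * Im (picard_rate \<alpha> \<theta> f \<tau>)\<bar> \<le> c / 2 * d\<^sup>2" by simp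
      moreover have "d\<^sup>2 * c \<le> d\<^sup>2 * Im (picard_rate \<alpha> \<theta> f \<tau>)" using rate[OF \<tau>] by (intro mult_left_mono) auto
      moreover have "d\<^sup>2 * c = 2 * (c / 2 * d\<^sup>2)" by simp
      ultimately show ?thesis by linarith
    qed
    have "c / 2 * d\<^sup>2 * t \<le> Im (h t) - Im (h 0)"
      by (rule real_derivative_lower_bound[where f = "\<lambda>\<tau>. Im (h \<tau>)" and f' = "\<lambda>\<tau>. Im (h' \<tau>)"])
        (use t der lower bounded_linear.has_vector_derivative[OF bounded_linear_Im] in auto)
    moreover have "h 0 = 0"
    proof -
      have "u 0 = d *\<^sub>R \<phi>" using sol by (simp add: cauchy_solution_def)
      then have "h 0 = (LINT \<zeta>|lborel. \<theta> \<zeta> * fourier_L2 (d *\<^sub>R \<phi>) \<zeta>)" by (simp add: h_def g_def propagate_def)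
      also have "\<dots> = (LINT \<zeta>|(lborel :: plane measure). 0)"
      proof (rule integral_cong_AE)
        show "AE \<zeta> in lborel. \<theta> \<zeta> * fourier_L2 (d *\<^sub>R \<phi>) \<zeta> = 0"
          using data by eventually_elim (use disj in auto)
      qed (use frequency_test_measurable[OF \<theta>] in auto)
      finally show ?thesis by simp
    qed
    ultimately show ?thesis by (simp add: h_def g_def mult_ac)
  qed
  then show ?thesis using d0 by blast
qed

section \<open>From a flow of class C2 to a bound on the Picard rate\<close>

lemma second_order_lower_bound:
  fixes g g1 :: "real \<Rightarrow> real"
  assumes s0: "0 < s0" and der: "\<And>s. \<bar>s\<bar> < s0 \<Longrightarrow> (g has_real_derivative g1 s) (at s)"
    and lin: "\<And>e. 0 < e \<Longrightarrow> \<exists>d>0. \<forall>s. \<bar>s\<bar> < d \<longrightarrow> \<bar>g1 s - g1 0 - s * q\<bar> \<le> e * \<bar>s\<bar>"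
    and g0: "g 0 = 0" and lower: "\<And>s. \<bar>s\<bar> < s0 \<Longrightarrow> C * s\<^sup>2 \<le> g s" and C: "0 < C"
  shows "C \<le> \<bar>q\<bar>"
proof (rule le_if_le_add_small)
  fix e :: real assume e: "0 < e"
  obtain d where d: "0 < d" "\<And>s. \<bar>s\<bar> < d \<Longrightarrow> \<bar>g1 s - g1 0 - s * q\<bar> \<le> e * \<bar>s\<bar>" using lin[OF e] by blast
  define s where "s = min d s0 / 2"
  have s: "0 < s" "s < d" "s < s0" using d(1) s0 by (auto simp: s_def min_def)
  \<comment> \<open>The symmetric sum cancels \<open>g1 0\<close>: the mean value theorem expresses
    it by \<open>g1 x - g1 (- x)\<close>, which is \<open>2 * x * q\<close> up to a small multiple
    of x.\<close>
  define k where "k x = g x + g (- x)" for x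
  have kder: "(k has_real_derivative (g1 x - g1 (- x))) (at x)" if "\<bar>x\<bar> < s0" for x
    unfolding k_def using der[of x] der[of "- x"] that
    by (auto intro!: derivative_eq_intros DERIV_chain2[of g] simp: algebra_simps)
  obtain x where x: "0 < x" "x < s" "k s - k 0 = (s - 0) * (g1 x - g1 (- x))"
    using MVT2[OF s(1), of k "\<lambda>x. g1 x - g1 (- x)"] kder s by auto
  have "\<bar>g1 x - g1 0 - x * q\<bar> \<le> e * x" "\<bar>g1 (- x) - g1 0 + x * q\<bar> \<le> e * x"
    using d(2)[of x] d(2)[of "- x"] x s by auto
  then have "g1 x - g1 (- x) \<le> 2 * x * q + 2 * e * x" by (simp add: abs_le_iff algebra_simps)
  also have "\<dots> \<le> 2 * x * (\<bar>q\<bar> + e)" using x(1) by (simp add: algebra_simps)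
  also have "\<dots> \<le> 2 * s * (\<bar>q\<bar> + e)" using x e by (intro mult_right_mono) auto
  finally have "k s \<le> s * (2 * s * (\<bar>q\<bar> + e))" using x(3) s(1) g0 by (simp add: k_def)
  moreover have "2 * (C * s\<^sup>2) \<le> k s" unfolding k_def using lower[of s] lower[of "- s"] s by simp
  ultimately have "C * (2 * s\<^sup>2) \<le> (\<bar>q\<bar> + e * 1) * (2 * s\<^sup>2)" by (simp add: power2_eq_square mult_ac)
  then show "C \<le> \<bar>q\<bar> + e * 1" using s(1) by (simp add: mult_le_cancel_right)
qed

lemma flow_is_solution:
  assumes "\<psi> \<in> flow_domain \<alpha> s1 s2 t"
  shows "\<exists>T u. t \<le> T \<and> cauchy_solution \<alpha> s1 s2 T \<psi> u \<and> flow \<alpha> s1 s2 t \<psi> = u t"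
proof -
  have "\<exists>v T u. t \<le> T \<and> cauchy_solution \<alpha> s1 s2 T \<psi> u \<and> v = u t" using assms by (auto simp: flow_domain_def)
  then show ?thesis unfolding flow_def by (rule someI_ex)
qed

text \<open>Duality for the Sobolev norm: dividing the test function by the weight and multiplying
  the transform by it leaves the pairing unchanged. Such functionals turn Frechet derivatives of the
  flow into derivatives of a real function of one variable.\<close>

lemma weighted_functional:
  assumes p: "sqint (\<lambda>\<zeta>. p \<zeta> / complex_of_real (weight s1 s2 \<zeta>))" and ps: "sqint p"
  defines "\<Lambda> \<equiv> \<lambda>v. Im (LINT \<zeta>|lborel. p \<zeta> * fourier_L2 v \<zeta>)"
  shows "\<Lambda> (v - w) = \<Lambda> v - \<Lambda> w" and "\<Lambda> (a *\<^sub>R v) = a * \<Lambda> v"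
    and "v \<in> sobolev s1 s2 \<Longrightarrow> \<bar>\<Lambda> v\<bar> \<le> l2norm (\<lambda>\<zeta>. p \<zeta> / complex_of_real (weight s1 s2 \<zeta>)) * sobolev_norm s1 s2 v"
proof -
  note [measurable] = sqint_measurable[OF ps]
  have i: "integrable lborel (\<lambda>\<zeta>. p \<zeta> * fourier_L2 v \<zeta>)" for v by (rule sqint_mult_integrable[OF ps sqint_fourier_L2])
  have "(LINT \<zeta>|lborel. p \<zeta> * fourier_L2 (v - w) \<zeta>) = (LINT \<zeta>|lborel. p \<zeta> * fourier_L2 v \<zeta> - p \<zeta> * fourier_L2 w \<zeta>)"
    by (rule integral_cong_AE) (measurable, use fourier_L2_diff[of v w] in \<open>eventually_elim\<close>, simp add: right_diff_distrib)
  then show "\<Lambda> (v - w) = \<Lambda> v - \<Lambda> w" unfolding \<Lambda>_def using i by simp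
  have "(LINT \<zeta>|lborel. p \<zeta> * fourier_L2 (a *\<^sub>R v) \<zeta>) = (LINT \<zeta>|lborel. complex_of_real a * (p \<zeta> * fourier_L2 v \<zeta>))"
    by (rule integral_cong_AE) (measurable, use fourier_L2_scale[of a v] in \<open>eventually_elim\<close>, simp)
  also have "\<dots> = complex_of_real a * (LINT \<zeta>|lborel. p \<zeta> * fourier_L2 v \<zeta>)" by (rule integral_mult_right_zero)
  finally show "\<Lambda> (a *\<^sub>R v) = a * \<Lambda> v" by (simp add: \<Lambda>_def)
  assume v: "v \<in> sobolev s1 s2"
  have "(LINT \<zeta>|lborel. p \<zeta> * fourier_L2 v \<zeta>) = (LINT \<zeta>|lborel. (p \<zeta> / complex_of_real (weight s1 s2 \<zeta>)) * wfourier s1 s2 v \<zeta>)"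
    using weight_pos[of s1 s2] by (intro Bochner_Integration.integral_cong) (auto simp: wfourier_def less_imp_neq[symmetric])
  also have "cmod \<dots> \<le> l2norm (\<lambda>\<zeta>. p \<zeta> / complex_of_real (weight s1 s2 \<zeta>)) * l2norm (wfourier s1 s2 v)"
    using v by (intro l2_Cauchy_Schwarz p) (simp add: sobolev_iff)
  finally show "\<bar>\<Lambda> v\<bar> \<le> l2norm (\<lambda>\<zeta>. p \<zeta> / complex_of_real (weight s1 s2 \<zeta>)) * sobolev_norm s1 s2 v"
    unfolding \<Lambda>_def sobolev_norm_eq using abs_Im_le_cmod order_trans by blast
qed

text \<open>K is the bound of the second derivative at 0 and is fixed before the datum and the test
  function; this uniformity is what the resonant data will contradict. Restricting the flow to the
  line through \<open>\<phi>\<close> and pairing with \<open>\<theta>\<close> leaves a second-order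
  statement on the real line.\<close>

lemma C2_flow_bounds_picard_rate:
  assumes s1: "1 \<le> s1" and t: "0 < t"
    and U: "open_wrt (sobolev s1 s2) (sobolev_norm s1 s2) U" "0 \<in> U" "U \<subseteq> flow_domain \<alpha> s1 s2 t"
    and C2: "C2_on_wrt (sobolev s1 s2) (sobolev_norm s1 s2) U (flow \<alpha> s1 s2 t)"
  shows "\<exists>K\<ge>0. \<forall>\<phi> f \<theta> c. \<phi> \<in> sobolev s1 s2 \<longrightarrow> sqint f \<longrightarrow> (AE \<zeta> in lborel. fourier_L2 \<phi> \<zeta> = f \<zeta>) \<longrightarrow>
    frequency_test \<theta> \<longrightarrow> (\<forall>\<zeta>. \<theta> \<zeta> * f \<zeta> = 0) \<longrightarrow> 0 < c \<longrightarrow>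
    (\<forall>\<tau>\<in>{0..t}. c \<le> Im (picard_rate \<alpha> \<theta> f \<tau>)) \<longrightarrow>
    c / 2 * t \<le> l2norm (\<lambda>\<zeta>. \<theta> \<zeta> / complex_of_real (weight s1 s2 \<zeta>)) * (K * (sobolev_norm s1 s2 \<phi>)\<^sup>2)"
proof -
  let ?V = "sobolev s1 s2" and ?N = "sobolev_norm s1 s2" and ?F = "flow \<alpha> s1 s2 t"
  have FV: "\<And>\<psi>. \<psi> \<in> U \<Longrightarrow> ?F \<psi> \<in> ?V" using C2 unfolding C2_on_wrt_def by blast
  obtain F' F'' where D: "\<forall>\<psi>\<in>U.
        bounded_linear_wrt ?V ?N (F' \<psi>) \<and>
        (\<forall>e>0. \<exists>d>0. \<forall>h\<in>?V. ?N h < d \<longrightarrow> \<psi> + h \<in> U \<longrightarrow> ?N (?F (\<psi> + h) - ?F \<psi> - F' \<psi> h) \<le> e * ?N h) \<and>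
        bounded_bilinear_wrt ?V ?N (F'' \<psi>) \<and>
        (\<forall>e>0. \<exists>d>0. \<forall>h\<in>?V. ?N h < d \<longrightarrow> \<psi> + h \<in> U \<longrightarrow>
           (\<forall>k\<in>?V. ?N (F' (\<psi> + h) k - F' \<psi> k - F'' \<psi> h k) \<le> e * ?N h * ?N k)) \<and>
        (\<forall>e>0. \<exists>d>0. \<forall>h\<in>?V. ?N h < d \<longrightarrow> \<psi> + h \<in> U \<longrightarrow>
           (\<forall>k\<in>?V. \<forall>l\<in>?V. ?N (F'' (\<psi> + h) k l - F'' \<psi> k l) \<le> e * ?N k * ?N l))"
    using C2[unfolded C2_on_wrt_def, THEN conjunct2] by (elim exE) (rule that)
  note F' = bspec[OF D, THEN conjunct1]
  note F'_der = bspec[OF D, THEN conjunct2, THEN conjunct1, THEN spec, THEN mp]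
  note F'' = bspec[OF D, THEN conjunct2, THEN conjunct2, THEN conjunct1]
  note F''_der = bspec[OF D, THEN conjunct2, THEN conjunct2, THEN conjunct2, THEN conjunct1, THEN spec, THEN mp]
  obtain K0 where K0: "\<And>h k. h \<in> ?V \<Longrightarrow> k \<in> ?V \<Longrightarrow> ?N (F'' 0 h k) \<le> K0 * ?N h * ?N k"
    using F''[OF U(2)] unfolding bounded_bilinear_wrt_def by blast
  define K where "K = \<bar>K0\<bar>"
  have N0: "0 \<le> ?N h" for h by (simp add: sobolev_norm_eq)
  have K: "?N (F'' 0 h k) \<le> K * ?N h * ?N k" if "h \<in> ?V" "k \<in> ?V" for h k
  proof -
    have "K0 * (?N h * ?N k) \<le> K * (?N h * ?N k)" by (intro mult_right_mono) (auto simp: K_def N0)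
    then show ?thesis using K0[OF that] by (simp add: mult.assoc)
  qed
  have "c / 2 * t \<le> l2norm (\<lambda>\<zeta>. \<theta> \<zeta> / complex_of_real (weight s1 s2 \<zeta>)) * (K * (?N \<phi>)\<^sup>2)"
    if \<phi>V: "\<phi> \<in> ?V" and f: "sqint f" and \<phi>f: "AE \<zeta> in lborel. fourier_L2 \<phi> \<zeta> = f \<zeta>" and \<theta>: "frequency_test \<theta>"
      and disj: "\<forall>\<zeta>. \<theta> \<zeta> * f \<zeta> = 0" and c: "0 < c" and rate: "\<forall>\<tau>\<in>{0..t}. c \<le> Im (picard_rate \<alpha> \<theta> f \<tau>)"
    for \<phi> f \<theta> c
  proof -
    define p where "p = propagate \<alpha> t \<theta>"
    define pw where "pw \<zeta> = p \<zeta> / complex_of_real (weight s1 s2 \<zeta>)" for \<zeta>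
    define \<theta>w where "\<theta>w \<zeta> = \<theta> \<zeta> / complex_of_real (weight s1 s2 \<zeta>)" for \<zeta>
    have \<theta>s: "sqint \<theta>" by (rule frequency_test_sqint[OF \<theta>])
    have ps: "sqint p" unfolding p_def by (rule sqint_propagate[OF \<theta>s])
    have pm [measurable]: "p \<in> borel_measurable borel" by (rule sqint_measurable[OF ps])
    have pws: "sqint pw"
    proof (rule l2norm_mono_norm(1)[OF ps])
      show "pw \<in> borel_measurable borel" unfolding pw_def by measurable
      show "cmod (pw \<zeta>) \<le> cmod (p \<zeta>)" for \<zeta>
        using weight_ge(1)[OF s1, of s2 \<zeta>] mult_left_mono[OF weight_ge(1)[OF s1, of s2 \<zeta>], of "cmod (p \<zeta>)"]
        by (simp add: pw_def norm_divide divide_le_eq)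
    qed
    have pw_n: "l2norm pw = l2norm \<theta>w"
      by (rule l2norm_cong_norm) (simp add: pw_def \<theta>w_def p_def propagate_def norm_mult norm_divide)
    define \<Lambda> where "\<Lambda> v = Im (LINT \<zeta>|lborel. p \<zeta> * fourier_L2 v \<zeta>)" for v
    define L where "L = l2norm \<theta>w"
    have L0: "0 \<le> L" by (simp add: L_def)
    note wf = weighted_functional[OF pws[unfolded pw_def] ps, folded \<Lambda>_def pw_def]
    have \<Lambda>_le: "\<bar>\<Lambda> v\<bar> \<le> L * ?N v" if "v \<in> ?V" for v using wf(3)[OF that] pw_n by (simp add: L_def)
    obtain r where r: "0 < r" "\<And>h. h \<in> ?V \<Longrightarrow> ?N h < r \<Longrightarrow> h \<in> U"
      using U(1,2) unfolding open_wrt_def by force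
    obtain d0 where d0: "0 < d0" and growth: "\<And>d T u. \<bar>d\<bar> < d0 \<Longrightarrow> t \<le> T \<Longrightarrow> cauchy_solution \<alpha> s1 s2 T (d *\<^sub>R \<phi>) u \<Longrightarrow>
        c / 2 * t * d\<^sup>2 \<le> Im (LINT \<zeta>|lborel. propagate \<alpha> t \<theta> \<zeta> * fourier_L2 (u t) \<zeta>)"
      using quadratic_growth_of_pairing[OF s1 f \<phi>f _ \<theta> _ c, of t \<alpha> s2] t disj rate by (meson less_imp_le)
    define n where "n = ?N \<phi>"
    have n0: "0 \<le> n" using N0 by (simp add: n_def)
    \<comment> \<open>For \<open>\<bar>s\<bar> < s0\<close> the point lies in U and the growth bound
      applies; n may be 0, hence the divisor n + 1.\<close>
    define s0 where "s0 = min d0 (r / (n + 1))"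
    have s0: "0 < s0" using d0 r(1) n0 by (simp add: s0_def)
    have sV: "s *\<^sub>R \<phi> \<in> ?V" "?N (s *\<^sub>R \<phi>) = \<bar>s\<bar> * n" for s using sobolev_scale[OF \<phi>V] by (auto simp: n_def)
    have sU: "s *\<^sub>R \<phi> \<in> U" if "\<bar>s\<bar> < s0" for s
    proof (rule r(2)[OF sV(1)])
      have "\<bar>s\<bar> * (n + 1) < r" using that n0 by (simp add: s0_def pos_less_divide_eq)
      then show "?N (s *\<^sub>R \<phi>) < r" unfolding sV(2) by (simp add: algebra_simps)
    qed
    define g where "g s = \<Lambda> (?F (s *\<^sub>R \<phi>))" for s
    define g1 where "g1 s = \<Lambda> (F' (s *\<^sub>R \<phi>) \<phi>)" for s
    define q where "q = \<Lambda> (F'' 0 \<phi> \<phi>)"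
    have "c / 2 * t \<le> \<bar>q\<bar>"
    proof (rule second_order_lower_bound[OF s0, of g g1])
      fix s assume s: "\<bar>s\<bar> < s0"
      show "(g has_real_derivative g1 s) (at s)"
        unfolding has_field_derivative_def has_derivative_at_alt
      proof (intro conjI allI impI)
        show "bounded_linear ((*) (g1 s))" by (rule bounded_linear_mult_right)
        fix e :: real assume e: "0 < e"
        \<comment> \<open>Scaled to absorb the dual norm L and the norm n of \<open>\<phi>\<close>;
          the added 1 covers \<open>L * n = 0\<close>.\<close>
        define e' where "e' = e / (L * n + 1)"
        have Ln: "0 < L * n + 1" using L0 n0 by (simp add: add_nonneg_pos)
        have e': "0 < e'" using e Ln by (simp add: e'_def)
        obtain d where d: "0 < d" "\<And>h. h \<in> ?V \<Longrightarrow> ?N h < d \<Longrightarrow> s *\<^sub>R \<phi> + h \<in> U \<Longrightarrow>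
            ?N (?F (s *\<^sub>R \<phi> + h) - ?F (s *\<^sub>R \<phi>) - F' (s *\<^sub>R \<phi>) h) \<le> e' * ?N h"
          using F'_der[OF sU[OF s] e'] by blast
        define d1 where "d1 = min (d / (n + 1)) (s0 - \<bar>s\<bar>)"
        have d1: "0 < d1" using d(1) n0 s by (simp add: d1_def)
        have "norm (g y - g s - g1 s * (y - s)) \<le> e * norm (y - s)" if y: "norm (y - s) < d1" for y
        proof -
          define h where "h = (y - s) *\<^sub>R \<phi>"
          have yh: "y *\<^sub>R \<phi> = s *\<^sub>R \<phi> + h" by (simp add: h_def algebra_simps)
          have "\<bar>y - s\<bar> < s0 - \<bar>s\<bar>" using y by (simp add: d1_def)
          then have ys: "\<bar>y\<bar> < s0" by linarith
          have hV: "h \<in> ?V" and hN: "?N h = \<bar>y - s\<bar> * n" unfolding h_def by (rule sV)+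
          have "\<bar>y - s\<bar> * (n + 1) < d" using y n0 by (simp add: d1_def pos_less_divide_eq)
          then have "?N h < d" unfolding hN by (simp add: algebra_simps)
          then have le: "?N (?F (y *\<^sub>R \<phi>) - ?F (s *\<^sub>R \<phi>) - F' (s *\<^sub>R \<phi>) h) \<le> e' * ?N h"
            unfolding yh using sU[OF ys] by (intro d(2) hV) (simp_all add: yh)
          have F'V: "F' (s *\<^sub>R \<phi>) h \<in> ?V" and F'h: "F' (s *\<^sub>R \<phi>) h = (y - s) *\<^sub>R F' (s *\<^sub>R \<phi>) \<phi>"
            using F'[OF sU[OF s]] hV \<phi>V unfolding bounded_linear_wrt_def h_def by auto
          have "g y - g s - g1 s * (y - s) = \<Lambda> (?F (y *\<^sub>R \<phi>) - ?F (s *\<^sub>R \<phi>) - F' (s *\<^sub>R \<phi>) h)"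
            unfolding wf(1) F'h wf(2) by (simp add: g_def g1_def mult.commute)
          also have "\<bar>\<dots>\<bar> \<le> L * (e' * ?N h)"
          proof -
            have "\<bar>\<Lambda> (?F (y *\<^sub>R \<phi>) - ?F (s *\<^sub>R \<phi>) - F' (s *\<^sub>R \<phi>) h)\<bar> \<le> L * ?N (?F (y *\<^sub>R \<phi>) - ?F (s *\<^sub>R \<phi>) - F' (s *\<^sub>R \<phi>) h)"
              by (intro \<Lambda>_le sobolev_diff(1) FV sU ys s F'V)
            also have "\<dots> \<le> L * (e' * ?N h)" by (intro mult_left_mono le L0)
            finally show ?thesis .
          qed
          also have "L * (e' * ?N h) = (L * n) * e' * \<bar>y - s\<bar>" by (simp add: hN mult_ac)
          also have "\<dots> \<le> (L * n + 1) * e' * \<bar>y - s\<bar>" using e' by (intro mult_right_mono) auto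
          also have "\<dots> = e * \<bar>y - s\<bar>" using Ln by (simp add: e'_def)
          finally show ?thesis by simp
        qed
        then show "\<exists>d>0. \<forall>y. norm (y - s) < d \<longrightarrow> norm (g y - g s - g1 s * (y - s)) \<le> e * norm (y - s)" using d1 by blast
      qed
    next
      fix e :: real assume e: "0 < e"
      define e' where "e' = e / (L * n * n + 1)"
      have Ln: "0 < L * n * n + 1" using L0 n0 by (simp add: add_nonneg_pos)
      have e': "0 < e'" using e Ln by (simp add: e'_def)
      obtain d where d: "0 < d" "\<And>h. h \<in> ?V \<Longrightarrow> ?N h < d \<Longrightarrow> 0 + h \<in> U \<Longrightarrow>
          (\<forall>k\<in>?V. ?N (F' (0 + h) k - F' 0 k - F'' 0 h k) \<le> e' * ?N h * ?N k)"
        using F''_der[OF U(2) e'] by blast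
      define d1 where "d1 = min (d / (n + 1)) s0"
      have d1: "0 < d1" using d(1) n0 s0 by (simp add: d1_def)
      have "\<bar>g1 s - g1 0 - s * q\<bar> \<le> e * \<bar>s\<bar>" if s: "\<bar>s\<bar> < d1" for s
      proof -
        have ss: "\<bar>s\<bar> < s0" using s by (simp add: d1_def)
        have "\<bar>s\<bar> * (n + 1) < d" using s n0 by (simp add: d1_def pos_less_divide_eq)
        then have "?N (s *\<^sub>R \<phi>) < d" unfolding sV(2) by (simp add: algebra_simps)
        then have le: "?N (F' (s *\<^sub>R \<phi>) \<phi> - F' 0 \<phi> - F'' 0 (s *\<^sub>R \<phi>) \<phi>) \<le> e' * ?N (s *\<^sub>R \<phi>) * ?N \<phi>"
          using d(2)[OF sV(1)] sU[OF ss] \<phi>V by simp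
        have F''h: "F'' 0 (s *\<^sub>R \<phi>) \<phi> = s *\<^sub>R F'' 0 \<phi> \<phi>"
          using F''[OF U(2)] \<phi>V unfolding bounded_bilinear_wrt_def by blast
        have F''V: "F'' 0 (s *\<^sub>R \<phi>) \<phi> \<in> ?V"
          using F''[OF U(2)] \<phi>V sV(1) unfolding bounded_bilinear_wrt_def by blast
        have F'V: "F' (s *\<^sub>R \<phi>) \<phi> \<in> ?V" "F' 0 \<phi> \<in> ?V"
          using F'[OF sU[OF ss]] F'[OF U(2)] \<phi>V unfolding bounded_linear_wrt_def by auto
        have "g1 s - g1 0 - s * q = \<Lambda> (F' (s *\<^sub>R \<phi>) \<phi> - F' 0 \<phi> - F'' 0 (s *\<^sub>R \<phi>) \<phi>)"
          unfolding wf(1) F''h wf(2) by (simp add: g1_def q_def)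
        also have "\<bar>\<dots>\<bar> \<le> L * ?N (F' (s *\<^sub>R \<phi>) \<phi> - F' 0 \<phi> - F'' 0 (s *\<^sub>R \<phi>) \<phi>)"
          by (intro \<Lambda>_le sobolev_diff(1) F'V F''V)
        also have "\<dots> \<le> L * (e' * ?N (s *\<^sub>R \<phi>) * ?N \<phi>)" by (intro mult_left_mono le L0)
        also have "\<dots> = (L * n * n) * e' * \<bar>s\<bar>" unfolding sV(2) n_def[symmetric] by (simp add: mult_ac)
        also have "\<dots> \<le> (L * n * n + 1) * e' * \<bar>s\<bar>" using e' by (intro mult_right_mono) auto
        also have "\<dots> = e * \<bar>s\<bar>" using Ln by (simp add: e'_def)
        finally show ?thesis .
      qed
      then show "\<exists>d>0. \<forall>s. \<bar>s\<bar> < d \<longrightarrow> \<bar>g1 s - g1 0 - s * q\<bar> \<le> e * \<bar>s\<bar>" using d1 by blast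
    next
      show "c / 2 * t * s\<^sup>2 \<le> g s" if s: "\<bar>s\<bar> < s0" for s
      proof -
        obtain T u where "t \<le> T" "cauchy_solution \<alpha> s1 s2 T (s *\<^sub>R \<phi>) u" "?F (s *\<^sub>R \<phi>) = u t"
          using flow_is_solution sU[OF s] U(3) by blast
        then show ?thesis using growth[of s T u] s by (simp add: g_def \<Lambda>_def p_def s0_def)
      qed
      \<comment> \<open>For zero datum the conservation law makes the transform of the solution
        vanish almost everywhere, hence \<open>g 0 = 0\<close>.\<close>
      obtain T u where T: "t \<le> T" and sol: "cauchy_solution \<alpha> s1 s2 T 0 u" and Fu: "?F 0 = u t"
        using flow_is_solution U(2,3) by blast
      have "l2norm (fourier_L2 0) = 0" using l2norm_fourier_L2_diff[of 0 0] by (simp add: l2norm_def)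
      then have "l2norm (fourier_L2 (u t)) = 0" using energy_conservation[OF s1 sol, of t] t T by simp
      then have "cmod (LINT \<zeta>|lborel. p \<zeta> * fourier_L2 (u t) \<zeta>) \<le> 0"
        using l2_Cauchy_Schwarz[OF ps sqint_fourier_L2[of "u t"]] by simp
      then show "g 0 = 0" using Fu by (simp add: g_def \<Lambda>_def)
      show "0 < c / 2 * t" using c t by simp
    qed
    also have "\<bar>q\<bar> \<le> L * ?N (F'' 0 \<phi> \<phi>)"
      unfolding q_def using F''[OF U(2)] \<phi>V by (intro \<Lambda>_le) (simp add: bounded_bilinear_wrt_def)
    also have "\<dots> \<le> L * (K * ?N \<phi> * ?N \<phi>)" by (intro mult_left_mono K \<phi>V L0)
    finally show ?thesis by (simp add: L_def \<theta>w_def[abs_def] power2_eq_square mult.assoc)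
  qed
  moreover have "0 \<le> K" by (simp add: K_def)
  ultimately show ?thesis by blast
qed

section \<open>The resonant datum\<close>

text \<open>\<open>L2\<close> contains real functions only, and evenness of p is what makes its
  inverse transform real. For an even p the forward and the inverse transform agree, so the datum is
  the real part of \<open>fourierc\<close> of p.\<close>

lemma even_profile_exists:
  fixes p :: "plane \<Rightarrow> real"
  assumes p: "sqint (\<lambda>z. complex_of_real (p z))" "integrable lborel p" and even: "\<And>z. p (- z) = p z"
  shows "\<exists>\<phi>. AE \<zeta> in lborel. fourier_L2 \<phi> \<zeta> = complex_of_real (p \<zeta>)"
proof -
  define f where "f z = complex_of_real (p z)" for z
  have f: "sqint f" "integrable lborel f" using p by (simp_all add: f_def[abs_def])
  have cnj_f: "(\<lambda>z. cnj (f z)) = f" by (simp add: f_def[abs_def])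
  have "fourierc f \<zeta> = cnj (fourierc f \<zeta>)" for \<zeta>
  proof -
    have "fourierc f \<zeta> = fourierc (\<lambda>z. f (0 - z)) \<zeta>" using even by (simp add: f_def[abs_def])
    also have "\<dots> = fourierc f (- \<zeta>)"
    proof -
      have [measurable]: "f \<in> borel_measurable borel" by (rule sqint_measurable[OF f(1)])
      show ?thesis
        using lborel_plane_reflect(1)[of "\<lambda>z. f z * cis (z \<bullet> \<zeta>)" 0] by (simp add: fourierc_def)
    qed
    also have "\<dots> = cnj (fourierc (\<lambda>z. cnj (f z)) \<zeta>)"
      using fourierc_cnj_reflect[OF sqint_measurable[OF f(1)], of \<zeta>] by simp
    finally show ?thesis by (simp only: cnj_f)
  qed
  then have real: "complex_of_real (Re (fourierc f \<zeta>)) = fourierc f \<zeta>" for \<zeta>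
    by (metis Reals_cnj_iff complex_is_Real_iff of_real_Re)
  obtain k where k: "ft (\<lambda>z. cnj (f z)) k" "ft (\<lambda>z. cnj (k z)) f" using ft_surjective[OF f(1)] by blast
  have "ft f k" using k(1) by (simp only: cnj_f)
  then have kF: "AE z in lborel. k z = fourierc f z" by (rule ft_unique) (rule ft_fourierc[OF f])
  define q where "q z = Re (fourierc f z)" for z
  have Fs: "sqint (fourierc f)" using ft_sqint(2)[OF ft_fourierc[OF f]] .
  have qs: "square_integrable q" using Fs sqint_of_real[of q] real by (simp add: q_def)
  have "ft (\<lambda>z. complex_of_real (rep_L2 (abs_L2 q) z)) f"
  proof (rule ft_cong_AE[OF k(2)])
    show "(\<lambda>z. complex_of_real (rep_L2 (abs_L2 q) z)) \<in> borel_measurable borel" by (rule sqint_measurable[OF sqint_rep_L2])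
    show "AE z in lborel. cnj (k z) = complex_of_real (rep_L2 (abs_L2 q) z)"
      using kF rep_L2_abs[OF qs]
    proof eventually_elim
      case (elim z)
      have "cnj (fourierc f z) = fourierc f z" using real[of z] by (metis complex_cnj_complex_of_real)
      then show ?case using elim real[of z] by (simp add: q_def)
    qed
  qed (use sqint_measurable[OF f(1)] in auto)
  from fourier_L2_unique[OF this] show ?thesis by (auto simp: f_def)
qed

lemma cos_ge_half: "\<bar>x\<bar> \<le> 1 \<Longrightarrow> 1 / 2 \<le> cos (x :: real)"
proof -
  assume x: "\<bar>x\<bar> \<le> 1"
  have "cos x = 1 - 2 * (sin (x / 2))\<^sup>2" using cos_double_sin[of "x / 2"] by simp
  moreover have "(sin (x / 2))\<^sup>2 \<le> (1 / 2)\<^sup>2"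
  proof -
    have "\<bar>sin (x / 2)\<bar> \<le> 1 / 2" using abs_sin_x_le_abs_x[of "x / 2"] x by simp
    then have "\<bar>sin (x / 2)\<bar>\<^sup>2 \<le> (1 / 2)\<^sup>2" by (rule power_mono) simp
    then show ?thesis by simp
  qed
  ultimately show ?thesis by (simp add: power2_eq_square)
qed

section \<open>Comparison of weights on frequency blocks\<close>

lemma bracket_compare:
  assumes "\<bar>x\<bar> \<le> 2 * \<bar>y\<bar>" shows "bracket x \<le> 2 * bracket y"
proof -
  have "x\<^sup>2 \<le> (2 * y)\<^sup>2" using assms abs_le_square_iff[of x "2 * y"] by (simp add: abs_mult)
  then have "1 + x\<^sup>2 \<le> 2\<^sup>2 * (1 + y\<^sup>2)" by (simp add: power_mult_distrib)
  then have "sqrt (1 + x\<^sup>2) \<le> sqrt (2\<^sup>2 * (1 + y\<^sup>2))" by (rule real_sqrt_le_mono)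
  then show ?thesis unfolding bracket_def by (simp only: real_sqrt_mult real_sqrt_abs abs_numeral)
qed

lemma powr_compare:
  fixes p q s :: real
  assumes "0 < p" "0 < q" "p \<le> 2 * q" "q \<le> 2 * p"
  shows "p powr s \<le> 2 powr \<bar>s\<bar> * q powr s"
proof (cases "0 \<le> s")
  case True
  have "p powr s \<le> (2 * q) powr s" using assms True by (intro powr_mono2) auto
  then show ?thesis using assms True by (simp add: powr_mult)
next
  case False
  have "(2 * p) powr s \<le> q powr s" using assms False by (intro powr_mono2') auto
  then have "2 powr (- s) * (2 powr s * p powr s) \<le> 2 powr (- s) * q powr s"
    using assms by (intro mult_left_mono) (auto simp: powr_mult)
  then show ?thesis using False by (simp add: powr_minus field_simps)
qed

text \<open>Each bracket varies by a factor of at most 2 when its argument does, so the weight is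
  essentially constant on the high blocks, with a constant that does not involve N. The absolute
  values allow exponents of either sign.\<close>

lemma weight_compare:
  assumes "\<bar>fst x\<bar> \<le> 2 * \<bar>fst y\<bar>" "\<bar>fst y\<bar> \<le> 2 * \<bar>fst x\<bar>" "\<bar>snd x\<bar> \<le> 2 * \<bar>snd y\<bar>" "\<bar>snd y\<bar> \<le> 2 * \<bar>snd x\<bar>"
  shows "weight s1 s2 x \<le> 2 powr (\<bar>s1\<bar> + \<bar>s2\<bar>) * weight s1 s2 y"
proof -
  define R where "R = (2::real) powr (2 * (\<bar>s1\<bar> + \<bar>s2\<bar>))"
  have cmp: "bracket a powr (2 * s) \<le> R * bracket b powr (2 * s)"
    if "\<bar>a\<bar> \<le> 2 * \<bar>b\<bar>" "\<bar>b\<bar> \<le> 2 * \<bar>a\<bar>" "\<bar>s\<bar> \<le> \<bar>s1\<bar> + \<bar>s2\<bar>" for a b s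
  proof -
    have "bracket a powr (2 * s) \<le> 2 powr \<bar>2 * s\<bar> * bracket b powr (2 * s)"
      using bracket_ge_1[of a] bracket_ge_1[of b] bracket_compare that by (intro powr_compare) auto
    also have "\<dots> \<le> R * bracket b powr (2 * s)"
      unfolding R_def using that(3) by (intro mult_right_mono powr_mono) auto
    finally show ?thesis .
  qed
  have "bracket (fst x) powr (2 * s1) + bracket (snd x) powr (2 * s2)
      \<le> R * (bracket (fst y) powr (2 * s1) + bracket (snd y) powr (2 * s2))"
    unfolding distrib_left by (intro add_mono cmp assms) auto
  then have "weight s1 s2 x \<le> sqrt (R * (bracket (fst y) powr (2 * s1) + bracket (snd y) powr (2 * s2)))"
    unfolding weight_def by (rule real_sqrt_le_mono)
  also have "\<dots> = sqrt R * weight s1 s2 y" by (simp add: weight_def real_sqrt_mult)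
  also have "sqrt R = 2 powr (\<bar>s1\<bar> + \<bar>s2\<bar>)"
    unfolding R_def by (rule real_sqrt_unique) (simp_all add: power2_eq_square flip: powr_add)
  finally show ?thesis .
qed

lemma weight_minus [simp]: "weight s1 s2 (- x) = weight s1 s2 x"
  by (simp add: weight_def bracket_def)

lemma weight_low_frequency:
  assumes "\<bar>fst x\<bar> \<le> 1" "\<bar>snd x\<bar> \<le> 1"
  shows "weight s1 s2 x \<le> 2 * 2 powr (\<bar>s1\<bar> + \<bar>s2\<bar>)"
proof -
  define R where "R = (2::real) powr (2 * (\<bar>s1\<bar> + \<bar>s2\<bar>))"
  have le: "bracket a powr (2 * s) \<le> R" if "\<bar>a\<bar> \<le> 1" "\<bar>s\<bar> \<le> \<bar>s1\<bar> + \<bar>s2\<bar>" for a s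
  proof -
    have "1 + a\<^sup>2 \<le> 2\<^sup>2" using that(1) power_mono[of "\<bar>a\<bar>" 1 2] by simp
    then have b: "bracket a \<le> 2" unfolding bracket_def by (intro real_le_lsqrt) auto
    have "bracket a powr (2 * s) \<le> 2 powr \<bar>2 * s\<bar> * 1 powr (2 * s)"
      using bracket_ge_1[of a] b by (intro powr_compare) auto
    also have "\<dots> \<le> R" unfolding R_def using that(2) by (simp add: powr_mono)
    finally show ?thesis .
  qed
  have "bracket (fst x) powr (2 * s1) \<le> R" "bracket (snd x) powr (2 * s2) \<le> R" "0 \<le> R"
    by (rule le[OF assms(1)], simp, rule le[OF assms(2)], simp, simp add: R_def)
  then have "bracket (fst x) powr (2 * s1) + bracket (snd x) powr (2 * s2) \<le> 2\<^sup>2 * R" by simp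
  then have "weight s1 s2 x \<le> sqrt (2\<^sup>2 * R)" unfolding weight_def by (rule real_sqrt_le_mono)
  also have "\<dots> = 2 * sqrt R" by (simp add: real_sqrt_mult)
  also have "sqrt R = 2 powr (\<bar>s1\<bar> + \<bar>s2\<bar>)"
    unfolding R_def by (rule real_sqrt_unique) (simp_all add: power2_eq_square flip: powr_add)
  finally show ?thesis .
qed

text \<open>The point \<open>(N, H)\<close> is chosen on the curve \<open>\<partial>\<^sub>\<xi> \<omega> = 0\<close>, so that a perturbation in \<open>\<xi>\<close>
  changes the phase only to second order; this is why low frequencies of size \<open>a \<sim> N\<^sup>-\<^sup>1\<^sup>/\<^sup>2\<close> are admissible.\<close>

lemma resonance:
  fixes \<beta> N H a b \<xi>1 \<xi>2 \<eta>1 \<eta>2 :: real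
  assumes \<beta>: "0 < \<beta>" "\<beta> \<le> 1" and N: "1 \<le> N" and a: "0 < a" "a \<le> 1" and b: "0 < b" "b \<le> H"
    and H: "\<beta> * N powr (- \<beta> - 1) * H\<^sup>2 = 3 * N\<^sup>2"
    and \<xi>1: "N \<le> \<xi>1" "\<xi>1 \<le> N + a" and \<xi>2: "a / 2 \<le> \<xi>2" "\<xi>2 \<le> a"
    and \<eta>1: "H \<le> \<eta>1" "\<eta>1 \<le> H + b" and \<eta>2: "\<bar>\<eta>2\<bar> \<le> b"
  shows "\<bar>dispersion (- \<beta>) ((\<xi>1, \<eta>1) + (\<xi>2, \<eta>2)) - dispersion (- \<beta>) (\<xi>1, \<eta>1) - dispersion (- \<beta>) (\<xi>2, \<eta>2)\<bar>
    \<le> a * (24 * a * N + 12 * a\<^sup>2 + 9 * N\<^sup>2 * b / H) + 5 * N powr (- \<beta>) * H * b + 2 * b\<^sup>2 / a"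
proof -
  have H0: "0 < H" using b by simp
  define p where "p \<xi> = \<xi> powr (- \<beta>)" for \<xi> :: real
  have pos: "0 < \<xi>1" "0 < \<xi>2" "0 < \<xi>1 + \<xi>2" using N \<xi>1 \<xi>2 a by auto
  have "\<exists>c. \<xi>1 < c \<and> c < \<xi>1 + \<xi>2 \<and> p (\<xi>1 + \<xi>2) - p \<xi>1 = (\<xi>1 + \<xi>2 - \<xi>1) * (- \<beta> * c powr (- \<beta> - 1))"
  proof (rule MVT2)
    show "(p has_real_derivative - \<beta> * x powr (- \<beta> - 1)) (at x)" if "\<xi>1 \<le> x" "x \<le> \<xi>1 + \<xi>2" for x
      unfolding p_def using that pos by (intro has_real_derivative_powr) auto
  qed (use pos in simp)
  then obtain c where c: "\<xi>1 < c" "c < \<xi>1 + \<xi>2" and pc: "p (\<xi>1 + \<xi>2) - p \<xi>1 = - \<beta> * c powr (- \<beta> - 1) * \<xi>2" by auto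
  \<comment> \<open>The change of the second term of the dispersion per unit of
    \<open>\<xi>2\<close>, up to sign. At \<open>(N, H)\<close> the corresponding quantity equals
    \<open>3 * N^2\<close>, so the difference with \<open>3 * \<xi>1 * (\<xi>1 + \<xi>2)\<close> has
    no leading term.\<close>
  define q where "q = \<beta> * c powr (- \<beta> - 1) * \<eta>1\<^sup>2"
  have split: "dispersion (- \<beta>) ((\<xi>1, \<eta>1) + (\<xi>2, \<eta>2)) - dispersion (- \<beta>) (\<xi>1, \<eta>1) - dispersion (- \<beta>) (\<xi>2, \<eta>2)
      = \<xi>2 * (3 * \<xi>1 * (\<xi>1 + \<xi>2) - q) + p (\<xi>1 + \<xi>2) * (2 * \<eta>1 * \<eta>2 + \<eta>2\<^sup>2) - p \<xi>2 * \<eta>2\<^sup>2"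
  proof -
    have "dispersion (- \<beta>) ((\<xi>1, \<eta>1) + (\<xi>2, \<eta>2)) - dispersion (- \<beta>) (\<xi>1, \<eta>1) - dispersion (- \<beta>) (\<xi>2, \<eta>2)
        = (\<xi>1 + \<xi>2) ^ 3 - \<xi>1 ^ 3 - \<xi>2 ^ 3 + (p (\<xi>1 + \<xi>2) - p \<xi>1) * \<eta>1\<^sup>2
          + p (\<xi>1 + \<xi>2) * (2 * \<eta>1 * \<eta>2 + \<eta>2\<^sup>2) - p \<xi>2 * \<eta>2\<^sup>2"
      using pos by (simp add: dispersion_def p_def power2_sum algebra_simps)
    also have "(p (\<xi>1 + \<xi>2) - p \<xi>1) * \<eta>1\<^sup>2 = - \<xi>2 * q" unfolding pc q_def by simp
    also have "(\<xi>1 + \<xi>2) ^ 3 - \<xi>1 ^ 3 - \<xi>2 ^ 3 = \<xi>2 * (3 * \<xi>1 * (\<xi>1 + \<xi>2))"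
      by (simp add: power3_eq_cube algebra_simps)
    finally show ?thesis by (simp add: algebra_simps)
  qed
  have A_lower: "3 * N\<^sup>2 \<le> 3 * \<xi>1 * (\<xi>1 + \<xi>2)"
  proof -
    have "N * N \<le> \<xi>1 * (\<xi>1 + \<xi>2)" using N \<xi>1 pos by (intro mult_mono) auto
    then show ?thesis by (simp add: power2_eq_square)
  qed
  have A_upper: "3 * \<xi>1 * (\<xi>1 + \<xi>2) \<le> 3 * N\<^sup>2 + 12 * a * N + 12 * a\<^sup>2"
  proof -
    have "\<xi>1 * (\<xi>1 + \<xi>2) \<le> (N + 2 * a) * (N + 2 * a)" using N \<xi>1 \<xi>2 a pos by (intro mult_mono) auto
    then show ?thesis by (simp add: power2_eq_square algebra_simps)
  qed
  have cN: "N \<le> c" "c \<le> N + 2 * a" using c \<xi>1 \<xi>2 by auto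
  have q_upper: "q \<le> 3 * N\<^sup>2 + 9 * N\<^sup>2 * b / H"
  proof -
    have "q \<le> \<beta> * N powr (- \<beta> - 1) * (H + b)\<^sup>2"
      unfolding q_def using \<beta> N cN \<eta>1 H0 by (intro mult_mono power_mono powr_mono2' mult_nonneg_nonneg) auto
    also have "(H + b)\<^sup>2 \<le> H\<^sup>2 * (1 + 3 * b / H)"
    proof -
      have "b * b \<le> b * H" using b by (intro mult_left_mono) auto
      then show ?thesis using H0 by (simp add: power2_eq_square field_simps)
    qed
    then have "\<beta> * N powr (- \<beta> - 1) * (H + b)\<^sup>2 \<le> \<beta> * N powr (- \<beta> - 1) * (H\<^sup>2 * (1 + 3 * b / H))"
      using \<beta> by (intro mult_left_mono) auto
    also have "\<dots> = 3 * N\<^sup>2 * (1 + 3 * b / H)" unfolding H[symmetric] by (simp only: mult.assoc)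
    finally show ?thesis by (simp add: algebra_simps)
  qed
  have q_lower: "3 * N\<^sup>2 - 12 * a * N \<le> q"
  proof -
    \<comment> \<open>For \<open>x \<le> 1\<close> and exponent \<open>\<beta> + 1 \<le> 2\<close>
      the power is at least x^2, and x^2 is at least \<open>1 - 2 * (1 - x)\<close>.\<close>
    define x where "x = N / (N + 2 * a)"
    have x: "0 < x" "x \<le> 1" using N a by (auto simp: x_def)
    have "(1 - 4 * a / N) \<le> x\<^sup>2"
    proof -
      have le: "1 - x \<le> 2 * a / N"
      proof -
        have "1 - x = 2 * a / (N + 2 * a)" using N a by (simp add: x_def field_simps)
        also have "\<dots> \<le> 2 * a / N" using N a by (intro divide_left_mono) auto
        finally show ?thesis .
      qed
      have "1 - 4 * a / N = 1 - 2 * (2 * a / N)" by simp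
      also have "\<dots> \<le> 1 - 2 * (1 - x)" by (intro diff_left_mono mult_left_mono le) simp
      also have "\<dots> \<le> x\<^sup>2" using zero_le_power2[of "1 - x"] by (simp add: power2_eq_square algebra_simps)
      finally show ?thesis .
    qed
    also have "x\<^sup>2 = x powr 2" using x by simp
    also have "x powr 2 \<le> x powr (\<beta> + 1)" using x \<beta> by (intro powr_mono') auto
    finally have "3 * N\<^sup>2 * (1 - 4 * a / N) \<le> 3 * N\<^sup>2 * x powr (\<beta> + 1)" by (intro mult_left_mono) auto
    also have "\<dots> = \<beta> * (N + 2 * a) powr (- \<beta> - 1) * H\<^sup>2"
    proof -
      have "N powr (- \<beta> - 1) * x powr (\<beta> + 1) = (N + 2 * a) powr (- \<beta> - 1)"
      proof -
        have "x powr (\<beta> + 1) = N powr (\<beta> + 1) * (N + 2 * a) powr (- (\<beta> + 1))"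
          unfolding x_def powr_minus_divide[of "N + 2 * a" "\<beta> + 1"] using N a by (simp add: powr_divide)
        moreover have "N powr (- \<beta> - 1) * N powr (\<beta> + 1) = 1" using N by (simp flip: powr_add)
        ultimately show ?thesis by (simp add: mult.assoc[symmetric])
      qed
      then show ?thesis unfolding H[symmetric] by (simp add: mult_ac)
    qed
    also have "\<dots> \<le> q"
      unfolding q_def using \<beta> N a cN \<eta>1 H0 by (intro mult_mono power_mono powr_mono2' mult_nonneg_nonneg) auto
    finally have "3 * N\<^sup>2 * (1 - 4 * a / N) \<le> q" .
    moreover have "3 * N\<^sup>2 * (1 - 4 * a / N) = 3 * N\<^sup>2 - 12 * a * N" using N by (simp add: power2_eq_square field_simps)
    ultimately show ?thesis by simp
  qed
  have T1: "\<bar>\<xi>2 * (3 * \<xi>1 * (\<xi>1 + \<xi>2) - q)\<bar> \<le> a * (24 * a * N + 12 * a\<^sup>2 + 9 * N\<^sup>2 * b / H)"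
  proof -
    have "0 \<le> 9 * N\<^sup>2 * b / H" "0 \<le> a * N" using b H0 a N by auto
    then have "\<bar>3 * \<xi>1 * (\<xi>1 + \<xi>2) - q\<bar> \<le> 24 * a * N + 12 * a\<^sup>2 + 9 * N\<^sup>2 * b / H"
      using A_lower A_upper q_upper q_lower zero_le_power2[of a] by (intro abs_leI) linarith+
    then show ?thesis unfolding abs_mult using \<xi>2 pos by (intro mult_mono) auto
  qed
  have T2: "\<bar>p (\<xi>1 + \<xi>2) * (2 * \<eta>1 * \<eta>2 + \<eta>2\<^sup>2)\<bar> \<le> 5 * N powr (- \<beta>) * H * b"
  proof -
    have "p (\<xi>1 + \<xi>2) \<le> N powr (- \<beta>)" unfolding p_def using \<beta> N \<xi>1 pos by (intro powr_mono2') auto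
    moreover have "\<bar>2 * \<eta>1 * \<eta>2 + \<eta>2\<^sup>2\<bar> \<le> 5 * H * b"
    proof -
      have "\<bar>2 * \<eta>1 * \<eta>2 + \<eta>2\<^sup>2\<bar> \<le> 2 * (\<bar>\<eta>1\<bar> * \<bar>\<eta>2\<bar>) + \<bar>\<eta>2\<bar> * \<bar>\<eta>2\<bar>"
        using abs_triangle_ineq[of "2 * \<eta>1 * \<eta>2" "\<eta>2\<^sup>2"] by (simp add: abs_mult power2_eq_square)
      also have "\<dots> \<le> 2 * ((2 * H) * b) + H * b"
        using \<eta>1 \<eta>2 b H0 by (intro add_mono mult_left_mono mult_mono) auto
      finally show ?thesis by simp
    qed
    ultimately have "\<bar>p (\<xi>1 + \<xi>2)\<bar> * \<bar>2 * \<eta>1 * \<eta>2 + \<eta>2\<^sup>2\<bar> \<le> N powr (- \<beta>) * (5 * H * b)"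
      by (intro mult_mono) (auto simp: p_def)
    then show ?thesis by (simp add: abs_mult mult_ac)
  qed
  have T3: "\<bar>p \<xi>2 * \<eta>2\<^sup>2\<bar> \<le> 2 * b\<^sup>2 / a"
  proof -
    have "p \<xi>2 \<le> (a / 2) powr (- \<beta>)" unfolding p_def using \<beta> a \<xi>2 by (intro powr_mono2') auto
    also have "\<dots> \<le> (a / 2) powr (- 1)" using \<beta> a by (intro powr_mono') auto
    also have "\<dots> = 2 / a" using a by (simp add: powr_minus_divide)
    finally have p2: "p \<xi>2 \<le> 2 / a" .
    have e2: "\<eta>2\<^sup>2 \<le> b\<^sup>2" using \<eta>2 power_mono[of "\<bar>\<eta>2\<bar>" b 2] by simp
    have "p \<xi>2 * \<eta>2\<^sup>2 \<le> 2 / a * b\<^sup>2" using p2 e2 a by (intro mult_mono) auto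
    moreover have "0 \<le> p \<xi>2 * \<eta>2\<^sup>2" by (simp add: p_def)
    ultimately show ?thesis by simp
  qed
  show ?thesis unfolding split using T1 T2 T3 by linarith
qed

text \<open>The sizes are dictated by the error terms of \<open>resonance\<close>. Bounding
  \<open>a^2 * N\<close> gives a of order N^(-1/2); the critical curve gives H of order
  N^((3+\<open>\<beta>\<close>)/2), and bounding \<open>N powr (- \<beta>) * H * b\<close> then
  gives b of order N^(-(3-\<open>\<beta>\<close>)/2). The other terms stay bounded as well, and the
  constant k brings the total below \<open>\<delta>\<close>.\<close>

lemma resonance_scaling:
  fixes \<beta> \<delta> :: real
  assumes \<beta>: "0 < \<beta>" "\<beta> \<le> 1" and \<delta>: "0 < \<delta>"
  shows "\<exists>k. 0 < k \<and> (\<forall>N\<ge>1. \<exists>a b H. 0 < a \<and> a \<le> 1 \<and> 0 < b \<and> b \<le> 1 \<and> b \<le> H \<and> N \<le> H \<and> N * sqrt (a * b) = k * N powr (\<beta> / 4) \<and>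
    (\<forall>\<xi>1 \<xi>2 \<eta>1 \<eta>2. N \<le> \<xi>1 \<longrightarrow> \<xi>1 \<le> N + a \<longrightarrow> a / 2 \<le> \<xi>2 \<longrightarrow> \<xi>2 \<le> a \<longrightarrow> H \<le> \<eta>1 \<longrightarrow> \<eta>1 \<le> H + b \<longrightarrow> \<bar>\<eta>2\<bar> \<le> b \<longrightarrow>
      \<bar>dispersion (- \<beta>) ((\<xi>1, \<eta>1) + (\<xi>2, \<eta>2)) - dispersion (- \<beta>) (\<xi>1, \<eta>1) - dispersion (- \<beta>) (\<xi>2, \<eta>2)\<bar> \<le> \<delta>))"
proof -
  \<comment> \<open>With this factor \<open>H = r * N powr ((3 + \<beta>) / 2)\<close> solves the
    equation of the critical curve exactly.\<close>
  define r where "r = sqrt (3 / \<beta>)"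
  have r: "1 \<le> r" "r\<^sup>2 = 3 / \<beta>" using \<beta> by (auto simp: r_def)
  \<comment> \<open>The coefficients of the five error terms: 24 + 12 + 9 + 2 = 47, and
    \<open>5 * r\<close> from the term with H.\<close>
  define C where "C = 47 + 5 * r"
  have C: "0 < C" using r by (simp add: C_def)
  define k where "k = min 1 (\<delta> / C)"
  have k: "0 < k" "k \<le> 1" "k * C \<le> \<delta>" using \<delta> C by (auto simp: k_def min_def pos_le_divide_eq)
  have "\<exists>a b H. 0 < a \<and> a \<le> 1 \<and> 0 < b \<and> b \<le> 1 \<and> b \<le> H \<and> N \<le> H \<and> N * sqrt (a * b) = k * N powr (\<beta> / 4) \<and>
    (\<forall>\<xi>1 \<xi>2 \<eta>1 \<eta>2. N \<le> \<xi>1 \<longrightarrow> \<xi>1 \<le> N + a \<longrightarrow> a / 2 \<le> \<xi>2 \<longrightarrow> \<xi>2 \<le> a \<longrightarrow> H \<le> \<eta>1 \<longrightarrow> \<eta>1 \<le> H + b \<longrightarrow> \<bar>\<eta>2\<bar> \<le> b \<longrightarrow>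
      \<bar>dispersion (- \<beta>) ((\<xi>1, \<eta>1) + (\<xi>2, \<eta>2)) - dispersion (- \<beta>) (\<xi>1, \<eta>1) - dispersion (- \<beta>) (\<xi>2, \<eta>2)\<bar> \<le> \<delta>)"
    if N: "1 \<le> N" for N
  proof -
    have N0: "0 < N" using N by simp
    define a b H where "a = k * N powr (- 1 / 2)" and "b = k * N powr (- (3 - \<beta>) / 2)" and "H = r * N powr ((3 + \<beta>) / 2)"
    have a: "0 < a" and b: "0 < b" using k N0 by (auto simp: a_def b_def)
    have Np: "N powr x \<le> 1" if "x \<le> 0" for x using powr_mono[OF that N] N0 by simp
    have a1: "a \<le> k" "a \<le> 1" and b1: "b \<le> k" "b \<le> 1"
      using k Np[of "- 1 / 2"] Np[of "- (3 - \<beta>) / 2"] \<beta> mult_le_one[of k] mult_left_le[of _ k]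
      unfolding a_def b_def by (auto intro: mult_le_one)
    have NH: "N \<le> H"
    proof -
      have "1 * N powr 1 \<le> r * N powr ((3 + \<beta>) / 2)" using r \<beta> N by (intro mult_mono powr_mono) auto
      then show ?thesis using N0 by (simp add: H_def)
    qed
    have bH: "b \<le> H" using b1 N NH by linarith
    have Hq: "\<beta> * N powr (- \<beta> - 1) * H\<^sup>2 = 3 * N\<^sup>2"
    proof -
      have "(N powr ((3 + \<beta>) / 2))\<^sup>2 = N powr (3 + \<beta>)" by (simp add: power2_eq_square flip: powr_add)
      then have "\<beta> * N powr (- \<beta> - 1) * H\<^sup>2 = \<beta> * (3 / \<beta>) * (N powr (- \<beta> - 1) * N powr (3 + \<beta>))"
        by (simp add: H_def power_mult_distrib r(2))
      also have "N powr (- \<beta> - 1) * N powr (3 + \<beta>) = N powr 2" by (simp flip: powr_add)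
      finally show ?thesis using \<beta> N0 by simp
    qed
    have aN: "a * a * N = k * k"
    proof -
      have "N powr (- 1 / 2) * N powr (- 1 / 2) * N powr 1 = 1" using N0 by (simp only: powr_add[symmetric]) simp
      then show ?thesis using N0 by (simp add: a_def mult_ac)
    qed
    have kk: "k * k \<le> k" using k by (simp add: mult_left_le)
    have ba: "b \<le> a"
      unfolding a_def b_def using k \<beta> N by (intro mult_left_mono powr_mono) auto
    have e1: "a * (24 * a * N) \<le> 24 * k" using aN kk by (simp add: mult_ac)
    have e2: "a * (12 * a\<^sup>2) \<le> 12 * k"
    proof -
      have "a * (a * a) \<le> k * (1 * 1)" using a a1 by (intro mult_mono) auto
      then show ?thesis by (simp add: power2_eq_square)
    qed
    have e3: "a * (9 * N\<^sup>2 * b / H) \<le> 9 * k"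
    proof -
      have "b * N \<le> 1"
      proof -
        have "N powr (- (3 - \<beta>) / 2) * N powr 1 \<le> 1" unfolding powr_add[symmetric] by (intro Np) (use \<beta> in \<open>simp add: field_simps\<close>)
        then have "k * (N powr (- (3 - \<beta>) / 2) * N) \<le> 1 * 1" using k N0 by (intro mult_mono) auto
        then show ?thesis by (simp add: b_def mult_ac)
      qed
      then have "N * (b * N) \<le> H * 1" using NH N0 b by (intro mult_mono) auto
      then have "N\<^sup>2 * b / H \<le> 1" using NH N0 by (simp add: power2_eq_square divide_le_eq mult_ac)
      then have le: "a * (N\<^sup>2 * b / H) \<le> k * 1" using a a1 k b NH N0 by (intro mult_mono) auto
      have "a * (9 * N\<^sup>2 * b / H) = 9 * (a * (N\<^sup>2 * b / H))" by simp
      also have "\<dots> \<le> 9 * (k * 1)" by (intro mult_left_mono le) simp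
      finally show ?thesis by simp
    qed
    have e4: "5 * N powr (- \<beta>) * H * b = 5 * r * k"
    proof -
      have "N powr (- \<beta>) * N powr ((3 + \<beta>) / 2) * N powr (- (3 - \<beta>) / 2) = N powr 0"
        unfolding powr_add[symmetric] by (intro arg_cong2[where f = "(powr)"] refl) (simp add: field_simps)
      then show ?thesis using N0 by (simp add: H_def b_def mult_ac)
    qed
    have e5: "2 * b\<^sup>2 / a \<le> 2 * k"
    proof -
      have "b * b \<le> k * a" using ba b1 b k by (intro mult_mono) auto
      then show ?thesis using a by (simp add: power2_eq_square divide_le_eq)
    qed
    have total: "a * (24 * a * N + 12 * a\<^sup>2 + 9 * N\<^sup>2 * b / H) + 5 * N powr (- \<beta>) * H * b + 2 * b\<^sup>2 / a \<le> \<delta>"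
    proof -
      have "a * (24 * a * N + 12 * a\<^sup>2 + 9 * N\<^sup>2 * b / H) = a * (24 * a * N) + a * (12 * a\<^sup>2) + a * (9 * N\<^sup>2 * b / H)"
        by (simp only: distrib_left)
      moreover have "24 * k + 12 * k + 9 * k + 5 * r * k + 2 * k = k * C" by (simp add: C_def algebra_simps)
      ultimately show ?thesis using e1 e2 e3 e4 e5 k(3) by linarith
    qed
    have growth: "N * sqrt (a * b) = k * N powr (\<beta> / 4)"
    proof -
      have "a * b = k\<^sup>2 * (N powr (- 1 / 2) * N powr (- (3 - \<beta>) / 2))" by (simp add: a_def b_def power2_eq_square mult_ac)
      also have "N powr (- 1 / 2) * N powr (- (3 - \<beta>) / 2) = (N powr (\<beta> / 4 - 1))\<^sup>2"
        unfolding power2_eq_square powr_add[symmetric] by (intro arg_cong2[where f = "(powr)"] refl) (simp add: field_simps)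
      finally have "sqrt (a * b) = k * N powr (\<beta> / 4 - 1)" using k by (simp add: real_sqrt_mult)
      moreover have "N powr 1 * N powr (\<beta> / 4 - 1) = N powr (\<beta> / 4)" unfolding powr_add[symmetric] by simp
      ultimately show ?thesis using N0 by (simp add: mult_ac)
    qed
    show ?thesis
      by (intro exI[of _ a] exI[of _ b] exI[of _ H] conjI a b a1 b1 bH NH growth allI impI order_trans[OF resonance total] \<beta> N Hq) auto
  qed
  then show ?thesis using k(1) by blast
qed

text \<open>A phase of size at most 1 has cosine at least 1/2, so nothing cancels: for nonnegative p
  the real part of the twisted convolution is at least half of the plain one. The factor
  \<open>\<i>\<close> from the derivative moves it to the imaginary part, and the half turns
  \<open>4 * pi\<close> into \<open>8 * pi\<close>.\<close>

lemma picard_rate_lower_bound: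
  fixes p \<theta> :: "plane \<Rightarrow> real"
  assumes p: "sqint (\<lambda>z. complex_of_real (p z))" "\<And>z. 0 \<le> p z"
    and \<theta>: "frequency_test (\<lambda>z. complex_of_real (\<theta> z))" "\<And>z. 0 \<le> \<theta> z" and N: "0 \<le> N" and m: "0 \<le> m"
    and supp: "\<And>\<zeta>. \<theta> \<zeta> \<noteq> 0 \<Longrightarrow> N \<le> fst \<zeta>" "\<And>\<zeta>. \<theta> \<zeta> \<noteq> 0 \<Longrightarrow> m \<le> (LINT \<zeta>'|lborel. p (\<zeta> - \<zeta>') * p \<zeta>')"
    and phase: "\<And>\<zeta> \<zeta>'. \<theta> \<zeta> \<noteq> 0 \<Longrightarrow> p (\<zeta> - \<zeta>') * p \<zeta>' \<noteq> 0 \<Longrightarrow>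
      \<bar>\<tau> * (dispersion \<alpha> \<zeta> - dispersion \<alpha> (\<zeta> - \<zeta>') - dispersion \<alpha> \<zeta>')\<bar> \<le> 1"
  shows "N * m / (8 * pi) * (LINT \<zeta>|lborel. \<theta> \<zeta>) \<le> Im (picard_rate \<alpha> (\<lambda>z. complex_of_real (\<theta> z)) (\<lambda>z. complex_of_real (p z)) \<tau>)"
proof -
  define F where "F = propagate \<alpha> (- \<tau>) (\<lambda>z. complex_of_real (p z))"
  have Fs: "sqint F" unfolding F_def by (rule sqint_propagate[OF p(1)])
  define P where "P \<zeta> = propagate \<alpha> \<tau> (\<lambda>z. complex_of_real (\<theta> z)) \<zeta> * nonlinear_part F \<zeta>" for \<zeta>
  have Pint: "integrable lborel P" unfolding P_def
    by (rule frequency_test_nonlinear_integrable[OF frequency_test_propagate[OF \<theta>(1)] Fs])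
  have \<theta>int: "integrable lborel \<theta>" using frequency_test_integrable[OF \<theta>(1)] by (simp only: complex_of_real_integrable_eq)
  have pointwise: "\<theta> \<zeta> * (N * m / (8 * pi)) \<le> Im (P \<zeta>)" for \<zeta>
  proof (cases "\<theta> \<zeta> = 0")
    case False
    define \<Omega> where "\<Omega> \<zeta>' = \<tau> * (dispersion \<alpha> \<zeta> - dispersion \<alpha> (\<zeta> - \<zeta>') - dispersion \<alpha> \<zeta>')" for \<zeta>'
    define c where "c = cis (\<tau> * dispersion \<alpha> \<zeta>)"
    have FF: "c * (F (\<zeta> - \<zeta>') * F \<zeta>') = cis (\<Omega> \<zeta>') * complex_of_real (p (\<zeta> - \<zeta>') * p \<zeta>')" for \<zeta>'
    proof -
      have "c * (F (\<zeta> - \<zeta>') * F \<zeta>') = (c * (cis (- \<tau> * dispersion \<alpha> (\<zeta> - \<zeta>')) * cis (- \<tau> * dispersion \<alpha> \<zeta>'))) * complex_of_real (p (\<zeta> - \<zeta>') * p \<zeta>')"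
        by (simp add: F_def propagate_def mult_ac)
      also have "c * (cis (- \<tau> * dispersion \<alpha> (\<zeta> - \<zeta>')) * cis (- \<tau> * dispersion \<alpha> \<zeta>')) = cis (\<Omega> \<zeta>')"
        unfolding c_def cis_mult \<Omega>_def by (rule arg_cong[where f = cis]) (simp add: algebra_simps)
      finally show ?thesis .
    qed
    have FFi: "integrable lborel (\<lambda>\<zeta>'. c * (F (\<zeta> - \<zeta>') * F \<zeta>'))"
      by (intro integrable_mult_right conv_integrable Fs)
    have ppi: "integrable lborel (\<lambda>\<zeta>'. p (\<zeta> - \<zeta>') * p \<zeta>')" using conv_integrable[OF p(1) p(1), of \<zeta>] by (simp only: of_real_mult[symmetric] complex_of_real_integrable_eq)
    have "m / 2 \<le> (LINT \<zeta>'|lborel. (1 / 2) * (p (\<zeta> - \<zeta>') * p \<zeta>'))" using supp(2)[OF False] by simp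
    also have "\<dots> \<le> (LINT \<zeta>'|lborel. Re (c * (F (\<zeta> - \<zeta>') * F \<zeta>')))"
    proof (rule integral_mono)
      show "integrable lborel (\<lambda>\<zeta>'. (1 / 2) * (p (\<zeta> - \<zeta>') * p \<zeta>'))" using ppi by (rule integrable_mult_right)
      show "integrable lborel (\<lambda>\<zeta>'. Re (c * (F (\<zeta> - \<zeta>') * F \<zeta>')))" using FFi by (rule integrable_Re)
      fix \<zeta>'
      have re: "Re (c * (F (\<zeta> - \<zeta>') * F \<zeta>')) = cos (\<Omega> \<zeta>') * (p (\<zeta> - \<zeta>') * p \<zeta>')" unfolding FF by simp
      show "(1 / 2) * (p (\<zeta> - \<zeta>') * p \<zeta>') \<le> Re (c * (F (\<zeta> - \<zeta>') * F \<zeta>'))"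
      proof (cases "p (\<zeta> - \<zeta>') * p \<zeta>' = 0")
        case nz: False
        have "1 / 2 \<le> cos (\<Omega> \<zeta>')" unfolding \<Omega>_def by (intro cos_ge_half phase False nz)
        then show ?thesis unfolding re using p(2) by (intro mult_right_mono) auto
      next
        case True
        show ?thesis unfolding re True by simp
      qed
    qed
    also have "\<dots> = Re (LINT \<zeta>'|lborel. c * (F (\<zeta> - \<zeta>') * F \<zeta>'))" by (rule integral_Re[OF FFi])
    also have "\<dots> = Re (c * conv F F \<zeta>)" unfolding conv_def by simp
    finally have conv_ge: "m / 2 \<le> Re (c * conv F F \<zeta>)" .
    have "P \<zeta> = \<i> * complex_of_real (\<theta> \<zeta> * fst \<zeta> / (4 * pi)) * (c * conv F F \<zeta>)"
      by (simp add: P_def propagate_def nonlinear_part_def c_def mult_ac)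
    then have "Im (P \<zeta>) = \<theta> \<zeta> * fst \<zeta> / (4 * pi) * Re (c * conv F F \<zeta>)" by simp
    moreover have "\<theta> \<zeta> * N / (4 * pi) * (m / 2) \<le> \<theta> \<zeta> * fst \<zeta> / (4 * pi) * Re (c * conv F F \<zeta>)"
      using supp(1)[OF False] conv_ge \<theta>(2)[of \<zeta>] N m by (intro mult_mono divide_right_mono mult_left_mono) auto
    ultimately show ?thesis by (simp add: mult_ac)
  qed (simp add: P_def propagate_def)
  have "N * m / (8 * pi) * (LINT \<zeta>|lborel. \<theta> \<zeta>) = (LINT \<zeta>|lborel. \<theta> \<zeta> * (N * m / (8 * pi)))" by simp
  also have "\<dots> \<le> (LINT \<zeta>|lborel. Im (P \<zeta>))"
    by (intro integral_mono pointwise integrable_mult_left \<theta>int integrable_Im Pint)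
  also have "\<dots> = Im (LINT \<zeta>|lborel. P \<zeta>)" by (rule integral_Im[OF Pint])
  finally show ?thesis by (simp add: picard_rate_def P_def F_def)
qed

lemma measure_rectangle:
  fixes a b c d :: real
  assumes "a \<le> b" "c \<le> d"
  shows "measure lborel (cbox (a, c) (b, d)) = (b - a) * (d - c)"
  using assms by (simp add: content_Pair)

lemma indicator_rectangle_integral:
  fixes a b c d k :: real
  assumes "a \<le> b" "c \<le> d"
  shows "integrable lborel (\<lambda>z::plane. k * indicator (cbox (a, c) (b, d)) z)"
    and "(LINT z|lborel. k * indicator (cbox (a, c) (b, d)) z) = k * ((b - a) * (d - c))"
  using measure_rectangle[OF assms] emeasure_lborel_cbox_finite[of "(a, c)" "(b, d)"]
  by (auto simp: less_top)

lemma mem_rectangle: "(z :: plane) \<in> cbox (a, c) (b, d) \<longleftrightarrow> a \<le> fst z \<and> fst z \<le> b \<and> c \<le> snd z \<and> snd z \<le> d"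
  by (cases z) (simp add: cbox_Pair_eq)

text \<open>Low frequencies in \<open>D1\<close> interact with the weight-normalised high frequencies in \<open>D2\<close>, and the
  output is observed on \<open>D3\<close>, where no other interaction contributes.\<close>

lemma resonant_profile:
  fixes N H a b s1 s2 t \<alpha> K :: real
  assumes N: "4 \<le> N" "N \<le> H" and a: "0 < a" "a \<le> 1" and b: "0 < b" "b \<le> 1" and t: "0 < t"
    and res: "\<And>\<xi>1 \<xi>2 \<eta>1 \<eta>2. N \<le> \<xi>1 \<Longrightarrow> \<xi>1 \<le> N + a \<Longrightarrow> a / 2 \<le> \<xi>2 \<Longrightarrow> \<xi>2 \<le> a \<Longrightarrow> H \<le> \<eta>1 \<Longrightarrow> \<eta>1 \<le> H + b \<Longrightarrow> \<bar>\<eta>2\<bar> \<le> b \<Longrightarrow>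
      \<bar>dispersion \<alpha> ((\<xi>1, \<eta>1) + (\<xi>2, \<eta>2)) - dispersion \<alpha> (\<xi>1, \<eta>1) - dispersion \<alpha> (\<xi>2, \<eta>2)\<bar> \<le> 1 / t"
    and K: "0 \<le> K"
    and bound: "\<And>\<phi> f \<theta> c. \<lbrakk>\<phi> \<in> sobolev s1 s2; sqint f; AE \<zeta> in lborel. fourier_L2 \<phi> \<zeta> = f \<zeta>;
      frequency_test \<theta>; \<forall>\<zeta>. \<theta> \<zeta> * f \<zeta> = 0; 0 < c; \<forall>\<tau>\<in>{0..t}. c \<le> Im (picard_rate \<alpha> \<theta> f \<tau>)\<rbrakk> \<Longrightarrow>
      c / 2 * t \<le> l2norm (\<lambda>\<zeta>. \<theta> \<zeta> / complex_of_real (weight s1 s2 \<zeta>)) * (K * (sobolev_norm s1 s2 \<phi>)\<^sup>2)"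
  shows "N * sqrt (a * b) \<le> 40960 * pi * K * (2 powr (\<bar>s1\<bar> + \<bar>s2\<bar>)) ^ 3 / t"
proof -
  define R where "R = (2::real) powr (\<bar>s1\<bar> + \<bar>s2\<bar>)"
  have R: "0 < R" by (simp add: R_def)
  define W0 where "W0 = weight s1 s2 (N, H)"
  have W0: "0 < W0" unfolding W0_def by (rule weight_pos)
  \<comment> \<open>Arranged so that differences of points of D3 and D2 lie in D1: in the first
    coordinate [3a/4, a] minus [0, a/4] is [a/2, a], in the second [0, b] minus [0, b] is [-b, b].
    D3 lies beyond D2, where the datum vanishes.\<close>
  define D1 D2 D3 where "D1 = cbox (a / 2, - b) (a, b)" and "D2 = cbox (N, H) (N + a / 4, H + b)"
    and "D3 = cbox (N + 3 * a / 4, H) (N + a, H + b)"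
  note mem = D1_def D2_def D3_def mem_rectangle
  define q where "q z = indicator D1 z + indicator D2 z / W0" for z :: plane
  \<comment> \<open>Symmetrised so as to be the transform of a real datum. The divisor W0 gives the
    high block a Sobolev norm comparable with that of the low block.\<close>
  define p where "p z = q z + q (- z)" for z
  have q0: "0 \<le> q z" for z using W0 by (simp add: q_def)
  have p0: "0 \<le> p z" for z using q0 by (simp add: p_def)
  have [measurable]: "D1 \<in> sets borel" "D2 \<in> sets borel" "D3 \<in> sets borel" by (simp_all add: D1_def D2_def D3_def)
  have qm [measurable]: "q \<in> borel_measurable borel" unfolding q_def by measurable
  have pm [measurable]: "p \<in> borel_measurable borel" unfolding p_def by measurable
  have q_cases: "q z = (if z \<in> D1 then 1 else if z \<in> D2 then 1 / W0 else 0)" for z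
    using N a by (auto simp: q_def mem indicator_def)
  have p_cases: "p z = (if z \<in> D1 \<or> - z \<in> D1 then 1 else if z \<in> D2 \<or> - z \<in> D2 then 1 / W0 else 0)" for z
    using N a unfolding p_def q_cases by (auto simp: mem)
  \<comment> \<open>The indicators of the four blocks; D1 has area \<open>a * b\<close> and D2 has
    area \<open>a * b / 4\<close>, and both occur twice. One integral then controls p, its square
    and its weighted square.\<close>
  define B where "B z = indicator D1 z + indicator D2 z + (indicator D1 (- z) + indicator D2 (- z) :: real)" for z :: plane
  have B: "integrable lborel B" "(LINT z|lborel. B z) = 5 / 2 * (a * b)"
  proof -
    have i1: "integrable lborel (indicator D1 :: plane \<Rightarrow> real)" "(LINT z|lborel. indicator D1 z) = a * b"
      using indicator_rectangle_integral[of "a / 2" a "- b" b 1] a b by (simp_all add: D1_def)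
    have i2: "integrable lborel (indicator D2 :: plane \<Rightarrow> real)" "(LINT z|lborel. indicator D2 z) = a * b / 4"
      using indicator_rectangle_integral[of N "N + a / 4" H "H + b" 1] a b by (simp_all add: D2_def)
    have refl: "integrable lborel (\<lambda>z::plane. indicator D (- z) :: real)" "(LINT z|lborel. indicator D (- z)) = (LINT z|lborel. indicator D z :: real)"
      if "integrable lborel (indicator D :: plane \<Rightarrow> real)" "D \<in> sets borel" for D :: "plane set"
      using lborel_plane_reflect[of "indicator D :: plane \<Rightarrow> real" 0] that by simp_all
    show "integrable lborel B" unfolding B_def using i1 i2 refl by (intro Bochner_Integration.integrable_add) auto
    show "(LINT z|lborel. B z) = 5 / 2 * (a * b)" unfolding B_def using i1 i2 refl by simp
  qed
  have wp_le: "(weight s1 s2 z * p z)\<^sup>2 \<le> 4 * R\<^sup>2 * B z" for z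
  proof -
    have low: "weight s1 s2 x \<le> 2 * R" if "x \<in> D1" for x
      using that a b unfolding R_def by (intro weight_low_frequency) (auto simp: mem)
    have high: "weight s1 s2 x * (1 / W0) \<le> 2 * R" if "x \<in> D2" for x
    proof -
      have "weight s1 s2 x \<le> R * W0"
        unfolding R_def W0_def using that N a b by (intro weight_compare) (auto simp: mem)
      then have "weight s1 s2 x * (1 / W0) \<le> R" using W0 by (simp add: pos_divide_le_eq)
      then show ?thesis using R by linarith
    qed
    have B0: "1 \<le> B z" if "z \<in> D1 \<or> - z \<in> D1 \<or> z \<in> D2 \<or> - z \<in> D2"
      using that by (auto simp: B_def indicator_def)
    have w0: "0 \<le> weight s1 s2 z" using weight_pos[of s1 s2 z] by simp
    show ?thesis
    proof (cases "z \<in> D1 \<or> - z \<in> D1 \<or> z \<in> D2 \<or> - z \<in> D2")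
      case True
      have "weight s1 s2 z * p z \<le> 2 * R"
        using True low[of z] low[of "- z"] high[of z] high[of "- z"] by (auto simp: p_cases)
      then have "(weight s1 s2 z * p z)\<^sup>2 \<le> (2 * R)\<^sup>2" using w0 p0 by (intro power_mono) auto
      also have "\<dots> \<le> (2 * R)\<^sup>2 * B z" using B0[OF True] by (simp add: mult_le_cancel_left1)
      finally show ?thesis by (simp add: power_mult_distrib)
    qed (simp add: p_cases B_def)
  qed
  define f where "f z = complex_of_real (p z)" for z
  have wf: "sqint (\<lambda>z. complex_of_real (weight s1 s2 z) * f z)"
      "(l2norm (\<lambda>z. complex_of_real (weight s1 s2 z) * f z))\<^sup>2 \<le> 10 * R\<^sup>2 * (a * b)"
  proof -
    have eq: "(cmod (complex_of_real (weight s1 s2 z) * f z))\<^sup>2 = (weight s1 s2 z * p z)\<^sup>2" for z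
      by (simp add: f_def norm_mult power_mult_distrib)
    have Bi: "integrable lborel (\<lambda>z. 4 * R\<^sup>2 * B z)" using B(1) by simp
    have i: "integrable lborel (\<lambda>z. (weight s1 s2 z * p z)\<^sup>2)"
      using Bi by (rule Bochner_Integration.integrable_bound) (use order_trans[OF wp_le abs_ge_self] in auto)
    show "sqint (\<lambda>z. complex_of_real (weight s1 s2 z) * f z)"
      unfolding sqint_def eq using i by (simp add: f_def)
    have "(l2norm (\<lambda>z. complex_of_real (weight s1 s2 z) * f z))\<^sup>2 \<le> (LINT z|lborel. 4 * R\<^sup>2 * B z)"
      unfolding l2norm_square eq by (intro integral_mono i Bi wp_le)
    then show "(l2norm (\<lambda>z. complex_of_real (weight s1 s2 z) * f z))\<^sup>2 \<le> 10 * R\<^sup>2 * (a * b)" using B(2) by (simp add: mult_ac)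
  qed
  have p_le: "p z \<le> (1 + 1 / W0) * B z" "(p z)\<^sup>2 \<le> (1 + 1 / W0)\<^sup>2 * B z" for z
  proof -
    have *: "p z \<le> 1 + 1 / W0 \<and> 1 \<le> B z \<or> p z = 0 \<and> B z = 0"
      using W0 by (auto simp: p_cases B_def indicator_def)
    then show "p z \<le> (1 + 1 / W0) * B z"
      using W0 mult_left_mono[of 1 "B z" "1 + 1 / W0"] by auto
    show "(p z)\<^sup>2 \<le> (1 + 1 / W0)\<^sup>2 * B z"
      using *
    proof (elim disjE conjE)
      assume z: "p z \<le> 1 + 1 / W0" "1 \<le> B z"
      have "(p z)\<^sup>2 \<le> (1 + 1 / W0)\<^sup>2" by (rule power_mono[OF z(1) p0])
      also have "\<dots> \<le> (1 + 1 / W0)\<^sup>2 * B z" using mult_left_mono[OF z(2), of "(1 + 1 / W0)\<^sup>2"] by simp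
      finally show ?thesis .
    qed simp
  qed
  have pint: "integrable lborel p"
  proof (rule Bochner_Integration.integrable_bound)
    show "integrable lborel (\<lambda>z. (1 + 1 / W0) * B z)" using B(1) by simp
    show "AE z in lborel. norm (p z) \<le> norm ((1 + 1 / W0) * B z)"
      using order_trans[OF p_le(1) abs_ge_self] p0 by auto
  qed simp
  have fs: "sqint f"
  proof -
    have "integrable lborel (\<lambda>z. (p z)\<^sup>2)"
    proof (rule Bochner_Integration.integrable_bound)
      show "integrable lborel (\<lambda>z. (1 + 1 / W0)\<^sup>2 * B z)" using B(1) by simp
      show "AE z in lborel. norm ((p z)\<^sup>2) \<le> norm ((1 + 1 / W0)\<^sup>2 * B z)"
        using order_trans[OF p_le(2) abs_ge_self] by auto
    qed simp
    moreover have "f \<in> borel_measurable borel" unfolding f_def[abs_def] by measurable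
    ultimately show ?thesis by (simp add: sqint_def f_def)
  qed
  obtain \<phi> where \<phi>: "AE \<zeta> in lborel. fourier_L2 \<phi> \<zeta> = f \<zeta>"
    using even_profile_exists[of p] fs pint unfolding f_def by (auto simp: p_def)
  have ae: "AE \<zeta> in lborel. complex_of_real (weight s1 s2 \<zeta>) * f \<zeta> = wfourier s1 s2 \<phi> \<zeta>"
    using \<phi> by eventually_elim (simp add: wfourier_def)
  have \<phi>V: "\<phi> \<in> sobolev s1 s2" unfolding sobolev_iff by (rule sqint_cong_AE[OF wf(1) _ ae]) simp
  have \<phi>N: "(sobolev_norm s1 s2 \<phi>)\<^sup>2 \<le> 10 * R\<^sup>2 * (a * b)"
    using wf(2) l2norm_cong_AE[OF _ _ ae] sqint_measurable[OF wf(1)] by (simp add: sobolev_norm_eq)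
  \<comment> \<open>A product of two tents centred in D3, because tests have to be
    continuous.\<close>
  define \<theta> where "\<theta> z = max 0 (1 - \<bar>fst z - (N + 7 * a / 8)\<bar> / (a / 8)) * max 0 (1 - \<bar>snd z - (H + b / 2)\<bar> / (b / 2))" for z :: plane
  have \<theta>0: "0 \<le> \<theta> z" for z by (simp add: \<theta>_def)
  have \<theta>1: "\<theta> z \<le> 1" for z unfolding \<theta>_def using a b by (intro mult_le_one) auto
  have \<theta>D: "z \<in> D3" if "\<theta> z \<noteq> 0" for z
  proof -
    have *: "u < 1" if "max 0 (1 - u) \<noteq> 0" for u :: real using that by (auto simp: max_def split: if_splits)
    have "\<bar>fst z - (N + 7 * a / 8)\<bar> / (a / 8) < 1" "\<bar>snd z - (H + b / 2)\<bar> / (b / 2) < 1"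
      using that *[of "\<bar>fst z - (N + 7 * a / 8)\<bar> / (a / 8)"] *[of "\<bar>snd z - (H + b / 2)\<bar> / (b / 2)"]
      unfolding \<theta>_def mult_eq_0_iff de_Morgan_disj by blast+
    then have "\<bar>fst z - (N + 7 * a / 8)\<bar> < a / 8" "\<bar>snd z - (H + b / 2)\<bar> < b / 2" using a b by auto
    then show ?thesis unfolding mem by (intro conjI) linarith+
  qed
  have \<theta>test: "frequency_test (\<lambda>z. complex_of_real (\<theta> z))"
    unfolding frequency_test_def
  proof (intro conjI exI[of _ D3] allI impI)
    show "continuous_on UNIV (\<lambda>z. complex_of_real (\<theta> z))"
      unfolding \<theta>_def by (intro continuous_intros) (use a b in auto)
    show "compact D3" by (simp add: D3_def)
    show "(0, \<eta>) \<notin> D3" for \<eta> using N a by (auto simp: mem)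
    show "complex_of_real (\<theta> \<zeta>) = 0" if "\<zeta> \<notin> D3" for \<zeta> using \<theta>D[of \<zeta>] that by auto
  qed
  have \<theta>int: "integrable lborel \<theta>" using frequency_test_integrable[OF \<theta>test] by (simp only: complex_of_real_integrable_eq)
  have \<theta>_integral: "a * b / 64 \<le> (LINT z|lborel. \<theta> z)"
  proof -
    \<comment> \<open>On the concentric rectangle of half the side lengths both tents are at least
      1/2; its area is \<open>a * b / 16\<close>.\<close>
    define I where "I = cbox (N + 7 * a / 8 - a / 16, H + b / 2 - b / 4) (N + 7 * a / 8 + a / 16, H + b / 2 + b / 4)"
    have I: "integrable lborel (\<lambda>z. (1 / 4) * indicator I z :: real)" "(LINT z|lborel. (1 / 4) * indicator I z) = a * b / 64"
      using indicator_rectangle_integral[of "N + 7 * a / 8 - a / 16" "N + 7 * a / 8 + a / 16" "H + b / 2 - b / 4" "H + b / 2 + b / 4" "1 / 4"] a b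
      by (simp_all add: I_def)
    have "(1 / 4) * indicator I z \<le> \<theta> z" for z
    proof (cases "z \<in> I")
      case True
      then have "\<bar>fst z - (N + 7 * a / 8)\<bar> \<le> a / 16" "\<bar>snd z - (H + b / 2)\<bar> \<le> b / 4"
        unfolding I_def mem_rectangle by linarith+
      then have "\<bar>fst z - (N + 7 * a / 8)\<bar> / (a / 8) \<le> 1 / 2" "\<bar>snd z - (H + b / 2)\<bar> / (b / 2) \<le> 1 / 2"
        using a b by (simp_all add: divide_le_eq)
      then have "(1 / 2) * (1 / 2) \<le> \<theta> z" unfolding \<theta>_def by (intro mult_mono) auto
      then show ?thesis using True by simp
    qed (use \<theta>0 in simp)
    then have "(LINT z|lborel. (1 / 4) * indicator I z) \<le> (LINT z|lborel. \<theta> z)" by (intro integral_mono I \<theta>int)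
    then show ?thesis using I(2) by simp
  qed
  have D12: "\<zeta> - \<zeta>' \<in> D1" if "\<zeta> \<in> D3" "\<zeta>' \<in> D2" for \<zeta> \<zeta>'
    using that a b by (auto simp: mem)
  \<comment> \<open>The area of D2 times the amplitude 1 / W0 of the high block; the low factor has
    amplitude 1 on all differences involved.\<close>
  define m where "m = a * b / (4 * W0)"
  have m_le: "m \<le> (LINT \<zeta>'|lborel. p (\<zeta> - \<zeta>') * p \<zeta>')" if "\<theta> \<zeta> \<noteq> 0" for \<zeta>
  proof -
    have \<zeta>: "\<zeta> \<in> D3" using \<theta>D that by blast
    have "(LINT \<zeta>'|lborel. (1 / W0) * indicator D2 \<zeta>') = m"
      using indicator_rectangle_integral(2)[of N "N + a / 4" H "H + b" "1 / W0"] a b by (simp add: D2_def m_def)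
    moreover have "(LINT \<zeta>'|lborel. (1 / W0) * indicator D2 \<zeta>') \<le> (LINT \<zeta>'|lborel. p (\<zeta> - \<zeta>') * p \<zeta>')"
    proof (rule integral_mono)
      show "integrable lborel (\<lambda>\<zeta>'. (1 / W0) * indicator D2 \<zeta>' :: real)"
        using indicator_rectangle_integral(1)[of N "N + a / 4" H "H + b" "1 / W0"] a b by (simp add: D2_def)
      show "integrable lborel (\<lambda>\<zeta>'. p (\<zeta> - \<zeta>') * p \<zeta>')"
        using conv_integrable[OF fs fs, of \<zeta>] by (simp only: f_def of_real_mult[symmetric] complex_of_real_integrable_eq)
      fix \<zeta>'
      show "(1 / W0) * indicator D2 \<zeta>' \<le> p (\<zeta> - \<zeta>') * p \<zeta>'"
      proof (cases "\<zeta>' \<in> D2")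
        case True
        have "p (\<zeta> - \<zeta>') = 1" using D12[OF \<zeta> True] by (simp add: p_cases)
        moreover have "p \<zeta>' = 1 / W0" using True N a by (auto simp: p_cases mem)
        ultimately show ?thesis using True by simp
      qed (use p0 in simp)
    qed
    ultimately show ?thesis by simp
  qed
  have phase: "\<bar>\<tau> * (dispersion \<alpha> \<zeta> - dispersion \<alpha> (\<zeta> - \<zeta>') - dispersion \<alpha> \<zeta>')\<bar> \<le> 1"
    if \<tau>: "\<tau> \<in> {0..t}" and nz: "\<theta> \<zeta> \<noteq> 0" "p (\<zeta> - \<zeta>') * p \<zeta>' \<noteq> 0" for \<tau> \<zeta> \<zeta>'
  proof -
    have pair: "\<bar>dispersion \<alpha> (x + y) - dispersion \<alpha> x - dispersion \<alpha> y\<bar> \<le> 1 / t" if "x \<in> D2" "y \<in> D1" for x y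
      using res[of "fst x" "fst y" "snd x" "snd y"] that a by (auto simp: mem)
    have \<zeta>: "\<zeta> \<in> D3" using \<theta>D nz(1) by blast
    have s: "\<zeta>' \<in> D1 \<or> - \<zeta>' \<in> D1 \<or> \<zeta>' \<in> D2 \<or> - \<zeta>' \<in> D2"
      "\<zeta> - \<zeta>' \<in> D1 \<or> - (\<zeta> - \<zeta>') \<in> D1 \<or> \<zeta> - \<zeta>' \<in> D2 \<or> - (\<zeta> - \<zeta>') \<in> D2"
      using nz(2) by (auto simp: p_cases split: if_splits)
    have "(\<zeta> - \<zeta>' \<in> D2 \<and> \<zeta>' \<in> D1) \<or> (\<zeta>' \<in> D2 \<and> \<zeta> - \<zeta>' \<in> D1)"
    proof -
      \<comment> \<open>First coordinates suffice: with \<open>N \<ge> 4\<close> and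
        \<open>a \<le> 1\<close>, among the four blocks only an unreflected low and an unreflected
        high frequency can add up to a point of D3.\<close>
      have x: "N + 3 * a / 4 \<le> fst \<zeta>" "fst \<zeta> \<le> N + a" using \<zeta> by (auto simp: mem)
      have cases: "z \<in> D1 \<and> a / 2 \<le> fst z \<and> fst z \<le> a \<or> z \<in> D2 \<and> N \<le> fst z \<and> fst z \<le> N + a / 4
          \<or> - a \<le> fst z \<and> fst z \<le> - a / 2 \<or> - N - a / 4 \<le> fst z \<and> fst z \<le> - N"
        if "z \<in> D1 \<or> - z \<in> D1 \<or> z \<in> D2 \<or> - z \<in> D2" for z
        using that by (auto simp: mem)
      show ?thesis
        using cases[OF s(1)] cases[OF s(2)] x N a unfolding fst_diff by (elim disjE conjE; (blast | linarith))
    qed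
    then have "\<bar>dispersion \<alpha> \<zeta> - dispersion \<alpha> (\<zeta> - \<zeta>') - dispersion \<alpha> \<zeta>'\<bar> \<le> 1 / t"
      using pair[of "\<zeta> - \<zeta>'" \<zeta>'] pair[of \<zeta>' "\<zeta> - \<zeta>'"] by (auto simp: algebra_simps)
    then have "\<bar>\<tau>\<bar> * \<bar>dispersion \<alpha> \<zeta> - dispersion \<alpha> (\<zeta> - \<zeta>') - dispersion \<alpha> \<zeta>'\<bar> \<le> t * (1 / t)"
      using \<tau> t by (intro mult_mono) auto
    then show ?thesis using t by (simp add: abs_mult)
  qed
  \<comment> \<open>This is \<open>N * m / (8 * pi)\<close> times the lower bound
    \<open>a * b / 64\<close> of the integral of \<open>\<theta>\<close>.\<close>
  define c where "c = N * (a * b)\<^sup>2 / (2048 * pi * W0)"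
  have c0: "0 < c" using N a b W0 by (simp add: c_def)
  have rate: "c \<le> Im (picard_rate \<alpha> (\<lambda>z. complex_of_real (\<theta> z)) f \<tau>)" if \<tau>: "\<tau> \<in> {0..t}" for \<tau>
  proof -
    have m0: "0 \<le> m" using a b W0 by (simp add: m_def)
    have "c = N * m / (8 * pi) * (a * b / 64)" by (simp add: c_def m_def power2_eq_square mult_ac)
    also have "\<dots> \<le> N * m / (8 * pi) * (LINT z|lborel. \<theta> z)" using N m0 by (intro mult_left_mono \<theta>_integral) auto
    also have "\<dots> \<le> Im (picard_rate \<alpha> (\<lambda>z. complex_of_real (\<theta> z)) (\<lambda>z. complex_of_real (p z)) \<tau>)"
    proof (rule picard_rate_lower_bound[OF _ p0 \<theta>test \<theta>0 _ m0 _ m_le phase[OF \<tau>]])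
      show "sqint (\<lambda>z. complex_of_real (p z))" using fs by (simp add: f_def[abs_def])
      show "N \<le> fst \<zeta>" if "\<theta> \<zeta> \<noteq> 0" for \<zeta> using \<theta>D[OF that] a by (auto simp: mem)
    qed (use N in auto)
    finally show ?thesis by (simp add: f_def[abs_def])
  qed
  have disj: "\<forall>\<zeta>. complex_of_real (\<theta> \<zeta>) * f \<zeta> = 0"
  proof
    fix \<zeta>
    show "complex_of_real (\<theta> \<zeta>) * f \<zeta> = 0"
    proof (cases "\<theta> \<zeta> = 0")
      case False
      then have "\<zeta> \<in> D3" by (rule \<theta>D)
      then have "p \<zeta> = 0" using N a by (auto simp: p_cases mem)
      then show ?thesis by (simp add: f_def)
    qed simp
  qed
  define S where "S = sqrt (a * b)"
  have S: "0 < S" "S\<^sup>2 = a * b" using a b by (simp_all add: S_def)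
  have \<theta>w: "l2norm (\<lambda>\<zeta>. complex_of_real (\<theta> \<zeta>) / complex_of_real (weight s1 s2 \<zeta>)) \<le> R / W0 * S"
  proof (rule power2_le_imp_le)
    have D3i: "integrable lborel (\<lambda>\<zeta>. (R / W0)\<^sup>2 * indicator D3 \<zeta> :: real)" "(LINT \<zeta>|lborel. (R / W0)\<^sup>2 * indicator D3 \<zeta>) = (R / W0)\<^sup>2 * (a * b / 4)"
      using indicator_rectangle_integral[of "N + 3 * a / 4" "N + a" H "H + b" "(R / W0)\<^sup>2"] a b by (simp_all add: D3_def)
    have le: "(cmod (complex_of_real (\<theta> \<zeta>) / complex_of_real (weight s1 s2 \<zeta>)))\<^sup>2 \<le> (R / W0)\<^sup>2 * indicator D3 \<zeta>" for \<zeta>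
    proof (cases "\<theta> \<zeta> = 0")
      case False
      then have \<zeta>: "\<zeta> \<in> D3" by (rule \<theta>D)
      have w: "0 < weight s1 s2 \<zeta>" by (rule weight_pos)
      have "W0 \<le> R * weight s1 s2 \<zeta>"
        unfolding W0_def R_def using \<zeta> N a b by (intro weight_compare) (auto simp: mem)
      then have "1 / weight s1 s2 \<zeta> \<le> R / W0" using W0 w by (simp add: field_simps)
      moreover have "\<theta> \<zeta> / weight s1 s2 \<zeta> \<le> 1 / weight s1 s2 \<zeta>" using \<theta>1[of \<zeta>] w by (intro divide_right_mono) auto
      ultimately have "\<theta> \<zeta> / weight s1 s2 \<zeta> \<le> R / W0" by linarith
      then have "(\<theta> \<zeta> / weight s1 s2 \<zeta>)\<^sup>2 \<le> (R / W0)\<^sup>2" using \<theta>0[of \<zeta>] w by (intro power_mono) auto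
      then show ?thesis using \<zeta> by (simp add: norm_divide power_divide)
    qed (use R W0 in simp)
    have "(l2norm (\<lambda>\<zeta>. complex_of_real (\<theta> \<zeta>) / complex_of_real (weight s1 s2 \<zeta>)))\<^sup>2 \<le> (LINT \<zeta>|lborel. (R / W0)\<^sup>2 * indicator D3 \<zeta>)"
      unfolding l2norm_square
    proof (rule integral_mono)
      have "(\<lambda>\<zeta>. complex_of_real (\<theta> \<zeta>)) \<in> borel_measurable borel" by (rule frequency_test_measurable[OF \<theta>test])
      then have m: "(\<lambda>\<zeta>. (cmod (complex_of_real (\<theta> \<zeta>) / complex_of_real (weight s1 s2 \<zeta>)))\<^sup>2) \<in> borel_measurable lborel" by measurable
      show "integrable lborel (\<lambda>\<zeta>. (cmod (complex_of_real (\<theta> \<zeta>) / complex_of_real (weight s1 s2 \<zeta>)))\<^sup>2)"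
        using D3i(1) m
      proof (rule Bochner_Integration.integrable_bound)
        show "AE \<zeta> in lborel. norm ((cmod (complex_of_real (\<theta> \<zeta>) / complex_of_real (weight s1 s2 \<zeta>)))\<^sup>2) \<le> norm ((R / W0)\<^sup>2 * indicator D3 \<zeta> :: real)"
        proof (rule AE_I2)
          fix \<zeta>
          have "norm ((cmod (complex_of_real (\<theta> \<zeta>) / complex_of_real (weight s1 s2 \<zeta>)))\<^sup>2) = (cmod (complex_of_real (\<theta> \<zeta>) / complex_of_real (weight s1 s2 \<zeta>)))\<^sup>2"
            by (simp only: real_norm_def abs_power2)
          then show "norm ((cmod (complex_of_real (\<theta> \<zeta>) / complex_of_real (weight s1 s2 \<zeta>)))\<^sup>2) \<le> norm ((R / W0)\<^sup>2 * indicator D3 \<zeta> :: real)"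
            using order_trans[OF le[of \<zeta>] abs_ge_self] by (simp only: real_norm_def)
        qed
      qed
    qed (use D3i(1) le in auto)
    also have "\<dots> \<le> (R / W0 * S)\<^sup>2" unfolding D3i(2) power_mult_distrib S(2) using a b by (intro mult_left_mono) auto
    finally show "(l2norm (\<lambda>\<zeta>. complex_of_real (\<theta> \<zeta>) / complex_of_real (weight s1 s2 \<zeta>)))\<^sup>2 \<le> (R / W0 * S)\<^sup>2" .
  qed (use R W0 S in simp)
  have "c / 2 * t \<le> l2norm (\<lambda>\<zeta>. complex_of_real (\<theta> \<zeta>) / complex_of_real (weight s1 s2 \<zeta>)) * (K * (sobolev_norm s1 s2 \<phi>)\<^sup>2)"
    by (rule bound[OF \<phi>V fs \<phi> \<theta>test disj c0]) (use rate in blast)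
  also have "\<dots> \<le> (R / W0 * S) * (K * (10 * R\<^sup>2 * (a * b)))"
    using \<theta>w \<phi>N K R W0 S by (intro mult_mono mult_left_mono) auto
  finally have main: "N * (S\<^sup>2)\<^sup>2 / (2048 * pi * W0) / 2 * t \<le> (R / W0 * S) * (K * (10 * R\<^sup>2 * S\<^sup>2))"
    by (simp add: c_def S(2))
  \<comment> \<open>Both sides of the main inequality contain 1 / W0 and S^3; the left side has one
    power of S and the factor N in excess.\<close>
  have "(N * S) * (S ^ 3 * t / (4096 * pi * W0)) \<le> (40960 * pi * K * R ^ 3 / t) * (S ^ 3 * t / (4096 * pi * W0))"
  proof -
    have "(N * S) * (S ^ 3 * t / (4096 * pi * W0)) = N * (S\<^sup>2)\<^sup>2 / (2048 * pi * W0) / 2 * t"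
      by (simp add: power2_eq_square power3_eq_cube mult_ac)
    moreover have "(40960 * pi * K * R ^ 3 / t) * (S ^ 3 * t / (4096 * pi * W0)) = (R / W0 * S) * (K * (10 * R\<^sup>2 * S\<^sup>2))"
      using t by (simp add: power2_eq_square power3_eq_cube mult_ac)
    ultimately show ?thesis using main by simp
  qed
  moreover have "0 < S ^ 3 * t / (4096 * pi * W0)" using S t W0 by simp
  ultimately have "N * S \<le> 40960 * pi * K * R ^ 3 / t" by (simp only: mult_le_cancel_right_pos)
  then show ?thesis by (simp only: S_def R_def)
qed

theorem theorem4p4:
  fixes \<alpha> s1 s2 \<epsilon> :: real
  assumes "-1 \<le> \<alpha>" and "\<alpha> < 0"
    and "s2 \<le> s1" and "s2 \<noteq> 0"
    and "0 < \<epsilon>" and "\<epsilon> < 1"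
    and "s1 > (17 + 4 * \<epsilon> - 3 * \<alpha>) / 12"
    and "(5 + 4 * \<epsilon> - 3 * \<alpha>) / (12 * s1) + 1 / s2 < 1"
  shows "\<forall>t>0. \<forall>U. open_wrt (sobolev s1 s2) (sobolev_norm s1 s2) U \<and> 0 \<in> U \<and>
            U \<subseteq> flow_domain \<alpha> s1 s2 t \<longrightarrow>
            \<not> C2_on_wrt (sobolev s1 s2) (sobolev_norm s1 s2) U (flow \<alpha> s1 s2 t)"
proof (intro allI impI notI, elim conjE)
  fix t :: real and U
  assume t: "0 < t" and U: "open_wrt (sobolev s1 s2) (sobolev_norm s1 s2) U" "0 \<in> U" "U \<subseteq> flow_domain \<alpha> s1 s2 t"
    and C2: "C2_on_wrt (sobolev s1 s2) (sobolev_norm s1 s2) U (flow \<alpha> s1 s2 t)"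
  have s1: "1 \<le> s1" using assms(2,5,7) by simp
  obtain K where K: "0 \<le> K" and bound: "\<And>\<phi> f \<theta> c. \<lbrakk>\<phi> \<in> sobolev s1 s2; sqint f; AE \<zeta> in lborel. fourier_L2 \<phi> \<zeta> = f \<zeta>;
      frequency_test \<theta>; \<forall>\<zeta>. \<theta> \<zeta> * f \<zeta> = 0; 0 < c; \<forall>\<tau>\<in>{0..t}. c \<le> Im (picard_rate \<alpha> \<theta> f \<tau>)\<rbrakk> \<Longrightarrow>
      c / 2 * t \<le> l2norm (\<lambda>\<zeta>. \<theta> \<zeta> / complex_of_real (weight s1 s2 \<zeta>)) * (K * (sobolev_norm s1 s2 \<phi>)\<^sup>2)"
    using C2_flow_bounds_picard_rate[OF s1 t U C2] by blast
  define \<beta> where "\<beta> = - \<alpha>"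
  have \<beta>: "0 < \<beta>" "\<beta> \<le> 1" "\<alpha> = - \<beta>" using assms(1,2) by (simp_all add: \<beta>_def)
  define C where "C = 40960 * pi * K * (2 powr (\<bar>s1\<bar> + \<bar>s2\<bar>)) ^ 3 / t"
  have C: "0 \<le> C" using K t by (simp add: C_def)
  \<comment> \<open>The tolerance 1 / t keeps the phase at most 1 for all times up to t.\<close>
  obtain k where k: "0 < k" and scale: "\<And>N. 1 \<le> N \<Longrightarrow> \<exists>a b H. 0 < a \<and> a \<le> 1 \<and> 0 < b \<and> b \<le> 1 \<and> b \<le> H \<and> N \<le> H \<and> N * sqrt (a * b) = k * N powr (\<beta> / 4) \<and>
    (\<forall>\<xi>1 \<xi>2 \<eta>1 \<eta>2. N \<le> \<xi>1 \<longrightarrow> \<xi>1 \<le> N + a \<longrightarrow> a / 2 \<le> \<xi>2 \<longrightarrow> \<xi>2 \<le> a \<longrightarrow> H \<le> \<eta>1 \<longrightarrow> \<eta>1 \<le> H + b \<longrightarrow> \<bar>\<eta>2\<bar> \<le> b \<longrightarrow>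
      \<bar>dispersion (- \<beta>) ((\<xi>1, \<eta>1) + (\<xi>2, \<eta>2)) - dispersion (- \<beta>) (\<xi>1, \<eta>1) - dispersion (- \<beta>) (\<xi>2, \<eta>2)\<bar> \<le> 1 / t)"
    using resonance_scaling[OF \<beta>(1,2), of "1 / t"] t by auto
  \<comment> \<open>Chosen so that \<open>k * X\<close> exceeds C. The power of X in N gives
    \<open>N powr (\<beta> / 4) \<ge> X\<close>, and the 4 separates the frequency blocks.\<close>
  define X where "X = C / k + 1"
  have X: "1 \<le> X" using C k by (simp add: X_def)
  define N where "N = max 4 (X powr (4 / \<beta>))"
  have N1: "1 \<le> N" by (simp add: N_def)
  obtain a b H where ab: "0 < a" "a \<le> 1" "0 < b" "b \<le> 1" "N \<le> H" and growth: "N * sqrt (a * b) = k * N powr (\<beta> / 4)"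
    and res: "\<And>\<xi>1 \<xi>2 \<eta>1 \<eta>2. N \<le> \<xi>1 \<Longrightarrow> \<xi>1 \<le> N + a \<Longrightarrow> a / 2 \<le> \<xi>2 \<Longrightarrow> \<xi>2 \<le> a \<Longrightarrow> H \<le> \<eta>1 \<Longrightarrow> \<eta>1 \<le> H + b \<Longrightarrow> \<bar>\<eta>2\<bar> \<le> b \<Longrightarrow>
      \<bar>dispersion \<alpha> ((\<xi>1, \<eta>1) + (\<xi>2, \<eta>2)) - dispersion \<alpha> (\<xi>1, \<eta>1) - dispersion \<alpha> (\<xi>2, \<eta>2)\<bar> \<le> 1 / t"
    using scale[OF N1] unfolding \<beta>(3) by blast
  have "N * sqrt (a * b) \<le> C"
    unfolding C_def by (rule resonant_profile[OF _ ab(5,1-4) t res K bound]) (auto simp: N_def)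
  moreover have "X \<le> N powr (\<beta> / 4)"
  proof -
    have "X = (X powr (4 / \<beta>)) powr (\<beta> / 4)" using X \<beta> by (simp add: powr_powr)
    also have "\<dots> \<le> N powr (\<beta> / 4)" using \<beta> by (intro powr_mono2) (auto simp: N_def)
    finally show ?thesis .
  qed
  then have "k * X \<le> k * N powr (\<beta> / 4)" using k by (intro mult_left_mono) auto
  moreover have "k * X = C + k" using k by (simp add: X_def field_simps)
  ultimately show False using growth k by linarith
qed

end
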